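(* Let $G=(V,E)$ be an embedded planar $st$-graph and let $\pi$ be a bitonic $st$-ordering for $G$. Then an upward planar straight-line grid drawing of $G$ (respecting the embedding) of size $(2|V|-2)\times(|V|-1)$ can be computed from $\pi$ in linear time.
   Context: A planar $st$-graph is a planar, acyclic directed graph without parallel edges with exactly one source $s$ and exactly one sink $t$ (the edge $(s,t)$ need not be present); embedded means a fixed planar embedding with $s$ and $t$ on the outer face. For a vertex $u$ its successor list $S(u)=\{v_1,\dots,v_m\}$ lists the heads of the outgoing edges of $u$ in the clockwise order around $u$ in the embedding; for $u=s$, $v_1$ and $v_m$ are chosen so that $v_m,s,v_1$ appear clockwise on the outer face. An $st$-ordering is a bijection $\pi:V\to\{1,\dots,|V|\}$ with $\pi(u)<\pi(v)$ for every edge $(u,v)$; it is bitonic if for every $u$ with $S(u)=\{v_1,\dots,v_m\}$ there is $1\le h\le m$ with $\pi(v_1)<\dots<\pi(v_h)>\dots>\pi(v_m)$. An upward planar straight-line drawing is a planar drawing with vertices at integer grid points and edges as straight segments such that every edge $(u,v)$ has $u$ strictly below $v$. *)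

theory Defs
  imports "HOL-Analysis.Analysis"
begin

text \<open>
  The vertices are \<open>0, \<dots>, nv - 1\<close>. Together with \<open>src\<close>, the lists \<open>rot u\<close> are the combinatorial
  embedding: \<open>rot u\<close> lists all neighbours of \<open>u\<close> (heads of outgoing and tails of incoming
  edges) in clockwise order around \<open>u\<close>. This order is cyclic; the following choice of where
  the list starts loses no generality.
  \<^item> \<open>rot src\<close> starts behind the outer face, that is, the angle clockwise from its last to its
    first entry belongs to the outer face. This fixes the outer face of the embedding.
  \<^item> For \<open>u \<noteq> src\<close> the list ends with the tail of an incoming edge (see \<open>succ_list\<close>).
\<close>

record emb_graph =
  nv   :: nat
  arcs :: "(nat \<times> nat) set"
  src  :: nat
  snk  :: nat
  rot  :: "nat \<Rightarrow> nat list"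

definition verts :: "emb_graph \<Rightarrow> nat set" where
  "verts G = {..<nv G}"

definition st_graph :: "emb_graph \<Rightarrow> bool" where
  "st_graph G \<longleftrightarrow>
     arcs G \<subseteq> verts G \<times> verts G \<and> acyclic (arcs G) \<and>
     {v \<in> verts G. \<forall>u. (u, v) \<notin> arcs G} = {src G} \<and>
     {v \<in> verts G. \<forall>w. (v, w) \<notin> arcs G} = {snk G}"

definition rotation_lists :: "emb_graph \<Rightarrow> bool" where
  "rotation_lists G \<longleftrightarrow>
     (\<forall>u \<in> verts G.
        distinct (rot G u) \<and>
        set (rot G u) = {v. (u, v) \<in> arcs G \<or> (v, u) \<in> arcs G} \<and>
        (u \<noteq> src G \<longrightarrow> (last (rot G u), u) \<in> arcs G))"

text \<open>
  The plane is \<^typ>\<open>complex\<close>. As in the usual definition of a plane graph by polygonal arcs, an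
  edge \<open>(u, v)\<close> is drawn as the polygonal line from \<open>pos u\<close> via the points \<open>bends (u, v)\<close> to \<open>pos v\<close>.
\<close>

record drawing =
  pos   :: "nat \<Rightarrow> complex"
  bends :: "nat \<times> nat \<Rightarrow> complex list"

fun polyline :: "complex list \<Rightarrow> real \<Rightarrow> complex" where
  "polyline (a # b # c # ps) = linepath a b +++ polyline (b # c # ps)"
| "polyline [a, b] = linepath a b"
| "polyline [a] = linepath a a"
| "polyline [] = linepath 0 0"

definition edge_points :: "drawing \<Rightarrow> nat \<times> nat \<Rightarrow> complex list" where
  "edge_points D e = pos D (fst e) # bends D e @ [pos D (snd e)]"

definition edge_curve :: "drawing \<Rightarrow> nat \<times> nat \<Rightarrow> real \<Rightarrow> complex" where
  "edge_curve D e = polyline (edge_points D e)"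

definition planar_drawing :: "emb_graph \<Rightarrow> drawing \<Rightarrow> bool" where
  "planar_drawing G D \<longleftrightarrow>
     inj_on (pos D) (verts G) \<and>
     (\<forall>e \<in> arcs G. arc (edge_curve D e)) \<and>
     (\<forall>e \<in> arcs G. \<forall>w \<in> verts G.
        pos D w \<in> path_image (edge_curve D e) \<longrightarrow> w \<in> {fst e, snd e}) \<and>
     (\<forall>e \<in> arcs G. \<forall>e' \<in> arcs G. e \<noteq> e' \<longrightarrow>
        path_image (edge_curve D e) \<inter> path_image (edge_curve D e')
          \<subseteq> pos D ` ({fst e, snd e} \<inter> {fst e', snd e'}))"

text \<open>\<^const>\<open>outside\<close> of the point set of the drawing is the unbounded face.\<close>

definition outer_face :: "emb_graph \<Rightarrow> drawing \<Rightarrow> complex set" where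
  "outer_face G D =
     outside (pos D ` verts G \<union> (\<Union>e \<in> arcs G. path_image (edge_curve D e)))"

text \<open>
  The vector along the first segment, seen from \<open>u\<close>, of the edge between the neighbours
  \<open>u\<close> and \<open>v\<close>, whichever way that edge is directed.
\<close>

definition direction :: "emb_graph \<Rightarrow> drawing \<Rightarrow> nat \<Rightarrow> nat \<Rightarrow> complex" where
  "direction G D u v =
     (if (u, v) \<in> arcs G then edge_points D (u, v) else rev (edge_points D (v, u))) ! 1 - pos D u"

text \<open>One clockwise turn, starting with the first vector, meets the vectors in list order.\<close>

definition clockwise :: "complex list \<Rightarrow> bool" where
  "clockwise zs \<longleftrightarrow>
     (\<exists>\<theta> :: nat \<Rightarrow> real.
        (\<forall>i < length zs. zs ! i \<noteq> 0 \<and> is_Arg (zs ! i) (\<theta> i)) \<and>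
        (\<forall>j < length zs. \<forall>i < j. \<theta> j < \<theta> i) \<and>
        (\<forall>i < length zs. \<theta> 0 - \<theta> i < 2 * pi))"

text \<open>
  Near \<open>u\<close>, the open sector swept clockwise from the edge to \<open>a\<close> to the edge to \<open>b\<close> lies in \<open>F\<close>;
  for \<open>a = b\<close> this is the full turn.
\<close>

definition angle_in_face ::
  "emb_graph \<Rightarrow> drawing \<Rightarrow> nat \<Rightarrow> nat \<Rightarrow> nat \<Rightarrow> complex set \<Rightarrow> bool" where
  "angle_in_face G D u a b F \<longleftrightarrow>
     (\<exists>\<alpha> \<beta> \<epsilon>. is_Arg (direction G D u a) \<alpha> \<and> is_Arg (direction G D u b) \<beta> \<and>
        \<beta> < \<alpha> \<and> \<alpha> \<le> \<beta> + 2 * pi \<and> 0 < \<epsilon> \<and>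
        (\<forall>\<theta> \<in> {\<beta><..<\<alpha>}. \<forall>r \<in> {0<..<\<epsilon>}. pos D u + of_real r * cis \<theta> \<in> F))"

text \<open>
  The drawing has the rotation system and the outer face of the embedding of \<open>G\<close>, and \<open>s\<close> and \<open>t\<close>
  lie on the outer face. Given the rotation system, a face is determined by any one of its
  angles, so it suffices to fix the outer angle at \<open>s\<close>.
\<close>

definition respects_embedding :: "emb_graph \<Rightarrow> drawing \<Rightarrow> bool" where
  "respects_embedding G D \<longleftrightarrow>
     (\<forall>u \<in> verts G. clockwise (map (direction G D u) (rot G u))) \<and>
     pos D (src G) \<in> frontier (outer_face G D) \<and>
     pos D (snk G) \<in> frontier (outer_face G D) \<and>
     (rot G (src G) \<noteq> [] \<longrightarrow>
        angle_in_face G D (src G) (last (rot G (src G))) (hd (rot G (src G))) (outer_face G D))"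

definition embedded_planar_st_graph :: "emb_graph \<Rightarrow> bool" where
  "embedded_planar_st_graph G \<longleftrightarrow>
     st_graph G \<and> rotation_lists G \<and> (\<exists>D. planar_drawing G D \<and> respects_embedding G D)"

text \<open>
  In an embedded planar st-graph the incoming edges are consecutive around every vertex. Since
  \<open>rot u\<close> ends with an incoming edge for \<open>u \<noteq> s\<close>, and at the outer face for \<open>u = s\<close>, filtering gives
  the outgoing edges in clockwise order with the first and the last one as intended.
\<close>

definition succ_list :: "emb_graph \<Rightarrow> nat \<Rightarrow> nat list" where
  "succ_list G u = filter (\<lambda>v. (u, v) \<in> arcs G) (rot G u)"

definition st_ordering :: "emb_graph \<Rightarrow> (nat \<Rightarrow> nat) \<Rightarrow> bool" where
  "st_ordering G \<pi> \<longleftrightarrow>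
     bij_betw \<pi> (verts G) {1..card (verts G)} \<and> (\<forall>(u, v) \<in> arcs G. \<pi> u < \<pi> v)"

text \<open>The index \<open>h\<close> counts from 0 here, and the two sublists share the entry \<open>xs ! h\<close>.\<close>

definition bitonic :: "nat list \<Rightarrow> bool" where
  "bitonic xs \<longleftrightarrow>
     (\<exists>h < length xs. sorted_wrt (<) (take (Suc h) xs) \<and> sorted_wrt (>) (drop h xs))"

definition bitonic_st_ordering :: "emb_graph \<Rightarrow> (nat \<Rightarrow> nat) \<Rightarrow> bool" where
  "bitonic_st_ordering G \<pi> \<longleftrightarrow>
     st_ordering G \<pi> \<and>
     (\<forall>u \<in> verts G. succ_list G u \<noteq> [] \<longrightarrow> bitonic (map \<pi> (succ_list G u)))"

definition straight_line_drawing :: "(nat \<Rightarrow> int) \<Rightarrow> (nat \<Rightarrow> int) \<Rightarrow> drawing" where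
  "straight_line_drawing x y =
     \<lparr>pos = (\<lambda>v. Complex (of_int (x v)) (of_int (y v))), bends = (\<lambda>_. [])\<rparr>"

definition upward_planar_grid_drawing ::
  "emb_graph \<Rightarrow> (nat \<Rightarrow> int) \<Rightarrow> (nat \<Rightarrow> int) \<Rightarrow> bool" where
  "upward_planar_grid_drawing G x y \<longleftrightarrow>
     planar_drawing G (straight_line_drawing x y) \<and> (\<forall>(u, v) \<in> arcs G. y u < y v)"

definition has_grid_size ::
  "emb_graph \<Rightarrow> (nat \<Rightarrow> int) \<Rightarrow> (nat \<Rightarrow> int) \<Rightarrow> int \<Rightarrow> int \<Rightarrow> bool" where
  "has_grid_size G x y w h \<longleftrightarrow> (\<forall>v \<in> verts G. x v \<in> {0..w} \<and> y v \<in> {0..h})"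

text \<open>
  Unit-cost random access machine with addition, subtraction and halving on integers, programmed
  by structured commands over finitely many registers and arrays. Assignments, array writes and
  evaluations of a test take one unit of time each; since the expressions are part of the program,
  counting the operations inside them would change the time only by a constant factor.
\<close>

datatype aexp =
    Num int
  | Reg nat
  | Get nat aexp
  | Add aexp aexp
  | Sub aexp aexp
  | Half aexp

datatype bexp =
    Less aexp aexp
  | Equal aexp aexp
  | Neg bexp
  | Conj bexp bexp

datatype com =
    Skip
  | Assign nat aexp
  | Put nat aexp aexp
  | Seq com com
  | Cond bexp com com
  | While bexp com

record state =
  regs :: "nat \<Rightarrow> int"
  arrs :: "nat \<Rightarrow> int \<Rightarrow> int"

fun aval :: "aexp \<Rightarrow> state \<Rightarrow> int" where
  "aval (Num k) \<sigma> = k"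
| "aval (Reg r) \<sigma> = regs \<sigma> r"
| "aval (Get A e) \<sigma> = arrs \<sigma> A (aval e \<sigma>)"
| "aval (Add e f) \<sigma> = aval e \<sigma> + aval f \<sigma>"
| "aval (Sub e f) \<sigma> = aval e \<sigma> - aval f \<sigma>"
| "aval (Half e) \<sigma> = aval e \<sigma> div 2"

fun bval :: "bexp \<Rightarrow> state \<Rightarrow> bool" where
  "bval (Less e f) \<sigma> \<longleftrightarrow> aval e \<sigma> < aval f \<sigma>"
| "bval (Equal e f) \<sigma> \<longleftrightarrow> aval e \<sigma> = aval f \<sigma>"
| "bval (Neg b) \<sigma> \<longleftrightarrow> \<not> bval b \<sigma>"
| "bval (Conj b c) \<sigma> \<longleftrightarrow> bval b \<sigma> \<and> bval c \<sigma>"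

text \<open>\<open>exec p \<sigma> k \<tau>\<close>: started in \<open>\<sigma>\<close>, the program \<open>p\<close> halts in \<open>\<tau>\<close> after exactly \<open>k\<close> units of time.\<close>

inductive exec :: "com \<Rightarrow> state \<Rightarrow> nat \<Rightarrow> state \<Rightarrow> bool" where
  Skip: "exec Skip \<sigma> 0 \<sigma>"
| Assign: "exec (Assign r e) \<sigma> 1 (\<sigma>\<lparr>regs := (regs \<sigma>)(r := aval e \<sigma>)\<rparr>)"
| Put: "exec (Put A i e) \<sigma> 1
    (\<sigma>\<lparr>arrs := (arrs \<sigma>)(A := (arrs \<sigma> A)(aval i \<sigma> := aval e \<sigma>))\<rparr>)"
| Seq: "exec p \<sigma> k \<tau> \<Longrightarrow> exec q \<tau> l \<upsilon> \<Longrightarrow> exec (Seq p q) \<sigma> (k + l) \<upsilon>"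
| CondTrue: "bval b \<sigma> \<Longrightarrow> exec p \<sigma> k \<tau> \<Longrightarrow> exec (Cond b p q) \<sigma> (Suc k) \<tau>"
| CondFalse: "\<not> bval b \<sigma> \<Longrightarrow> exec q \<sigma> k \<tau> \<Longrightarrow> exec (Cond b p q) \<sigma> (Suc k) \<tau>"
| WhileFalse: "\<not> bval b \<sigma> \<Longrightarrow> exec (While b p) \<sigma> 1 \<sigma>"
| WhileTrue: "bval b \<sigma> \<Longrightarrow> exec p \<sigma> k \<tau> \<Longrightarrow> exec (While b p) \<tau> l \<upsilon> \<Longrightarrow>
    exec (While b p) \<sigma> (Suc (k + l)) \<upsilon>"

text \<open>
  The input in array 0: the number of vertices, the ordering, for every vertex the offset of its
  rotation list (and the total length of these lists), and the concatenated rotation lists.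
  Edge directions are not stored, since \<open>\<pi>\<close> determines them. All other cells are initially 0.
\<close>

definition encode :: "emb_graph \<Rightarrow> (nat \<Rightarrow> nat) \<Rightarrow> int list" where
  "encode G \<pi> = map int
     ([nv G] @ map \<pi> [0..<nv G] @
      map (\<lambda>u. \<Sum>w<u. length (rot G w)) [0..<Suc (nv G)] @
      concat (map (rot G) [0..<nv G]))"

definition initial_state :: "int list \<Rightarrow> state" where
  "initial_state xs =
     \<lparr>regs = (\<lambda>_. 0),
      arrs = (\<lambda>A i. if A = 0 \<and> 0 \<le> i \<and> i < int (length xs) then xs ! nat i else 0)\<rparr>"

text \<open>The coordinates of vertex \<open>v\<close> are left in cell \<open>v\<close> of arrays 1 and 2.\<close>

definition computes_within ::
  "com \<Rightarrow> int list \<Rightarrow> nat \<Rightarrow> (nat \<Rightarrow> int) \<Rightarrow> (nat \<Rightarrow> int) \<Rightarrow> bool" where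
  "computes_within p xs k x y \<longleftrightarrow>
     (\<exists>l \<tau>. exec p (initial_state xs) l \<tau> \<and> l \<le> k \<and>
        x = (\<lambda>v. arrs \<tau> 1 (int v)) \<and> y = (\<lambda>v. arrs \<tau> 2 (int v)))"

end

theory Submission
  imports Defs "HOL-Complex_Analysis.Complex_Analysis"
begin

text \<open>The vertices are placed in the order \<open>\<pi>\<close>. Winding numbers of closed curves inside the given drawing show
  that the edges leaving the first \<open>k\<close> vertices have a left-to-right order in which the edges entering
  vertex \<open>k + 1\<close> are consecutive, are the reverse of its incoming edges in clockwise order, and are
  replaced by its outgoing edges in the next step. This is the only use of the given drawing.

  As in the algorithm of de Fraysseix, Pach and Pollack, a contour from an artificial left end \<open>L\<close> to an
  artificial right end \<open>R\<close> is maintained that carries all tails of pending edges. A new vertex covers the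
  part of the contour strictly between its leftmost and its rightmost predecessor; if it has only one
  predecessor \<open>u\<close>, then by bitonicity its higher successors lie on one side only of the new edge, and the
  neighbour of \<open>u\<close> on the other side serves as second end. The covered part is shifted by 1 and the right
  part by 2, so that the new vertex is the meeting point of the lines of slope 1 and -1 through the two
  ends. In the drawing with all contour edges of slope 1 or -1 the horizontal distances along the contour
  are the total variations of the heights, so the heights alone determine the position of a covered vertex
  relative to the covering one, and these offsets are summed up in a second pass. Every new edge lies above
  the old contour and below the new one, hence the drawing is planar.\<close>

text \<open>The embedding is given only through some polygonal drawing, whereas the algorithm works
  with lists. All topology is therefore condensed into the predicate \<open>sweep\<close>. Winding
  numbers take the place of the Jordan curve theorem: the closed curves may intersect themselves,
  and it suffices that the winding number jumps across a segment run through once, is constant on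
  faces and vanishes on the outer face.

  The grid size comes from one count. Replacing the covered part of the contour by the two sides of
  the new vertex raises the total variation of the heights by exactly 2. The ends L and R, both at
  height -1, start with variation 0, so n vertices give 2n: the last vertex has height n - 1 between
  ends at -1 and 2n - 1, which leaves the columns 0 to 2n - 2.

  Intermediate drawings never occur in the proof. Later shifts only widen contour edges, so in the
  final coordinates a contour edge has slope between -1 and 1 instead of 1 or -1. This weaker fact
  is proved by going back from the last contour, and it is enough for planarity because a covered
  vertex lies strictly inside the cone of slopes 1 and -1 below its covering vertex.\<close>

subsection \<open>Faces at a point\<close>

text \<open>\<open>F\<close> contains the points near \<open>z\<close> slightly to the left (\<open>\<sigma> = 1\<close>) or to the right (\<open>\<sigma> = -1\<close>) of the
  ray from \<open>z\<close> in direction \<open>d\<close>.\<close>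

definition germ :: "real \<Rightarrow> complex \<Rightarrow> complex \<Rightarrow> complex set \<Rightarrow> bool" where
  "germ \<sigma> z d F \<longleftrightarrow>
     (\<forall>\<^sub>F p in at_right 0 \<times>\<^sub>F at_right 0. z + of_real (fst p) * d * cis (\<sigma> * snd p) \<in> F)"

lemma eventually_at_right_0D: "\<forall>\<^sub>F \<delta> in at_right (0::real). P \<delta> \<Longrightarrow> \<exists>\<delta>. P \<delta>"
  using eventually_happens'[OF trivial_limit_at_right_real] by blast

lemma germ_iff:
  "germ \<sigma> z d F \<longleftrightarrow> (\<exists>r0>0. \<exists>\<phi>0>0. \<forall>r \<phi>. 0 < r \<and> r < r0 \<and> 0 < \<phi> \<and> \<phi> < \<phi>0 \<longrightarrow>
     z + of_real r * d * cis (\<sigma> * \<phi>) \<in> F)"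
proof
  assume "germ \<sigma> z d F"
  then obtain P Q where P: "eventually P (at_right (0::real))" and Q: "eventually Q (at_right (0::real))"
    and PQ: "\<And>r \<phi>. P r \<Longrightarrow> Q \<phi> \<Longrightarrow> z + of_real r * d * cis (\<sigma> * \<phi>) \<in> F"
    unfolding germ_def eventually_prod_filter by auto
  obtain r0 where "r0 > 0" "\<And>r. 0 < r \<Longrightarrow> r < r0 \<Longrightarrow> P r"
    using P unfolding eventually_at_right_field by auto
  moreover obtain \<phi>0 where "\<phi>0 > 0" "\<And>r. 0 < r \<Longrightarrow> r < \<phi>0 \<Longrightarrow> Q r"
    using Q unfolding eventually_at_right_field by auto
  ultimately show "\<exists>r0>0. \<exists>\<phi>0>0. \<forall>r \<phi>. 0 < r \<and> r < r0 \<and> 0 < \<phi> \<and> \<phi> < \<phi>0 \<longrightarrow>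
     z + of_real r * d * cis (\<sigma> * \<phi>) \<in> F"
    using PQ by blast
next
  assume "\<exists>r0>0. \<exists>\<phi>0>0. \<forall>r \<phi>. 0 < r \<and> r < r0 \<and> 0 < \<phi> \<and> \<phi> < \<phi>0 \<longrightarrow>
     z + of_real r * d * cis (\<sigma> * \<phi>) \<in> F"
  then obtain r0 \<phi>0 where *: "r0 > 0" "\<phi>0 > 0"
    "\<And>r \<phi>. 0 < r \<and> r < r0 \<and> 0 < \<phi> \<and> \<phi> < \<phi>0 \<Longrightarrow> z + of_real r * d * cis (\<sigma> * \<phi>) \<in> F"
    by auto
  show "germ \<sigma> z d F"
    unfolding germ_def eventually_prod_filter eventually_at_right_field
    by (rule exI[of _ "\<lambda>r. 0 < r \<and> r < r0"], rule exI[of _ "\<lambda>r. 0 < r \<and> r < \<phi>0"]) (use * in auto)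
qed

lemma germ_Int: "germ \<sigma> z d F \<Longrightarrow> germ \<sigma> z d F' \<Longrightarrow> germ \<sigma> z d (F \<inter> F')"
  unfolding germ_def by (auto elim: eventually_elim2)

lemma germ_nonempty: "germ \<sigma> z d F \<Longrightarrow> F \<noteq> {}"
proof -
  assume "germ \<sigma> z d F"
  then obtain r0 \<phi>0 where *: "r0 > 0" "\<phi>0 > 0"
    "\<And>r \<phi>. 0 < r \<and> r < r0 \<and> 0 < \<phi> \<and> \<phi> < \<phi>0 \<Longrightarrow> z + of_real r * d * cis (\<sigma> * \<phi>) \<in> F"
    unfolding germ_iff by auto
  have "z + of_real (r0/2) * d * cis (\<sigma> * (\<phi>0/2)) \<in> F"
    using *(1,2) by (intro *(3)) auto
  then show ?thesis by auto
qed

text \<open>Two germs on the same side of the same ray overlap, and distinct components are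
  disjoint.\<close>

lemma germ_unique:
  assumes "germ \<sigma> z d F" "germ \<sigma> z d F'" "F \<in> components S" "F' \<in> components S"
  shows "F = F'"
  using germ_nonempty[OF germ_Int[OF assms(1,2)]] components_nonoverlap[OF assms(3,4)] by auto

text \<open>Passes to rectangular coordinates along the ray, in units of d: the point \<eta> along
  and \<delta> across has modulus \<open>\<eta> * sqrt (1 + (\<delta>/\<eta>)^2)\<close> and angle
  \<open>arctan (\<delta>/\<eta>)\<close>, which tend to \<eta> and 0. In this form a face can be
  followed parallel to a segment.\<close>

lemma germ_perp:
  assumes g: "germ \<sigma> z d F" and \<sigma>: "\<sigma> \<in> {1, -1}"
  shows "\<exists>\<eta>0>0. \<forall>\<eta>. 0 < \<eta> \<and> \<eta> < \<eta>0 \<longrightarrow> (\<forall>\<^sub>F \<delta> in at_right 0. z + d * Complex \<eta> (\<sigma> * \<delta>) \<in> F)"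
proof -
  obtain r0 \<phi>0 where *: "r0 > 0" "\<phi>0 > 0"
    "\<And>r \<phi>. 0 < r \<and> r < r0 \<and> 0 < \<phi> \<and> \<phi> < \<phi>0 \<Longrightarrow> z + of_real r * d * cis (\<sigma> * \<phi>) \<in> F"
    using g unfolding germ_iff by auto
  have "\<forall>\<^sub>F \<delta> in at_right 0. z + d * Complex \<eta> (\<sigma> * \<delta>) \<in> F" if \<eta>: "0 < \<eta>" "\<eta> < r0" for \<eta>
  proof -
    have "((\<lambda>\<delta>. \<eta> * sqrt (1 + (\<delta>/\<eta>)^2)) \<longlongrightarrow> \<eta> * sqrt (1 + (0/\<eta>)^2)) (at_right 0)"
      by (intro tendsto_intros) (use \<eta> in auto)
    then have 1: "\<forall>\<^sub>F \<delta> in at_right 0. \<eta> * sqrt (1 + (\<delta>/\<eta>)^2) < r0"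
      using \<eta> by (intro order_tendstoD(2)[where y="\<eta> * sqrt (1 + (0/\<eta>)^2)"]) auto
    have "((\<lambda>\<delta>. arctan (\<delta>/\<eta>)) \<longlongrightarrow> arctan (0/\<eta>)) (at_right 0)"
      by (intro tendsto_intros) (use \<eta> in auto)
    then have 2: "\<forall>\<^sub>F \<delta> in at_right 0. arctan (\<delta>/\<eta>) < \<phi>0"
      using * by (intro order_tendstoD(2)[where y="arctan (0/\<eta>)"]) auto
    have 3: "\<forall>\<^sub>F \<delta> in at_right 0. (0::real) < \<delta>"
      by (simp add: eventually_at_right_less)
    show ?thesis using 1 2 3
    proof eventually_elim
      case (elim \<delta>)
      let ?r = "\<eta> * sqrt (1 + (\<delta>/\<eta>)^2)" and ?\<phi> = "arctan (\<delta>/\<eta>)"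
      have pos: "sqrt (1 + (\<delta>/\<eta>)^2) > 0" by (simp add: add_pos_nonneg)
      have "?r * cos ?\<phi> = \<eta>" "?r * sin ?\<phi> = \<delta>"
        using pos \<eta> by (auto simp: cos_arctan sin_arctan)
      then have "of_real ?r * cis (\<sigma> * ?\<phi>) = Complex \<eta> (\<sigma> * \<delta>)"
        using \<sigma> by (auto simp: complex_eq_iff)
      moreover have "z + of_real ?r * d * cis (\<sigma> * ?\<phi>) \<in> F"
        using elim \<eta> pos by (intro *(3)) (auto simp: zero_less_arctan_iff)
      ultimately show ?case by (metis mult.assoc mult.commute)
    qed
  qed
  then show ?thesis using *(1) by blast
qed

text \<open>An inclusion, not an equality: near z, the set K stays within rays in the directions ds.
  Hence the property passes to subsets and can be checked edge by edge.\<close>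

definition local_star :: "complex set \<Rightarrow> complex \<Rightarrow> complex list \<Rightarrow> bool" where
  "local_star K z ds \<longleftrightarrow>
     (\<exists>\<rho>>0. \<forall>w\<in>K. dist w z < \<rho> \<longrightarrow> w = z \<or> (\<exists>d\<in>set ds. \<exists>t>0. w = z + of_real t * d))"

lemma local_star_Un:
  assumes "local_star A z ds" "local_star B z ds"
  shows "local_star (A \<union> B) z ds"
proof -
  obtain r s where "r > 0" "s > 0"
    "\<And>w. w \<in> A \<Longrightarrow> dist w z < r \<Longrightarrow> w = z \<or> (\<exists>d\<in>set ds. \<exists>t>0. w = z + of_real t * d)"
    "\<And>w. w \<in> B \<Longrightarrow> dist w z < s \<Longrightarrow> w = z \<or> (\<exists>d\<in>set ds. \<exists>t>0. w = z + of_real t * d)"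
    using assms unfolding local_star_def by metis
  then show ?thesis
    unfolding local_star_def by (intro exI[of _ "min r s"]) auto
qed

lemma local_star_empty [simp]: "local_star {} z ds"
  unfolding local_star_def by (auto intro: exI[of _ 1])

lemma local_star_UN:
  assumes "finite I" "\<And>i. i \<in> I \<Longrightarrow> local_star (A i) z ds"
  shows "local_star (\<Union>i\<in>I. A i) z ds"
  using assms by (induction I rule: finite_induct) (auto intro: local_star_Un)

lemma local_star_subset: "local_star B z ds \<Longrightarrow> A \<subseteq> B \<Longrightarrow> local_star A z ds"
  unfolding local_star_def by blast

lemma local_star_off:
  assumes "closed A" "z \<notin> A"
  shows "local_star A z ds"
proof -
  obtain e where "e > 0" "ball z e \<subseteq> - A"
    using assms open_contains_ball[of "- A"] by (auto simp: open_Compl)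
  then show ?thesis
    unfolding local_star_def by (intro exI[of _ e]) (auto simp: subset_iff dist_commute)
qed

lemma local_star_segment:
  assumes "w - z \<in> set ds"
  shows "local_star (closed_segment z w) z ds"
proof -
  have "p = z \<or> (\<exists>d\<in>set ds. \<exists>t>0. p = z + of_real t * d)" if p: "p \<in> closed_segment z w" for p
  proof -
    obtain u where u: "0 \<le> u" "p = (1 - u) *\<^sub>R z + u *\<^sub>R w"
      using p unfolding in_segment by blast
    then have "p = z + of_real u * (w - z)" by (simp add: scaleR_conv_of_real algebra_simps)
    then show ?thesis using u(1) assms by (cases "u = 0") (simp, metis order_le_less)
  qed
  then show ?thesis unfolding local_star_def by (intro exI[of _ 1]) auto
qed

text \<open>In polar coordinates an open sector is the image of a rectangle, hence
  connected.\<close>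

lemma sector_component:
  assumes "0 < \<rho>" "\<beta> < \<alpha>"
    and free: "\<And>\<theta> r. \<beta> < \<theta> \<Longrightarrow> \<theta> < \<alpha> \<Longrightarrow> 0 < r \<Longrightarrow> r < \<rho> \<Longrightarrow> z + of_real r * cis \<theta> \<notin> K"
  obtains F where "F \<in> components (- K)"
    "\<And>\<theta> r. \<beta> < \<theta> \<Longrightarrow> \<theta> < \<alpha> \<Longrightarrow> 0 < r \<Longrightarrow> r < \<rho> \<Longrightarrow> z + of_real r * cis \<theta> \<in> F"
proof -
  let ?f = "\<lambda>p::real\<times>real. z + of_real (fst p) * cis (snd p)"
  let ?S = "?f ` ({0<..<\<rho>} \<times> {\<beta><..<\<alpha>})"
  have "connected ?S"
    by (intro connected_continuous_image continuous_intros connected_Times) auto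
  moreover have "?S \<subseteq> - K" using free by auto
  moreover have "- K \<noteq> {}"
    using free[of "(\<alpha>+\<beta>)/2" "\<rho>/2"] assms(1,2) by (auto simp: field_simps)
  ultimately obtain F where "F \<in> components (- K)" "?S \<subseteq> F"
    using exists_component_superset[of ?S "- K"] by blast
  then show thesis by (intro that[of F]) force+
qed

lemma is_Arg_cis: "is_Arg d \<alpha> \<Longrightarrow> d = of_real (cmod d) * cis \<alpha>"
  unfolding is_Arg_def cis_conv_exp .

lemma germ_sector_cw:
  assumes "d \<noteq> 0" "is_Arg d \<alpha>" "\<beta> < \<alpha>" "0 < \<rho>"
    and "\<And>\<theta> r. \<beta> < \<theta> \<Longrightarrow> \<theta> < \<alpha> \<Longrightarrow> 0 < r \<Longrightarrow> r < \<rho> \<Longrightarrow> z + of_real r * cis \<theta> \<in> F"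
  shows "germ (-1) z d F"
proof -
  have d: "d = of_real (cmod d) * cis \<alpha>" by (rule is_Arg_cis[OF assms(2)])
  have "z + of_real r * d * cis (- 1 * \<phi>) \<in> F" if "0 < r" "r < \<rho> / cmod d" "0 < \<phi>" "\<phi> < \<alpha> - \<beta>" for r \<phi>
  proof -
    have "z + of_real (r * cmod d) * cis (\<alpha> - \<phi>) \<in> F"
      using that assms(1) by (intro assms(5)) (auto simp: field_simps)
    moreover have "of_real (r * cmod d) * cis (\<alpha> - \<phi>) = of_real r * (of_real (cmod d) * cis \<alpha>) * cis (- 1 * \<phi>)"
      by (simp add: cis_mult)
    ultimately show ?thesis using d by metis
  qed
  then show ?thesis unfolding germ_iff using assms(1,3,4)
    by (intro exI[of _ "\<rho> / cmod d"] conjI exI[of _ "\<alpha> - \<beta>"]) auto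
qed

lemma germ_sector_ccw:
  assumes "d \<noteq> 0" "is_Arg d \<beta>" "\<beta> < \<alpha>" "0 < \<rho>"
    and "\<And>\<theta> r. \<beta> < \<theta> \<Longrightarrow> \<theta> < \<alpha> \<Longrightarrow> 0 < r \<Longrightarrow> r < \<rho> \<Longrightarrow> z + of_real r * cis \<theta> \<in> F"
  shows "germ 1 z d F"
proof -
  have d: "d = of_real (cmod d) * cis \<beta>" by (rule is_Arg_cis[OF assms(2)])
  have "z + of_real r * d * cis (1 * \<phi>) \<in> F" if "0 < r" "r < \<rho> / cmod d" "0 < \<phi>" "\<phi> < \<alpha> - \<beta>" for r \<phi>
  proof -
    have "z + of_real (r * cmod d) * cis (\<beta> + \<phi>) \<in> F"
      using that assms(1) by (intro assms(5)) (auto simp: field_simps)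
    moreover have "of_real (r * cmod d) * cis (\<beta> + \<phi>) = of_real r * (of_real (cmod d) * cis \<beta>) * cis (1 * \<phi>)"
      by (simp add: cis_mult)
    ultimately show ?thesis using d by metis
  qed
  then show ?thesis unfolding germ_iff using assms(1,3,4)
    by (intro exI[of _ "\<rho> / cmod d"] conjI exI[of _ "\<alpha> - \<beta>"]) auto
qed

text \<open>A point of K in the sector would have an angle \<open>\<theta> j\<close> plus m full
  turns. Since all angles lie within less than one turn, the bounds leave m = 0, which contradicts
  the monotonicity of \<theta>, or no m at all. After the last direction the sector reaches to the
  first one, lowered by a full turn; for a single direction this is the whole turn.\<close>

lemma star_sector_free:
  assumes \<theta>: "\<forall>i < length ds. ds ! i \<noteq> 0 \<and> is_Arg (ds ! i) (\<theta> i)"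
    "\<forall>j < length ds. \<forall>i < j. \<theta> j < \<theta> i" "\<forall>i < length ds. \<theta> 0 - \<theta> i < 2 * pi"
    and ls: "local_star K z ds" and i: "i < length ds"
    and \<beta>_def: "\<beta> = (if Suc i < length ds then \<theta> (Suc i) else \<theta> 0 - 2 * pi)"
  obtains \<rho> where "0 < \<rho>" "\<beta> < \<theta> i" "is_Arg (ds ! (Suc i mod length ds)) \<beta>"
    "\<And>\<theta>' r. \<beta> < \<theta>' \<Longrightarrow> \<theta>' < \<theta> i \<Longrightarrow> 0 < r \<Longrightarrow> r < \<rho> \<Longrightarrow> z + of_real r * cis \<theta>' \<notin> K"
proof -
  obtain \<rho> where \<rho>: "\<rho> > 0" "\<And>w. w\<in>K \<Longrightarrow> dist w z < \<rho> \<Longrightarrow> w = z \<or> (\<exists>d\<in>set ds. \<exists>t>0. w = z + of_real t * d)"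
    using ls unfolding local_star_def by auto
  have mono: "\<theta> b \<le> \<theta> a" if "a \<le> b" "b < length ds" for a b
    using \<theta>(2) that by (cases "a = b") (auto simp: less_imp_le)
  have lt: "\<beta> < \<theta> i"
    using \<theta>(2,3) i unfolding \<beta>_def by (auto simp: algebra_simps)
  have arg: "is_Arg (ds ! (Suc i mod length ds)) \<beta>"
  proof (cases "Suc i < length ds")
    case True then show ?thesis using \<theta>(1) by (simp add: \<beta>_def)
  next
    case False
    then have *: "Suc i = length ds" using i by simp
    have "is_Arg (ds ! 0) (\<theta> 0)" using \<theta>(1) i by force
    then have "is_Arg (ds ! 0) (\<theta> 0 - 2 * pi)"
      unfolding is_Arg_def by (metis cis_conv_exp cis_2pi cis_divide div_by_1)
    then show ?thesis using * by (simp add: \<beta>_def)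
  qed
  have "z + of_real r * cis \<theta>' \<notin> K" if t: "\<beta> < \<theta>'" "\<theta>' < \<theta> i" "0 < r" "r < \<rho>" for \<theta>' r
  proof
    assume "z + of_real r * cis \<theta>' \<in> K"
    moreover have "dist (z + of_real r * cis \<theta>') z < \<rho>" using t by (simp add: dist_norm norm_mult)
    moreover have "z + of_real r * cis \<theta>' \<noteq> z" using t by simp
    ultimately obtain d u where d: "d \<in> set ds" "u > 0" "of_real r * cis \<theta>' = of_real u * d"
      using \<rho>(2) by (metis add_left_cancel)
    obtain j where j: "j < length ds" "d = ds ! j" using d(1) by (metis in_set_conv_nth)
    have dj: "d \<noteq> 0" "d = of_real (cmod d) * cis (\<theta> j)"
    proof -
      have "ds ! j \<noteq> 0" "is_Arg (ds ! j) (\<theta> j)" using \<theta>(1) j(1) by auto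
      then show "d \<noteq> 0" "d = of_real (cmod d) * cis (\<theta> j)" unfolding j(2) by (auto intro: is_Arg_cis)
    qed
    have "cmod (of_real r * cis \<theta>') = cmod (of_real u * d)" using d(3) by simp
    then have "r = u * cmod d" using t d(2) by (simp add: norm_mult)
    then have "cis \<theta>' = cis (\<theta> j)"
      using d(3) dj t by (metis mult.assoc mult_cancel_left of_real_eq_0_iff of_real_mult order_less_irrefl)
    then have "cis (\<theta>' - \<theta> j) = 1" by (metis cis_divide divide_self_if cis_neq_zero)
    then have "cos (\<theta>' - \<theta> j) = 1" by (metis cis.sel(1) one_complex.sel(1))
    then obtain m :: int where m: "\<theta>' - \<theta> j = of_int m * (2 * pi)"
      by (auto simp: cos_one_2pi_int)
    have j0: "\<theta> j \<le> \<theta> 0" "\<theta> 0 - \<theta> j < 2 * pi" using mono[of 0 j] j(1) \<theta>(3) by auto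
    have i0: "\<theta> i \<le> \<theta> 0" "\<theta> 0 - \<theta> i < 2 * pi" using mono[of 0 i] i \<theta>(3) by auto
    show False
    proof (cases "Suc i < length ds")
      case True
      then have *: "\<beta> = \<theta> (Suc i)" by (simp add: \<beta>_def)
      have "\<theta> 0 - \<beta> < 2 * pi" using \<theta>(3) True * by auto
      then have "of_int m * (2 * pi) < 1 * (2 * pi)" "(-1) * (2 * pi) < of_int m * (2 * pi)"
        using m j0 i0 t by linarith+
      then have "of_int m < (1::real)" "(-1::real) < of_int m"
        by (simp_all only: mult_less_cancel_right) auto
      then have "m = 0" by linarith
      then have "\<theta>' = \<theta> j" using m by simp
      then show False
        using mono[of j i] mono[of "Suc i" j] t * i j(1) by (cases "j \<le> i") auto
    next
      case False
      then have *: "\<beta> = \<theta> 0 - 2 * pi" by (simp add: \<beta>_def)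
      have "\<theta> i \<le> \<theta> j" using mono[of j i] i j(1) False by simp
      then have "of_int m * (2 * pi) < 0 * (2 * pi)" "(-1) * (2 * pi) < of_int m * (2 * pi)"
        using m j0 i0 t * by linarith+
      then have "of_int m < (0::real)" "of_int (-1) < (of_int m::real)"
        by (simp_all only: mult_less_cancel_right) auto
      then have "m < 0" "-1 < m" by (simp_all only: of_int_less_iff of_int_less_0_iff)
      then show False by linarith
    qed
  qed
  then show thesis using that[OF \<rho>(1) lt arg] by blast
qed

text \<open>The sector clockwise from one direction to the next lies in one component, which is to
  the right of the first ray and to the left of the second. The modulus closes the cycle and covers
  a point with one ray, which has the same face on both sides.\<close>

lemma fan:
  assumes cl: "clockwise ds" and ls: "local_star K z ds" and i: "i < length ds"
  shows "\<exists>F\<in>components (- K). germ (-1) z (ds ! i) F \<and> germ 1 z (ds ! (Suc i mod length ds)) F"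
proof -
  obtain \<theta> where th: "\<forall>i < length ds. ds ! i \<noteq> 0 \<and> is_Arg (ds ! i) (\<theta> i)"
    "\<forall>j < length ds. \<forall>i < j. \<theta> j < \<theta> i" "\<forall>i < length ds. \<theta> 0 - \<theta> i < 2 * pi"
    using cl unfolding clockwise_def by auto
  define \<beta> where "\<beta> = (if Suc i < length ds then \<theta> (Suc i) else \<theta> 0 - 2 * pi)"
  obtain \<rho> where free: "0 < \<rho>" "\<beta> < \<theta> i" "is_Arg (ds ! (Suc i mod length ds)) \<beta>"
    "\<And>\<theta>' r. \<beta> < \<theta>' \<Longrightarrow> \<theta>' < \<theta> i \<Longrightarrow> 0 < r \<Longrightarrow> r < \<rho> \<Longrightarrow> z + of_real r * cis \<theta>' \<notin> K"
    using star_sector_free[OF th ls i \<beta>_def] by blast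
  note \<theta> = th(1) free
  obtain F where F: "F \<in> components (- K)"
    "\<And>\<theta>' r. \<beta> < \<theta>' \<Longrightarrow> \<theta>' < \<theta> i \<Longrightarrow> 0 < r \<Longrightarrow> r < \<rho> \<Longrightarrow> z + of_real r * cis \<theta>' \<in> F"
    using sector_component[OF \<theta>(2,3), of z K] \<theta>(5) by blast
  have nz: "ds ! i \<noteq> 0" "is_Arg (ds ! i) (\<theta> i)" "ds ! (Suc i mod length ds) \<noteq> 0"
    using \<theta>(1) i mod_less_divisor[of "length ds" "Suc i"] by fastforce+
  show ?thesis
    using germ_sector_cw[OF nz(1,2) \<theta>(3,2) F(2)] germ_sector_ccw[OF nz(3) \<theta>(4,3,2) F(2)] F(1) by blast
qed

text \<open>Meant for the bends of a polygonal line, where exactly two segments meet. The second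
  argument is lowered by a full turn where necessary.\<close>

lemma clockwise_pair:
  assumes "d \<noteq> 0" "e \<noteq> 0" "\<nexists>t. 0 < t \<and> e = of_real t * d"
  shows "clockwise [d, e]"
proof -
  have ne: "Arg d \<noteq> Arg e"
  proof
    assume "Arg d = Arg e"
    then have "e = of_real (cmod e / cmod d) * d"
      using Arg_eq[OF assms(1)] Arg_eq[OF assms(2)] assms(1)
      by (metis (no_types, lifting) mult.assoc nonzero_mult_div_cancel_right norm_eq_zero
          of_real_divide of_real_eq_0_iff times_divide_eq_left times_divide_eq_right)
    then show False using assms by (metis zero_less_divide_iff zero_less_norm_iff)
  qed
  define \<theta> where "\<theta> = (\<lambda>i::nat. if i = 0 then Arg d else if Arg e < Arg d then Arg e else Arg e - 2 * pi)"
  have a: "is_Arg d (Arg d)" "is_Arg e (Arg e)" using is_Arg_Arg assms by auto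
  have b: "is_Arg e (Arg e - 2 * pi)"
    using a(2) unfolding is_Arg_def by (metis cis_conv_exp cis_2pi cis_divide div_by_1)
  have "-pi < Arg d" "Arg d \<le> pi" "-pi < Arg e" "Arg e \<le> pi"
    using Arg_le_pi mpi_less_Arg by auto
  then show ?thesis unfolding clockwise_def
    using a b assms ne by (intro exI[of _ \<theta>]) (auto simp: \<theta>_def less_Suc_eq)
qed

subsection \<open>Winding numbers and polygonal paths\<close>

lemma in_closed_segment_offset:
  fixes a b :: complex
  assumes "0 \<le> u" "u \<le> 1"
  shows "a + of_real u * (b - a) \<in> closed_segment a b"
  unfolding closed_segment_def using assms
  by (auto simp: scaleR_conv_of_real algebra_simps intro!: exI[of _ u])

text \<open>Away from its ends the segment has positive distance from the rest of K, so a parallel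
  copy on one side avoids K and joins the two faces. Seen from b the direction is reversed, hence
  the opposite sign.\<close>

lemma seg_walk:
  assumes ab: "a \<noteq> b" and K': "closed K'" "K \<subseteq> closed_segment a b \<union> K'" "K' \<inter> open_segment a b = {}"
    and \<sigma>: "\<sigma> \<in> {1, -1}"
    and g: "germ \<sigma> a (b - a) F" "germ (- \<sigma>) b (a - b) F'"
    and F: "F \<in> components (- K)" "F' \<in> components (- K)"
  shows "F = F'"
proof -
  obtain \<eta>1 where \<eta>1: "\<eta>1 > 0" "\<And>\<eta>. 0 < \<eta> \<Longrightarrow> \<eta> < \<eta>1 \<Longrightarrow> \<forall>\<^sub>F \<delta> in at_right 0. a + (b - a) * Complex \<eta> (\<sigma> * \<delta>) \<in> F"
    using germ_perp[OF g(1) \<sigma>] by auto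
  have \<sigma>': "- \<sigma> \<in> {1, -1}" using \<sigma> by auto
  obtain \<eta>2 where \<eta>2: "\<eta>2 > 0" "\<And>\<eta>. 0 < \<eta> \<Longrightarrow> \<eta> < \<eta>2 \<Longrightarrow> \<forall>\<^sub>F \<delta> in at_right 0. b + (a - b) * Complex \<eta> (- \<sigma> * \<delta>) \<in> F'"
    using germ_perp[OF g(2) \<sigma>'] by auto
  \<comment> \<open>Small enough for both germs, and below 1/2 so that the parallel piece from
    \<eta> to \<open>1 - \<eta>\<close> is nonempty.\<close>
  define \<eta> where "\<eta> = min (1/2) (min \<eta>1 \<eta>2) / 2"
  have \<eta>: "0 < \<eta>" "\<eta> < \<eta>1" "\<eta> < \<eta>2" "\<eta> < 1/2"
    using \<eta>1(1) \<eta>2(1) by (auto simp: \<eta>_def min_def)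
  let ?C = "(\<lambda>t. a + (b - a) * of_real t) ` {\<eta>..1 - \<eta>}"
  have "compact ?C"
    by (intro compact_continuous_image continuous_intros) auto
  moreover have "?C \<subseteq> open_segment a b"
  proof -
    have "a + (b - a) * of_real t \<in> open_segment a b" if "t \<in> {\<eta>..1 - \<eta>}" for t
      using that \<eta> ab
      by (auto simp: in_segment scaleR_conv_of_real algebra_simps intro!: exI[of _ t])
    then show ?thesis by blast
  qed
  ultimately obtain e where e: "e > 0" "\<And>x y. x \<in> ?C \<Longrightarrow> y \<in> K' \<Longrightarrow> e \<le> dist x y"
    using separate_compact_closed[OF _ K'(1), of ?C] K'(3) by blast
  have "((\<lambda>\<delta>. \<delta> * cmod (b - a)) \<longlongrightarrow> 0 * cmod (b - a)) (at_right (0::real))"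
    by (intro tendsto_intros)
  then have "\<forall>\<^sub>F \<delta> in at_right (0::real). \<delta> * cmod (b - a) < e"
    using e(1) by (intro order_tendstoD(2)[where y="0 * cmod (b - a)"]) auto
  with \<eta>1(2)[OF \<eta>(1,2)] \<eta>2(2)[OF \<eta>(1,3)] eventually_at_right_less[of 0]
  have "\<forall>\<^sub>F \<delta> in at_right (0::real). 0 < \<delta> \<and> \<delta> * cmod (b - a) < e \<and>
      a + (b - a) * Complex \<eta> (\<sigma> * \<delta>) \<in> F \<and> b + (a - b) * Complex \<eta> (- \<sigma> * \<delta>) \<in> F'"
    by eventually_elim auto
  then obtain \<delta> where \<delta>: "0 < \<delta>" "\<delta> * cmod (b - a) < e"
      "a + (b - a) * Complex \<eta> (\<sigma> * \<delta>) \<in> F" "b + (a - b) * Complex \<eta> (- \<sigma> * \<delta>) \<in> F'"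
    by (blast dest: eventually_at_right_0D)
  let ?p = "\<lambda>t. a + (b - a) * Complex t (\<sigma> * \<delta>)"
  let ?T = "?p ` {\<eta>..1 - \<eta>}"
  have "continuous_on {\<eta>..1 - \<eta>} ?p"
    unfolding Complex_eq by (intro continuous_intros)
  then have conn: "connected ?T" by (intro connected_continuous_image) auto
  have sub: "?T \<subseteq> - K"
  proof -
    have "?p t \<notin> K" if t: "t \<in> {\<eta>..1 - \<eta>}" for t
    proof
      assume "?p t \<in> K"
      then consider "?p t \<in> closed_segment a b" | "?p t \<in> K'" using K'(2) by auto
      then show False
      proof cases
        case 1
        then obtain u where "?p t = (1 - u) *\<^sub>R a + u *\<^sub>R b" unfolding closed_segment_def by auto
        then have "(b - a) * Complex t (\<sigma> * \<delta>) = (b - a) * of_real u"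
          by (simp add: scaleR_conv_of_real algebra_simps)
        then have "Complex t (\<sigma> * \<delta>) = of_real u" using ab by simp
        then show False using \<sigma> \<delta> by (auto simp: complex_eq_iff)
      next
        case 2
        have "dist (a + (b - a) * of_real t) (?p t) = cmod ((b - a) * Complex 0 (\<sigma> * \<delta>))"
          unfolding dist_norm by (subst norm_minus_commute) (simp add: Complex_eq algebra_simps)
        also have "\<dots> = \<bar>\<sigma> * \<delta>\<bar> * cmod (b - a)" by (simp add: norm_mult cmod_def[of "Complex 0 (\<sigma> * \<delta>)"])
        also have "\<dots> = \<delta> * cmod (b - a)" using \<sigma> \<delta> by auto
        finally have "dist (a + (b - a) * of_real t) (?p t) < e" using \<delta>(2) by linarith
        moreover have "a + (b - a) * of_real t \<in> ?C" using t by blast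
        ultimately show False using e(2)[OF _ 2] by force
      qed
    qed
    then show ?thesis by auto
  qed
  have "?p \<eta> \<in> ?T" "?p (1 - \<eta>) \<in> ?T" using \<eta> by auto
  moreover have "?p (1 - \<eta>) = b + (a - b) * Complex \<eta> (- \<sigma> * \<delta>)"
    by (simp add: complex_eq_iff algebra_simps)
  ultimately have "F \<inter> ?T \<noteq> {}" "F' \<inter> ?T \<noteq> {}" using \<delta>(3,4) by (metis disjoint_iff)+
  then show ?thesis using joinable_components_eq[of ?T "- K" F F'] conn sub F by blast
qed

text \<open>The winding number is the same around all points of a face \<open>F\<close>, so any of them may be chosen.\<close>

definition val :: "(real \<Rightarrow> complex) \<Rightarrow> complex set \<Rightarrow> complex" where
  "val \<gamma> F = winding_number \<gamma> (SOME p. p \<in> F)"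

lemma val_eq:
  assumes "path \<gamma>" "pathfinish \<gamma> = pathstart \<gamma>" "path_image \<gamma> \<subseteq> K" "F \<in> components (- K)" "p \<in> F"
  shows "winding_number \<gamma> p = val \<gamma> F"
  unfolding val_def
proof (rule winding_number_eq[OF assms(1,2)])
  show "connected F" using assms(4) in_components_connected by blast
  show "F \<inter> path_image \<gamma> = {}" using assms(3,4) in_components_subset by blast
  show "(SOME p. p \<in> F) \<in> F" using assms(5) by (rule someI)
qed (use assms in auto)

lemma winding_number_near:
  assumes "path \<gamma>" "pathfinish \<gamma> = pathstart \<gamma>" "z \<notin> path_image \<gamma>"
  shows "\<exists>e>0. \<forall>w\<in>ball z e. winding_number \<gamma> w = winding_number \<gamma> z"
proof -
  obtain e where e: "e > 0" "ball z e \<subseteq> - path_image \<gamma>"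
    using assms closed_path_image[OF assms(1)] open_contains_ball[of "- path_image \<gamma>"]
    by (auto simp: open_Compl)
  then have "winding_number \<gamma> w = winding_number \<gamma> z" if "w \<in> ball z e" for w
    using winding_number_eq[OF assms(1,2) that, of z] by auto
  then show ?thesis using e by blast
qed

text \<open>The ray may run along an edge and then lies in no face. Off the curve the winding number
  is still locally constant, and points of F come arbitrarily close to the ray.\<close>

lemma val_cross:
  assumes \<gamma>: "path \<gamma>" "pathfinish \<gamma> = pathstart \<gamma>" "path_image \<gamma> \<subseteq> K" and F: "F \<in> components (- K)"
    and g: "germ \<sigma> z d F" and off: "\<forall>\<^sub>F r in at_right 0. z + of_real r * d \<notin> path_image \<gamma>"
  shows "\<forall>\<^sub>F r in at_right 0. winding_number \<gamma> (z + of_real r * d) = val \<gamma> F"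
proof -
  obtain r0 \<phi>0 where *: "r0 > 0" "\<phi>0 > 0"
    "\<And>r \<phi>. 0 < r \<and> r < r0 \<and> 0 < \<phi> \<and> \<phi> < \<phi>0 \<Longrightarrow> z + of_real r * d * cis (\<sigma> * \<phi>) \<in> F"
    using g unfolding germ_iff by auto
  have "\<forall>\<^sub>F r in at_right 0. r < r0"
    using *(1) by (intro eventually_at_rightI[of 0 r0]) auto
  then show ?thesis using off eventually_at_right_less[of 0]
  proof eventually_elim
    case (elim r)
    obtain e where e: "e > 0" "\<And>w. w \<in> ball (z + of_real r * d) e \<Longrightarrow>
        winding_number \<gamma> w = winding_number \<gamma> (z + of_real r * d)"
      using winding_number_near[OF \<gamma>(1,2) elim(2)] by blast
    have "((\<lambda>\<phi>. z + of_real r * d * cis (\<sigma> * \<phi>)) \<longlongrightarrow> z + of_real r * d * cis (\<sigma> * 0)) (at_right 0)"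
      by (intro tendsto_intros)
    then have "\<forall>\<^sub>F \<phi> in at_right 0. z + of_real r * d * cis (\<sigma> * \<phi>) \<in> ball (z + of_real r * d) e"
      using e(1) tendstoD[of "\<lambda>\<phi>. z + of_real r * d * cis (\<sigma> * \<phi>)" "z + of_real r * d" "at_right 0" e]
      by (simp only: mem_ball dist_commute[of "z + of_real r * d"] mult_zero_right cis_zero mult_1_right)
    moreover have "\<forall>\<^sub>F \<phi> in at_right 0. \<phi> < \<phi>0"
      using *(2) by (intro eventually_at_rightI[of 0 \<phi>0]) auto
    ultimately have "\<forall>\<^sub>F \<phi> in at_right 0. \<phi> < \<phi>0 \<and> 0 < \<phi> \<and> z + of_real r * d * cis (\<sigma> * \<phi>) \<in> ball (z + of_real r * d) e"
      using eventually_at_right_less[of "0::real"] by eventually_elim auto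
    then obtain \<phi> where \<phi>: "0 < \<phi>" "\<phi> < \<phi>0" "z + of_real r * d * cis (\<sigma> * \<phi>) \<in> ball (z + of_real r * d) e"
      by (blast dest: eventually_at_right_0D)
    then have "z + of_real r * d * cis (\<sigma> * \<phi>) \<in> F" using elim by (intro *(3)) auto
    then show ?case using val_eq[OF \<gamma> F] e(2)[OF \<phi>(3)] by simp
  qed
qed

text \<open>The local model of a crossing. The apex c is erected over m to the left of the segment,
  so a point slightly to the left of m is interior to the triangle and one slightly to the right is
  outside its convex hull. Dividing by \<open>b - a\<close> turns the segment into the real interval
  from 0 to 1.\<close>

lemma triangle_winding_jump:
  fixes a b :: complex
  assumes ab: "a \<noteq> b" and r: "0 < r" "r < 1" and \<epsilon>: "0 < \<epsilon>" "\<epsilon> < 1"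
  defines "m \<equiv> a + (b - a) * of_real r"
  defines "c \<equiv> m + (b - a) * \<i>"
  defines "T \<equiv> linepath a b +++ linepath b c +++ linepath c a"
  shows "winding_number T (a + (b - a) * Complex r \<epsilon>) \<noteq> 0"
    and "winding_number T (a + (b - a) * Complex r (- \<epsilon>)) = 0"
    and "m \<notin> closed_segment a c" "m \<notin> closed_segment c b"
proof -
  have half: "0 \<le> Im ((p - a) / (b - a))" if hull: "p \<in> convex hull {a, b, c}" for p
  proof -
    obtain x y z where p: "0 \<le> x" "0 \<le> y" "0 \<le> z" "x + y + z = 1" "p = x *\<^sub>R a + y *\<^sub>R b + z *\<^sub>R c"
      using hull unfolding convex_hull_3 by blast
    have x: "x = 1 - y - z" using p(4) by simp
    have "p - a = (b - a) * (of_real y + of_real z * (of_real r + \<i>))"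
      unfolding p(5) x c_def m_def by (simp add: scaleR_conv_of_real algebra_simps)
    then have "(p - a) / (b - a) = of_real y + of_real z * (of_real r + \<i>)"
      using ab by simp
    then show ?thesis using p by simp
  qed
  have pimg: "path_image T \<subseteq> convex hull {a, b, c}"
    unfolding T_def
    by (intro subset_path_image_join) (simp_all add: segment_convex_hull hull_mono)
  show "winding_number T (a + (b - a) * Complex r (- \<epsilon>)) = 0"
  proof (rule winding_number_zero_outside[OF _ convex_convex_hull _ _ pimg])
    show "path T" "pathfinish T = pathstart T" by (auto simp: T_def)
    have "(a + (b - a) * Complex r (- \<epsilon>) - a) / (b - a) = Complex r (- \<epsilon>)" using ab by simp
    then show "a + (b - a) * Complex r (- \<epsilon>) \<notin> convex hull {a, b, c}"
      using half[of "a + (b - a) * Complex r (- \<epsilon>)"] \<epsilon> by auto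
  qed
  have ncol: "\<not> collinear {a, b, c}"
  proof
    assume "collinear {a, b, c}"
    then have "collinear {a, c, b}" by (simp add: insert_commute)
    then obtain u where u: "c = u *\<^sub>R a + (1 - u) *\<^sub>R b"
      using ab unfolding collinear_3_expand by blast
    define k where "k = 1 - u"
    have "c - a = k *\<^sub>R (b - a)" unfolding u k_def by (simp add: algebra_simps)
    then have "(b - a) * (of_real r + \<i>) = (b - a) * of_real k"
      unfolding c_def m_def by (simp add: scaleR_conv_of_real algebra_simps)
    then have "of_real r + \<i> = of_real k" using ab by simp
    then show False by (auto simp: complex_eq_iff)
  qed
  have "a + (b - a) * Complex r \<epsilon> \<in> interior (convex hull {a, b, c})"
  proof -
    have "((1 - \<epsilon>) * (1 - r)) *\<^sub>R a + ((1 - \<epsilon>) * r) *\<^sub>R b + \<epsilon> *\<^sub>R c + (\<epsilon> * (1-r)) *\<^sub>R a + (\<epsilon> * r) *\<^sub>R b - \<epsilon> *\<^sub>R m =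
       a + (b - a) * Complex r \<epsilon>"
      unfolding c_def m_def by (simp add: scaleR_conv_of_real Complex_eq algebra_simps)
    moreover have "\<epsilon> *\<^sub>R m = (\<epsilon> * (1-r)) *\<^sub>R a + (\<epsilon> * r) *\<^sub>R b"
      unfolding m_def by (simp add: scaleR_conv_of_real algebra_simps)
    ultimately have "((1 - \<epsilon>) * (1 - r)) *\<^sub>R a + ((1 - \<epsilon>) * r) *\<^sub>R b + \<epsilon> *\<^sub>R c = a + (b - a) * Complex r \<epsilon>"
      by simp
    moreover have "(1 - \<epsilon>) * (1 - r) + (1 - \<epsilon>) * r + \<epsilon> = 1" by (simp add: algebra_simps)
    moreover have "0 < (1 - \<epsilon>) * (1 - r)" "0 < (1 - \<epsilon>) * r" using r \<epsilon> by simp_all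
    ultimately show ?thesis
      unfolding interior_convex_hull_3_minimal[OF ncol DIM_complex]
      by (intro CollectI) (rule exI[of _ "(1 - \<epsilon>) * (1 - r)"], rule exI[of _ "(1 - \<epsilon>) * r"],
          rule exI[of _ \<epsilon>], intro conjI \<epsilon>(1); assumption)
  qed
  from winding_number_triangle[OF this]
  show "winding_number T (a + (b - a) * Complex r \<epsilon>) \<noteq> 0" unfolding T_def by simp
  have seg: "m \<notin> closed_segment p c" if ends: "p \<in> {a, b}" for p
  proof
    assume "m \<in> closed_segment p c"
    then obtain u where u: "m = (1 - u) *\<^sub>R p + u *\<^sub>R c" unfolding closed_segment_def by auto
    obtain s where s: "p = a + (b - a) * of_real s" "s = 0 \<or> s = 1"
    proof (cases "p = a")
      case True then show thesis by (intro that[of 0]) auto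
    next
      case False then show thesis using ends by (intro that[of 1]) auto
    qed
    have "(b - a) * of_real r = (b - a) * ((1 - of_real u) * of_real s + of_real u * (of_real r + \<i>))"
      using u unfolding s(1) c_def m_def by (simp add: scaleR_conv_of_real algebra_simps)
    then have "of_real r = (1 - of_real u) * of_real s + of_real u * (of_real r + \<i>)"
      using ab by simp
    then have "u = 0" "r = s" by (auto simp: complex_eq_iff)
    then show False using s r by auto
  qed
  show "m \<notin> closed_segment a c" "m \<notin> closed_segment c b"
    using seg[of a] seg[of b] by (auto simp: closed_segment_commute)
qed

text \<open>The curve is the sum of the triangle and a closed rest that makes the detour over c
  instead of using the segment. The rest misses a disc around m and contributes equally on both
  sides, so the jump is that of the triangle. The path p may intersect itself.\<close>

lemma val_jump:
  assumes ab: "a \<noteq> b" and p: "path p" "pathstart p = b" "pathfinish p = a"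
    and off: "open_segment a b \<inter> path_image p = {}"
    and \<gamma>: "\<gamma> = linepath a b +++ p" "path_image \<gamma> \<subseteq> K"
    and F: "F \<in> components (- K)" "F' \<in> components (- K)"
    and g: "germ 1 a (b - a) F" "germ (-1) a (b - a) F'"
  shows "val \<gamma> F \<noteq> val \<gamma> F'"
proof -
  obtain \<eta>1 where \<eta>1: "\<eta>1 > 0" "\<And>\<eta>. 0 < \<eta> \<Longrightarrow> \<eta> < \<eta>1 \<Longrightarrow> \<forall>\<^sub>F \<delta> in at_right 0. a + (b - a) * Complex \<eta> (1 * \<delta>) \<in> F"
    using germ_perp[OF g(1)] by auto
  obtain \<eta>2 where \<eta>2: "\<eta>2 > 0" "\<And>\<eta>. 0 < \<eta> \<Longrightarrow> \<eta> < \<eta>2 \<Longrightarrow> \<forall>\<^sub>F \<delta> in at_right 0. a + (b - a) * Complex \<eta> (- 1 * \<delta>) \<in> F'"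
    using germ_perp[OF g(2)] by auto
  \<comment> \<open>A distance from a at which both germs apply; m is then an inner point of the
    segment.\<close>
  define r where "r = min (1/2) (min \<eta>1 \<eta>2) / 2"
  have r: "0 < r" "r < \<eta>1" "r < \<eta>2" "r < 1"
    using \<eta>1(1) \<eta>2(1) by (auto simp: r_def min_def)
  define m where "m = a + (b - a) * of_real r"
  define c where "c = m + (b - a) * \<i>"
  let ?T = "linepath a b +++ linepath b c +++ linepath c a"
  let ?R = "p +++ linepath a c +++ linepath c b"
  have m: "m \<in> open_segment a b"
    using r ab by (auto simp: m_def in_segment scaleR_conv_of_real algebra_simps intro!: exI[of _ r])
  have mR: "m \<notin> path_image ?R"
    using triangle_winding_jump(3,4)[OF ab r(1,4), of "1/2", folded m_def, folded c_def] off m p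
    by (auto simp: path_image_join closed_segment_commute)
  obtain e where e: "e > 0" "ball m e \<subseteq> - path_image ?R"
    using mR closed_path_image[of ?R] open_contains_ball[of "- path_image ?R"] p
    by (auto simp: open_Compl)
  have "((\<lambda>\<delta>. \<delta> * cmod (b - a)) \<longlongrightarrow> 0 * cmod (b - a)) (at_right (0::real))"
    by (intro tendsto_intros)
  then have "\<forall>\<^sub>F \<delta> in at_right (0::real). \<delta> * cmod (b - a) < e"
    using e(1) by (intro order_tendstoD(2)[where y="0 * cmod (b - a)"]) auto
  moreover have "\<forall>\<^sub>F \<delta> in at_right (0::real). \<delta> < 1"
    by (intro eventually_at_rightI[of 0 1]) auto
  ultimately have "\<forall>\<^sub>F \<delta> in at_right (0::real). 0 < \<delta> \<and> \<delta> < 1 \<and> \<delta> * cmod (b - a) < e \<and>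
      a + (b - a) * Complex r \<delta> \<in> F \<and> a + (b - a) * Complex r (- \<delta>) \<in> F'"
    using \<eta>1(2)[OF r(1,2)] \<eta>2(2)[OF r(1,3)] eventually_at_right_less[of "0::real"]
    by eventually_elim auto
  then obtain \<delta> where \<delta>: "0 < \<delta>" "\<delta> < 1" "\<delta> * cmod (b - a) < e"
      "a + (b - a) * Complex r \<delta> \<in> F" "a + (b - a) * Complex r (- \<delta>) \<in> F'"
    by (blast dest: eventually_at_right_0D)
  have \<gamma>': "path \<gamma>" "pathfinish \<gamma> = pathstart \<gamma>" using \<gamma> p by auto
  have inball: "a + (b - a) * Complex r s \<in> ball m e" if "s \<in> {\<delta>, - \<delta>}" for s
  proof -
    have "dist m (a + (b - a) * Complex r s) = cmod ((b - a) * Complex 0 s)"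
      unfolding dist_norm m_def by (subst norm_minus_commute) (simp add: Complex_eq algebra_simps)
    also have "\<dots> = \<bar>s\<bar> * cmod (b - a)" by (simp add: norm_mult cmod_def[of "Complex 0 s"])
    also have "\<dots> = \<delta> * cmod (b - a)" using that \<delta> by auto
    finally show ?thesis using \<delta> by simp
  qed
  have R: "winding_number ?R (a + (b - a) * Complex r \<delta>) = winding_number ?R (a + (b - a) * Complex r (- \<delta>))"
    by (rule winding_number_eq[of _ _ "ball m e"]) (use p e inball in auto)
  \<comment> \<open>The two sides at c are run through in both directions and cancel.\<close>
  have split: "winding_number \<gamma> z = winding_number ?T z + winding_number ?R z"
    if z: "z \<in> ball m e" "z \<notin> path_image \<gamma>" for z
  proof -
    have zR: "z \<notin> path_image ?R" using z e by blast
    have 1: "z \<notin> closed_segment a b" "z \<notin> path_image p"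
      using z(2) \<gamma> p by (auto simp: path_image_join)
    have 2: "z \<notin> closed_segment a c" "z \<notin> closed_segment c b"
      using zR p by (auto simp: path_image_join)
    have "winding_number (reversepath (linepath a c)) z = - winding_number (linepath a c) z"
        "winding_number (reversepath (linepath c b)) z = - winding_number (linepath c b) z"
      using 2 winding_number_reversepath[of "linepath a c" z] winding_number_reversepath[of "linepath c b" z] by simp_all
    then show ?thesis unfolding \<gamma>
      using 1 2 p by (simp add: winding_number_join path_image_join closed_segment_commute)
  qed
  have off: "a + (b - a) * Complex r \<delta> \<notin> path_image \<gamma>" "a + (b - a) * Complex r (- \<delta>) \<notin> path_image \<gamma>"
    using \<delta>(4,5) F \<gamma>(2) in_components_subset by blast+
  have "val \<gamma> F = winding_number ?T (a + (b - a) * Complex r \<delta>) + winding_number ?R (a + (b - a) * Complex r \<delta>)"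
    using val_eq[OF \<gamma>' \<gamma>(2) F(1) \<delta>(4)] split[OF inball off(1)] by simp
  moreover have "val \<gamma> F' = winding_number ?T (a + (b - a) * Complex r (- \<delta>)) + winding_number ?R (a + (b - a) * Complex r (- \<delta>))"
    using val_eq[OF \<gamma>' \<gamma>(2) F(2) \<delta>(5)] split[OF inball off(2)] by simp
  ultimately show ?thesis
    using R triangle_winding_jump(1,2)[OF ab r(1,4) \<delta>(1,2), folded m_def, folded c_def] by simp
qed

section \<open>Polygonal arcs\<close>

lemma path_polyline [simp]: "path (polyline ps)"
  and pathstart_polyline [simp]: "pathstart (polyline (a # qs)) = a"
  and pathfinish_polyline [simp]: "ps \<noteq> [] \<Longrightarrow> pathfinish (polyline ps) = last ps"
proof -
  show start: "pathstart (polyline (a # qs)) = a" for a qs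
    by (cases "a # qs" rule: polyline.cases) auto
  show "path (polyline ps)" by (induction ps rule: polyline.induct) (auto simp: start, simp_all add: path_def)
  show "ps \<noteq> [] \<Longrightarrow> pathfinish (polyline ps) = last ps" by (induction ps rule: polyline.induct) auto
qed

lemma path_image_polyline_Cons:
  "path_image (polyline (a # b # ps)) = closed_segment a b \<union> path_image (polyline (b # ps))"
  by (cases ps) (auto simp: path_image_join)

lemma path_image_polyline_snoc:
  "path_image (polyline (ps @ [b, c])) = path_image (polyline (ps @ [b])) \<union> closed_segment b c"
proof (induction ps)
  case Nil
  then show ?case by auto
next
  case (Cons a ps)
  show ?case
  proof (cases ps)
    case Nil
    then show ?thesis by (simp add: path_image_join)
  next
    case (Cons d qs)
    then show ?thesis using Cons.IH by (simp add: path_image_polyline_Cons Un_assoc del: polyline.simps)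
  qed
qed

lemma arc_polylineD:
  assumes "arc (polyline (a # b # ps))"
  shows "a \<noteq> b" "ps \<noteq> [] \<Longrightarrow> arc (polyline (b # ps))"
    "closed_segment a b \<inter> path_image (polyline (b # ps)) \<subseteq> {b}"
    "a \<notin> path_image (polyline (b # ps))"
proof -
  have "a \<noteq> b \<and> (ps \<noteq> [] \<longrightarrow> arc (polyline (b # ps))) \<and> closed_segment a b \<inter> path_image (polyline (b # ps)) \<subseteq> {b}"
  proof (cases ps)
    case Nil
    then show ?thesis using assms arc_distinct_ends[OF assms] by auto
  next
    case (Cons c qs)
    then have *: "arc (linepath a b) \<and> arc (polyline (b # ps)) \<and>
        closed_segment a b \<inter> path_image (polyline (b # ps)) \<subseteq> {b}"
      using assms arc_join_eq[of "linepath a b" "polyline (b # ps)"] by simp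
    then show ?thesis using arc_distinct_ends[of "linepath a b"] by auto
  qed
  then show "a \<noteq> b" "ps \<noteq> [] \<Longrightarrow> arc (polyline (b # ps))"
    "closed_segment a b \<inter> path_image (polyline (b # ps)) \<subseteq> {b}"
    "a \<notin> path_image (polyline (b # ps))" by auto
qed

text \<open>The recursion of \<open>polyline\<close> takes segments off the front, so the last
  segment needs an induction of its own.\<close>

lemma arc_polyline_last:
  assumes "arc (polyline (ps @ [b, c]))"
  shows "b \<noteq> c" "c \<notin> path_image (polyline (ps @ [b]))"
proof -
  have "b \<noteq> c \<and> c \<notin> path_image (polyline (ps @ [b]))"
    using assms
  proof (induction ps)
    case Nil
    then show ?case using arc_polylineD[of b c "[]"] by auto
  next
    case (Cons a ps)
    show ?case
    proof (cases ps)
      case Nil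
      have A: "arc (polyline (a # b # [c]))" using Cons.prems Nil by simp
      have "b \<noteq> c" using arc_polylineD(1)[of b c "[]"] arc_polylineD(2)[OF A] by simp
      moreover have "c \<in> path_image (polyline [b, c])" by simp
      ultimately show ?thesis using arc_polylineD(3)[OF A] Nil by auto
    next
      case (Cons d qs)
      have A: "arc (polyline (a # d # (qs @ [b, c])))" using Cons.prems Cons by simp
      have "c \<in> path_image (polyline (d # (qs @ [b, c])))"
        using pathfinish_in_path_image[of "polyline (d # (qs @ [b, c]))"] by simp
      moreover have IH: "b \<noteq> c \<and> c \<notin> path_image (polyline (d # qs @ [b]))"
        using Cons.IH arc_polylineD(2)[OF A] Cons by simp
      moreover have "d \<in> path_image (polyline (d # qs @ [b]))"
        using pathstart_in_path_image[of "polyline (d # qs @ [b])"] by simp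
      ultimately show ?thesis using arc_polylineD(3)[OF A] Cons
        by (auto simp: path_image_polyline_Cons simp del: polyline.simps)
    qed
  qed
  then show "b \<noteq> c" "c \<notin> path_image (polyline (ps @ [b]))" by auto
qed

text \<open>Along a segment the face is kept by \<open>seg_walk\<close>. At a bend only two rays
  leave, so \<open>fan\<close> with two directions carries the face from one segment to the next.
  The rest \<open>K'\<close> may touch the arc at its two ends only.\<close>

lemma polyline_walk:
  assumes "arc (polyline (a # b # ps))" "closed K'"
    and "K \<subseteq> path_image (polyline (a # b # ps)) \<union> K'"
    and "path_image (polyline (a # b # ps)) \<inter> K' \<subseteq> {a, last (b # ps)}"
    and \<sigma>: "\<sigma> \<in> {1, -1}"
    and "germ \<sigma> a (b - a) F"
    and g': "germ (- \<sigma>) (last (b # ps)) (rev (a # b # ps) ! 1 - last (b # ps)) F'"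
    and "F \<in> components (- K)" and F': "F' \<in> components (- K)"
  shows "F = F'"
  using assms(1-4,6-8)
proof (induction ps arbitrary: a b K' F)
  case Nil
  have "K' \<inter> open_segment a b = {}"
    using Nil.prems(4) by (auto simp: open_segment_def)
  then show ?case
    using seg_walk[OF _ Nil.prems(2) _ _ \<sigma> Nil.prems(5) _ Nil.prems(7) F'] Nil.prems(1,3,6)
      arc_polylineD(1)[OF Nil.prems(1)] by simp
next
  case (Cons c ps)
  note A = arc_polylineD[OF Cons.prems(1)]
  let ?tl = "path_image (polyline (b # c # ps))"
  have arc': "arc (polyline (b # c # ps))" using A(2) by simp
  note B = arc_polylineD[OF arc']
  have img: "path_image (polyline (a # b # c # ps)) = closed_segment a b \<union> ?tl"
    by (rule path_image_polyline_Cons)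
  have last_in: "last (c # ps) \<in> path_image (polyline (c # ps))"
    using pathfinish_in_path_image[of "polyline (c # ps)"] by simp
  have b: "b \<notin> path_image (polyline (c # ps))" by (rule B(4))
  then have bl: "b \<noteq> last (c # ps)" using last_in by auto
  have P4: "(closed_segment a b \<union> ?tl) \<inter> K' \<subseteq> {a, last (c # ps)}"
    using Cons.prems(4) unfolding img by (simp only: last_ConsR list.simps simp_thms)
  have "b \<in> closed_segment a b" by simp
  then have bK': "b \<notin> K'" using P4 A(1) bl by blast
  have tlK': "?tl \<inter> K' \<subseteq> {last (c # ps)}" using P4 A(4) by blast
  have star: "local_star K b [a - b, c - b]"
  proof (rule local_star_subset)
    show "K \<subseteq> closed_segment b a \<union> (closed_segment b c \<union> (path_image (polyline (c # ps)) \<union> K'))"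
      using Cons.prems(3) unfolding path_image_polyline_Cons by (auto simp: closed_segment_commute)
    show "local_star (closed_segment b a \<union> (closed_segment b c \<union> (path_image (polyline (c # ps)) \<union> K'))) b [a - b, c - b]"
      using b bK' Cons.prems(2)
      by (intro local_star_Un local_star_segment local_star_off closed_path_image) auto
  qed
  have "\<nexists>t. 0 < t \<and> c - b = of_real t * (a - b)"
  proof
    assume "\<exists>t. 0 < t \<and> c - b = of_real t * (a - b)"
    then obtain t where t: "0 < t" "c - b = of_real t * (a - b)" by auto
    \<comment> \<open>If the line folded back at b, the point at parameter u from b towards a would
      lie on both segments, although the arc is injective.\<close>
    define u where "u = min 1 t"
    have u: "0 < u" "u \<le> 1" "u \<le> t" using t by (auto simp: u_def)
    let ?p = "b + of_real u * (a - b)"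
    have "?p \<in> closed_segment b a"
      using u by (intro in_closed_segment_offset) auto
    moreover have "?p = b + of_real (u / t) * (c - b)"
      using t by (simp add: t(2))
    then have "?p \<in> closed_segment b c"
      using in_closed_segment_offset[of "u / t" b c] u t(1) by simp
    ultimately have "?p = b"
      using A(3) unfolding path_image_polyline_Cons[of b] by (auto simp: closed_segment_commute)
    then show False using u A(1) by simp
  qed
  then have cw: "clockwise [a - b, c - b]"
    using A(1) B(1) by (intro clockwise_pair) auto
  have "\<exists>F1\<in>components (- K). germ (- \<sigma>) b (a - b) F1 \<and> germ \<sigma> b (c - b) F1"
  proof (cases "\<sigma> = 1")
    case True
    then show ?thesis using fan[OF cw star, of 0] by simp
  next
    case False
    then show ?thesis using \<sigma> fan[OF cw star, of 1] by (auto simp: numeral_2_eq_2)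
  qed
  then obtain F1 where F1: "F1 \<in> components (- K)" "germ (- \<sigma>) b (a - b) F1" "germ \<sigma> b (c - b) F1"
    by auto
  have "F = F1"
  proof (rule seg_walk[OF A(1) _ _ _ \<sigma> Cons.prems(5) F1(2) Cons.prems(7) F1(1)])
    show "closed (?tl \<union> K')" using Cons.prems(2) by (intro closed_Un closed_path_image) auto
    show "K \<subseteq> closed_segment a b \<union> (?tl \<union> K')" using Cons.prems(3) img by auto
    show "(?tl \<union> K') \<inter> open_segment a b = {}"
      using A(3) Cons.prems(4) img A(4) last_in unfolding path_image_polyline_Cons[of b]
      by (auto simp: open_segment_def simp del: polyline.simps)
  qed
  moreover have "F1 = F'"
  proof (rule Cons.IH[OF arc' _ _ _ F1(3) _ F1(1)])
    show "closed (closed_segment a b \<union> K')" using Cons.prems(2) by auto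
    show "K \<subseteq> ?tl \<union> (closed_segment a b \<union> K')" using Cons.prems(3) img by auto
    show "?tl \<inter> (closed_segment a b \<union> K') \<subseteq> {b, last (c # ps)}"
      using A(3) tlK' by blast
    show "germ (- \<sigma>) (last (c # ps)) (rev (b # c # ps) ! 1 - last (c # ps)) F'"
    proof -
      have "rev (a # b # c # ps) ! 1 = rev (b # c # ps) ! 1"
        by (cases ps rule: rev_cases) (auto simp: nth_append)
      then show ?thesis using Cons.prems(6) by simp
    qed
  qed
  ultimately show ?case by simp
qed

subsection \<open>Faces of a planar drawing\<close>

locale st_rotation =
  fixes G :: emb_graph
  assumes st: "st_graph G" and rl: "rotation_lists G"
begin

lemma arcs_verts: "(u, v) \<in> arcs G \<Longrightarrow> u \<in> verts G \<and> v \<in> verts G"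
  using st unfolding st_graph_def by auto

lemma finite_verts [simp]: "finite (verts G)" by (simp add: verts_def)

lemma card_verts: "card (verts G) = nv G" by (simp add: verts_def)

lemma finite_arcs [simp]: "finite (arcs G)"
  using st finite_subset[of "arcs G" "verts G \<times> verts G"] unfolding st_graph_def by auto

lemma arcs_irrefl: "(u, u) \<notin> arcs G"
  using st unfolding st_graph_def acyclic_def by auto

lemma arcs_antisym: "(u, v) \<in> arcs G \<Longrightarrow> (v, u) \<notin> arcs G"
  using st unfolding st_graph_def acyclic_def by (meson trancl.intros)

lemma src_verts: "src G \<in> verts G" and snk_verts: "snk G \<in> verts G"
  using st unfolding st_graph_def by blast+

lemma ex_in_arc: "v \<in> verts G \<Longrightarrow> v \<noteq> src G \<Longrightarrow> \<exists>u. (u, v) \<in> arcs G"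
  using st unfolding st_graph_def by blast

lemma ex_out_arc: "v \<in> verts G \<Longrightarrow> v \<noteq> snk G \<Longrightarrow> \<exists>w. (v, w) \<in> arcs G"
  using st unfolding st_graph_def by blast

lemma src_no_in: "(u, src G) \<notin> arcs G" and snk_no_out: "(snk G, u) \<notin> arcs G"
  using st unfolding st_graph_def by blast+

lemma rot_distinct: "u \<in> verts G \<Longrightarrow> distinct (rot G u)"
  and rot_set: "u \<in> verts G \<Longrightarrow> set (rot G u) = {v. (u, v) \<in> arcs G \<or> (v, u) \<in> arcs G}"
  and rot_last: "u \<in> verts G \<Longrightarrow> u \<noteq> src G \<Longrightarrow> (last (rot G u), u) \<in> arcs G"
  using rl unfolding rotation_lists_def by blast+

lemma set_succ_list: "u \<in> verts G \<Longrightarrow> set (succ_list G u) = {v. (u, v) \<in> arcs G}"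
  by (auto simp: succ_list_def rot_set)

lemma distinct_succ_list: "u \<in> verts G \<Longrightarrow> distinct (succ_list G u)"
  by (simp add: succ_list_def rot_distinct)

lemma rot_src: "rot G (src G) = succ_list G (src G)"
  unfolding succ_list_def using src_no_in by (intro filter_True[symmetric]) (auto simp: rot_set src_verts)

end

locale planar_st = st_rotation +
  fixes D :: drawing
  assumes pd: "planar_drawing G D"
begin

definition K :: "complex set" where
  "K = pos D ` verts G \<union> (\<Union>e\<in>arcs G. path_image (edge_curve D e))"

abbreviation img :: "nat \<times> nat \<Rightarrow> complex set" where "img e \<equiv> path_image (edge_curve D e)"

abbreviation dir :: "nat \<Rightarrow> nat \<Rightarrow> complex" where "dir u w \<equiv> direction G D u w"

definition adj :: "nat \<Rightarrow> nat \<Rightarrow> bool" where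
  "adj u w \<longleftrightarrow> (u, w) \<in> arcs G \<or> (w, u) \<in> arcs G"

lemma adj_rot: "u \<in> verts G \<Longrightarrow> w \<in> set (rot G u) \<longleftrightarrow> adj u w"
  by (auto simp: adj_def rot_set)

lemma adj_verts: "adj u w \<Longrightarrow> u \<in> verts G \<and> w \<in> verts G"
  using arcs_verts unfolding adj_def by blast

lemma pos_inj: "u \<in> verts G \<Longrightarrow> w \<in> verts G \<Longrightarrow> pos D u = pos D w \<Longrightarrow> u = w"
  using pd unfolding planar_drawing_def by (meson inj_onD)

lemma pos_on_edge: "e \<in> arcs G \<Longrightarrow> w \<in> verts G \<Longrightarrow> pos D w \<in> img e \<Longrightarrow> w = fst e \<or> w = snd e"
  using pd unfolding planar_drawing_def by blast

lemma edges_meet: "e \<in> arcs G \<Longrightarrow> e' \<in> arcs G \<Longrightarrow> e \<noteq> e' \<Longrightarrow>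
    img e \<inter> img e' \<subseteq> pos D ` ({fst e, snd e} \<inter> {fst e', snd e'})"
  using pd unfolding planar_drawing_def by blast

lemma arc_edge: "e \<in> arcs G \<Longrightarrow> arc (edge_curve D e)"
  using pd by (simp add: planar_drawing_def)

lemma path_edge [simp]: "path (edge_curve D e)"
  by (simp add: edge_curve_def)

lemma start_edge [simp]: "pathstart (edge_curve D e) = pos D (fst e)"
  and finish_edge [simp]: "pathfinish (edge_curve D e) = pos D (snd e)"
  by (auto simp: edge_curve_def edge_points_def)

lemma pos_img: "pos D u \<in> img (u, w)" "pos D w \<in> img (u, w)"
  using pathstart_in_path_image[of "edge_curve D (u, w)"] pathfinish_in_path_image[of "edge_curve D (u, w)"] by auto

lemma edge_points_first:
  assumes "(u, w) \<in> arcs G"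
  obtains b ps where "edge_points D (u, w) = pos D u # b # ps" "last (b # ps) = pos D w"
    "dir u w = b - pos D u" "dir w u = rev (pos D u # b # ps) ! 1 - pos D w"
    "arc (polyline (pos D u # b # ps))"
proof -
  obtain b ps where bps: "bends D (u, w) @ [pos D w] = b # ps" by (cases "bends D (u, w)") auto
  then have ep: "edge_points D (u, w) = pos D u # b # ps" by (simp add: edge_points_def)
  show thesis
    using assms arcs_antisym[OF assms] arc_edge[OF assms]
      last_snoc[of "bends D (u, w)" "pos D w", unfolded bps]
    by (intro that[OF ep]) (simp_all add: direction_def ep edge_curve_def)
qed

lemma edge_points_last:
  assumes "(u, w) \<in> arcs G"
  obtains c ps where "edge_points D (u, w) = ps @ [c, pos D w]" "dir w u = c - pos D w"
    "arc (polyline (ps @ [c, pos D w]))"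
proof -
  obtain c ps where cps: "pos D u # bends D (u, w) = ps @ [c]"
    by (metis append_butlast_last_id list.distinct(1))
  then have ep: "edge_points D (u, w) = ps @ [c, pos D w]"
    by (simp add: edge_points_def flip: append_Cons)
  show thesis
    using assms arcs_antisym[OF assms] arc_edge[OF assms]
    by (intro that[OF ep]) (simp_all add: direction_def ep edge_curve_def nth_append)
qed

text \<open>An edge at u contributes its first or last segment; since it is an arc, its remainder is
  closed and misses u. Every other edge misses u altogether.\<close>

lemma vertex_star:
  assumes u: "u \<in> verts G"
  shows "local_star K (pos D u) (map (dir u) (rot G u))"
proof -
  let ?ds = "map (dir u) (rot G u)"
  have "local_star (\<Union>v\<in>verts G. {pos D v}) (pos D u) ?ds"
  proof (rule local_star_UN)
    fix v assume v: "v \<in> verts G"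
    show "local_star {pos D v} (pos D u) ?ds"
    proof (cases "v = u")
      case True
      then show ?thesis unfolding local_star_def by (auto intro: exI[of _ 1])
    next
      case False
      then show ?thesis using pos_inj[OF u v] by (intro local_star_off) auto
    qed
  qed simp
  moreover have "local_star (\<Union>e\<in>arcs G. img e) (pos D u) ?ds"
  proof (rule local_star_UN)
    fix e assume e: "e \<in> arcs G"
    obtain a b where ab: "e = (a, b)" by force
    consider "u = a" | "u = b" | "u \<noteq> a" "u \<noteq> b" by blast
    then show "local_star (img e) (pos D u) ?ds"
    proof cases
      case 1
      obtain c ps where c: "edge_points D (a, b) = pos D a # c # ps" "dir a b = c - pos D a"
        "arc (polyline (pos D a # c # ps))" using edge_points_first e ab by metis
      have "b \<in> set (rot G u)" using e ab 1 u by (simp add: rot_set)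
      then have "c - pos D u \<in> set ?ds" using c 1 by force
      then have "local_star (closed_segment (pos D u) c) (pos D u) ?ds" by (rule local_star_segment)
      moreover have "local_star (path_image (polyline (c # ps))) (pos D u) ?ds"
        using arc_polylineD(4)[OF c(3)] 1 by (intro local_star_off closed_path_image path_polyline) simp
      ultimately show ?thesis unfolding ab edge_curve_def c(1) path_image_polyline_Cons 1
        by (rule local_star_Un)
    next
      case 2
      obtain c ps where c: "edge_points D (a, b) = ps @ [c, pos D b]" "dir b a = c - pos D b"
        "arc (polyline (ps @ [c, pos D b]))" using edge_points_last e ab by metis
      have "a \<in> set (rot G u)" using e ab 2 u by (simp add: rot_set)
      then have "c - pos D u \<in> set ?ds" using c 2 by force
      then have "local_star (closed_segment (pos D u) c) (pos D u) ?ds" by (rule local_star_segment)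
      moreover have "local_star (path_image (polyline (ps @ [c]))) (pos D u) ?ds"
        using arc_polyline_last(2)[OF c(3)] 2 by (intro local_star_off closed_path_image path_polyline) simp
      ultimately show ?thesis
        unfolding ab edge_curve_def c(1) path_image_polyline_snoc 2 closed_segment_commute[of c]
        by (intro local_star_Un)
    next
      case 3
      then show ?thesis using pos_on_edge[OF e u] ab by (intro local_star_off closed_path_image) auto
    qed
  qed simp
  ultimately show ?thesis unfolding K_def by (simp add: local_star_Un UNION_singleton_eq_range)
qed

lemma outer_face_K: "outer_face G D = outside K"
  by (simp add: outer_face_def K_def)

end

locale embedded_st = planar_st +
  assumes re: "respects_embedding G D"
begin

lemma rot_clockwise: "u \<in> verts G \<Longrightarrow> clockwise (map (dir u) (rot G u))"
  using re unfolding respects_embedding_def by blast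

lemma corner_ex:
  assumes "u \<in> verts G" "i < length (rot G u)"
  shows "\<exists>F\<in>components (- K). germ (-1) (pos D u) (dir u (rot G u ! i)) F \<and>
     germ 1 (pos D u) (dir u (rot G u ! (Suc i mod length (rot G u)))) F"
proof -
  have "Suc i mod length (rot G u) < length (rot G u)" using assms(2) by (intro mod_less_divisor) auto
  then show ?thesis
    using fan[OF rot_clockwise[OF assms(1)] vertex_star[OF assms(1)], of i] assms(2) by simp
qed

text \<open>The face to the left (\<open>\<sigma> = 1\<close>) or right (\<open>\<sigma> = -1\<close>) of the edge between \<open>u\<close> and \<open>w\<close>, seen from \<open>u\<close>.\<close>

definition side :: "real \<Rightarrow> nat \<Rightarrow> nat \<Rightarrow> complex set" where
  "side \<sigma> u w = (SOME F. F \<in> components (- K) \<and> germ \<sigma> (pos D u) (dir u w) F)"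

lemma side_ex:
  assumes "adj u w" "\<sigma> \<in> {1, -1}"
  shows "\<exists>F. F \<in> components (- K) \<and> germ \<sigma> (pos D u) (dir u w) F"
proof -
  have u: "u \<in> verts G" using adj_verts assms by blast
  obtain i where i: "i < length (rot G u)" "rot G u ! i = w"
    using adj_rot[OF u] assms(1) by (metis in_set_conv_nth)
  show ?thesis
  proof (cases "\<sigma> = 1")
    case True
    let ?m = "length (rot G u)"
    \<comment> \<open>The index cyclically before i: the face to the left of an edge belongs to the
      corner of its predecessor.\<close>
    define j where "j = (i + ?m - 1) mod ?m"
    have "0 < ?m" using i(1) by linarith
    then have j: "j < ?m" unfolding j_def by (rule mod_less_divisor)
    have "Suc j mod ?m = Suc (i + ?m - 1) mod ?m" by (simp only: j_def mod_Suc_eq)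
    also have "Suc (i + ?m - 1) = i + ?m" using \<open>0 < ?m\<close> by simp
    also have "\<dots> mod ?m = i" using i(1) by simp
    finally have "Suc j mod ?m = i" .
    then show ?thesis using corner_ex[OF u j] i True by auto
  next
    case False
    then show ?thesis using corner_ex[OF u i(1)] i assms(2) by auto
  qed
qed

lemma side_comp: "adj u w \<Longrightarrow> \<sigma> \<in> {1, -1} \<Longrightarrow> side \<sigma> u w \<in> components (- K)"
  and side_germ: "adj u w \<Longrightarrow> \<sigma> \<in> {1, -1} \<Longrightarrow> germ \<sigma> (pos D u) (dir u w) (side \<sigma> u w)"
  using someI_ex[OF side_ex[of u w \<sigma>]] unfolding side_def by auto

lemma side_eqI: "adj u w \<Longrightarrow> \<sigma> \<in> {1, -1} \<Longrightarrow> F \<in> components (- K) \<Longrightarrow>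
    germ \<sigma> (pos D u) (dir u w) F \<Longrightarrow> side \<sigma> u w = F"
  using germ_unique[OF side_germ _ side_comp] by blast

lemma corner:
  assumes u: "u \<in> verts G" and i: "i < length (rot G u)"
  shows "side (-1) u (rot G u ! i) = side 1 u (rot G u ! (Suc i mod length (rot G u)))"
proof -
  have i': "Suc i mod length (rot G u) < length (rot G u)" using i by (intro mod_less_divisor) auto
  obtain F where F: "F \<in> components (- K)" "germ (-1) (pos D u) (dir u (rot G u ! i)) F"
     "germ 1 (pos D u) (dir u (rot G u ! (Suc i mod length (rot G u)))) F"
    using corner_ex[OF assms] by blast
  have "adj u (rot G u ! i)" "adj u (rot G u ! (Suc i mod length (rot G u)))"
    using adj_rot[OF u] i i' nth_mem by blast+
  then show ?thesis using side_eqI[OF _ _ F(1,2)] side_eqI[OF _ _ F(1,3)] by simp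
qed

text \<open>Everything except this edge plays the part of \<open>K'\<close> in
  \<open>polyline_walk\<close>; by planarity it meets the edge at the ends only. Seen from the other
  end, left and right are exchanged.\<close>

lemma side_walk_arc:
  assumes e: "(u, w) \<in> arcs G" and \<sigma>: "\<sigma> \<in> {1, -1}"
  shows "side \<sigma> u w = side (- \<sigma>) w u"
proof -
  obtain b ps where b: "edge_points D (u, w) = pos D u # b # ps" "last (b # ps) = pos D w"
    "dir u w = b - pos D u" "dir w u = rev (pos D u # b # ps) ! 1 - pos D w"
    "arc (polyline (pos D u # b # ps))" using edge_points_first[OF e] by metis
  let ?K' = "pos D ` verts G \<union> (\<Union>e\<in>arcs G - {(u, w)}. img e)"
  have im: "path_image (polyline (pos D u # b # ps)) = img (u, w)" by (simp add: edge_curve_def b(1))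
  have \<sigma>': "- \<sigma> \<in> {1, -1}" using \<sigma> by auto
  have adj: "adj u w" "adj w u" using e by (auto simp: adj_def)
  show ?thesis
  proof (rule polyline_walk[OF b(5), of ?K' K \<sigma>])
    show "closed ?K'" by (intro closed_Un closed_UN closed_path_image[OF path_edge] ballI finite_imp_closed) auto
    show "K \<subseteq> path_image (polyline (pos D u # b # ps)) \<union> ?K'"
      unfolding im K_def by blast
    show "path_image (polyline (pos D u # b # ps)) \<inter> ?K' \<subseteq> {pos D u, last (b # ps)}"
    proof
      fix p assume p: "p \<in> path_image (polyline (pos D u # b # ps)) \<inter> ?K'"
      then consider x where "x \<in> verts G" "p = pos D x" "p \<in> img (u, w)"
        | e' where "e' \<in> arcs G" "e' \<noteq> (u, w)" "p \<in> img e'" "p \<in> img (u, w)" unfolding im by blast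
      then show "p \<in> {pos D u, last (b # ps)}"
      proof cases
        case 1 then show ?thesis using pos_on_edge[OF e] b(2) by auto
      next
        case 2 then show ?thesis using edges_meet[OF e 2(1)] b(2) by auto
      qed
    qed
    show "germ \<sigma> (pos D u) (b - pos D u) (side \<sigma> u w)" using side_germ[OF adj(1) \<sigma>] b(3) by simp
    show "germ (- \<sigma>) (last (b # ps)) (rev (pos D u # b # ps) ! 1 - last (b # ps)) (side (- \<sigma>) w u)"
      using side_germ[OF adj(2) \<sigma>'] unfolding b(2,4) .
    show "side \<sigma> u w \<in> components (- K)" by (rule side_comp[OF adj(1) \<sigma>])
    show "side (- \<sigma>) w u \<in> components (- K)" by (rule side_comp[OF adj(2) \<sigma>'])
  qed (use \<sigma> in auto)
qed

text \<open>Supplies test points near the tail of an edge: by planarity an inner point of the first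
  segment cannot be shared with anything else. Letting r tend to 0 reaches the faces at the
  tail.\<close>

lemma first_segment:
  assumes e: "(x, z) \<in> arcs G" and r: "0 < r" "r < 1"
  defines "p \<equiv> pos D x + of_real r * dir x z"
  shows "p \<in> img (x, z)" "p \<notin> pos D ` verts G" "\<And>e'. e' \<in> arcs G \<Longrightarrow> e' \<noteq> (x, z) \<Longrightarrow> p \<notin> img e'"
proof -
  obtain b ps where b: "edge_points D (x, z) = pos D x # b # ps" "last (b # ps) = pos D z"
    "dir x z = b - pos D x" "arc (polyline (pos D x # b # ps))" using edge_points_first[OF e] by metis
  note A = arc_polylineD[OF b(4)]
  have im: "img (x, z) = closed_segment (pos D x) b \<union> path_image (polyline (b # ps))"
    by (simp only: edge_curve_def b(1) path_image_polyline_Cons)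
  have pseg: "p \<in> closed_segment (pos D x) b"
    unfolding p_def b(3) using r by (intro in_closed_segment_offset) auto
  then show 1: "p \<in> img (x, z)" using im by blast
  have px: "p \<noteq> pos D x" using r A(1) unfolding p_def b(3) by simp
  have "p - b = of_real (r - 1) * (b - pos D x)" unfolding p_def b(3) by (simp add: algebra_simps)
  then have "p \<noteq> b" using r A(1) by auto
  then have "p \<notin> path_image (polyline (b # ps))" using A(3) pseg by blast
  moreover have "pos D z \<in> path_image (polyline (b # ps))"
    using pathfinish_in_path_image[of "polyline (b # ps)"] b(2) by simp
  ultimately have pz: "p \<noteq> pos D z" by auto
  show 2: "p \<notin> pos D ` verts G"
  proof
    assume "p \<in> pos D ` verts G"
    then obtain y where y: "y \<in> verts G" "p = pos D y" by blast
    then have "y = x \<or> y = z" using pos_on_edge[OF e y(1)] 1 by simp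
    then show False using y px pz by blast
  qed
  show "p \<notin> img e'" if "e' \<in> arcs G" "e' \<noteq> (x, z)" for e'
    using edges_meet[OF e that(1)] that(2) 1 2 arcs_verts[OF e] by auto
qed

text \<open>The face at the outer corner of the source, given without reference to unboundedness.
  The connection to the unbounded face is \<open>val_outer\<close>.\<close>

definition outer :: "complex set" where "outer = side (-1) (src G) (last (rot G (src G)))"

lemma outer_hd: "rot G (src G) \<noteq> [] \<Longrightarrow> outer = side 1 (src G) (hd (rot G (src G)))"
  using corner[OF src_verts, of "length (rot G (src G)) - 1"]
  by (simp add: outer_def last_conv_nth hd_conv_nth)

lemma winding_outside:
  assumes "path \<gamma>" "pathfinish \<gamma> = pathstart \<gamma>" "path_image \<gamma> \<subseteq> K" "p \<in> outer_face G D"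
  shows "winding_number \<gamma> p = 0"
  using winding_number_zero_in_outside[OF assms(1,2)] outside_mono[OF assms(3)] assms(4) outer_face_K by blast

text \<open>\<open>respects_embedding\<close> puts a sector next to the last edge of the source into
  the unbounded face. This sector meets \<open>outer\<close>, so a point of the unbounded face can
  represent the value.\<close>

lemma val_outer:
  assumes \<gamma>: "path \<gamma>" "pathfinish \<gamma> = pathstart \<gamma>" "path_image \<gamma> \<subseteq> K" and ne: "rot G (src G) \<noteq> []"
  shows "val \<gamma> outer = 0"
proof -
  let ?l = "last (rot G (src G))"
  have adj: "adj (src G) ?l" using adj_rot[OF src_verts, of ?l] last_in_set[OF ne] by blast
  obtain \<alpha> \<beta> \<epsilon> where *: "is_Arg (dir (src G) ?l) \<alpha>" "\<beta> < \<alpha>" "0 < \<epsilon>"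
    "\<forall>\<theta>\<in>{\<beta><..<\<alpha>}. \<forall>r\<in>{0<..<\<epsilon>}. pos D (src G) + of_real r * cis \<theta> \<in> outer_face G D"
    using re ne unfolding respects_embedding_def angle_in_face_def by blast
  have "dir (src G) ?l \<noteq> 0"
    using rot_clockwise[OF src_verts] ne unfolding clockwise_def
    by (metis in_set_conv_nth last_in_set length_map nth_map)
  then have "germ (-1) (pos D (src G)) (dir (src G) ?l) (outer_face G D)"
    using * by (intro germ_sector_cw[OF _ *(1-3)]) auto
  then have "outer_face G D \<inter> outer \<noteq> {}"
    using germ_nonempty[OF germ_Int] side_germ[OF adj, of "-1"] unfolding outer_def by blast
  then obtain p where p: "p \<in> outer_face G D" "p \<in> outer" by blast
  have "outer \<in> components (- K)" unfolding outer_def by (rule side_comp[OF adj]) auto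
  then show ?thesis using val_eq[OF \<gamma> _ p(2)] winding_outside[OF \<gamma> p(1)] by simp
qed

end

subsection \<open>Separating closed curves\<close>

text \<open>Applied to the rotation at a vertex and its predecessors I from left to right. The
  assumption makes I, reversed, a run of the cyclic order; since the list ends inside this run, the
  run appears as a suffix Y continued by a prefix X.\<close>

lemma cyclic_block:
  assumes xs: "distinct xs" "xs \<noteq> []" and I: "distinct I" "set I \<subseteq> set xs" "last xs \<in> set I"
    and next_I: "\<And>c p. Suc c < length I \<Longrightarrow> p < length xs \<Longrightarrow> xs ! p = I ! Suc c \<Longrightarrow>
      xs ! (Suc p mod length xs) = I ! c"
  shows "\<exists>X Y. xs = X @ filter (\<lambda>x. x \<notin> set I) xs @ Y \<and> Y @ X = rev I \<and> Y \<noteq> []"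
proof -
  let ?m = "length xs" and ?d = "length I"
  obtain a where a: "a < ?d" "I ! a = last xs" using I(3) by (metis in_set_conv_nth)
  have m: "0 < ?m" using xs(2) by simp
  have last: "xs ! (?m - 1) = I ! a" using a xs(2) by (simp add: last_conv_nth)
  have eqI: "p = q" if "p < ?m" "q < ?m" "xs ! p = xs ! q" for p q
    using that xs(1) nth_eq_iff_index_eq by blast
  have eqI': "p = q" if "p < ?d" "q < ?d" "I ! p = I ! q" for p q
    using that I(1) nth_eq_iff_index_eq by blast
  \<comment> \<open>Going backwards from the end, the entries run through I upwards from position a.
    A wrap from the first entry to the last would repeat \<open>I ! a\<close>.\<close>
  have up: "j < ?m \<and> xs ! (?m - 1 - j) = I ! (a + j)" if "a + j < ?d" for j
    using that
  proof (induction j)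
    case 0
    then show ?case using last m by simp
  next
    case (Suc j)
    then have IH: "j < ?m" "xs ! (?m - 1 - j) = I ! (a + j)" by auto
    have "I ! (a + Suc j) \<in> set xs" using Suc.prems I(2) nth_mem by blast
    then obtain p where p: "p < ?m" "xs ! p = I ! Suc (a + j)"
      using in_set_conv_nth[of "I ! (a + Suc j)" xs] by auto
    have "xs ! (Suc p mod ?m) = I ! (a + j)" using next_I[OF _ p] Suc.prems by simp
    then have eq: "Suc p mod ?m = ?m - 1 - j" using IH m by (intro eqI) auto
    have "Suc p \<noteq> ?m"
    proof
      assume "Suc p = ?m"
      then have "I ! Suc (a + j) = I ! a" using p last by (metis diff_Suc_1)
      then show False using eqI'[of "Suc (a + j)" a] Suc.prems a by simp
    qed
    then have "Suc p = ?m - 1 - j" using eq p by simp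
    then have "p = ?m - 1 - Suc j" "Suc j < ?m" by auto
    then show ?case using p by simp
  qed
  \<comment> \<open>Going on past the end, the list starts with the entries of I below a,
    downwards.\<close>
  have down: "j < ?m \<and> xs ! j = I ! (a - 1 - j)" if "j < a" for j
    using that
  proof (induction j)
    case 0
    have "xs ! (Suc (?m - 1) mod ?m) = I ! (a - 1)"
      using next_I[of "a - 1" "?m - 1"] 0 a m last by simp
    then show ?case using m by simp
  next
    case (Suc j)
    then have IH: "j < ?m" "xs ! j = I ! (a - 1 - j)" by auto
    have S: "Suc (a - 1 - Suc j) = a - 1 - j" using Suc.prems by simp
    have "j \<noteq> ?m - 1"
    proof
      assume "j = ?m - 1"
      then have "I ! (a - 1 - j) = I ! a" using IH last by simp
      then have "a - 1 - j = a" using Suc.prems a by (intro eqI') auto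
      then show False using Suc.prems by linarith
    qed
    then have j: "Suc j < ?m" using IH by simp
    have "xs ! (Suc j mod ?m) = I ! (a - 1 - Suc j)"
      using next_I[of "a - 1 - Suc j" j] IH S Suc.prems a by simp
    then show ?case using j by simp
  qed
  have dm: "?d \<le> ?m" using card_mono[OF _ I(2)] distinct_card[OF xs(1)] distinct_card[OF I(1)] by simp
  define X where "X = take a xs"
  define Y where "Y = drop (?m - (?d - a)) xs"
  define Z where "Z = take (?m - ?d) (drop a xs)"
  have X: "X = rev (take a I)"
  proof (rule nth_equalityI)
    show "length X = length (rev (take a I))" using a dm by (simp add: X_def)
    fix i assume "i < length X"
    then have "i < a" by (simp add: X_def)
    then show "X ! i = rev (take a I) ! i" using down[of i] a by (simp add: X_def rev_nth)
  qed
  have Y: "Y = rev (drop a I)"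
  proof (rule nth_equalityI)
    show "length Y = length (rev (drop a I))" using a dm by (simp add: Y_def)
    fix i assume "i < length Y"
    then have i: "i < ?d - a" using dm by (simp add: Y_def)
    define j where "j = ?d - a - 1 - i"
    have "?m - (?d - a) + i = ?m - 1 - j" using i dm by (simp add: j_def)
    then have "Y ! i = I ! (a + j)" using up[of j] i dm by (simp add: Y_def j_def)
    moreover have "rev (drop a I) ! i = I ! (a + j)" using i by (simp add: rev_nth j_def)
    ultimately show "Y ! i = rev (drop a I) ! i" by simp
  qed
  have split: "xs = X @ Z @ Y"
  proof -
    have "drop (?m - (?d - a)) xs = drop (?m - ?d) (drop a xs)" using a dm by (simp add: add.commute)
    then have "Z @ Y = drop a xs" unfolding Z_def Y_def by (simp only: append_take_drop_id)
    then show ?thesis by (simp add: X_def)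
  qed
  have YX: "Y @ X = rev I" unfolding X Y by (simp flip: rev_append)
  have "set I = set X \<union> set Y" using arg_cong[OF YX, of set] by auto
  moreover have "set Z \<inter> (set X \<union> set Y) = {}" using xs(1) unfolding split by auto
  ultimately have "filter (\<lambda>x. x \<notin> set I) xs = Z"
    unfolding split by (auto simp: filter_empty_conv filter_id_conv)
  moreover have "Y \<noteq> []" using Y a by simp
  ultimately show ?thesis using split YX by metis
qed

lemma contiguous_filter:
  assumes "\<And>i j m. i < j \<Longrightarrow> j < m \<Longrightarrow> m < length xs \<Longrightarrow> P (xs ! i) \<Longrightarrow> P (xs ! m) \<Longrightarrow> P (xs ! j)"
  shows "\<exists>A B. xs = A @ filter P xs @ B \<and> (\<forall>x\<in>set A \<union> set B. \<not> P x)"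
proof -
  define A where "A = takeWhile (\<lambda>x. \<not> P x) xs"
  define R where "R = dropWhile (\<lambda>x. \<not> P x) xs"
  define M where "M = takeWhile P R"
  define B where "B = dropWhile P R"
  have xs: "xs = A @ M @ B" by (simp add: A_def R_def M_def B_def)
  have A: "\<forall>x\<in>set A. \<not> P x" unfolding A_def by (auto dest: set_takeWhileD)
  have M: "\<forall>x\<in>set M. P x" unfolding M_def by (auto dest: set_takeWhileD)
  have B: "\<not> P x" if x: "x \<in> set B" for x
  proof
    assume Px: "P x"
    obtain i where i: "i < length B" "B ! i = x" using x by (metis in_set_conv_nth)
    have hdB: "\<not> P (B ! 0)" using x hd_dropWhile[of P R] unfolding B_def
      by (metis empty_iff hd_conv_nth list.set(1))
    have "R \<noteq> []" using x unfolding B_def by auto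
    then have hdR: "P (hd R)" using hd_dropWhile[of "\<lambda>x. \<not> P x" xs] unfolding R_def by auto
    have "M \<noteq> []" using hdR \<open>R \<noteq> []\<close> unfolding M_def by (cases R) auto
    then have P0: "P (xs ! length A)" using M unfolding xs by (simp add: nth_append)
    have "i \<noteq> 0" using hdB i Px by (cases i) auto
    moreover have "xs ! (length A + length M + i) = x" using i unfolding xs by (simp add: nth_append)
    ultimately have "P (xs ! (length A + length M))"
      using assms[of "length A" "length A + length M" "length A + length M + i"] P0 Px i \<open>M \<noteq> []\<close>
      unfolding xs by simp
    moreover have "xs ! (length A + length M) = B ! 0" using i unfolding xs by (simp add: nth_append)
    ultimately show False using hdB by simp
  qed
  have "filter P xs = M" using A M B unfolding xs by (simp add: filter_empty_conv filter_id_conv)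
  then show ?thesis using xs A B by (intro exI[of _ A] exI[of _ B]) auto
qed

section \<open>st-orderings\<close>

locale ordered_st = st_rotation +
  fixes \<pi> :: "nat \<Rightarrow> nat"
  assumes so: "st_ordering G \<pi>"
begin

lemma pi_mono: "(u, v) \<in> arcs G \<Longrightarrow> \<pi> u < \<pi> v"
  using so unfolding st_ordering_def by auto

lemma pi_bij: "bij_betw \<pi> (verts G) {1..nv G}"
  using so unfolding st_ordering_def card_verts by auto

lemma pi_inj: "u \<in> verts G \<Longrightarrow> v \<in> verts G \<Longrightarrow> \<pi> u = \<pi> v \<Longrightarrow> u = v"
  using pi_bij unfolding bij_betw_def inj_on_def by blast

lemma pi_range: "u \<in> verts G \<Longrightarrow> 1 \<le> \<pi> u \<and> \<pi> u \<le> nv G"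
  using bij_betwE[OF pi_bij] by auto

lemma ex_pi: "1 \<le> k \<Longrightarrow> k \<le> nv G \<Longrightarrow> \<exists>v\<in>verts G. \<pi> v = k"
  using pi_bij unfolding bij_betw_def by (metis atLeastAtMost_iff imageE)

lemma nv_pos: "1 \<le> nv G" using src_verts by (simp add: verts_def)

lemma pi_src: "\<pi> (src G) = 1"
proof -
  obtain v where v: "v \<in> verts G" "\<pi> v = 1" using ex_pi nv_pos by blast
  have "v = src G"
  proof (rule ccontr)
    assume "v \<noteq> src G"
    then obtain u where "(u, v) \<in> arcs G" using ex_in_arc v by blast
    then show False using pi_mono[of u v] pi_range[of u] arcs_verts v by fastforce
  qed
  then show ?thesis using v by simp
qed

lemma pi_snk: "\<pi> (snk G) = nv G"
proof -
  obtain v where v: "v \<in> verts G" "\<pi> v = nv G" using ex_pi nv_pos by blast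
  have "v = snk G"
  proof (rule ccontr)
    assume "v \<noteq> snk G"
    then obtain u where "(v, u) \<in> arcs G" using ex_out_arc v by blast
    then show False using pi_mono[of v u] pi_range[of u] arcs_verts v by fastforce
  qed
  then show ?thesis using v by simp
qed

lemma src_snk: "1 < nv G \<Longrightarrow> src G \<noteq> snk G" using pi_src pi_snk by auto

lemma rot_src_nonempty: "1 < nv G \<Longrightarrow> rot G (src G) \<noteq> []"
  using ex_out_arc[OF src_verts src_snk] rot_set[OF src_verts] by auto

end

section \<open>Closed curves through two edges with the same head\<close>

locale embedded_ordered = embedded_st + ordered_st
begin

text \<open>The part of the drawing present after k steps. An edge enters together with its head, so
  pending edges are left out.\<close>

definition W :: "nat \<Rightarrow> complex set" where
  "W k = pos D ` {u \<in> verts G. \<pi> u \<le> k} \<union> (\<Union>e\<in>{e\<in>arcs G. \<pi> (snd e) \<le> k}. img e)"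

lemma W_subset: "W k \<subseteq> K" unfolding W_def K_def by blast

text \<open>Incoming edges traced back from u end at the source, and all heads on the way are at
  most k.\<close>

lemma W_connected: "u \<in> verts G \<Longrightarrow> \<pi> u \<le> k \<Longrightarrow> path_component (W k) (pos D (src G)) (pos D u)"
proof (induction "\<pi> u" arbitrary: u rule: less_induct)
  case less
  show ?case
  proof (cases "u = src G")
    case True
    have "pos D u \<in> W k" using less.prems unfolding W_def by blast
    then show ?thesis using True path_component_refl by metis
  next
    case False
    then obtain w where w: "(w, u) \<in> arcs G" using ex_in_arc less.prems by blast
    have "path_component (W k) (pos D (src G)) (pos D w)"
      using less.hyps[of w] pi_mono[OF w] arcs_verts[OF w] less.prems by simp
    moreover have "path_component (W k) (pos D w) (pos D u)"
      unfolding path_component_def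
      using w less.prems by (intro exI[of _ "edge_curve D (w, u)"]) (auto simp: W_def)
    ultimately show ?thesis by (rule path_component_trans)
  qed
qed

text \<open>A closed curve through two edges entering \<open>v\<close> that winds differently around the two sides of the first
  one. Edges with a head later than \<open>v\<close> can be followed to the sink without meeting the curve, so it does not
  wind around their sides.\<close>

definition good :: "nat \<Rightarrow> nat \<Rightarrow> nat \<Rightarrow> nat \<Rightarrow> (real \<Rightarrow> complex) \<Rightarrow> bool" where
  "good k v u1 u2 \<gamma> \<longleftrightarrow> path \<gamma> \<and> pathfinish \<gamma> = pathstart \<gamma> \<and> path_image \<gamma> \<subseteq> K \<and>
     path_image \<gamma> \<subseteq> img (u1, v) \<union> img (u2, v) \<union> W k \<and>
     val \<gamma> (side 1 u1 v) \<noteq> val \<gamma> (side (-1) u1 v)"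

text \<open>The curve runs along the edge from u1, back along the edge from u2, and closes inside
  \<open>W k\<close>. It is cut at the first bend of the first edge, because \<open>val_jump\<close>
  asks for a straight segment that the rest of the curve avoids.\<close>

lemma good_ex:
  assumes v: "v \<in> verts G" "\<pi> v = Suc k" and e: "(u1, v) \<in> arcs G" "(u2, v) \<in> arcs G" "u1 \<noteq> u2"
  shows "\<exists>\<gamma>. good k v u1 u2 \<gamma>"
proof -
  have u: "u1 \<in> verts G" "u2 \<in> verts G" "\<pi> u1 \<le> k" "\<pi> u2 \<le> k"
    using e arcs_verts pi_mono v by force+
  have "path_component (W k) (pos D u2) (pos D u1)"
    using W_connected[OF u(1,3)] W_connected[OF u(2,4)] by (metis path_component_sym path_component_trans)
  then obtain g where g: "path g" "path_image g \<subseteq> W k" "pathstart g = pos D u2" "pathfinish g = pos D u1"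
    unfolding path_component_def by blast
  obtain b ps where b: "edge_points D (u1, v) = pos D u1 # b # ps" "last (b # ps) = pos D v"
    "dir u1 v = b - pos D u1" "arc (polyline (pos D u1 # b # ps))" using edge_points_first[OF e(1)] by metis
  note A = arc_polylineD[OF b(4)]
  define p where "p = polyline (b # ps) +++ (reversepath (edge_curve D (u2, v)) +++ g)"
  have p: "path p" "pathstart p = b" "pathfinish p = pos D u1"
    using g b(2) by (auto simp: p_def)
  have pim: "path_image p = path_image (polyline (b # ps)) \<union> (img (u2, v) \<union> path_image g)"
    using g b(2) unfolding p_def by (simp add: path_image_join)
  define \<gamma> where "\<gamma> = linepath (pos D u1) b +++ p"
  have \<gamma>: "path \<gamma>" "pathfinish \<gamma> = pathstart \<gamma>" using p by (auto simp: \<gamma>_def)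
  have im1: "img (u1, v) = closed_segment (pos D u1) b \<union> path_image (polyline (b # ps))"
    by (simp only: edge_curve_def b(1) path_image_polyline_Cons)
  have gim: "path_image \<gamma> = img (u1, v) \<union> img (u2, v) \<union> path_image g"
    unfolding im1 using p pim by (simp add: \<gamma>_def path_image_join Un_assoc)
  then have sub: "path_image \<gamma> \<subseteq> img (u1, v) \<union> img (u2, v) \<union> W k" using g by blast
  have "img (u1, v) \<subseteq> K" "img (u2, v) \<subseteq> K" using e unfolding K_def by blast+
  then have subK: "path_image \<gamma> \<subseteq> K" using W_subset[of k] sub by blast
  have adj: "adj u1 v" using e by (simp add: adj_def)
  have "open_segment (pos D u1) b \<inter> path_image p = {}"
  proof (rule ccontr)
    assume "open_segment (pos D u1) b \<inter> path_image p \<noteq> {}"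
    then obtain q where q: "q \<in> open_segment (pos D u1) b" "q \<in> path_image p" by blast
    obtain r where r: "0 < r" "r < 1" "q = (1 - r) *\<^sub>R pos D u1 + r *\<^sub>R b"
      using q(1) unfolding in_segment by blast
    have qe: "q = pos D u1 + of_real r * dir u1 v"
      unfolding r(3) b(3) by (simp add: scaleR_conv_of_real algebra_simps)
    note fs = first_segment[OF e(1) r(1,2), folded qe]
    have "q \<notin> path_image (polyline (b # ps))"
    proof -
      have "q \<in> closed_segment (pos D u1) b" "q \<noteq> b" using q(1) unfolding open_segment_def by blast+
      then show ?thesis using A(3) by blast
    qed
    moreover have "q \<notin> img (u2, v)" using fs(3)[OF e(2)] e(3) by simp
    moreover have "q \<notin> W k"
    proof
      assume "q \<in> W k"
      then consider "q \<in> pos D ` verts G" | e' where "e' \<in> arcs G" "\<pi> (snd e') \<le> k" "q \<in> img e'"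
        unfolding W_def by blast
      then show False
        using fs(2,3) v(2) by cases force+
    qed
    ultimately show False using q(2) pim g by blast
  qed
  from val_jump[OF A(1) p this \<gamma>_def subK, of "side 1 u1 v" "side (-1) u1 v"]
  have "val \<gamma> (side 1 u1 v) \<noteq> val \<gamma> (side (-1) u1 v)"
    using side_comp[OF adj] side_germ[OF adj] b(3) by simp
  then show ?thesis using \<gamma> sub subK unfolding good_def by blast
qed

lemma good_inter_subset:
  assumes g: "good k v u1 u2 \<gamma>" and v: "\<pi> v = Suc k" and e: "(u1, v) \<in> arcs G" "(u2, v) \<in> arcs G"
    and S: "\<And>a b. (a, b) \<in> arcs G \<Longrightarrow> \<pi> b \<le> Suc k \<Longrightarrow> I \<inter> img (a, b) \<subseteq> S"
      "\<And>y. y \<in> verts G \<Longrightarrow> \<pi> y \<le> k \<Longrightarrow> pos D y \<in> I \<Longrightarrow> pos D y \<in> S"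
  shows "I \<inter> path_image \<gamma> \<subseteq> S"
proof
  fix p assume p: "p \<in> I \<inter> path_image \<gamma>"
  have "p \<in> img (u1, v) \<union> img (u2, v) \<union> W k" using g p unfolding good_def by blast
  then consider "p \<in> img (u1, v)" | "p \<in> img (u2, v)" | y where "y \<in> verts G" "\<pi> y \<le> k" "p = pos D y"
    | a b where "(a, b) \<in> arcs G" "\<pi> b \<le> k" "p \<in> img (a, b)" unfolding W_def by auto
  then show "p \<in> S"
  proof cases
    case 1 then show ?thesis using S(1)[OF e(1)] v p by auto
  next
    case 2 then show ?thesis using S(1)[OF e(2)] v p by auto
  next
    case 3 then show ?thesis using S(2) p by auto
  next
    case 4 then show ?thesis using S(1)[OF 4(1)] p by auto
  qed
qed

lemma good_cross:
  assumes g: "good k v u1 u2 \<gamma>" and f: "(x, z) \<in> arcs G" "k < \<pi> z" "(x, z) \<noteq> (u1, v)" "(x, z) \<noteq> (u2, v)"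
    and e: "(u1, v) \<in> arcs G" "(u2, v) \<in> arcs G" and \<sigma>: "\<sigma> \<in> {1, -1}"
  shows "\<forall>\<^sub>F r in at_right 0. winding_number \<gamma> (pos D x + of_real r * dir x z) = val \<gamma> (side \<sigma> x z)"
proof -
  have adj: "adj x z" using f by (simp add: adj_def)
  have off: "pos D x + of_real r * dir x z \<notin> path_image \<gamma>" if "0 < r" "r < 1" for r
  proof -
    have "pos D x + of_real r * dir x z \<notin> img (u1, v)" "pos D x + of_real r * dir x z \<notin> img (u2, v)"
      using first_segment(3)[OF f(1) that] f e by metis+
    moreover have "pos D x + of_real r * dir x z \<notin> W k"
    proof
      assume "pos D x + of_real r * dir x z \<in> W k"
      then consider "pos D x + of_real r * dir x z \<in> pos D ` verts G"
        | e' where "e' \<in> arcs G" "\<pi> (snd e') \<le> k" "pos D x + of_real r * dir x z \<in> img e'"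
        unfolding W_def by blast
      then show False
        using first_segment(2,3)[OF f(1) that] f(2) by cases force+
    qed
    ultimately show ?thesis using g unfolding good_def by blast
  qed
  have "\<forall>\<^sub>F r in at_right 0. pos D x + of_real r * dir x z \<notin> path_image \<gamma>"
    using off by (intro eventually_at_rightI[of 0 1]) auto
  then show ?thesis
    using g unfolding good_def by (intro val_cross[OF _ _ _ side_comp[OF adj \<sigma>] side_germ[OF adj \<sigma>]]) auto
qed

text \<open>Near its tail, apart from the tail itself, such an edge is off the curve, so the values
  on both sides equal the winding number on the edge.\<close>

lemma good_cross_eq:
  assumes g: "good k v u1 u2 \<gamma>" and f: "(x, z) \<in> arcs G" "k < \<pi> z" "(x, z) \<noteq> (u1, v)" "(x, z) \<noteq> (u2, v)"
    and e: "(u1, v) \<in> arcs G" "(u2, v) \<in> arcs G"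
  shows "val \<gamma> (side 1 x z) = val \<gamma> (side (-1) x z)"
proof -
  have "\<forall>\<^sub>F r in at_right (0::real). val \<gamma> (side 1 x z) = val \<gamma> (side (-1) x z)"
    using good_cross[OF assms, of 1, simplified] good_cross[OF assms, of "-1", simplified]
    by eventually_elim simp
  then show ?thesis by (blast dest: eventually_at_right_0D)
qed

text \<open>Induction downwards from the sink. The sink lies on the frontier of the outer face,
  where the winding number is 0, and it is off the curve, where the winding number is locally
  constant. Any other z has an edge to a later vertex, which misses the curve because the heads of
  all edges on the curve are at most \<open>\<pi> v\<close>.\<close>

lemma good_zero_vertex:
  assumes g: "good k v u1 u2 \<gamma>" and v: "v \<in> verts G" "\<pi> v = Suc k"
    and e: "(u1, v) \<in> arcs G" "(u2, v) \<in> arcs G"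
  shows "z \<in> verts G \<Longrightarrow> Suc k < \<pi> z \<Longrightarrow> pos D z \<notin> path_image \<gamma> \<and> winding_number \<gamma> (pos D z) = 0"
proof (induction "nv G - \<pi> z" arbitrary: z rule: less_induct)
  case less
  have \<gamma>: "path \<gamma>" "pathfinish \<gamma> = pathstart \<gamma>" "path_image \<gamma> \<subseteq> K"
    "path_image \<gamma> \<subseteq> img (u1, v) \<union> img (u2, v) \<union> W k" using g unfolding good_def by auto
  have u: "\<pi> u1 \<le> k" "\<pi> u2 \<le> k" using e pi_mono v by force+
  have "pos D z \<notin> img (u1, v)" "pos D z \<notin> img (u2, v)"
    using pos_on_edge[OF e(1) less.prems(1)] pos_on_edge[OF e(2) less.prems(1)] u less.prems(2) v by auto
  moreover have "pos D z \<notin> W k"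
  proof
    assume "pos D z \<in> W k"
    then consider y where "y \<in> verts G" "\<pi> y \<le> k" "pos D z = pos D y"
      | a b where "(a, b) \<in> arcs G" "\<pi> b \<le> k" "pos D z \<in> img (a, b)" unfolding W_def by auto
    then show False
    proof cases
      case 1 then show ?thesis using pos_inj[OF less.prems(1)] less.prems(2) by force
    next
      case 2 then show ?thesis using pos_on_edge[OF 2(1) less.prems(1) 2(3)] less.prems(2) pi_mono[OF 2(1)] by auto
    qed
  qed
  ultimately have off: "pos D z \<notin> path_image \<gamma>" using \<gamma> by blast
  show ?case
  proof (cases "z = snk G")
    case True
    obtain r where r: "r > 0" "\<forall>w\<in>ball (pos D z) r. winding_number \<gamma> w = winding_number \<gamma> (pos D z)"
      using winding_number_near[OF \<gamma>(1,2) off] by blast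
    have "pos D z \<in> closure (outer_face G D)"
      using re True unfolding respects_embedding_def frontier_def by blast
    then obtain q where "q \<in> outer_face G D" "dist q (pos D z) < r"
      using r(1) unfolding closure_approachable by blast
    then show ?thesis using r winding_outside[OF \<gamma>(1,2,3)] off by (metis dist_commute mem_ball)
  next
    case False
    then obtain z' where z': "(z, z') \<in> arcs G" using ex_out_arc less.prems by blast
    have lt: "\<pi> z < \<pi> z'" "z' \<in> verts G" using pi_mono z' arcs_verts by blast+
    have IH: "winding_number \<gamma> (pos D z') = 0"
      using less.hyps[of z'] lt less.prems(2) pi_range[of z'] by simp
    have "img (z, z') \<inter> path_image \<gamma> \<subseteq> {}"
    proof (rule good_inter_subset[OF g v(2) e])
      fix a b assume ab: "(a, b) \<in> arcs G" "\<pi> b \<le> Suc k"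
      have "(z, z') \<noteq> (a, b)" "{z, z'} \<inter> {a, b} = {}"
        using pi_mono[OF ab(1)] ab(2) lt less.prems(2) by auto
      then show "img (z, z') \<inter> img (a, b) \<subseteq> {}" using edges_meet[OF z' ab(1)] by auto
    next
      fix y assume "y \<in> verts G" "\<pi> y \<le> k" "pos D y \<in> img (z, z')"
      then show "pos D y \<in> {}" using pos_on_edge[OF z'] lt less.prems(2) by fastforce
    qed
    then have disj: "img (z, z') \<inter> path_image \<gamma> = {}" by blast
    have "winding_number \<gamma> (pos D z) = winding_number \<gamma> (pos D z')"
      using pos_img disj by (intro winding_number_eq[OF \<gamma>(1,2), of _ "img (z, z')"]) (auto intro: connected_path_image)
    then show ?thesis using IH off by simp
  qed
qed

text \<open>The tail x may lie on the curve. The edge without its tail is connected, misses the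
  curve and contains z, so the value 0 at z reaches the points next to x.\<close>

lemma good_zero:
  assumes g: "good k v u1 u2 \<gamma>" and v: "v \<in> verts G" "\<pi> v = Suc k"
    and e: "(u1, v) \<in> arcs G" "(u2, v) \<in> arcs G"
    and f: "(x, z) \<in> arcs G" "Suc k < \<pi> z" and \<sigma>: "\<sigma> \<in> {1, -1}"
  shows "val \<gamma> (side \<sigma> x z) = 0"
proof -
  have \<gamma>: "path \<gamma>" "pathfinish \<gamma> = pathstart \<gamma>" "path_image \<gamma> \<subseteq> K"
    "path_image \<gamma> \<subseteq> img (u1, v) \<union> img (u2, v) \<union> W k" using g unfolding good_def by auto
  have z: "z \<in> verts G" using arcs_verts f by blast
  have fne: "(x, z) \<noteq> (u1, v)" "(x, z) \<noteq> (u2, v)" using f v by auto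
  let ?S = "edge_curve D (x, z) ` {0<..1}"
  have arc: "arc (edge_curve D (x, z))" by (rule arc_edge[OF f(1)])
  have S: "img (x, z) - {pos D x} \<subseteq> ?S" "?S \<subseteq> img (x, z) - {pos D x}"
  proof -
    have start: "edge_curve D (x, z) 0 = pos D x" using start_edge[of "(x, z)"] by (simp add: pathstart_def)
    have inj: "t = 0" if "t \<in> {0..1}" "edge_curve D (x, z) t = pos D x" for t
      using arc that start unfolding arc_def inj_on_def by (metis atLeastAtMost_iff order_refl zero_le_one)
    have "edge_curve D (x, z) t \<noteq> pos D x" if "t \<in> {0<..1}" for t
      using inj[of t] that by auto
    then show "?S \<subseteq> img (x, z) - {pos D x}" unfolding path_image_def by auto
    show "img (x, z) - {pos D x} \<subseteq> ?S" unfolding path_image_def using start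
      by (auto simp: image_iff) (metis greaterThanAtMost_iff order_le_less)
  qed
  have conn: "connected ?S"
    using path_edge[of "(x, z)"] unfolding path_def
    by (intro connected_continuous_image) (auto intro: continuous_on_subset)
  have disj: "?S \<inter> path_image \<gamma> = {}"
  proof -
    have "img (x, z) \<inter> path_image \<gamma> \<subseteq> {pos D x}"
    proof (rule good_inter_subset[OF g v(2) e])
      fix a b assume ab: "(a, b) \<in> arcs G" "\<pi> b \<le> Suc k"
      have "(x, z) \<noteq> (a, b)" "{x, z} \<inter> {a, b} \<subseteq> {x}"
        using pi_mono[OF ab(1)] ab(2) f(2) by auto
      then show "img (x, z) \<inter> img (a, b) \<subseteq> {pos D x}" using edges_meet[OF f(1) ab(1)] by auto
    next
      fix y assume "y \<in> verts G" "\<pi> y \<le> k" "pos D y \<in> img (x, z)"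
      then show "pos D y \<in> {pos D x}" using pos_on_edge[OF f(1)] f(2) by fastforce
    qed
    then show ?thesis using S(2) by blast
  qed
  have z0: "winding_number \<gamma> (pos D z) = 0" "pos D z \<notin> path_image \<gamma>"
    using good_zero_vertex[OF g v e z f(2)] by auto
  have "pos D z \<in> ?S" using S(1) pos_img(2)[of z x] pos_inj[of z x] arcs_verts[OF f(1)] arcs_irrefl f(1) by blast
  have const: "winding_number \<gamma> q = 0" if "q \<in> ?S" for q
    using winding_number_eq[OF \<gamma>(1,2) that \<open>pos D z \<in> ?S\<close> conn disj] z0 by simp
  have near: "pos D x + of_real r * dir x z \<in> ?S" if "0 < r" "r < 1" for r
    using first_segment(1,2)[OF f(1) that] S(1) arcs_verts[OF f(1)] by blast
  have "\<forall>\<^sub>F r in at_right 0. winding_number \<gamma> (pos D x + of_real r * dir x z) = 0"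
    using const near by (intro eventually_at_rightI[of 0 1]) auto
  moreover have "\<forall>\<^sub>F r in at_right 0. winding_number \<gamma> (pos D x + of_real r * dir x z) = val \<gamma> (side \<sigma> x z)"
    using good_cross[OF g f(1) _ fne e \<sigma>] f(2) by simp
  ultimately have "\<forall>\<^sub>F r in at_right (0::real). val \<gamma> (side \<sigma> x z) = 0"
    by eventually_elim simp
  then show ?thesis by (blast dest: eventually_at_right_0D)
qed

subsection \<open>The sweep\<close>

abbreviation sd :: "real \<Rightarrow> nat \<times> nat \<Rightarrow> complex set" where
  "sd \<sigma> e \<equiv> side \<sigma> (fst e) (snd e)"

text \<open>A closed walk in the dual graph that leaves the outer face, crosses the pending edges
  one by one and returns to the outer face. This expresses the order from left to right without
  coordinates.\<close>

definition frontline :: "nat \<Rightarrow> (nat \<times> nat) list \<Rightarrow> bool" where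
  "frontline k Q \<longleftrightarrow> distinct Q \<and> set Q = {e \<in> arcs G. \<pi> (fst e) \<le> k \<and> k < \<pi> (snd e)} \<and>
     Q \<noteq> [] \<and> sd 1 (hd Q) = outer \<and> sd (-1) (last Q) = outer \<and>
     (\<forall>i. Suc i < length Q \<longrightarrow> sd (-1) (Q ! i) = sd 1 (Q ! Suc i))"

lemma frontline_init:
  assumes "1 < nv G"
  shows "frontline 1 (map (Pair (src G)) (succ_list G (src G)))"
proof -
  let ?Q = "map (Pair (src G)) (rot G (src G))"
  have ne: "rot G (src G) \<noteq> []" by (rule rot_src_nonempty[OF assms])
  have "set ?Q = {e \<in> arcs G. \<pi> (fst e) \<le> 1 \<and> 1 < \<pi> (snd e)}"
  proof -
    have "(u, v) \<in> arcs G \<and> \<pi> u \<le> 1 \<and> 1 < \<pi> v \<longleftrightarrow> u = src G \<and> v \<in> set (rot G (src G))" for u v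
    proof -
      have "u = src G" if "(u, v) \<in> arcs G" "\<pi> u \<le> 1"
      proof -
        have "u \<in> verts G" using arcs_verts[OF that(1)] by simp
        then show ?thesis using pi_range[of u] that(2) pi_src pi_inj[OF _ src_verts] by simp
      qed
      then show ?thesis
        using pi_mono[of "src G" v] pi_src rot_src set_succ_list[OF src_verts] by auto
    qed
    then have "(u, v) \<in> set ?Q \<longleftrightarrow> (u, v) \<in> arcs G \<and> \<pi> u \<le> 1 \<and> 1 < \<pi> v" for u v
      by (simp add: image_iff)
    then have "e \<in> set ?Q \<longleftrightarrow> e \<in> {e \<in> arcs G. \<pi> (fst e) \<le> 1 \<and> 1 < \<pi> (snd e)}" for e
      by (cases e) simp
    then show ?thesis by blast
  qed
  moreover have "sd (-1) (?Q ! i) = sd 1 (?Q ! Suc i)" if "Suc i < length ?Q" for i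
    using corner[OF src_verts, of i] that by simp
  moreover have "distinct ?Q" using rot_distinct[OF src_verts] by (simp add: distinct_map inj_on_def)
  moreover have "sd 1 (hd ?Q) = outer" using outer_hd[OF ne] ne by (simp add: hd_map)
  moreover have "sd (-1) (last ?Q) = outer" using ne by (simp add: last_map outer_def)
  ultimately show ?thesis unfolding frontline_def rot_src[symmetric] using ne by blast
qed

text \<open>Along the frontline the value is 0 at both ends, in the outer face, and changes at most
  at the two edges of the curve. It does change at the first one, so it is nonzero exactly between
  the two.\<close>

lemma frontline_vals:
  assumes Q: "frontline k Q" and v: "v \<in> verts G" "\<pi> v = Suc k"
    and ab: "a < b" "b < length Q" "Q ! a = (u1, v)" "Q ! b = (u2, v)"
  obtains \<gamma> where "good k v u1 u2 \<gamma>"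
    "\<And>i. i \<le> a \<Longrightarrow> val \<gamma> (sd 1 (Q ! i)) = 0"
    "\<And>i. i < a \<Longrightarrow> val \<gamma> (sd (-1) (Q ! i)) = 0"
    "\<And>i. a < i \<Longrightarrow> i \<le> b \<Longrightarrow> val \<gamma> (sd 1 (Q ! i)) \<noteq> 0"
    "\<And>i. a \<le> i \<Longrightarrow> i < b \<Longrightarrow> val \<gamma> (sd (-1) (Q ! i)) \<noteq> 0"
    "\<And>i. b \<le> i \<Longrightarrow> i < length Q \<Longrightarrow> val \<gamma> (sd (-1) (Q ! i)) = 0"
    "(u1, v) \<in> arcs G" "(u2, v) \<in> arcs G"
proof -
  have setQ: "set Q = {e \<in> arcs G. \<pi> (fst e) \<le> k \<and> k < \<pi> (snd e)}" and dQ: "distinct Q"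
    and Q0: "Q \<noteq> []" "sd 1 (Q ! 0) = outer" "sd (-1) (Q ! (length Q - 1)) = outer"
    and link: "\<And>i. Suc i < length Q \<Longrightarrow> sd (-1) (Q ! i) = sd 1 (Q ! Suc i)"
    using Q unfolding frontline_def by (auto simp: hd_conv_nth last_conv_nth)
  have "(u1, v) \<in> set Q" "(u2, v) \<in> set Q" using ab nth_mem[of a Q] nth_mem[of b Q] by auto
  then have e: "(u1, v) \<in> arcs G" "(u2, v) \<in> arcs G" using setQ by auto
  have "u1 \<noteq> u2" using ab dQ nth_eq_iff_index_eq[OF dQ, of a b] by auto
  then obtain \<gamma> where g: "good k v u1 u2 \<gamma>" using good_ex[OF v e] by blast
  have cross: "val \<gamma> (sd 1 (Q ! i)) = val \<gamma> (sd (-1) (Q ! i))" if i: "i < length Q" "i \<noteq> a" "i \<noteq> b" for i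
  proof -
    have "Q ! i \<in> set Q" using i by simp
    moreover have "Q ! i \<noteq> (u1, v)" "Q ! i \<noteq> (u2, v)"
      using i ab nth_eq_iff_index_eq[OF dQ, of i a] nth_eq_iff_index_eq[OF dQ, of i b] by auto
    ultimately show ?thesis
      using good_cross_eq[OF g _ _ _ _ e, of "fst (Q ! i)" "snd (Q ! i)"] setQ by auto
  qed
  have "rot G (src G) \<noteq> []"
  proof (rule rot_src_nonempty)
    show "1 < nv G" using pi_mono[OF e(1)] arcs_verts[OF e(1)] pi_range[of u1] pi_range[of v] by simp
  qed
  then have vo: "val \<gamma> outer = 0" using g unfolding good_def by (intro val_outer) auto
  have 1: "val \<gamma> (sd 1 (Q ! i)) = 0" if "i \<le> a" for i
    using that
  proof (induction i)
    case 0 then show ?case using Q0 vo by simp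
  next
    case (Suc i)
    then show ?case using link[of i] cross[of i] ab by simp
  qed
  have 2: "val \<gamma> (sd (-1) (Q ! i)) = 0" if "i < a" for i
    using 1[of i] cross[of i] that ab by simp
  have ne: "val \<gamma> (sd (-1) (Q ! a)) \<noteq> 0"
    using 1[of a] g ab unfolding good_def by simp
  have 3: "val \<gamma> (sd (-1) (Q ! i)) \<noteq> 0" if "a \<le> i" "i < b" for i
    using that
  proof (induction i rule: dec_induct)
    case base then show ?case using ne by simp
  next
    case (step i)
    then show ?case using link[of i] cross[of "Suc i"] ab by simp
  qed
  have 4: "val \<gamma> (sd 1 (Q ! i)) \<noteq> 0" if "a < i" "i \<le> b" for i
    using 3[of "i - 1"] link[of "i - 1"] that ab by simp
  have 5: "val \<gamma> (sd (-1) (Q ! i)) = 0" if "b \<le> i" "i \<le> length Q - 1" for i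
    using that(2,1)
  proof (induction i rule: inc_induct)
    case base then show ?case using Q0 vo by simp
  next
    case (step i)
    then show ?case using link[of i] cross[of "Suc i"] ab by simp
  qed
  show thesis using that[OF g 1 2 4 3 _ e] 5 by force
qed

text \<open>Between the two edges the values are nonzero, whereas \<open>good_zero\<close> yields 0
  beside an edge with a later head.\<close>

lemma frontline_contiguous:
  assumes Q: "frontline k Q" and v: "v \<in> verts G" "\<pi> v = Suc k"
    and ab: "a < j" "j < b" "b < length Q" "snd (Q ! a) = v" "snd (Q ! b) = v"
  shows "snd (Q ! j) = v"
proof (rule ccontr)
  assume nv: "snd (Q ! j) \<noteq> v"
  obtain \<gamma> where g: "good k v (fst (Q ! a)) (fst (Q ! b)) \<gamma>"
    "\<And>i. a < i \<Longrightarrow> i \<le> b \<Longrightarrow> val \<gamma> (sd 1 (Q ! i)) \<noteq> 0"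
    "(fst (Q ! a), v) \<in> arcs G" "(fst (Q ! b), v) \<in> arcs G"
    using frontline_vals[OF Q v, of a b "fst (Q ! a)" "fst (Q ! b)"] ab
    by (metis (no_types, lifting) order.strict_trans prod.collapse)
  have "Q ! j \<in> set Q" using ab by simp
  then have f: "(fst (Q ! j), snd (Q ! j)) \<in> arcs G" "k < \<pi> (snd (Q ! j))"
    using Q unfolding frontline_def by auto
  have "\<pi> (snd (Q ! j)) \<noteq> Suc k" using nv pi_inj[of "snd (Q ! j)" v] arcs_verts[OF f(1)] v by auto
  then have "val \<gamma> (sd 1 (Q ! j)) = 0" using f by (intro good_zero[OF g(1) v g(3,4) f(1)]) auto
  then show False using g(2)[of j] ab by simp
qed

lemma side_walk: "adj u w \<Longrightarrow> \<sigma> \<in> {1, -1} \<Longrightarrow> side \<sigma> u w = side (- \<sigma>) w u"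
  using side_walk_arc[of u w \<sigma>] side_walk_arc[of w u "- \<sigma>"] unfolding adj_def by auto

text \<open>The same values fix the rotation at v. Take the curve through the neighbouring incoming
  edges c and c + 1. The corner clockwise after edge c + 1 has nonzero value; an outgoing edge there
  would give 0, and so would any incoming edge except c. Hence edge c comes next, and
  \<open>cyclic_block\<close> applies. The corners at v then link the outgoing edges into the
  frontline.\<close>

lemma frontline_step:
  assumes Q: "frontline k Q" and v: "v \<in> verts G" "\<pi> v = Suc k" and k: "1 \<le> k"
  shows "\<exists>A I B X Y. Q = A @ map (\<lambda>u. (u, v)) I @ B \<and> rot G v = X @ succ_list G v @ Y \<and>
     Y @ X = rev I \<and> Y \<noteq> [] \<and>
     (Suc k < nv G \<longrightarrow> frontline (Suc k) (A @ map (Pair v) (succ_list G v) @ B))"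
proof -
  have setQ: "set Q = {e \<in> arcs G. \<pi> (fst e) \<le> k \<and> k < \<pi> (snd e)}" and dQ: "distinct Q"
    and Q0: "Q \<noteq> []" "sd 1 (hd Q) = outer" "sd (-1) (last Q) = outer"
    and link: "\<And>i. Suc i < length Q \<Longrightarrow> sd (-1) (Q ! i) = sd 1 (Q ! Suc i)"
    using Q unfolding frontline_def by auto
  obtain A B where AB: "Q = A @ filter (\<lambda>e. snd e = v) Q @ B" "\<forall>e\<in>set A \<union> set B. snd e \<noteq> v"
    using contiguous_filter[of Q "\<lambda>e. snd e = v"] frontline_contiguous[OF Q v] by blast
  define I where "I = map fst (filter (\<lambda>e. snd e = v) Q)"
  have mI: "map (\<lambda>u. (u, v)) I = filter (\<lambda>e. snd e = v) Q"
    unfolding I_def map_map by (rule map_idI) auto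
  have QI: "Q = A @ map (\<lambda>u. (u, v)) I @ B" using AB(1) unfolding mI .
  have dI: "distinct I"
    using dQ unfolding QI by (auto simp: distinct_map)
  have setI: "set I = {u. (u, v) \<in> arcs G}"
  proof -
    have "(u, v) \<in> set Q \<longleftrightarrow> (u, v) \<in> arcs G" for u
      using setQ pi_mono[of u v] v by auto
    then show ?thesis unfolding I_def by force
  qed
  have vs: "v \<noteq> src G" using pi_src v k by auto
  have rd: "distinct (rot G v)" by (rule rot_distinct[OF v(1)])
  have lastI: "last (rot G v) \<in> set I" using rot_last[OF v(1) vs] setI by simp
  have subI: "set I \<subseteq> set (rot G v)" using setI rot_set[OF v(1)] by auto
  have ne: "rot G v \<noteq> []" using subI lastI by force
  let ?n = "length (rot G v)" and ?a = "length A"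
  have nthI: "Q ! (?a + c) = (I ! c, v)" if "c < length I" for c
    using that unfolding QI by (simp add: nth_append)
  have lenQ: "length Q = ?a + length I + length B" unfolding QI by simp
  have adjI: "adj u v" "adj v u" if "u \<in> set I" for u using that setI by (auto simp: adj_def)
  have next_I: "rot G v ! (Suc p mod ?n) = I ! c"
    if c: "Suc c < length I" and p: "p < ?n" "rot G v ! p = I ! Suc c" for c p
  proof -
    have ab: "?a + c < ?a + Suc c" "?a + Suc c < length Q" using c lenQ by auto
    have Qa: "Q ! (?a + c) = (I ! c, v)" "Q ! (?a + Suc c) = (I ! Suc c, v)"
      using nthI[of c] nthI[of "Suc c"] c by auto
    obtain \<gamma> where g: "good k v (I ! c) (I ! Suc c) \<gamma>"
      "\<And>i. i < ?a + c \<Longrightarrow> val \<gamma> (sd (-1) (Q ! i)) = 0"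
      "\<And>i. ?a + c < i \<Longrightarrow> i \<le> ?a + Suc c \<Longrightarrow> val \<gamma> (sd 1 (Q ! i)) \<noteq> 0"
      "\<And>i. ?a + Suc c \<le> i \<Longrightarrow> i < length Q \<Longrightarrow> val \<gamma> (sd (-1) (Q ! i)) = 0"
      "(I ! c, v) \<in> arcs G" "(I ! Suc c, v) \<in> arcs G"
      using frontline_vals[OF Q v ab Qa] by metis
    \<comment> \<open>The entry of the rotation after \<open>I ! Suc c\<close>, to be identified as
      \<open>I ! c\<close>.\<close>
    define y where "y = rot G v ! (Suc p mod ?n)"
    have "Suc p mod ?n < ?n" using ne by (intro mod_less_divisor) simp
    then have y: "y \<in> set (rot G v)" unfolding y_def by simp
    have "side (-1) v (I ! Suc c) = side 1 v y"
      using corner[OF v(1) p(1)] p(2) unfolding y_def by simp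
    moreover have "side (-1) v (I ! Suc c) = side 1 (I ! Suc c) v"
      using side_walk[of v "I ! Suc c" "-1"] adjI[of "I ! Suc c"] c by simp
    moreover have "val \<gamma> (side 1 (I ! Suc c) v) \<noteq> 0"
      using g(3)[of "?a + Suc c"] Qa(2) by simp
    ultimately have vy: "val \<gamma> (side 1 v y) \<noteq> 0" by simp
    have "(v, y) \<notin> arcs G"
    proof
      assume a: "(v, y) \<in> arcs G"
      have "val \<gamma> (side 1 v y) = 0"
        using pi_mono[OF a] v by (intro good_zero[OF g(1) v g(5,6) a]) auto
      then show False using vy by simp
    qed
    then have "(y, v) \<in> arcs G" using y rot_set[OF v(1)] by auto
    then have "y \<in> set I" using setI by simp
    then obtain q where q: "q < length I" "I ! q = y" by (metis in_set_conv_nth)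
    have "side 1 v y = side (-1) y v" using side_walk[of v y 1] adjI[OF \<open>y \<in> set I\<close>] by simp
    then have nz: "val \<gamma> (sd (-1) (Q ! (?a + q))) \<noteq> 0" using vy nthI[OF q(1)] q(2) by simp
    have "\<not> q < c" using g(2)[of "?a + q"] nz by auto
    moreover have "\<not> Suc c \<le> q" using g(4)[of "?a + q"] nz q lenQ by auto
    ultimately have "q = c" by simp
    then show ?thesis using q y_def by simp
  qed
  obtain X Y where XY: "rot G v = X @ filter (\<lambda>x. x \<notin> set I) (rot G v) @ Y" "Y @ X = rev I" "Y \<noteq> []"
    using cyclic_block[OF rd ne dI subI lastI next_I] by blast
  have filt: "filter (\<lambda>x. x \<notin> set I) (rot G v) = succ_list G v"
    unfolding succ_list_def
    by (intro filter_cong) (use setI rot_set[OF v(1)] arcs_antisym in auto)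
  have rotv: "rot G v = X @ succ_list G v @ Y" using XY(1) unfolding filt .
  let ?Q' = "A @ map (Pair v) (succ_list G v) @ B"
  have "frontline (Suc k) ?Q'" if k': "Suc k < nv G"
  proof -
    let ?S = "succ_list G v"
    have "v \<noteq> snk G" using pi_snk v k' by auto
    then have Sne: "?S \<noteq> []" using ex_out_arc[OF v(1)] set_succ_list[OF v(1)] by auto
    have Ine: "I \<noteq> []" using XY(2,3) by auto
    have setAB: "set A \<union> set B = {e \<in> set Q. snd e \<noteq> v}" using AB(2) unfolding QI by auto
    have pv: "\<pi> x = Suc k \<longleftrightarrow> x = v" if "x \<in> verts G" for x using pi_inj[OF that v(1)] v by auto
    have set': "set ?Q' = {e \<in> arcs G. \<pi> (fst e) \<le> Suc k \<and> Suc k < \<pi> (snd e)}"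
    proof -
      have "(x, y) \<in> set ?Q' \<longleftrightarrow> (x, y) \<in> arcs G \<and> \<pi> x \<le> Suc k \<and> Suc k < \<pi> y" for x y
      proof (cases "(x, y) \<in> arcs G")
        case True
        then have V: "x \<in> verts G" "y \<in> verts G" using arcs_verts by blast+
        have "(x, y) \<in> set ?Q' \<longleftrightarrow> (x, y) \<in> set A \<union> set B \<or> x = v"
          using True set_succ_list[OF v(1)] by auto
        also have "\<dots> \<longleftrightarrow> (\<pi> x \<le> k \<and> k < \<pi> y \<and> y \<noteq> v) \<or> x = v"
          using True unfolding setAB setQ by auto
        also have "\<dots> \<longleftrightarrow> \<pi> x \<le> Suc k \<and> Suc k < \<pi> y"
          using pv[OF V(1)] pv[OF V(2)] pi_mono[OF True] by auto
        finally show ?thesis using True by simp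
      next
        case False
        then show ?thesis using setAB setQ set_succ_list[OF v(1)] by auto
      qed
      then have "e \<in> set ?Q' \<longleftrightarrow> e \<in> {e \<in> arcs G. \<pi> (fst e) \<le> Suc k \<and> Suc k < \<pi> (snd e)}" for e
        by (simp only: mem_Collect_eq flip: surjective_pairing)
          (metis (no_types, lifting) prod.collapse)
      then show ?thesis by blast
    qed
    have "(v, x) \<notin> set Q" for x using setQ v by auto
    then have "(v, x) \<notin> set A" "(v, x) \<notin> set B" for x unfolding QI by auto
    then have dist': "distinct ?Q'"
      using dQ distinct_succ_list[OF v(1)] unfolding QI
      by (auto simp: distinct_map inj_on_def)
    \<comment> \<open>the corner to the left of the incoming edges is the one to the left of the outgoing edges,
        seen along the leftmost incoming edge, and likewise on the right\<close>
    let ?i1 = "hd I" and ?id = "last I"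
    have i1: "?i1 \<in> set I" "?id \<in> set I" using Ine by auto
    have left: "sd 1 (?i1, v) = side 1 v (hd ?S)"
    proof -
      have lastYX: "last (Y @ X) = ?i1" unfolding XY(2) using Ine by (simp add: last_rev)
      obtain p where p: "p < ?n" "rot G v ! p = ?i1" "rot G v ! (Suc p mod ?n) = hd ?S"
      proof (cases "X = []")
        case True
        have "rot G v ! (?n - 1) = ?i1"
          using lastYX True XY(3) ne rotv by (metis append_Nil2 last_appendR last_conv_nth append_is_Nil_conv)
        moreover have "rot G v ! (Suc (?n - 1) mod ?n) = hd ?S"
          using True Sne ne rotv by (simp add: hd_conv_nth nth_append)
        ultimately show ?thesis using that[of "?n - 1"] ne by simp
      next
        case False
        have "rot G v ! (length X - 1) = ?i1"
        proof -
          have "last X = ?i1" using lastYX False by simp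
          then show ?thesis using False unfolding rotv by (simp add: last_conv_nth nth_append)
        qed
        moreover have "rot G v ! (Suc (length X - 1) mod ?n) = hd ?S"
          using False Sne unfolding rotv by (simp add: hd_conv_nth nth_append)
        moreover have "length X - 1 < ?n" using False unfolding rotv by (cases X) auto
        ultimately show ?thesis using that[of "length X - 1"] by blast
      qed
      have "side (-1) v ?i1 = side 1 v (hd ?S)" using corner[OF v(1) p(1)] p by simp
      then show ?thesis using side_walk[of v ?i1 "-1"] adjI[OF i1(1)] by simp
    qed
    have right: "sd (-1) (?id, v) = side (-1) v (last ?S)"
    proof -
      have hdYX: "hd Y = ?id" using arg_cong[OF XY(2), of hd] XY(3) Ine by (simp add: hd_rev)
      let ?p = "length X + length ?S - 1"
      have p: "?p < ?n" using Sne rotv by (simp, cases ?S, auto)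
      obtain S' s where S': "?S = S' @ [s]" using Sne by (metis rev_exhaust)
      have "rot G v ! ?p = last ?S"
        unfolding rotv S' by (simp add: nth_append)
      moreover have "rot G v ! (Suc ?p mod ?n) = hd Y"
        using XY(3) unfolding rotv S' by (simp add: hd_conv_nth nth_append)
      ultimately have "side (-1) v (last ?S) = side 1 v ?id" using corner[OF v(1) p] hdYX by simp
      then show ?thesis using side_walk[of v ?id 1] adjI[OF i1(2)] by simp
    qed
    let ?m = "length ?S"
    have S0: "0 < ?m" using Sne by simp
    have inner: "side (-1) v (?S ! i) = side 1 v (?S ! Suc i)" if "Suc i < ?m" for i
    proof -
      have "length X + i < ?n" "Suc (length X + i) < ?n" using that unfolding rotv by auto
      then show ?thesis using corner[OF v(1), of "length X + i"] that
        unfolding rotv by (simp add: nth_append)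
    qed
    have Q'_A: "?Q' ! i = Q ! i" if "i < ?a" for i using that unfolding QI by (simp add: nth_append)
    have Q'_S: "?Q' ! (?a + i) = (v, ?S ! i)" if "i < ?m" for i using that by (simp add: nth_append)
    have Q'_B: "?Q' ! (?a + ?m + i) = Q ! (?a + length I + i)" if "i < length B" for i
      using that unfolding QI by (simp add: nth_append)
    have lenI: "0 < length I" using Ine by simp
    have i1': "Q ! ?a = (?i1, v)" using nthI[of 0] Ine by (simp add: hd_conv_nth)
    have id': "Q ! (?a + (length I - 1)) = (?id, v)" using nthI[of "length I - 1"] Ine by (simp add: last_conv_nth)
    have link': "sd (-1) (?Q' ! i) = sd 1 (?Q' ! Suc i)" if i: "Suc i < length ?Q'" for i
    proof -
      consider "Suc i < ?a" | "Suc i = ?a" | j where "i = ?a + j" "Suc j < ?m"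
        | "i = ?a + (?m - 1)" "B \<noteq> []" | j where "i = ?a + ?m + j" "Suc j < length B"
      proof -
        assume c: "Suc i < ?a \<Longrightarrow> thesis" "Suc i = ?a \<Longrightarrow> thesis"
          "\<And>j. i = ?a + j \<Longrightarrow> Suc j < ?m \<Longrightarrow> thesis" "i = ?a + (?m - 1) \<Longrightarrow> B \<noteq> [] \<Longrightarrow> thesis"
          "\<And>j. i = ?a + ?m + j \<Longrightarrow> Suc j < length B \<Longrightarrow> thesis"
        have len: "length ?Q' = ?a + ?m + length B" by simp
        have "Suc i < ?a \<or> Suc i = ?a \<or> (?a \<le> i \<and> Suc (i - ?a) < ?m) \<or> i = ?a + (?m - 1) \<or> ?a + ?m \<le> i"
          using S0 by linarith
        then consider "Suc i < ?a" | "Suc i = ?a" | "?a \<le> i" "Suc (i - ?a) < ?m" | "i = ?a + (?m - 1)" | "?a + ?m \<le> i"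
          by blast
        then show thesis
        proof cases
          case 1 then show ?thesis by (rule c(1))
        next
          case 2 then show ?thesis by (rule c(2))
        next
          case 3 then show ?thesis by (intro c(3)[of "i - ?a"]) auto
        next
          case 4
          then have "B \<noteq> []" using i S0 unfolding len by auto
          then show ?thesis using 4 by (intro c(4))
        next
          case 5 then show ?thesis using i unfolding len by (intro c(5)[of "i - ?a - ?m"]) linarith+
        qed
      qed
      then show ?thesis
      proof cases
        case 1
        then show ?thesis using link[of i] Q'_A[of i] Q'_A[of "Suc i"] lenQ by simp
      next
        case 2
        then show ?thesis
          using link[of i] Q'_A[of i] Q'_S[of 0] S0 lenI lenQ i1' left Sne by (simp add: hd_conv_nth)
      next
        case 3
        then show ?thesis using inner[OF 3(2)] Q'_S[of j] Q'_S[of "Suc j"] by simp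
      next
        case 4
        then have B0: "0 < length B" by simp
        have "?Q' ! i = (v, ?S ! (?m - 1))"
          unfolding 4(1) using S0 by (intro Q'_S) simp
        then have "sd (-1) (?Q' ! i) = side (-1) v (last ?S)" by (simp only: last_conv_nth[OF Sne] fst_conv snd_conv)
        also have "\<dots> = sd (-1) (Q ! (?a + (length I - 1)))" using right id' by simp
        also have "\<dots> = sd 1 (Q ! (?a + length I))"
        proof -
          have S: "Suc (?a + (length I - 1)) = ?a + length I" using lenI by linarith
          show ?thesis using lenQ B0 by (intro link[of "?a + (length I - 1)", unfolded S]) linarith
        qed
        also have "Q ! (?a + length I) = ?Q' ! Suc i" using Q'_B[OF B0] 4 S0 by simp
        finally show ?thesis .
      next
        case 5
        then show ?thesis using link[of "?a + length I + j"] Q'_B[of j] Q'_B[of "Suc j"] lenQ by simp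
      qed
    qed
    have hd': "sd 1 (hd ?Q') = outer"
    proof (cases "A = []")
      case True
      then show ?thesis using Q0(2) left Sne Ine unfolding QI by (simp add: hd_append hd_map)
    next
      case False
      then show ?thesis using Q0(2) unfolding QI by (simp add: hd_append)
    qed
    have last': "sd (-1) (last ?Q') = outer"
    proof (cases "B = []")
      case True
      then show ?thesis using Q0(3) right Sne Ine unfolding QI by (simp add: last_append last_map)
    next
      case False
      then show ?thesis using Q0(3) unfolding QI by (simp add: last_append)
    qed
    show ?thesis unfolding frontline_def using set' dist' link' hd' last' Sne by blast
  qed
  then show ?thesis using QI rotv XY(2,3) by blast
qed

end

text \<open>All that is retained of the given drawing. Below v the clockwise order runs from right
  to left, hence the reversal; the rotation list may start inside the block of incoming edges, hence
  its two pieces X and Y.\<close>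

definition sweep :: "emb_graph \<Rightarrow> (nat \<Rightarrow> nat) \<Rightarrow> (nat \<Rightarrow> (nat \<times> nat) list) \<Rightarrow> bool" where
  "sweep G \<pi> Q \<longleftrightarrow>
     (\<forall>k. 1 \<le> k \<and> k < nv G \<longrightarrow>
        distinct (Q k) \<and> set (Q k) = {e \<in> arcs G. \<pi> (fst e) \<le> k \<and> k < \<pi> (snd e)}) \<and>
     Q 1 = map (Pair (src G)) (succ_list G (src G)) \<and>
     (\<forall>k v. 1 \<le> k \<and> k < nv G \<and> v \<in> verts G \<and> \<pi> v = Suc k \<longrightarrow>
        (\<exists>A I B X Y. Q k = A @ map (\<lambda>u. (u, v)) I @ B \<and> rot G v = X @ succ_list G v @ Y \<and>
           Y @ X = rev I \<and> Y \<noteq> [] \<and>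
           (Suc k < nv G \<longrightarrow> Q (Suc k) = A @ map (Pair v) (succ_list G v) @ B)))"

lemma sweep_exists:
  assumes G: "embedded_planar_st_graph G" and \<pi>: "st_ordering G \<pi>"
  shows "\<exists>Q. sweep G \<pi> Q"
proof -
  obtain D where "planar_drawing G D" "respects_embedding G D"
    using G unfolding embedded_planar_st_graph_def by blast
  then interpret embedded_ordered G D \<pi>
    using G \<pi> unfolding embedded_planar_st_graph_def by unfold_locales auto
  define R where "R k Q Q' \<longleftrightarrow> (\<forall>v. v \<in> verts G \<and> \<pi> v = Suc k \<longrightarrow>
        (\<exists>A I B X Y. Q = A @ map (\<lambda>u. (u, v)) I @ B \<and> rot G v = X @ succ_list G v @ Y \<and>
           Y @ X = rev I \<and> Y \<noteq> [] \<and>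
           (Suc k < nv G \<longrightarrow> Q' = A @ map (Pair v) (succ_list G v) @ B)))" for k Q Q'
  define P where "P n Q \<longleftrightarrow> (n = 0 \<longrightarrow> Q = map (Pair (src G)) (succ_list G (src G))) \<and>
    (Suc n < nv G \<longrightarrow> frontline (Suc n) Q)" for n Q
  have "\<exists>f. \<forall>n. P n (f n) \<and> (Suc n < nv G \<longrightarrow> R (Suc n) (f n) (f (Suc n)))"
  proof (rule dependent_nat_choice)
    show "\<exists>x. P 0 x" using frontline_init unfolding P_def by auto
    fix Q n assume P: "P n Q"
    show "\<exists>y. P (Suc n) y \<and> (Suc n < nv G \<longrightarrow> R (Suc n) Q y)"
    proof (cases "Suc n < nv G")
      case True
      then have fl: "frontline (Suc n) Q" using P unfolding P_def by simp
      obtain v where v: "v \<in> verts G" "\<pi> v = Suc (Suc n)" using ex_pi[of "Suc (Suc n)"] True by auto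
      obtain A I B X Y where *: "Q = A @ map (\<lambda>u. (u, v)) I @ B" "rot G v = X @ succ_list G v @ Y"
         "Y @ X = rev I" "Y \<noteq> []"
         "Suc (Suc n) < nv G \<Longrightarrow> frontline (Suc (Suc n)) (A @ map (Pair v) (succ_list G v) @ B)"
        using frontline_step[OF fl v] by auto
      have uniq: "w = v" if "w \<in> verts G" "\<pi> w = Suc (Suc n)" for w using pi_inj[OF that(1) v(1)] that v by simp
      have "R (Suc n) Q (A @ map (Pair v) (succ_list G v) @ B)"
        unfolding R_def using * uniq by blast
      moreover have "P (Suc n) (A @ map (Pair v) (succ_list G v) @ B)" unfolding P_def using *(5) by simp
      ultimately show ?thesis by blast
    next
      case False
      then show ?thesis unfolding P_def by auto
    qed
  qed
  then obtain f where f: "\<And>n. P n (f n)" "\<And>n. Suc n < nv G \<Longrightarrow> R (Suc n) (f n) (f (Suc n))" by blast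
  \<comment> \<open>Dependent choice numbers the frontlines from 0, the sweep from 1.\<close>
  define Q where "Q k = f (k - 1)" for k
  have fl: "frontline k (Q k)" if "1 \<le> k" "k < nv G" for k
    using f(1)[of "k - 1"] that unfolding P_def Q_def by simp
  have Q1: "Q 1 = map (Pair (src G)) (succ_list G (src G))"
    using f(1)[of 0] unfolding P_def Q_def by simp
  have step: "R k (Q k) (Q (Suc k))" if "1 \<le> k" "k < nv G" for k
    using f(2)[of "k - 1"] that unfolding Q_def by simp
  have "sweep G \<pi> Q"
    unfolding sweep_def
  proof (intro conjI allI impI)
    show "distinct (Q k)" "set (Q k) = {e \<in> arcs G. \<pi> (fst e) \<le> k \<and> k < \<pi> (snd e)}"
      if "1 \<le> k \<and> k < nv G" for k
      using fl[of k] that unfolding frontline_def by auto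
    show "Q 1 = map (Pair (src G)) (succ_list G (src G))" by (rule Q1)
    show "\<exists>A I B X Y. Q k = A @ map (\<lambda>u. (u, v)) I @ B \<and> rot G v = X @ succ_list G v @ Y \<and>
           Y @ X = rev I \<and> Y \<noteq> [] \<and>
           (Suc k < nv G \<longrightarrow> Q (Suc k) = A @ map (Pair v) (succ_list G v) @ B)"
      if "1 \<le> k \<and> k < nv G \<and> v \<in> verts G \<and> \<pi> v = Suc k" for k v
      using step[of k] that unfolding R_def by blast
  qed
  then show ?thesis by blast
qed

subsection \<open>The contour\<close>

definition vtx :: "emb_graph \<Rightarrow> (nat \<Rightarrow> nat) \<Rightarrow> nat \<Rightarrow> nat" where
  "vtx G \<pi> k = the_inv_into (verts G) \<pi> k"

text \<open>If \<open>v\<close> has only one predecessor \<open>u\<close>, this says that \<open>u\<close> has a pending edge to the left of \<open>(u, v)\<close> when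
  \<open>v\<close> is placed; by bitonicity it suffices to look at the entry next to \<open>v\<close>.\<close>

definition left_higher :: "emb_graph \<Rightarrow> (nat \<Rightarrow> nat) \<Rightarrow> nat \<Rightarrow> bool" where
  "left_higher G \<pi> v \<longleftrightarrow> (\<exists>u j. u < nv G \<and> Suc j < length (rot G u) \<and> rot G u ! Suc j = v \<and>
     \<pi> u < \<pi> v \<and> \<pi> v < \<pi> (rot G u ! j))"

definition before :: "'a list \<Rightarrow> 'a \<Rightarrow> 'a \<Rightarrow> bool" where
  "before xs a b \<longleftrightarrow> (\<exists>p q s. xs = p @ a # q @ b # s)"

definition open_arcs :: "emb_graph \<Rightarrow> (nat \<Rightarrow> nat) \<Rightarrow> nat \<Rightarrow> nat \<Rightarrow> (nat \<times> nat) list" where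
  "open_arcs G \<pi> k w = map (Pair w) (filter (\<lambda>z. k < \<pi> z) (succ_list G w))"

text \<open>The artificial ends of the contour are \<open>nv G\<close> and \<open>Suc (nv G)\<close>.\<close>

definition attach :: "emb_graph \<Rightarrow> (nat \<Rightarrow> nat) \<Rightarrow> nat \<Rightarrow> nat list \<Rightarrow>
    nat list \<Rightarrow> nat \<Rightarrow> nat list \<Rightarrow> nat \<Rightarrow> nat list \<Rightarrow> nat list \<Rightarrow> bool" where
  "attach G \<pi> k C P l M r S C' \<longleftrightarrow> (let v = vtx G \<pi> (Suc k) in
     C = P @ l # M @ r # S \<and> C' = P @ l # v # r # S \<and>
     (if k = 0 \<or> Suc k = nv G then l = nv G \<and> r = Suc (nv G)
      else \<exists>X Y. rot G v = X @ succ_list G v @ Y \<and> Y \<noteq> [] \<and>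
        (if last (Y @ X) \<noteq> hd Y then l = last (Y @ X) \<and> r = hd Y
         else M = [] \<and> (if left_higher G \<pi> v then l = hd Y else r = hd Y))))"

text \<open>What the geometric part asks of a step. Of the predecessors of v only l and r stay on
  the contour, so a predecessor with a pending edge to the right of v must be r, and one with a
  pending edge to the left must be l.\<close>

definition attach_ok :: "emb_graph \<Rightarrow> (nat \<Rightarrow> nat) \<Rightarrow> nat \<Rightarrow> nat list \<Rightarrow> nat \<Rightarrow> nat list \<Rightarrow> nat \<Rightarrow> bool" where
  "attach_ok G \<pi> k C l M r \<longleftrightarrow> (let v = vtx G \<pi> (Suc k) in
     (\<forall>u. (u, v) \<in> arcs G \<longrightarrow> u \<in> set (l # M @ [r])) \<and>
     (\<forall>u z. (u, v) \<in> arcs G \<and> Suc k < \<pi> z \<and> before (succ_list G u) v z \<longrightarrow> u = r) \<and>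
     (\<forall>u z. (u, v) \<in> arcs G \<and> Suc k < \<pi> z \<and> before (succ_list G u) z v \<longrightarrow> u = l) \<and>
     (\<exists>X Y. rot G v = X @ succ_list G v @ Y \<and> Y @ X = rev (filter (\<lambda>u. (u, v) \<in> arcs G) C)))"

definition contour_inv :: "emb_graph \<Rightarrow> (nat \<Rightarrow> nat) \<Rightarrow> nat \<Rightarrow> nat list \<Rightarrow> bool" where
  "contour_inv G \<pi> k C \<longleftrightarrow> distinct C \<and> hd C = nv G \<and> last C = Suc (nv G) \<and> C \<noteq> [] \<and>
     set C \<subseteq> insert (nv G) (insert (Suc (nv G)) {v \<in> verts G. \<pi> v \<le> k})"

lemma append_Cons_unique:
  "xs @ y # ys = zs @ y # ws \<Longrightarrow> y \<notin> set xs \<Longrightarrow> y \<notin> set zs \<Longrightarrow> xs = zs \<and> ys = ws"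
proof (induction xs arbitrary: zs)
  case Nil then show ?case by (cases zs) auto
next
  case (Cons x xs) then show ?case by (cases zs) auto
qed

section \<open>Construction of the contour\<close>

context ordered_st
begin

lemma vtx: assumes "k < nv G" shows "vtx G \<pi> (Suc k) \<in> verts G" "\<pi> (vtx G \<pi> (Suc k)) = Suc k"
proof -
  have "Suc k \<in> \<pi> ` verts G" using pi_bij assms unfolding bij_betw_def by auto
  then show "vtx G \<pi> (Suc k) \<in> verts G" "\<pi> (vtx G \<pi> (Suc k)) = Suc k"
    unfolding vtx_def using pi_bij the_inv_into_into[of \<pi> "verts G" "Suc k" "verts G"] f_the_inv_into_f[of \<pi> "verts G"]
    by (auto simp: bij_betw_def)
qed

lemma vtx_unique: "v \<in> verts G \<Longrightarrow> \<pi> v = Suc k \<Longrightarrow> k < nv G \<Longrightarrow> vtx G \<pi> (Suc k) = v"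
  using pi_inj vtx by metis

lemma succ_list_outside: "w \<notin> verts G \<Longrightarrow> succ_list G w = []"
  using arcs_verts unfolding succ_list_def by (auto simp: filter_empty_conv)

lemma distinct_succ: "distinct (succ_list G w)"
  using distinct_succ_list succ_list_outside by (cases "w \<in> verts G") auto

lemma in_succ_list: "z \<in> set (succ_list G w) \<longleftrightarrow> (w, z) \<in> arcs G"
proof (cases "w \<in> verts G")
  case True then show ?thesis using set_succ_list by blast
next
  case False then show ?thesis using succ_list_outside arcs_verts by auto
qed

end

locale bitonic_sweep = ordered_st +
  fixes Q :: "nat \<Rightarrow> (nat \<times> nat) list"
  assumes sw: "sweep G \<pi> Q"
    and bit: "u \<in> verts G \<Longrightarrow> succ_list G u \<noteq> [] \<Longrightarrow> bitonic (map \<pi> (succ_list G u))"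
begin

lemma rot_split:
  assumes u: "u \<in> verts G"
  shows "\<exists>X Y. rot G u = X @ succ_list G u @ Y"
proof (cases "u = src G")
  case True
  then show ?thesis using rot_src by (metis append_Nil append_Nil2)
next
  case False
  define k where "k = \<pi> u - 1"
  have "\<pi> u \<noteq> 1" using pi_src pi_inj[OF u src_verts] False by metis
  then have "1 \<le> k" "k < nv G" "\<pi> u = Suc k" using pi_range[OF u] by (auto simp: k_def)
  then show ?thesis using sw u unfolding sweep_def by blast
qed

text \<open>\<open>left_higher\<close> looks at the full rotation list, as the program does. The
  entry before v could also be the tail of an edge into u, but that vertex comes before u and hence
  before v in \<pi>, so the test cannot succeed there.\<close>

lemma left_higher_iff:
  assumes v: "v \<in> verts G" and u: "\<And>w. (w, v) \<in> arcs G \<longleftrightarrow> w = u" and S: "succ_list G u = S1 @ v # S2"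
  shows "left_higher G \<pi> v \<longleftrightarrow> S1 \<noteq> [] \<and> \<pi> v < \<pi> (last S1)"
proof -
  have uv: "(u, v) \<in> arcs G" using u by simp
  then have uV: "u \<in> verts G" using arcs_verts by blast
  obtain X Y where XY: "rot G u = X @ succ_list G u @ Y" using rot_split[OF uV] by blast
  then have r: "rot G u = (X @ S1) @ v # (S2 @ Y)" using S by simp
  have d: "distinct (rot G u)" by (rule rot_distinct[OF uV])
  show ?thesis
  proof
    assume "left_higher G \<pi> v"
    then obtain u' j where j: "u' < nv G" "Suc j < length (rot G u')" "rot G u' ! Suc j = v"
      "\<pi> u' < \<pi> v" "\<pi> v < \<pi> (rot G u' ! j)" unfolding left_higher_def by blast
    have "v \<in> set (rot G u')" using j nth_mem by blast
    then have "(u', v) \<in> arcs G" using rot_set[of u'] j pi_mono[of v u'] by (auto simp: verts_def)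
    then have [simp]: "u' = u" using u by simp
    have "rot G u ! length (X @ S1) = v" unfolding r by (rule nth_append_length)
    moreover have "length (X @ S1) < length (rot G u)" unfolding r by simp
    ultimately have "Suc j = length (X @ S1)"
      using j(2,3) d nth_eq_iff_index_eq[OF d, of "Suc j" "length (X @ S1)"] by simp
    moreover from this have ne: "X @ S1 \<noteq> []" by auto
    ultimately have "rot G u ! j = (X @ S1) ! j" unfolding r by (metis lessI nth_append)
    moreover have "j = length (X @ S1) - 1" using \<open>Suc j = length (X @ S1)\<close> by simp
    ultimately have jl: "rot G u ! j = last (X @ S1)" by (simp only: last_conv_nth[OF ne])
    have "S1 \<noteq> []"
    proof
      assume S1: "S1 = []"
      then have X: "last X \<in> set X" using ne by simp
      then have "last X \<notin> set (succ_list G u)" using d unfolding XY by auto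
      moreover have "last X \<in> set (rot G u)" using X XY by simp
      ultimately have "(last X, u) \<in> arcs G" using rot_set[OF uV] in_succ_list by auto
      then show False using jl S1 j(5) pi_mono[of "last X" u] pi_mono[OF uv] by simp
    qed
    then show "S1 \<noteq> [] \<and> \<pi> v < \<pi> (last S1)" using jl j(5) by simp
  next
    assume S1: "S1 \<noteq> [] \<and> \<pi> v < \<pi> (last S1)"
    let ?j = "length (X @ S1) - 1"
    have ne: "X @ S1 \<noteq> []" using S1 by simp
    then have Sj: "Suc ?j = length (X @ S1)" by (cases "X @ S1") auto
    have "rot G u ! ?j = (X @ S1) ! ?j" unfolding r using Sj by (metis lessI nth_append)
    then have "rot G u ! ?j = last (X @ S1)" by (simp only: last_conv_nth[OF ne])
    moreover have "rot G u ! Suc ?j = v" unfolding Sj r by (rule nth_append_length)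
    moreover have "Suc ?j < length (rot G u)" unfolding Sj r by simp
    ultimately show "left_higher G \<pi> v" unfolding left_higher_def
      using S1 uV pi_mono[OF uv] by (intro exI[of _ u] exI[of _ ?j]) (auto simp: verts_def)
  qed
qed

text \<open>If the entry to the left of v is higher, v is past the peak and everything to its right
  has been placed. Otherwise v is at or before the peak and everything to its left has been
  placed.\<close>

lemma bitonic_open:
  assumes u: "u \<in> verts G" and S: "succ_list G u = S1 @ v # S2" and v: "\<pi> v = Suc k"
  shows "S1 \<noteq> [] \<and> \<pi> v < \<pi> (last S1) \<Longrightarrow> filter (\<lambda>z. k < \<pi> z) S2 = []"
    and "\<not> (S1 \<noteq> [] \<and> \<pi> v < \<pi> (last S1)) \<Longrightarrow> filter (\<lambda>z. k < \<pi> z) S1 = []"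
proof -
  let ?xs = "map \<pi> (succ_list G u)" and ?p = "length S1"
  obtain h where h: "h < length ?xs" "sorted_wrt (<) (take (Suc h) ?xs)" "sorted_wrt (>) (drop h ?xs)"
    using bit[OF u] S unfolding bitonic_def by auto
  have inc: "?xs ! i < ?xs ! j" if "i < j" "j \<le> h" for i j
    using sorted_wrt_nth_less[OF h(2), of i j] that h(1) by simp
  have dec: "?xs ! j < ?xs ! i" if "h \<le> i" "i < j" "j < length ?xs" for i j
    using sorted_wrt_nth_less[OF h(3), of "i - h" "j - h"] that by simp
  have p: "?xs ! ?p = \<pi> v" "?p < length ?xs" unfolding S by (auto simp: nth_append)
  have p1: "?xs ! (?p - 1) = \<pi> (last S1)" if "S1 \<noteq> []"
    using that unfolding S by (auto simp: nth_append last_conv_nth)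
  show "filter (\<lambda>z. k < \<pi> z) S2 = []" if a: "S1 \<noteq> [] \<and> \<pi> v < \<pi> (last S1)"
  proof -
    have hp: "h < ?p"
    proof (rule ccontr)
      assume "\<not> h < ?p"
      then have "?xs ! (?p - 1) < ?xs ! ?p" using a by (intro inc) auto
      then show False using p p1 a by simp
    qed
    have "\<pi> z \<le> k" if z: "z \<in> set S2" for z
    proof -
      obtain i where i: "i < length S2" "S2 ! i = z" using z by (metis in_set_conv_nth)
      have "?xs ! (Suc ?p + i) < ?xs ! ?p" using i hp S by (intro dec) auto
      moreover have "?xs ! (Suc ?p + i) = \<pi> z" using i unfolding S by (simp add: nth_append)
      ultimately show ?thesis using p v by simp
    qed
    then show ?thesis by (simp add: filter_empty_conv not_less)
  qed
  show "filter (\<lambda>z. k < \<pi> z) S1 = []" if a: "\<not> (S1 \<noteq> [] \<and> \<pi> v < \<pi> (last S1))"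
  proof (cases "S1 = []")
    case False
    have hp: "?p \<le> h"
    proof (rule ccontr)
      assume "\<not> ?p \<le> h"
      then have "?xs ! ?p < ?xs ! (?p - 1)" using p(2) by (intro dec) auto
      then show False using p p1 a False by simp
    qed
    have "\<pi> z \<le> k" if z: "z \<in> set S1" for z
    proof -
      obtain i where i: "i < length S1" "S1 ! i = z" using z by (metis in_set_conv_nth)
      have "?xs ! i < ?xs ! ?p" using i hp by (intro inc) auto
      moreover have "?xs ! i = \<pi> z" using i unfolding S by (simp add: nth_append)
      ultimately show ?thesis using p v by simp
    qed
    then show ?thesis by (simp add: filter_empty_conv not_less)
  qed simp
qed

abbreviation "OA \<equiv> open_arcs G \<pi>"

text \<open>The bridge to the sweep. The invariant \<open>Q k = sweep_list k C\<close> says that the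
  frontline arises by listing, along the contour, the pending edges of each vertex; the artificial
  ends have none.\<close>

definition sweep_list :: "nat \<Rightarrow> nat list \<Rightarrow> (nat \<times> nat) list" where
  "sweep_list k C = concat (map (OA k) C)"

lemma sweep_list_simps [simp]:
  "sweep_list k [] = []" "sweep_list k (w # C) = OA k w @ sweep_list k C"
  "sweep_list k (C @ C') = sweep_list k C @ sweep_list k C'"
  by (simp_all add: sweep_list_def)

lemma set_open_arcs: "(a, b) \<in> set (OA k w) \<longleftrightarrow> a = w \<and> (w, b) \<in> arcs G \<and> k < \<pi> b"
  by (auto simp: open_arcs_def in_succ_list)

lemma set_sweep_list: "(a, b) \<in> set (sweep_list k C) \<longleftrightarrow> a \<in> set C \<and> (a, b) \<in> arcs G \<and> k < \<pi> b"
  by (induction C) (auto simp: set_open_arcs)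

lemma open_arcs_outside: "w \<notin> verts G \<Longrightarrow> OA k w = []"
  by (simp add: open_arcs_def succ_list_outside)

lemma open_arcs_split:
  assumes "(w, v) \<in> arcs G" "\<pi> v = Suc k"
  obtains S1 S2 where "succ_list G w = S1 @ v # S2" "v \<notin> set S1" "v \<notin> set S2"
    "OA k w = map (Pair w) (filter (\<lambda>z. k < \<pi> z) S1) @ (w, v) # map (Pair w) (filter (\<lambda>z. k < \<pi> z) S2)"
proof -
  have "v \<in> set (succ_list G w)" using assms in_succ_list by simp
  then obtain S1 S2 where S: "succ_list G w = S1 @ v # S2" by (meson split_list)
  then have "v \<notin> set S1" "v \<notin> set S2" using distinct_succ[of w] by auto
  then show thesis using that[OF S] assms unfolding open_arcs_def S by simp
qed

lemma open_arcs_Suc: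
  assumes v: "v \<in> verts G" "\<pi> v = Suc k"
  shows "OA (Suc k) w = filter (\<lambda>e. snd e \<noteq> v) (OA k w)"
proof -
  have "Suc k < \<pi> z \<longleftrightarrow> k < \<pi> z \<and> z \<noteq> v" if "z \<in> set (succ_list G w)" for z
    using that pi_inj[of z v] v arcs_verts[of w z] unfolding in_succ_list by (auto intro: Suc_lessI)
  then have "filter (\<lambda>z. Suc k < \<pi> z) (succ_list G w) = filter (\<lambda>z. k < \<pi> z \<and> z \<noteq> v) (succ_list G w)"
    by (intro filter_cong) auto
  then show ?thesis unfolding open_arcs_def by (simp add: filter_map o_def conj_commute)
qed

lemma sweep_list_Suc:
  assumes v: "v \<in> verts G" "\<pi> v = Suc k"
  shows "sweep_list (Suc k) C = filter (\<lambda>e. snd e \<noteq> v) (sweep_list k C)"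
  by (induction C) (auto simp: open_arcs_Suc[OF v])

lemma filter_head_open_arcs:
  assumes v: "\<pi> v = Suc k"
  shows "filter (\<lambda>e. snd e = v) (OA k w) = (if (w, v) \<in> arcs G then [(w, v)] else [])"
proof (cases "(w, v) \<in> arcs G")
  case True
  obtain S1 S2 where S: "v \<notin> set S1" "v \<notin> set S2"
    "OA k w = map (Pair w) (filter (\<lambda>z. k < \<pi> z) S1) @ (w, v) # map (Pair w) (filter (\<lambda>z. k < \<pi> z) S2)"
    using open_arcs_split[OF True v] by metis
  have "filter (\<lambda>e. snd e = v) (map (Pair w) (filter (\<lambda>z. k < \<pi> z) S1)) = []"
    "filter (\<lambda>e. snd e = v) (map (Pair w) (filter (\<lambda>z. k < \<pi> z) S2)) = []"
    using S(1,2) by (auto simp: filter_empty_conv)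
  then show ?thesis using True S(3) by simp
next
  case False
  then show ?thesis using set_open_arcs[of _ _ k w] by (auto simp: filter_empty_conv)
qed

lemma filter_head_sweep_list:
  assumes v: "\<pi> v = Suc k"
  shows "filter (\<lambda>e. snd e = v) (sweep_list k C) = map (\<lambda>u. (u, v)) (filter (\<lambda>u. (u, v) \<in> arcs G) C)"
  by (induction C) (auto simp: filter_head_open_arcs[OF v])

lemma contour_inv_step:
  assumes C: "contour_inv G \<pi> k (P @ l # M @ r # S)" and k: "k < nv G"
  shows "contour_inv G \<pi> (Suc k) (P @ l # vtx G \<pi> (Suc k) # r # S)"
proof -
  let ?v = "vtx G \<pi> (Suc k)"
  note v = vtx[OF k]
  have "?v \<noteq> nv G" "?v \<noteq> Suc (nv G)" using v(1) by (auto simp: verts_def)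
  then have "?v \<notin> set (P @ l # M @ r # S)" using C v(2) unfolding contour_inv_def by auto
  then have "distinct (P @ l # ?v # r # S)" using C unfolding contour_inv_def by auto
  moreover have "hd (P @ l # ?v # r # S) = nv G" "last (P @ l # ?v # r # S) = Suc (nv G)"
    using C unfolding contour_inv_def by (simp_all add: hd_append split: if_splits)
  moreover have "set (P @ l # ?v # r # S) \<subseteq> insert ?v (set (P @ l # M @ r # S))" by auto
  then have "set (P @ l # ?v # r # S) \<subseteq> insert (nv G) (insert (Suc (nv G)) {v \<in> verts G. \<pi> v \<le> Suc k})"
  proof -
    have "set (P @ l # M @ r # S) \<subseteq> insert (nv G) (insert (Suc (nv G)) {v \<in> verts G. \<pi> v \<le> k})"
      using C unfolding contour_inv_def by blast
    moreover have "{v \<in> verts G. \<pi> v \<le> k} \<subseteq> {v \<in> verts G. \<pi> v \<le> Suc k}" by auto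
    moreover have "?v \<in> {v \<in> verts G. \<pi> v \<le> Suc k}" using v by simp
    ultimately show ?thesis using \<open>set (P @ l # ?v # r # S) \<subseteq> insert ?v (set (P @ l # M @ r # S))\<close> by blast
  qed
  ultimately show ?thesis unfolding contour_inv_def by blast
qed

lemma outside_verts: "nv G \<notin> verts G" "Suc (nv G) \<notin> verts G"
  by (auto simp: verts_def)

text \<open>Selecting the edges with head v in both descriptions of \<open>Q k\<close> identifies
  the block of incoming edges with the predecessors of v in contour order.\<close>

lemma sweep_pred:
  assumes k: "1 \<le> k" "k < nv G" and QC: "Q k = sweep_list k C" and v: "v \<in> verts G" "\<pi> v = Suc k"
  obtains A I B X Y where "I = filter (\<lambda>u. (u, v) \<in> arcs G) C" "Q k = A @ map (\<lambda>u. (u, v)) I @ B"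
    "rot G v = X @ succ_list G v @ Y" "Y @ X = rev I" "Y \<noteq> []"
    "Suc k < nv G \<Longrightarrow> Q (Suc k) = A @ map (Pair v) (succ_list G v) @ B"
    "filter (\<lambda>e. snd e \<noteq> v) A = A" "filter (\<lambda>e. snd e \<noteq> v) B = B" "\<And>u. (u, v) \<in> arcs G \<Longrightarrow> u \<in> set I"
    "\<And>u. (u, v) \<notin> set A" "\<And>u. (u, v) \<notin> set B"
proof -
  obtain A I B X Y where *: "Q k = A @ map (\<lambda>u. (u, v)) I @ B" "rot G v = X @ succ_list G v @ Y"
     "Y @ X = rev I" "Y \<noteq> []" "Suc k < nv G \<Longrightarrow> Q (Suc k) = A @ map (Pair v) (succ_list G v) @ B"
    using sw k v unfolding sweep_def by blast
  have dQ: "distinct (Q k)" using sw k unfolding sweep_def by blast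
  have setI: "u \<in> set I" if "(u, v) \<in> arcs G" for u
  proof -
    have "u \<in> set (rot G v)" using rot_set[OF v(1)] that by simp
    moreover have "u \<notin> set (succ_list G v)" using in_succ_list arcs_antisym[OF that] by simp
    ultimately have "u \<in> set (Y @ X)" using *(2) by auto
    then show ?thesis unfolding *(3) by simp
  qed
  have nAB: "(u, v) \<notin> set A" "(u, v) \<notin> set B" for u
  proof -
    have "(u, v) \<in> set A \<union> set B \<Longrightarrow> False"
    proof -
      assume a: "(u, v) \<in> set A \<union> set B"
      then have "(u, v) \<in> set (Q k)" unfolding *(1) by auto
      then have "(u, v) \<in> arcs G" unfolding QC set_sweep_list by simp
      then have "(u, v) \<in> set (map (\<lambda>u. (u, v)) I)" using setI by auto
      then show False using a dQ unfolding *(1) by auto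
    qed
    then show "(u, v) \<notin> set A" "(u, v) \<notin> set B" by auto
  qed
  then have fAB: "filter (\<lambda>e. snd e \<noteq> v) A = A" "filter (\<lambda>e. snd e \<noteq> v) B = B"
     "filter (\<lambda>e. snd e = v) A = []" "filter (\<lambda>e. snd e = v) B = []"
    by (auto simp: filter_id_conv filter_empty_conv)
  have "filter (\<lambda>e. snd e = v) (Q k) = map (\<lambda>u. (u, v)) I"
    unfolding *(1) by (simp add: fAB filter_map o_def)
  then have "map (\<lambda>u. (u, v)) I = map (\<lambda>u. (u, v)) (filter (\<lambda>u. (u, v) \<in> arcs G) C)"
    unfolding QC filter_head_sweep_list[OF v(2)] by simp
  then have I: "I = filter (\<lambda>u. (u, v) \<in> arcs G) C"
    by (metis (no_types, lifting) inj_onI map_inj_on prod.inject)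
  show thesis using that[OF I *(1-5) fAB(1,2) setI nAB] by blast
qed

lemma open_before:
  assumes S: "succ_list G u = S1 @ v # S2" and z: "k < \<pi> z"
  shows "before (succ_list G u) v z \<Longrightarrow> filter (\<lambda>z. k < \<pi> z) S2 \<noteq> []"
    "before (succ_list G u) z v \<Longrightarrow> filter (\<lambda>z. k < \<pi> z) S1 \<noteq> []"
proof -
  have "distinct (S1 @ v # S2)" using distinct_succ[of u] S by simp
  then have dS: "v \<notin> set S1" by simp
  show "filter (\<lambda>z. k < \<pi> z) S2 \<noteq> []" if b: "before (succ_list G u) v z"
  proof -
    obtain p q s where "succ_list G u = p @ v # (q @ z # s)" using b unfolding before_def by blast
    then have "S1 @ v # S2 = p @ v # (q @ z # s)" "distinct (p @ v # (q @ z # s))"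
      using S distinct_succ[of u] by simp_all
    then have "S1 @ v # S2 = p @ v # (q @ z # s)" "v \<notin> set p" by simp_all
    from append_Cons_unique[OF this(1) dS this(2)] have "z \<in> set S2" by simp
    then show ?thesis using z by (auto simp: filter_empty_conv)
  qed
  show "filter (\<lambda>z. k < \<pi> z) S1 \<noteq> []" if b: "before (succ_list G u) z v"
  proof -
    obtain p q s where "succ_list G u = (p @ z # q) @ v # s" using b unfolding before_def by auto
    then have "S1 @ v # S2 = (p @ z # q) @ v # s" "distinct ((p @ z # q) @ v # s)"
      using S distinct_succ[of u] by simp_all
    then have "S1 @ v # S2 = (p @ z # q) @ v # s" "v \<notin> set (p @ z # q)" by simp_all
    from append_Cons_unique[OF this(1) dS this(2)] have "z \<in> set S1" by simp
    then show ?thesis using z by (auto simp: filter_empty_conv)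
  qed
qed

lemma sweep_list_next:
  assumes v: "v \<in> verts G" "\<pi> v = Suc k"
    and "filter (\<lambda>e. snd e \<noteq> v) (sweep_list k (P @ [l])) = A" "filter (\<lambda>e. snd e \<noteq> v) (sweep_list k (r # S)) = B"
  shows "sweep_list (Suc k) (P @ l # v # r # S) = A @ map (Pair v) (succ_list G v) @ B"
proof -
  have "filter (\<lambda>z. Suc k < \<pi> z) (succ_list G v) = succ_list G v"
    using in_succ_list pi_mono[of v] v by (auto simp: filter_id_conv)
  then have "OA (Suc k) v = map (Pair v) (succ_list G v)" by (simp add: open_arcs_def)
  moreover have "sweep_list (Suc k) (P @ [l]) = A" "sweep_list (Suc k) (r # S) = B"
    using assms(3,4) sweep_list_Suc[OF v] by metis+
  moreover have "sweep_list (Suc k) (P @ l # v # r # S) =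
     sweep_list (Suc k) (P @ [l]) @ OA (Suc k) v @ sweep_list (Suc k) (r # S)" by simp
  ultimately show ?thesis by simp
qed

text \<open>The first and the last vertex cover everything between the artificial ends. This is
  harmless for pending edges: the source has no predecessor, and no successor is later than the last
  vertex.\<close>

lemma contour_step_ends:
  assumes k: "k < nv G" "k = 0 \<or> Suc k = nv G" and C: "contour_inv G \<pi> k C"
    and QC: "1 \<le> k \<Longrightarrow> Q k = sweep_list k C"
  shows "\<exists>P l M r S C'. attach G \<pi> k C P l M r S C' \<and> attach_ok G \<pi> k C l M r \<and>
     contour_inv G \<pi> (Suc k) C' \<and> (Suc k < nv G \<longrightarrow> Q (Suc k) = sweep_list (Suc k) C')"
proof -
  let ?L = "nv G" and ?R = "Suc (nv G)"
  let ?v = "vtx G \<pi> (Suc k)"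
  note v = vtx[OF k(1)]
  obtain M where CM: "C = ?L # M @ [?R]"
  proof -
    obtain C1 where C1: "C = ?L # C1" using C unfolding contour_inv_def by (cases C) auto
    then have "C1 \<noteq> []" using C unfolding contour_inv_def by auto
    then obtain M where "C1 = M @ [?R]" using C unfolding C1 contour_inv_def by (cases C1 rule: rev_cases) auto
    then show thesis using that C1 by simp
  qed
  have att: "attach G \<pi> k C [] ?L M ?R [] [?L, ?v, ?R]" unfolding attach_def Let_def using CM k(2) by simp
  have inv: "contour_inv G \<pi> (Suc k) [?L, ?v, ?R]"
    using contour_inv_step[of k "[]" ?L M ?R "[]"] C CM k(1) by simp
  have noz: "\<not> (Suc k < \<pi> z \<and> (u, ?v) \<in> arcs G \<and> (before (succ_list G u) ?v z \<or> before (succ_list G u) z ?v))" for u z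
  proof
    assume a: "Suc k < \<pi> z \<and> (u, ?v) \<in> arcs G \<and> (before (succ_list G u) ?v z \<or> before (succ_list G u) z ?v)"
    show False
    proof (cases "k = 0")
      case True
      then have "?v = src G" using v pi_src pi_inj src_verts by simp
      then show ?thesis using a src_no_in by simp
    next
      case False
      have "z \<in> set (succ_list G u)" using a unfolding before_def by auto
      then have "z \<in> verts G" using in_succ_list arcs_verts by blast
      then show ?thesis using pi_range[of z] a k False by auto
    qed
  qed
  have "attach_ok G \<pi> k C ?L M ?R \<and> (Suc k < nv G \<longrightarrow> Q (Suc k) = sweep_list (Suc k) [?L, ?v, ?R])"
  proof (cases "k = 0")
    case True
    then have vs: "?v = src G" using v pi_src pi_inj src_verts by simp
    have "filter (\<lambda>u. (u, src G) \<in> arcs G) C = []" using src_no_in by (simp add: filter_empty_conv)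
    moreover have "rot G (src G) = [] @ succ_list G (src G) @ []" using rot_src by simp
    ultimately have "\<exists>X Y. rot G ?v = X @ succ_list G ?v @ Y \<and> Y @ X = rev (filter (\<lambda>u. (u, ?v) \<in> arcs G) C)"
      unfolding vs by (metis append_Nil2 rev.simps(1))
    then have ok: "attach_ok G \<pi> k C ?L M ?R"
      unfolding attach_ok_def Let_def using noz src_no_in vs by auto
    have "filter (\<lambda>z. Suc 0 < \<pi> z) (succ_list G (src G)) = succ_list G (src G)"
      using pi_mono[of "src G"] pi_src in_succ_list by (auto simp: filter_id_conv)
    then have "OA 1 (src G) = map (Pair (src G)) (succ_list G (src G))" by (simp add: open_arcs_def)
    then have "sweep_list 1 [?L, ?v, ?R] = map (Pair (src G)) (succ_list G (src G))"
      using vs open_arcs_outside outside_verts by simp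
    then show ?thesis using ok sw True unfolding sweep_def by simp
  next
    case False
    then have k1: "1 \<le> k" by simp
    obtain A I B X Y where *: "I = filter (\<lambda>u. (u, ?v) \<in> arcs G) C"
      "rot G ?v = X @ succ_list G ?v @ Y" "Y @ X = rev I" "\<And>u. (u, ?v) \<in> arcs G \<Longrightarrow> u \<in> set I"
      using sweep_pred[OF k1 k(1) QC[OF k1] v] by metis
    have "u \<in> set C" if "(u, ?v) \<in> arcs G" for u using *(4)[OF that] unfolding *(1) by simp
    then have "\<forall>u. (u, ?v) \<in> arcs G \<longrightarrow> u \<in> set (?L # M @ [?R])"
      unfolding CM by blast
    then have "attach_ok G \<pi> k C ?L M ?R"
      unfolding attach_ok_def Let_def using noz *(1,2,3) by blast
    then show ?thesis using False k by simp
  qed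
  then show ?thesis using att inv by blast
qed

text \<open>Two decompositions of \<open>Q k\<close> are compared: the one around the block of edges
  into v, and the one along the contour. With several predecessors, all pending edges strictly
  between the outermost edges of the block lead to v, so the vertices in between may be covered.
  With a single predecessor, bitonicity leaves one side of the new edge free of pending edges, and
  the contour neighbour on that side becomes the other end.\<close>

lemma contour_step_main:
  assumes k: "1 \<le> k" "Suc k < nv G" and C: "contour_inv G \<pi> k C" and QC: "Q k = sweep_list k C"
  shows "\<exists>P l M r S C'. attach G \<pi> k C P l M r S C' \<and> attach_ok G \<pi> k C l M r \<and>
     contour_inv G \<pi> (Suc k) C' \<and> (Suc k < nv G \<longrightarrow> Q (Suc k) = sweep_list (Suc k) C')"
proof -
  define v where "v = vtx G \<pi> (Suc k)"
  have k': "k < nv G" using k by simp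
  have v: "v \<in> verts G" "\<pi> v = Suc k" using vtx[OF k'] by (auto simp: v_def)
  obtain A I B X Y where I: "I = filter (\<lambda>u. (u, v) \<in> arcs G) C" and QA: "Q k = A @ map (\<lambda>u. (u, v)) I @ B"
    and XY: "rot G v = X @ succ_list G v @ Y" "Y @ X = rev I" "Y \<noteq> []"
    and Q': "Suc k < nv G \<Longrightarrow> Q (Suc k) = A @ map (Pair v) (succ_list G v) @ B"
    and AB: "filter (\<lambda>e. snd e \<noteq> v) A = A" "filter (\<lambda>e. snd e \<noteq> v) B = B"
    and setI: "\<And>u. (u, v) \<in> arcs G \<Longrightarrow> u \<in> set I" and nAB: "\<And>u. (u, v) \<notin> set A" "\<And>u. (u, v) \<notin> set B"
    using sweep_pred[OF k(1) k' QC v] by metis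
  have dQ: "distinct (Q k)" using sw k unfolding sweep_def by auto
  have dC: "distinct C" and endsC: "hd C = nv G" "last C = Suc (nv G)" "C \<noteq> []"
    using C unfolding contour_inv_def by auto
  have dI: "distinct I" using dC I by simp
  have arcI: "(u, v) \<in> arcs G" if "u \<in> set I" for u using that I by simp
  have Ine: "I \<noteq> []" using XY(2,3) by auto
  have lastYX: "last (Y @ X) = hd I" "hd Y = last I"
    using XY(2,3) Ine by (simp add: last_rev, metis hd_append2 hd_rev)
  \<comment> \<open>What each case has to supply. The last two assumptions say that the two parts of
    the contour that are kept carry exactly the edges A and B around the block.\<close>
  have finish: ?thesis
    if C_split: "C = P @ l # M @ r # S"
      and lr: "if hd I \<noteq> last I then l = hd I \<and> r = last I else M = [] \<and> (if left_higher G \<pi> v then l = last I else r = last I)"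
      and G1: "\<And>u. u \<in> set I \<Longrightarrow> u \<in> set (l # M @ [r])"
      and G3: "\<And>u z. (u, v) \<in> arcs G \<Longrightarrow> k < \<pi> z \<Longrightarrow> before (succ_list G u) v z \<Longrightarrow> u = r"
         "\<And>u z. (u, v) \<in> arcs G \<Longrightarrow> k < \<pi> z \<Longrightarrow> before (succ_list G u) z v \<Longrightarrow> u = l"
      and fA: "filter (\<lambda>e. snd e \<noteq> v) (sweep_list k (P @ [l])) = A"
      and fB: "filter (\<lambda>e. snd e \<noteq> v) (sweep_list k (r # S)) = B" for P l M r S
  proof -
    have "\<exists>X Y. rot G v = X @ succ_list G v @ Y \<and> Y \<noteq> [] \<and>
        (if last (Y @ X) \<noteq> hd Y then l = last (Y @ X) \<and> r = hd Y
         else M = [] \<and> (if left_higher G \<pi> v then l = hd Y else r = hd Y))"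
      using XY lr lastYX by - (rule exI[of _ X], rule exI[of _ Y], simp)
    then have "attach G \<pi> k C P l M r S (P @ l # v # r # S)"
      unfolding attach_def Let_def v_def[symmetric] using C_split k by simp
    moreover have "attach_ok G \<pi> k C l M r"
      unfolding attach_ok_def Let_def v_def[symmetric]
      using G1 G3 setI XY I by (meson Suc_lessD)
    moreover have "contour_inv G \<pi> (Suc k) (P @ l # v # r # S)"
      using contour_inv_step C k' unfolding C_split v_def by blast
    moreover have "Q (Suc k) = sweep_list (Suc k) (P @ l # v # r # S)"
      using Q' k sweep_list_next[OF v fA fB] by simp
    ultimately show ?thesis by blast
  qed
  have i1: "hd I \<in> set I" "(hd I, v) \<in> arcs G" using Ine arcI by auto
  obtain C1 C2 where C12: "C = C1 @ hd I # C2" using i1(1) I by (metis filter_is_subset subsetD split_list)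
  obtain S1 S2 where S: "succ_list G (hd I) = S1 @ v # S2" "v \<notin> set S1" "v \<notin> set S2"
    "OA k (hd I) = map (Pair (hd I)) (filter (\<lambda>z. k < \<pi> z) S1) @ (hd I, v) # map (Pair (hd I)) (filter (\<lambda>z. k < \<pi> z) S2)"
    using open_arcs_split[OF i1(2) v(2)] by metis
  let ?O1 = "map (Pair (hd I)) (filter (\<lambda>z. k < \<pi> z) S1)" and ?O2 = "map (Pair (hd I)) (filter (\<lambda>z. k < \<pi> z) S2)"
  obtain I' where I': "I = hd I # I'" using Ine by (cases I) auto
  have eq: "A @ (hd I, v) # (map (\<lambda>u. (u, v)) I' @ B) = (sweep_list k C1 @ ?O1) @ (hd I, v) # (?O2 @ sweep_list k C2)"
  proof -
    have "A @ (hd I, v) # (map (\<lambda>u. (u, v)) I' @ B) = A @ map (\<lambda>u. (u, v)) (hd I # I') @ B" by simp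
    also have "\<dots> = sweep_list k (C1 @ hd I # C2)" using QA QC C12 I' by metis
    also have "\<dots> = sweep_list k C1 @ OA k (hd I) @ sweep_list k C2" by simp
    finally show ?thesis by (simp only: S(4) append_assoc append_Cons append_Nil)
  qed
  have d2: "distinct ((sweep_list k C1 @ ?O1) @ (hd I, v) # (?O2 @ sweep_list k C2))"
  proof -
    have "distinct (sweep_list k (C1 @ hd I # C2))" using dQ QC C12 by metis
    then have "distinct (sweep_list k C1 @ OA k (hd I) @ sweep_list k C2)" by (simp only: sweep_list_simps)
    then show ?thesis by (simp only: S(4) append_assoc append_Cons append_Nil)
  qed
  have "A = sweep_list k C1 @ ?O1 \<and> map (\<lambda>u. (u, v)) I' @ B = ?O2 @ sweep_list k C2"
    using append_Cons_unique[OF eq] nAB d2 by simp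
  then have split1: "A = sweep_list k C1 @ ?O1" "map (\<lambda>u. (u, v)) I' @ B = ?O2 @ sweep_list k C2" by auto
  show ?thesis
  proof (cases "I' = []")
    case True
    then have Iu: "I = [hd I]" using I' by simp
    define u where "u = hd I"
    have I1: "I = [u]" using Iu unfolding u_def .
    have uI: "I = [u]" "hd I = u" "last I = u" 
    proof -
      show "hd I = u" by (simp only: u_def)
      show "last I = u" unfolding I1 by simp
    qed (rule I1)
    have only: "(w, v) \<in> arcs G \<longleftrightarrow> w = u" for w 
    proof -
      have "w \<in> set I \<longleftrightarrow> w = u" unfolding I1 by simp
      then show ?thesis using setI[of w] arcI[of w] by blast
    qed
    have uV: "u \<in> verts G" using only arcs_verts by blast
    then have uLR: "u \<noteq> nv G" "u \<noteq> Suc (nv G)" by (auto simp: verts_def)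
    have Su: "succ_list G u = S1 @ v # S2" using S(1) uI by simp
    have lh: "left_higher G \<pi> v \<longleftrightarrow> S1 \<noteq> [] \<and> \<pi> v < \<pi> (last S1)"
      by (rule left_higher_iff[OF v(1) only Su])
    show ?thesis
    proof (cases "left_higher G \<pi> v")
      case lhT: True
      have O2: "filter (\<lambda>z. k < \<pi> z) S2 = []" using bitonic_open(1)[OF uV Su v(2)] lh lhT by simp
      \<comment> \<open>The predecessor is a vertex of the graph and so not the right end of the
        contour; it has a right neighbour.\<close>
      obtain r S' where C2: "C2 = r # S'" using C12 endsC uLR uI by (cases C2) auto
      show ?thesis
      proof (rule finish[of C1 u "[]" r S'])
        show "C = C1 @ u # [] @ r # S'" using C12 C2 uI by simp
        show "filter (\<lambda>e. snd e \<noteq> v) (sweep_list k (C1 @ [u])) = A"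
          using split1(1) AB(1) S(4) O2 uI by simp
        show "filter (\<lambda>e. snd e \<noteq> v) (sweep_list k (r # S')) = B"
          using split1(2) AB(2) O2 True unfolding C2 by simp
        show "w = r" if "(w, v) \<in> arcs G" "k < \<pi> z" "before (succ_list G w) v z" for w z
          using open_before(1)[OF Su that(2)] that O2 only by simp
      qed (use uI lhT only in auto)
    next
      case lhF: False
      have O1: "filter (\<lambda>z. k < \<pi> z) S1 = []" using bitonic_open(2)[OF uV Su v(2)] lh lhF by blast
      obtain l P' where C1: "C1 = P' @ [l]" using C12 endsC uLR uI by (cases C1 rule: rev_cases) auto
      show ?thesis
      proof (rule finish[of P' l "[]" u C2])
        show "C = P' @ l # [] @ u # C2" using C12 C1 uI by simp
        show "filter (\<lambda>e. snd e \<noteq> v) (sweep_list k (P' @ [l])) = A"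
          using split1(1) AB(1) O1 unfolding C1 by simp
        show "filter (\<lambda>e. snd e \<noteq> v) (sweep_list k (u # C2)) = B"
          using split1(2) AB(2) S(4) O1 True uI by simp
        show "w = l" if "(w, v) \<in> arcs G" "k < \<pi> z" "before (succ_list G w) z v" for w z
          using open_before(2)[OF Su that(2)] that O1 only by simp
      qed (use uI lhF only in auto)
    qed
  next
    case False
    define d where "d = last I"
    obtain I'' where I'': "I' = I'' @ [d]" using False I' unfolding d_def
      by (metis append_butlast_last_id last_ConsR)
    have Isplit: "I = hd I # I'' @ [d]" using I' I'' by simp
    \<comment> \<open>A pending edge to the right of the first edge of the block would belong to the
      block and end at v again, but v occurs only once in a successor list.\<close>
    have O2: "filter (\<lambda>z. k < \<pi> z) S2 = []"
    proof (rule ccontr)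
      assume ne: "filter (\<lambda>z. k < \<pi> z) S2 \<noteq> []"
      then have "hd ?O2 = hd (map (\<lambda>u. (u, v)) I' @ B)" using split1(2) by simp
      then have "snd (hd ?O2) = v" using False by (simp add: hd_append hd_map)
      then have "hd (filter (\<lambda>z. k < \<pi> z) S2) = v" using ne by (simp add: hd_map)
      then show False using ne S(3) by (metis filter_is_subset hd_in_set subsetD)
    qed
    then have sC2: "map (\<lambda>u. (u, v)) I'' @ (d, v) # B = sweep_list k C2" using split1(2) I'' by simp
    then have "(d, v) \<in> set (sweep_list k C2)" by (metis in_set_conv_decomp)
    then have dC2: "d \<in> set C2" and darc: "(d, v) \<in> arcs G" unfolding set_sweep_list by auto
    obtain M S' where C2: "C2 = M @ d # S'" using dC2 by (meson split_list)
    obtain T1 T2 where T: "succ_list G d = T1 @ v # T2" "v \<notin> set T1" "v \<notin> set T2"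
      "OA k d = map (Pair d) (filter (\<lambda>z. k < \<pi> z) T1) @ (d, v) # map (Pair d) (filter (\<lambda>z. k < \<pi> z) T2)"
      using open_arcs_split[OF darc v(2)] by metis
    have eq2: "map (\<lambda>u. (u, v)) I'' @ (d, v) # B =
      (sweep_list k M @ map (Pair d) (filter (\<lambda>z. k < \<pi> z) T1)) @ (d, v) # (map (Pair d) (filter (\<lambda>z. k < \<pi> z) T2) @ sweep_list k S')"
      unfolding sC2 C2 by (simp add: T(4))
    have "distinct (sweep_list k C2)" using dQ unfolding QC C12 by simp
    then have dd: "distinct (map (\<lambda>u. (u, v)) I'' @ (d, v) # B)"
      "distinct ((sweep_list k M @ map (Pair d) (filter (\<lambda>z. k < \<pi> z) T1)) @ (d, v) # (map (Pair d) (filter (\<lambda>z. k < \<pi> z) T2) @ sweep_list k S'))"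
      unfolding sC2[symmetric] eq2[symmetric] by auto
    have "map (\<lambda>u. (u, v)) I'' = sweep_list k M @ map (Pair d) (filter (\<lambda>z. k < \<pi> z) T1) \<and>
        B = map (Pair d) (filter (\<lambda>z. k < \<pi> z) T2) @ sweep_list k S'"
      by (rule append_Cons_unique[OF eq2]) (use dd in auto)
    then have split2: "map (\<lambda>u. (u, v)) I'' = sweep_list k M @ map (Pair d) (filter (\<lambda>z. k < \<pi> z) T1)"
        "B = map (Pair d) (filter (\<lambda>z. k < \<pi> z) T2) @ sweep_list k S'" by auto
    have headv: "snd e = v" if "e \<in> set (sweep_list k M) \<union> Pair d ` set (filter (\<lambda>z. k < \<pi> z) T1)" for e
    proof -
      have "e \<in> set (map (\<lambda>u. (u, v)) I'')" using that unfolding split2(1) by simp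
      then show ?thesis by auto
    qed
    have O3: "filter (\<lambda>z. k < \<pi> z) T1 = []"
    proof (rule ccontr)
      assume "filter (\<lambda>z. k < \<pi> z) T1 \<noteq> []"
      then obtain z where "z \<in> set (filter (\<lambda>z. k < \<pi> z) T1)" by (metis list.set_sel(1))
      then show False using headv[of "(d, z)"] T(2) by auto
    qed
    have dI1: "d \<noteq> hd I" using dI Isplit by (metis distinct.simps(2) in_set_conv_decomp)
    have memI: "u = hd I \<or> u \<in> set M \<or> u = d" if "u \<in> set I" for u
    proof -
      have "u \<in> set (hd I # I'' @ [d])" using that Isplit by metis
      then consider "u = hd I" | "u = d" | "u \<in> set I''" by auto
      then show ?thesis
      proof cases
        case 3
        then have "(u, v) \<in> set (map (\<lambda>u. (u, v)) I'')" by auto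
        then have "(u, v) \<in> set (sweep_list k M)" unfolding split2(1) O3 by simp
        then show ?thesis unfolding set_sweep_list by simp
      qed auto
    qed
    have Mz: False if "u \<in> set M" "(u, v) \<in> arcs G" "k < \<pi> z" "before (succ_list G u) v z \<or> before (succ_list G u) z v" for u z
    proof -
      have "z \<in> set (succ_list G u)" using that(4) unfolding before_def by auto
      then have "(u, z) \<in> set (sweep_list k M)" using that unfolding set_sweep_list in_succ_list by simp
      then have "z = v" using headv by fastforce
      then show False using that(4) distinct_succ[of u] unfolding before_def by auto
    qed
    show ?thesis
    proof (rule finish[of C1 "hd I" M d S'])
      show "C = C1 @ hd I # M @ d # S'" using C12 C2 by simp
      show "if hd I \<noteq> last I then hd I = hd I \<and> d = last I else M = [] \<and> (if left_higher G \<pi> v then hd I = last I else d = last I)"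
        using dI1 d_def by auto
      show "u \<in> set (hd I # M @ [d])" if "u \<in> set I" for u using memI[OF that] by auto
      show "u = d" if "(u, v) \<in> arcs G" "k < \<pi> z" "before (succ_list G u) v z" for u z
        using memI[OF setI[OF that(1)]] Mz[OF _ that(1,2)] that(3) open_before(1)[OF S(1) that(2)] O2 by blast
      show "u = hd I" if "(u, v) \<in> arcs G" "k < \<pi> z" "before (succ_list G u) z v" for u z
        using memI[OF setI[OF that(1)]] Mz[OF _ that(1,2)] that(3) open_before(2)[OF T(1) that(2)] O3 by blast
      show "filter (\<lambda>e. snd e \<noteq> v) (sweep_list k (C1 @ [hd I])) = A"
        using split1(1) AB(1) S(4) O2 by simp
      show "filter (\<lambda>e. snd e \<noteq> v) (sweep_list k (d # S')) = B"
        using split2(2) AB(2) T(4) O3 by simp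
    qed
  qed
qed

lemma contour_exists:
  "\<exists>C P l M r S. C 0 = [nv G, Suc (nv G)] \<and>
     (\<forall>k<nv G. attach G \<pi> k (C k) (P k) (l k) (M k) (r k) (S k) (C (Suc k)) \<and>
        attach_ok G \<pi> k (C k) (l k) (M k) (r k)) \<and>
     (\<forall>k\<le>nv G. contour_inv G \<pi> k (C k))"
proof -
  define J where "J k C \<longleftrightarrow> (k = 0 \<longrightarrow> C = [nv G, Suc (nv G)]) \<and> (k \<le> nv G \<longrightarrow> contour_inv G \<pi> k C) \<and>
     (1 \<le> k \<and> k < nv G \<longrightarrow> Q k = sweep_list k C)" for k C
  define R where "R k C C' \<longleftrightarrow> (k < nv G \<longrightarrow> (\<exists>P l M r S. attach G \<pi> k C P l M r S C' \<and> attach_ok G \<pi> k C l M r))" for k C C'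
  have "\<exists>f. \<forall>k. J k (f k) \<and> R k (f k) (f (Suc k))"
  proof (rule dependent_nat_choice)
    show "\<exists>x. J 0 x" unfolding J_def contour_inv_def by auto
    fix C k assume J: "J k C"
    show "\<exists>y. J (Suc k) y \<and> R k C y"
    proof (cases "k < nv G")
      case True
      have "\<exists>P l M r S C'. attach G \<pi> k C P l M r S C' \<and> attach_ok G \<pi> k C l M r \<and>
         contour_inv G \<pi> (Suc k) C' \<and> (Suc k < nv G \<longrightarrow> Q (Suc k) = sweep_list (Suc k) C')"
      proof (cases "k = 0 \<or> Suc k = nv G")
        case T: True
        show ?thesis using J True by (intro contour_step_ends[OF True T]) (auto simp: J_def)
      next
        case False
        then show ?thesis using J True by (intro contour_step_main) (auto simp: J_def)
      qed
      then obtain P l M r S C' where step: "attach G \<pi> k C P l M r S C'" "attach_ok G \<pi> k C l M r"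
         "contour_inv G \<pi> (Suc k) C'" "Suc k < nv G \<Longrightarrow> Q (Suc k) = sweep_list (Suc k) C'" by metis
      then have "J (Suc k) C'" unfolding J_def by simp
      moreover have "R k C C'" unfolding R_def using step(1,2) by metis
      ultimately show ?thesis by metis
    next
      case False
      then show ?thesis unfolding J_def R_def by (intro exI[of _ "[]"]) auto
    qed
  qed
  then obtain f where f: "\<And>k. J k (f k)" "\<And>k. R k (f k) (f (Suc k))" by blast
  \<comment> \<open>R hides how a contour is decomposed; with the contours fixed, the decompositions
    are chosen separately for each step.\<close>
  define T where "T k x \<longleftrightarrow> (k < nv G \<longrightarrow> (case x of (P, l, M, r, S) \<Rightarrow>
      attach G \<pi> k (f k) P l M r S (f (Suc k)) \<and> attach_ok G \<pi> k (f k) l M r))" for k x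
  have "\<forall>k. \<exists>x. T k x"
  proof
    fix k
    show "\<exists>x. T k x"
    proof (cases "k < nv G")
      case True
      then obtain P l M r S where "attach G \<pi> k (f k) P l M r S (f (Suc k))" "attach_ok G \<pi> k (f k) l M r"
        using f(2)[of k] unfolding R_def by metis
      then show ?thesis unfolding T_def by (intro exI[of _ "(P, l, M, r, S)"]) simp
    qed (simp add: T_def)
  qed
  then obtain g where g: "\<And>k. T k (g k)" using choice by blast
  define P where "P k = fst (g k)" for k
  define l where "l k = fst (snd (g k))" for k
  define M where "M k = fst (snd (snd (g k)))" for k
  define r where "r k = fst (snd (snd (snd (g k))))" for k
  define S where "S k = snd (snd (snd (snd (g k))))" for k
  have att: "attach G \<pi> k (f k) (P k) (l k) (M k) (r k) (S k) (f (Suc k)) \<and>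
      attach_ok G \<pi> k (f k) (l k) (M k) (r k)" if "k < nv G" for k
    using g[of k] that unfolding T_def split_beta P_def l_def M_def r_def S_def by blast
  show ?thesis
  proof (rule exI[of _ f], rule exI[of _ P], rule exI[of _ l], rule exI[of _ M], rule exI[of _ r],
      rule exI[of _ S], intro conjI allI impI)
    show "f 0 = [nv G, Suc (nv G)]" using f(1)[of 0] unfolding J_def by simp
    show "contour_inv G \<pi> k (f k)" if "k \<le> nv G" for k using f(1)[of k] that unfolding J_def by simp
  qed (use att in simp_all)
qed

end

subsection \<open>Coordinates\<close>

definition links :: "'a list \<Rightarrow> ('a \<times> 'a) set" where
  "links xs = set (zip xs (tl xs))"

lemma links_simps [simp]:
  "links [] = {}" "links [a] = {}" "links (a # b # xs) = insert (a, b) (links (b # xs))"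
  by (auto simp: links_def)

lemma links_append: "links (xs @ y # ys) = links (xs @ [y]) \<union> links (y # ys)"
proof (induction xs)
  case (Cons a xs) then show ?case by (cases xs) auto
qed simp

lemma links_nth: "(a, b) \<in> links xs \<longleftrightarrow> (\<exists>i. Suc i < length xs \<and> a = xs ! i \<and> b = xs ! Suc i)"
proof
  assume "(a, b) \<in> links xs"
  then show "\<exists>i. Suc i < length xs \<and> a = xs ! i \<and> b = xs ! Suc i"
    by (auto simp: links_def set_zip nth_tl less_diff_conv)
next
  assume "\<exists>i. Suc i < length xs \<and> a = xs ! i \<and> b = xs ! Suc i"
  then obtain i where "Suc i < length xs" "a = xs ! i" "b = xs ! Suc i" by blast
  then show "(a, b) \<in> links xs"
    by (auto simp: links_def set_zip nth_tl intro!: exI[of _ i])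
qed

lemma links_mem: "(a, b) \<in> links xs \<Longrightarrow> a \<in> set xs \<and> b \<in> set xs"
  unfolding links_nth by auto

lemma links_left: "w \<in> set xs \<Longrightarrow> w \<noteq> hd xs \<Longrightarrow> \<exists>a. (a, w) \<in> links xs"
  by (induction xs rule: induct_list012) auto

lemma links_right: "w \<in> set xs \<Longrightarrow> w \<noteq> last xs \<Longrightarrow> \<exists>b. (w, b) \<in> links xs"
  by (induction xs rule: induct_list012) (auto split: if_splits)

lemma sorted_wrt_links:
  assumes "\<And>a b. (a, b) \<in> links xs \<Longrightarrow> R a b"
    and "\<And>a b c. a \<in> set xs \<Longrightarrow> b \<in> set xs \<Longrightarrow> c \<in> set xs \<Longrightarrow> R a b \<Longrightarrow> R b c \<Longrightarrow> R a c"
  shows "sorted_wrt R xs"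
  using assms
proof (induction xs rule: induct_list012)
  case (3 a b xs)
  have s: "sorted_wrt R (b # xs)"
    by (rule "3.IH"(2)) (use "3.prems" in \<open>auto, (meson list.set_intros)+\<close>)
  have ab: "R a b" using "3.prems"(1) by simp
  have "R a c" if "c \<in> set xs" for c
    using "3.prems"(2)[of a b c] ab s that by auto
  then show ?case using s ab by simp
qed auto

text \<open>Total variation: the width of a polygonal line with these heights and all slopes 1 or
  -1.\<close>

fun tv :: "int list \<Rightarrow> int" where
  "tv (a # b # xs) = \<bar>b - a\<bar> + tv (b # xs)"
| "tv _ = 0"

lemma tv_append: "tv (xs @ y # ys) = tv (xs @ [y]) + tv (y # ys)"
proof (induction xs)
  case (Cons a xs) then show ?case by (cases xs) auto
qed simp

lemma tv_ge: "xs \<noteq> [] \<Longrightarrow> \<bar>last xs - hd xs\<bar> \<le> tv xs"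
  by (induction xs rule: tv.induct) auto

lemma tv_mem_ge: "w \<in> set xs \<Longrightarrow> \<bar>w - hd xs\<bar> + \<bar>last xs - w\<bar> \<le> tv xs"
proof -
  assume "w \<in> set xs"
  then obtain ps qs where xs: "xs = ps @ w # qs" by (meson split_list)
  show ?thesis
    using tv_ge[of "ps @ [w]"] tv_ge[of "w # qs"] tv_append[of ps w qs] unfolding xs
    by (cases ps) auto
qed

text \<open>The cross product of a vector of slope at most 1 in absolute value, pointing to the
  right, with a vector inside the open upward cone of slopes 1 and -1 is positive.\<close>

lemma cone_orient:
  fixes g d s p :: int
  assumes "\<bar>d\<bar> \<le> g" "1 \<le> g" "\<bar>p\<bar> < s"
  shows "d * p < g * s"
proof -
  have "d * p \<le> \<bar>d\<bar> * \<bar>p\<bar>" by (metis abs_ge_self abs_mult)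
  also have "\<dots> \<le> g * \<bar>p\<bar>" using assms by (intro mult_right_mono) auto
  also have "\<dots> < g * s" using assms by simp
  finally show ?thesis .
qed

text \<open>\<open>y_step\<close> is the height of the meeting point of the line of slope 1 through
  l and the line of slope -1 through r when their horizontal distance is the variation of the base
  plus the 2 of the shift. In \<open>x_step\<close>, \<open>x (v k) - (y (v k) - y (l k))\<close> is
  where l stood at that moment; the 1 is the shift of the covered part. The final
  \<open>x (l k)\<close> may be smaller, because later shifts can separate l from v.\<close>

locale contour_drawing =
  fixes n :: nat and v :: "nat \<Rightarrow> nat" and L R :: nat
    and C P M S :: "nat \<Rightarrow> nat list" and l r :: "nat \<Rightarrow> nat" and x y :: "nat \<Rightarrow> int"
  assumes n1: "1 \<le> n"
    and C0: "C 0 = [L, R]" and Cn: "C n = [L, v (n - 1), R]"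
    and C_split: "k < n \<Longrightarrow> C k = P k @ l k # M k @ r k # S k"
    and C_Suc: "k < n \<Longrightarrow> C (Suc k) = P k @ l k # v k # r k # S k"
    and C_distinct: "k \<le> n \<Longrightarrow> distinct (C k)"
    and C_ends: "k \<le> n \<Longrightarrow> hd (C k) = L" "k \<le> n \<Longrightarrow> last (C k) = R"
    and y_ends: "y L = -1" "y R = -1"
    and x_ends: "x L = -1" "x R = 2 * int n - 1" "x (v (n - 1)) = int n - 1"
    and y_step: "k < n \<Longrightarrow> 2 * y (v k) = y (l k) + y (r k) + tv (map y (l k # M k @ [r k])) + 2"
    and x_step: "k < n \<Longrightarrow> j < length (M k) \<Longrightarrow>
      x (M k ! j) = x (v k) - (y (v k) - y (l k)) + 1 + tv (map y (l k # take (Suc j) (M k)))"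
begin

abbreviation base :: "nat \<Rightarrow> nat list" where "base k \<equiv> l k # M k @ [r k]"

lemma links_C: "k < n \<Longrightarrow> links (C k) = links (P k @ [l k]) \<union> links (base k) \<union> links (r k # S k)"
  using links_append[of "P k" "l k" "M k @ r k # S k"] links_append[of "l k # M k" "r k" "S k"] C_split by auto

lemma links_C_Suc: "k < n \<Longrightarrow>
    links (C (Suc k)) = links (P k @ [l k]) \<union> {(l k, v k), (v k, r k)} \<union> links (r k # S k)"
  using links_append[of "P k" "l k" "v k # r k # S k"] C_Suc by auto

lemma y_above: 
  assumes k: "k < n" and w: "w \<in> set (base k)"
  shows "y w < y (v k)"
proof -
  have "\<bar>y w - y (l k)\<bar> + \<bar>y (r k) - y w\<bar> \<le> tv (map y (base k))"
    using tv_mem_ge[of "y w" "map y (base k)"] w by auto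
  then show ?thesis using y_step[OF k] by linarith
qed

text \<open>By \<open>y_step\<close> the two new sides together rise and fall by the variation of
  the part they replace, plus 2.\<close>

lemma tv_C: "k \<le> n \<Longrightarrow> tv (map y (C k)) = 2 * int k"
proof (induction k)
  case 0
  then show ?case using C0 y_ends by simp
next
  case (Suc k)
  then have k: "k < n" by simp
  have "tv (map y (C k)) = tv (map y (P k @ [l k])) + tv (map y (base k)) + tv (map y (r k # S k))"
    unfolding C_split[OF k]
    using tv_append[of "map y (P k)" "y (l k)" "map y (M k @ r k # S k)"]
      tv_append[of "map y (l k # M k)" "y (r k)" "map y (S k)"] by simp
  moreover have "tv (map y (C (Suc k))) = tv (map y (P k @ [l k])) + \<bar>y (v k) - y (l k)\<bar> + \<bar>y (r k) - y (v k)\<bar> + tv (map y (r k # S k))"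
    unfolding C_Suc[OF k] using tv_append[of "map y (P k)" "y (l k)" "map y (v k # r k # S k)"] by simp
  moreover have "y (l k) < y (v k)" "y (r k) < y (v k)" using y_above[OF k] by auto
  ultimately show ?case using Suc y_step[OF k] by simp
qed

text \<open>The last contour rises once from height -1 and falls back, with total variation
  2n.\<close>

lemma y_last: "y (v (n - 1)) = int n - 1"
proof -
  have "2 * int n = \<bar>y (v (n-1)) + 1\<bar> + \<bar>y (v (n-1)) + 1\<bar>"
    using tv_C[of n] unfolding Cn by (simp add: y_ends)
  moreover have "- 1 < y (v (n - 1))"
  proof -
    have "C (Suc (n - 1)) = [L, v (n - 1), R]" using Cn n1 by simp
    then have "(l (n-1), v (n-1)) \<in> links [L, v (n - 1), R]"
      using links_C_Suc[of "n - 1"] n1 by auto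
    moreover have "distinct [L, v (n - 1), R]" using C_distinct[of n] Cn by simp
    ultimately have "l (n - 1) = L" by auto
    then show ?thesis using y_above[of "n - 1" L] y_ends n1 by auto
  qed
  ultimately show ?thesis by linarith
qed

text \<open>The induction goes back from the last contour because x is determined from the covering
  vertex to the covered ones. Inside a base the distances equal the height differences. At its two
  ends they are larger, since l is at or to the left and r at or to the right of its position when v
  was placed, and the shift adds 1 on either side.\<close>

lemma gap: "k \<le> n \<Longrightarrow> (a, b) \<in> links (C k) \<Longrightarrow> \<bar>y b - y a\<bar> \<le> x b - x a"
proof (induction k arbitrary: a b rule: inc_induct)
  case base
  then show ?case using Cn y_last y_ends x_ends n1 by auto
next
  case (step k)
  then have k: "k < n" by simp
  have gl: "y (v k) - y (l k) \<le> x (v k) - x (l k)" and gr: "y (v k) - y (r k) \<le> x (r k) - x (v k)"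
    using step.IH[of "l k" "v k"] step.IH[of "v k" "r k"] links_C_Suc[OF k] by auto
  note ys = y_step[OF k] and xs = x_step[OF k]
  consider "(a, b) \<in> links (P k @ [l k]) \<union> links (r k # S k)" | "(a, b) \<in> links (base k)"
    using step.prems links_C[OF k] by blast
  then show ?case
  proof cases
    case 1
    then show ?thesis using step.IH links_C_Suc[OF k] by blast
  next
    case 2
    show ?thesis
    proof (cases "M k = []")
      case True
      then have ab: "a = l k" "b = r k" using 2 by auto
      show ?thesis using ys gl gr True unfolding ab by simp
    next
      case False
      let ?m = "length (M k)"
      let ?T = "\<lambda>j. tv (map y (l k # take (Suc j) (M k)))"
      have m: "0 < ?m" using False by simp
      obtain i where i: "Suc i < length (base k)" "a = base k ! i" "b = base k ! Suc i"
        using 2 unfolding links_nth by (elim exE conjE)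
      have T_Suc: "?T (Suc j) = ?T j + \<bar>y (M k ! Suc j) - y (M k ! j)\<bar>" if "Suc j < ?m" for j
        using tv_append[of "map y (l k # take j (M k))" "y (M k ! j)" "[y (M k ! Suc j)]"] that
        by (simp add: take_Suc_conv_app_nth)
      have T_last: "tv (map y (base k)) = ?T (?m - 1) + \<bar>y (r k) - y (M k ! (?m - 1))\<bar>"
      proof -
        have "M k = take (?m - 1) (M k) @ [M k ! (?m - 1)]"
          using m take_Suc_conv_app_nth[of "?m - 1" "M k"] by simp
        then obtain N z where N: "M k = N @ [z]" "z = M k ! (?m - 1)" by blast
        have "?T (?m - 1) = tv (map y (l k # N @ [z]))" using N(1) by simp
        moreover have "tv (map y (base k)) = tv (map y (l k # N @ [z])) + \<bar>y (r k) - y z\<bar>"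
          unfolding N(1) using tv_append[of "map y (l k # N)" "y z" "[y (r k)]"] by simp
        ultimately show ?thesis using N(2) by simp
      qed
      have "?T 0 = \<bar>y (M k ! 0) - y (l k)\<bar>" using False by (cases "M k") auto
      consider "i = 0" | j where "i = Suc j" "Suc j < ?m" | "i = ?m" using i(1) by (cases i) (auto, linarith)
      then show ?thesis
      proof cases
        case 1
        then have ab: "a = l k" "b = M k ! 0" using i m by (auto simp: nth_append)
        show ?thesis using xs[OF m] gl \<open>?T 0 = _\<close> unfolding ab by linarith
      next
        case (2 j)
        then have ab: "a = M k ! j" "b = M k ! Suc j" using i by (auto simp: nth_append)
        show ?thesis using xs[of j] xs[of "Suc j"] 2 T_Suc[of j] unfolding ab by linarith
      next
        case 3
        then have ab: "a = M k ! (?m - 1)" "b = r k" using i m by (auto simp: nth_append nth_Cons')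
        show ?thesis using xs[of "?m - 1"] m gr ys T_last unfolding ab by linarith
      qed
    qed
  qed
qed

text \<open>New contour edges always rise strictly towards v. Together with \<open>gap\<close> this
  makes x strictly increasing along a contour; the first contour L, R is horizontal and is treated
  directly.\<close>

lemma y_ne: "1 \<le> k \<Longrightarrow> k \<le> n \<Longrightarrow> (a, b) \<in> links (C k) \<Longrightarrow> y a \<noteq> y b"
proof (induction k arbitrary: a b)
  case (Suc k)
  then have k: "k < n" by simp
  have lr: "y (l k) < y (v k)" "y (r k) < y (v k)" using y_above[OF k] by auto
  consider "(a, b) \<in> links (P k @ [l k]) \<union> links (r k # S k)" | "(a, b) = (l k, v k)" | "(a, b) = (v k, r k)"
    using Suc.prems(3) links_C_Suc[OF k] by blast
  then show ?case
  proof cases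
    case 1
    then have ab: "(a, b) \<in> links (C k)" using links_C[OF k] by blast
    show ?thesis
    proof (cases "k = 0")
      case True
      then have "P k @ l k # M k @ r k # S k = [L, R]" using C0 C_split[OF k] by simp
      then have "P k = []" "S k = []" by (auto simp: append_eq_Cons_conv Cons_eq_append_conv)
      then show ?thesis using 1 by simp
    next
      case False
      then show ?thesis using Suc.IH ab k by simp
    qed
  qed (use lr in auto)
qed simp

lemma x_less: "k \<le> n \<Longrightarrow> (a, b) \<in> links (C k) \<Longrightarrow> x a < x b"
proof (cases "k = 0")
  case True
  assume "(a, b) \<in> links (C k)"
  then show ?thesis using True C0 x_ends n1 by auto
next
  case False
  assume "k \<le> n" "(a, b) \<in> links (C k)"
  then show ?thesis using gap[of k a b] y_ne[of k a b] False by linarith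
qed

lemma x_sorted: "k \<le> n \<Longrightarrow> sorted_wrt (\<lambda>a b. x a < x b) (C k)"
  by (rule sorted_wrt_links) (auto intro: x_less)

lemma x_v: "k < n \<Longrightarrow> x (l k) < x (v k) \<and> x (v k) < x (r k)"
  using x_less[of "Suc k" "l k" "v k"] x_less[of "Suc k" "v k" "r k"] links_C_Suc by simp

text \<open>The shift by 1 on each side of the covered part makes the inequality strict: the
  variation from l to w bounds the distance to the left side of the cone, the variation from w to r
  that to the right side.\<close>

lemma cone:
  assumes k: "k < n" and w: "w \<in> set (M k)"
  shows "\<bar>x (v k) - x w\<bar> < y (v k) - y w"
proof -
  obtain j where j: "j < length (M k)" "M k ! j = w" using w by (metis in_set_conv_nth)
  let ?A = "l k # take j (M k)" and ?B = "drop (Suc j) (M k) @ [r k]"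
  have split: "base k = ?A @ w # ?B" 
    using arg_cong[OF id_take_nth_drop[OF j(1)], of "\<lambda>m. l k # m @ [r k]"] j(2) by simp
  have take: "l k # take (Suc j) (M k) = ?A @ [w]" using j by (simp add: take_Suc_conv_app_nth)
  have tv: "tv (map y (base k)) = tv (map y (?A @ [w])) + tv (map y (w # ?B))"
    unfolding split using tv_append[of "map y ?A" "y w" "map y ?B"] by simp
  have "\<bar>y w - y (l k)\<bar> \<le> tv (map y (?A @ [w]))" using tv_ge[of "map y (?A @ [w])"] by simp
  moreover have "\<bar>y (r k) - y w\<bar> \<le> tv (map y (w # ?B))" using tv_ge[of "map y (w # ?B)"] by simp
  moreover have "x w = x (v k) - (y (v k) - y (l k)) + 1 + tv (map y (?A @ [w]))"
    using x_step[OF k j(1)] j(2) take by simp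
  ultimately show ?thesis using y_step[OF k] tv by linarith
qed

text \<open>Twice the signed area of the triangle, positive iff a, b, c is counterclockwise.\<close>

definition orient :: "nat \<Rightarrow> nat \<Rightarrow> nat \<Rightarrow> int" where
  "orient a b c = (x b - x a) * (y c - y a) - (y b - y a) * (x c - x a)"

text \<open>Unless nothing is covered, one end of the base edge is a covered vertex, from which v
  lies in the upward cone, while the edge is not steeper than 1 by \<open>gap\<close>. If nothing is
  covered, v is horizontally between l and r and above both.\<close>

lemma orient_base:
  assumes k: "k < n" and ab: "(a, b) \<in> links (base k)"
  shows "0 < orient a b (v k)"
proof -
  have ab': "(a, b) \<in> links (C k)" using links_C[OF k] ab by blast
  have g: "\<bar>y b - y a\<bar> \<le> x b - x a" "1 \<le> x b - x a"
    using gap[OF _ ab'] x_less[OF _ ab'] k by auto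
  have mem: "a \<in> set (base k)" "b \<in> set (base k)" using links_mem[OF ab] by auto
  consider "M k = []" | "a \<in> set (M k)" | "b \<in> set (M k)"
  proof (cases "M k = []")
    case False
    obtain i where i: "Suc i < length (base k)" "a = base k ! i" "b = base k ! Suc i"
      using ab unfolding links_nth by (elim exE conjE)
    show thesis
    proof (cases i)
      case 0
      then show thesis using i False that(3) by (simp add: nth_append)
    next
      case (Suc j)
      then show thesis using i that(2) by (simp add: nth_append)
    qed
  qed (rule that(1))
  then show ?thesis
  proof cases
    case 1
    then have e: "a = l k" "b = r k" using ab by auto
    have p: "0 < x (v k) - x a" "0 < x b - x (v k)" "0 < y (v k) - y a" "0 < y (v k) - y b"
      using x_v[OF k] y_above[OF k] unfolding e by auto
    have "orient a b (v k) = (x b - x (v k)) * (y (v k) - y a) + (y (v k) - y b) * (x (v k) - x a)"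
      unfolding orient_def by algebra
    then show ?thesis using p by (simp add: add_pos_pos)
  next
    case 2
    then show ?thesis unfolding orient_def using cone_orient[OF g cone[OF k 2]] by simp
  next
    case 3
    have "orient a b (v k) = (x b - x a) * (y (v k) - y b) - (y b - y a) * (x (v k) - x b)"
      unfolding orient_def by algebra
    then show ?thesis using cone_orient[OF g cone[OF k 3]] by simp
  qed
qed

lemma y_ge: "k \<le> n \<Longrightarrow> w \<in> set (C k) \<Longrightarrow> -1 \<le> y w"
proof (induction k arbitrary: w)
  case 0
  then show ?case using C0 y_ends by auto
next
  case (Suc k)
  then have k: "k < n" by simp
  have "-1 \<le> y (l k)" using Suc.IH[of "l k"] C_split[OF k] k by simp
  moreover have "y (l k) < y (v k)" using y_above[OF k] by simp
  ultimately show ?case using Suc.IH[of w] Suc.prems C_split[OF k] C_Suc[OF k] by auto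
qed

text \<open>Between two ends at height -1 a vertex of height h uses a variation of at least 2 (h +
  1), and \<open>tv_C\<close> bounds this variation. Horizontally the vertex lies strictly between
  the artificial ends.\<close>

lemma bounds:
  assumes k: "k < n"
  shows "0 \<le> x (v k)" "x (v k) \<le> 2 * int n - 2" "0 \<le> y (v k)" "y (v k) \<le> int n - 1"
proof -
  have vC: "v k \<in> set (C (Suc k))" using C_Suc[OF k] by simp
  have "-1 \<le> y (l k)" using y_ge[of k "l k"] C_split[OF k] k by simp
  then show "0 \<le> y (v k)" using y_above[OF k, of "l k"] by simp
  have ne: "C (Suc k) \<noteq> []" using vC by auto
  have ends: "hd (C (Suc k)) = L" "last (C (Suc k)) = R" using C_ends k by auto
  have "\<bar>y (v k) - y L\<bar> + \<bar>y R - y (v k)\<bar> \<le> tv (map y (C (Suc k)))"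
    using tv_mem_ge[of "y (v k)" "map y (C (Suc k))"] vC ends ne by (simp add: hd_map last_map)
  then show "y (v k) \<le> int n - 1" using tv_C[of "Suc k"] k y_ends by simp
  obtain A B where AB: "C (Suc k) = A @ v k # B" "A \<noteq> []" "B \<noteq> []"
    using C_Suc[OF k] by (metis append_is_Nil_conv list.distinct(1) append.assoc append_Cons append_Nil)
  have "x L < x (v k)" "x (v k) < x R"
    using x_sorted[of "Suc k"] k ends AB by (auto simp: sorted_wrt_append hd_append)
  then show "0 \<le> x (v k)" "x (v k) \<le> 2 * int n - 2" using x_ends by auto
qed

end

subsection \<open>Planarity\<close>

definition cr :: "complex \<Rightarrow> complex \<Rightarrow> complex \<Rightarrow> real" where
  "cr a b c = (Re b - Re a) * (Im c - Im a) - (Im b - Im a) * (Re c - Re a)"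

text \<open>Two ways to compare the lines ab and uw at the abscissa of p: as the position of p
  relative to ab, or as that of the point of ab with this abscissa relative to wu. The second is a
  combination of the positions of a and b.\<close>

lemma cr_interp:
  assumes p: "p = u + of_real t * (w - u)"
  shows "(Re w - Re u) * cr a b p = (Re b - Re p) * cr w u a + (Re p - Re a) * cr w u b"
  unfolding p cr_def by (simp add: algebra_simps)

lemma cr_line:
  assumes p: "p = u + of_real t * (w - u)"
  shows "cr u b p = t * cr u b w" "cr a u p = t * cr a u w + (1 - t) * cr a u u"
  unfolding p cr_def by (simp_all add: algebra_simps)

lemma cr_diff: "Re p = Re q \<Longrightarrow> cr a b p = cr a b q + (Re b - Re a) * (Im p - Im q)"
  unfolding cr_def by (simp add: algebra_simps)

lemma weighted_pos:
  fixes A B g h :: real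
  assumes "0 \<le> g" "0 \<le> h" "0 < g + h" "0 < A" "0 < B"
  shows "0 < g * A + h * B"
  using assms by (metis add.right_neutral add_pos_nonneg add_pos_pos add_nonneg_pos less_eq_real_def mult_nonneg_nonneg mult_pos_pos)

text \<open>The case where the contour edge ab lies to the right of the tail u and on one side of
  the line through u and w. By \<open>cr_interp\<close> the new edge passes above it.\<close>

lemma cr_above_right:
  assumes p: "p = u + of_real t * (w - u)" "0 < t" "t \<le> 1"
    and x: "Re a \<le> Re p" "Re p \<le> Re b" "Re a < Re b"
    and c: "Re u < Re a" "0 < cr w u a" "0 < cr w u b"
  shows "0 < cr a b p"
proof -
  have "Re p = Re u + t * (Re w - Re u)" using p(1) by simp
  then have "0 < t * (Re w - Re u)" using x c by linarith
  then have w: "0 < Re w - Re u" using p(2) by (simp add: zero_less_mult_iff)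
  have "0 < (Re b - Re p) * cr w u a + (Re p - Re a) * cr w u b"
    using x c by (intro weighted_pos) auto
  then have "0 < (Re w - Re u) * cr a b p" unfolding cr_interp[OF p(1)] .
  then show ?thesis using w by (simp add: zero_less_mult_iff)
qed

lemma cr_above_left:
  assumes p: "p = u + of_real t * (w - u)" "0 < t" "t \<le> 1"
    and x: "Re a \<le> Re p" "Re p \<le> Re b" "Re a < Re b"
    and c: "Re b < Re u" "0 < - cr w u a" "0 < - cr w u b"
  shows "0 < cr a b p"
proof -
  have "Re p = Re u + t * (Re w - Re u)" using p(1) by simp
  then have "t * (Re w - Re u) < 0" using x c by linarith
  then have w: "Re w - Re u < 0" using p(2) by (simp add: mult_less_0_iff)
  have "0 < (Re b - Re p) * (- cr w u a) + (Re p - Re a) * (- cr w u b)"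
    using x c by (intro weighted_pos) auto
  then have "(Re w - Re u) * cr a b p < 0" unfolding cr_interp[OF p(1)] by simp
  then show ?thesis using w by (simp add: mult_less_0_iff)
qed

context contour_drawing
begin

definition pt :: "nat \<Rightarrow> complex" where "pt w = Complex (of_int (x w)) (of_int (y w))"

lemma pt_sel [simp]: "Re (pt w) = of_int (x w)" "Im (pt w) = of_int (y w)"
  by (auto simp: pt_def)

lemma cr_pt: "cr (pt a) (pt b) (pt c) = of_int (orient a b c)"
  by (simp add: cr_def orient_def)

text \<open>The ranges are closed, so at a contour vertex both adjacent edges are tested. Outside
  the horizontal range of the contour the condition is vacuous.\<close>

definition above :: "nat list \<Rightarrow> complex \<Rightarrow> bool" where
  "above ws p \<longleftrightarrow> (\<forall>(a, b) \<in> links ws. of_int (x a) \<le> Re p \<and> Re p \<le> of_int (x b) \<longrightarrow> 0 < cr (pt a) (pt b) p)"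

lemma orient_cyclic: "orient a b c = orient c a b"
  unfolding orient_def by algebra

lemma orient_flip: "orient a b c = - orient a c b"
  unfolding orient_def by algebra

text \<open>Seen from v, consecutive base vertices turn counterclockwise by
  \<open>orient_base\<close>. Since all of them are below v, their directions lie in a half-plane,
  where this relation is transitive.\<close>

lemma angular:
  assumes k: "k < n"
  shows "sorted_wrt (\<lambda>a b. 0 < orient (v k) a b) (base k)"
proof (rule sorted_wrt_links)
  show "0 < orient (v k) a b" if "(a, b) \<in> links (base k)" for a b
    using orient_base[OF k that] orient_cyclic by metis
  fix a b c assume "a \<in> set (base k)" "b \<in> set (base k)" "c \<in> set (base k)"
    and o: "0 < orient (v k) a b" "0 < orient (v k) b c"
  then have ys: "y a < y (v k)" "y b < y (v k)" "y c < y (v k)" using y_above[OF k] by blast+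
  \<comment> \<open>A three-term relation between cross products; the heights below v are the cross
    products with a horizontal direction.\<close>
  have "orient (v k) a c * (y (v k) - y b) = orient (v k) a b * (y (v k) - y c) + orient (v k) b c * (y (v k) - y a)"
    unfolding orient_def by algebra
  also have "\<dots> > 0" using ys o by (intro add_pos_pos mult_pos_pos) auto
  finally show "0 < orient (v k) a c" using ys by (simp add: zero_less_mult_iff)
qed

lemma angular_nth: "k < n \<Longrightarrow> i < j \<Longrightarrow> j < length (base k) \<Longrightarrow> 0 < orient (v k) (base k ! i) (base k ! j)"
  using sorted_wrt_nth_less[OF angular] by blast

lemma base_x: 
  assumes k: "k < n"
  shows "i < j \<Longrightarrow> j < length (base k) \<Longrightarrow> x (base k ! i) < x (base k ! j)"
    "w \<in> set (base k) \<Longrightarrow> x (l k) \<le> x w \<and> x w \<le> x (r k)"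
    "w \<in> set (P k @ [l k]) \<Longrightarrow> x w \<le> x (l k)"
    "w \<in> set (r k # S k) \<Longrightarrow> x (r k) \<le> x w"
proof -
  have s: "sorted_wrt (\<lambda>a b. x a < x b) (P k @ base k @ S k)"
    using x_sorted[of k] C_split[OF k] k by simp
  then have "sorted_wrt (\<lambda>a b. x a < x b) (base k)" by (simp only: sorted_wrt_append)
  then show "i < j \<Longrightarrow> j < length (base k) \<Longrightarrow> x (base k ! i) < x (base k ! j)"
    by (rule sorted_wrt_nth_less)
  show "w \<in> set (base k) \<Longrightarrow> x (l k) \<le> x w \<and> x w \<le> x (r k)"
    "w \<in> set (P k @ [l k]) \<Longrightarrow> x w \<le> x (l k)" "w \<in> set (r k # S k) \<Longrightarrow> x (r k) \<le> x w"
    using s by (auto simp: sorted_wrt_append less_imp_le intro: less_imp_le)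
qed

lemma edge_x:
  assumes k: "k < n" and u: "u \<in> set (base k)" and p: "p = pt u + of_real t * (pt (v k) - pt u)" "0 < t" "t \<le> 1"
  shows "of_int (x (l k)) < Re p" "Re p < of_int (x (r k))"
proof -
  have e: "Re p = (1 - t) * of_int (x u) + t * of_int (x (v k))" unfolding p(1) by (simp add: algebra_simps)
  have u': "real_of_int (x (l k)) \<le> of_int (x u)" "real_of_int (x u) \<le> of_int (x (r k))"
    using base_x(2)[OF k u] by auto
  have v': "real_of_int (x (l k)) < of_int (x (v k))" "real_of_int (x (v k)) < of_int (x (r k))"
    using x_v[OF k] by auto
  have "(1 - t) * real_of_int (x (l k)) + t * of_int (x (l k)) < (1 - t) * of_int (x u) + t * of_int (x (v k))"
    using u' v' p by (intro add_le_less_mono mult_left_mono mult_strict_left_mono) auto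
  then show "of_int (x (l k)) < Re p" unfolding e by (simp add: algebra_simps)
  have "(1 - t) * real_of_int (x u) + t * of_int (x (v k)) < (1 - t) * of_int (x (r k)) + t * of_int (x (r k))"
    using u' v' p by (intro add_le_less_mono mult_left_mono mult_strict_left_mono) auto
  then show "Re p < of_int (x (r k))" unfolding e by (simp add: algebra_simps)
qed

text \<open>Only base edges can be below the new edge. One that does not contain u lies wholly to
  the left or to the right of u, and by angular order on one side of the line from v to u.\<close>

lemma edge_above:
  assumes k: "k < n" and u: "u \<in> set (base k)" and p: "p = pt u + of_real t * (pt (v k) - pt u)" "0 < t" "t \<le> 1"
  shows "above (C k) p"
proof -
  have "0 < cr (pt a) (pt b) p"
    if ab: "(a, b) \<in> links (C k)" and px: "of_int (x a) \<le> Re p" "Re p \<le> of_int (x b)" for a b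
  proof -
    have lt: "x a < x b" using x_less[OF _ ab] k by simp
    consider "(a, b) \<in> links (P k @ [l k])" | "(a, b) \<in> links (base k)" | "(a, b) \<in> links (r k # S k)"
      using ab links_C[OF k] by blast
    then show ?thesis
    proof cases
      case 1
      then have "real_of_int (x b) \<le> of_int (x (l k))" using base_x(3)[OF k, of b] links_mem[OF 1] by simp
      then show ?thesis using edge_x(1)[OF k u p] px by linarith
    next
      case 3
      then have "real_of_int (x (r k)) \<le> of_int (x a)" using base_x(4)[OF k, of a] links_mem[OF 3] by simp
      then show ?thesis using edge_x(2)[OF k u p] px by linarith
    next
      case 2
      obtain i where i: "Suc i < length (base k)" "a = base k ! i" "b = base k ! Suc i"
        using 2 unfolding links_nth by (elim exE conjE)
      obtain m where m: "m < length (base k)" "u = base k ! m" using u by (metis in_set_conv_nth)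
      have orient: "0 < cr (pt a) (pt b) (pt (v k))" using orient_base[OF k 2] by (simp add: cr_pt)
      consider "m < i" | "m = i" | "m = Suc i" | "Suc i < m" by linarith
      then show ?thesis
      proof cases
        case 1
        have o: "0 < orient (v k) u a" "0 < orient (v k) u b" "x u < x a"
          unfolding m(2) i(2,3)
          using angular_nth[OF k, of m i] angular_nth[OF k, of m "Suc i"] base_x(1)[OF k, of m i] 1 i(1) by simp_all
        show ?thesis using o px lt by (intro cr_above_right[OF p]) (auto simp: cr_pt)
      next
        case 2
        then show ?thesis using cr_line(1)[OF p(1), of "pt b"] orient p i m by simp
      next
        case 3
        then have "b = u" using i m by simp
        moreover have "cr (pt a) (pt u) (pt u) = 0" by (simp add: cr_def)
        ultimately show ?thesis using cr_line(2)[OF p(1), of "pt a"] orient p by simp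
      next
        case 4
        have o: "0 < orient (v k) a u" "0 < orient (v k) b u" "x b < x u"
          unfolding m(2) i(2,3)
          using angular_nth[OF k, of i m] angular_nth[OF k, of "Suc i" m] base_x(1)[OF k, of "Suc i" m] 4 i(1) m(1) by simp_all
        show ?thesis using o px lt orient_flip[of "v k" u a] orient_flip[of "v k" u b]
          by (intro cr_above_left[OF p]) (auto simp: cr_pt)
      qed
    qed
  qed
  then show ?thesis unfolding above_def by blast
qed

text \<open>The new contour is nowhere below the old one. Over the covered part, p is compared with
  the point q of the same abscissa on a new side, which is weakly above the old contour by
  \<open>edge_above\<close>.\<close>

lemma above_step:
  assumes k: "k < n" and p: "above (C (Suc k)) p"
  shows "above (C k) p"
proof -
  have "0 < cr (pt a) (pt b) p"
    if ab: "(a, b) \<in> links (C k)" and px: "of_int (x a) \<le> Re p" "Re p \<le> of_int (x b)" for a b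
  proof -
    have lt: "x a < x b" using x_less[OF _ ab] k by simp
    consider "(a, b) \<in> links (P k @ [l k]) \<union> links (r k # S k)" | "(a, b) \<in> links (base k)"
      using ab links_C[OF k] by blast
    then show ?thesis
    proof cases
      case 1
      then show ?thesis using p px links_C_Suc[OF k] unfolding above_def by blast
    next
      case 2
      have mem: "a \<in> set (base k)" "b \<in> set (base k)" using links_mem[OF 2] by auto
      have xr: "real_of_int (x (l k)) \<le> Re p" "Re p \<le> of_int (x (r k))"
        using base_x(2)[OF k mem(1)] base_x(2)[OF k mem(2)] px by (meson of_int_le_iff order_trans)+
      have inj: "w = w'" if "w \<in> set (base k)" "w' \<in> set (base k)" "x w = x w'" for w w'
        using that base_x(1)[OF k] by (metis in_set_conv_nth linorder_neqE_nat order_less_irrefl)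
      \<comment> \<open>The foot of that side of v which lies over the abscissa of p.\<close>
      define w where "w = (if Re p \<le> of_int (x (v k)) then l k else r k)"
      have w: "w \<in> set (base k)" by (simp add: w_def)
      have vw: "real_of_int (x (v k)) - of_int (x w) \<noteq> 0" using x_v[OF k] by (auto simp: w_def)
      define t where "t = (Re p - of_int (x w)) / (of_int (x (v k)) - of_int (x w))"
      define q where "q = pt w + of_real t * (pt (v k) - pt w)"
      have t: "0 \<le> t" "t \<le> 1"
        unfolding t_def w_def using xr x_v[OF k] by (auto simp: divide_simps)
      have req: "Re p = Re q" unfolding q_def t_def using vw by (simp add: field_simps)
      have im: "Im q < Im p"
      proof (cases "Re p \<le> of_int (x (v k))")
        case True
        then have [simp]: "w = l k" by (simp add: w_def)
        have "0 < cr (pt (l k)) (pt (v k)) p" using p True xr links_C_Suc[OF k] unfolding above_def by auto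
        also have "cr (pt (l k)) (pt (v k)) p = cr (pt (l k)) (pt (v k)) q + (of_int (x (v k)) - of_int (x (l k))) * (Im p - Im q)"
          using cr_diff[OF req] by simp
        also have "cr (pt (l k)) (pt (v k)) q = 0" unfolding q_def cr_def by simp
        finally show ?thesis using x_v[OF k] by (simp add: zero_less_mult_iff)
      next
        case False
        then have [simp]: "w = r k" by (simp add: w_def)
        have "0 < cr (pt (v k)) (pt (r k)) p" using p False xr links_C_Suc[OF k] unfolding above_def by auto
        also have "cr (pt (v k)) (pt (r k)) p = cr (pt (v k)) (pt (r k)) q + (of_int (x (r k)) - of_int (x (v k))) * (Im p - Im q)"
          using cr_diff[OF req] by simp
        also have "cr (pt (v k)) (pt (r k)) q = 0" unfolding q_def cr_def by (simp add: algebra_simps)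
        finally show ?thesis using x_v[OF k] by (simp add: zero_less_mult_iff)
      qed
      \<comment> \<open>Unless q is the foot itself, which is an end of the contour edge in
        question, \<open>edge_above\<close> applies.\<close>
      have "0 \<le> cr (pt a) (pt b) q"
      proof (cases "t = 0")
        case True
        then have qw: "q = pt w" by (simp add: q_def)
        then have rw: "Re p = of_int (x w)" using req by simp
        then have "w = a \<or> w = b"
        proof (cases "w = l k")
          case True
          then have "x a = x w" using px(1) rw base_x(2)[OF k mem(1)] by simp
          then show ?thesis using inj[OF mem(1) w] by blast
        next
          case False
          then have "w = r k" by (simp add: w_def split: if_splits)
          then have "x b = x w" using px(2) rw base_x(2)[OF k mem(2)] by simp
          then show ?thesis using inj[OF mem(2) w] by blast
        qed
        then show ?thesis unfolding qw cr_def by auto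
      next
        case False
        then have "above (C k) q" using edge_above[OF k w q_def] t by simp
        then show ?thesis using ab px unfolding above_def req by fastforce
      qed
      moreover have "0 < (real_of_int (x b) - of_int (x a)) * (Im p - Im q)"
        using lt im by simp
      ultimately show ?thesis using cr_diff[OF req, of "pt a" "pt b"] by simp
    qed
  qed
  then show ?thesis unfolding above_def by blast
qed

lemma above_mono: "k \<le> m \<Longrightarrow> m \<le> n \<Longrightarrow> above (C m) p \<Longrightarrow> above (C k) p"
proof (induction m rule: dec_induct)
  case (step m) then show ?case using above_step[of m p] by simp
qed

text \<open>Seen from v, the tail u lies in angular order between l and r, so the edge runs weakly
  below the two new sides.\<close>

lemma edge_not_above:
  assumes k: "k < n" and u: "u \<in> set (base k)" and p: "p \<in> closed_segment (pt u) (pt (v k))"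
  shows "\<not> above (C (Suc k)) p"
proof
  assume a: "above (C (Suc k)) p"
  obtain t where t: "0 \<le> t" "t \<le> 1" "p = (1 - t) *\<^sub>R pt u + t *\<^sub>R pt (v k)"
    using p unfolding in_segment by blast
  have pe: "p = pt u + of_real t * (pt (v k) - pt u)"
    unfolding t(3) by (simp add: scaleR_conv_of_real algebra_simps)
  obtain m where m: "m < length (base k)" "u = base k ! m" using u by (metis in_set_conv_nth)
  have ol: "0 \<le> orient (v k) (l k) u"
  proof (cases m)
    case 0 then show ?thesis using m by (simp add: orient_def)
  next
    case (Suc i)
    then have "0 < orient (v k) (base k ! 0) (base k ! m)" using angular_nth[OF k, of 0 m] m(1) by blast
    then show ?thesis using m(2) by simp
  qed
  have or: "0 \<le> orient (v k) u (r k)"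
  proof (cases "m = Suc (length (M k))")
    case True then show ?thesis using m by (simp add: orient_def nth_append)
  next
    case False
    then have "0 < orient (v k) (base k ! m) (base k ! Suc (length (M k)))" using m(1) by (intro angular_nth[OF k]) auto
    then show ?thesis using m(2) by (simp add: nth_append)
  qed
  have xs: "real_of_int (x (l k)) \<le> Re p" "Re p \<le> of_int (x (r k))"
    using edge_x[OF k u pe] base_x(2)[OF k u] t pe by (cases "t = 0", auto)+
  show False
  proof (cases "Re p \<le> of_int (x (v k))")
    case True
    then have pos: "0 < cr (pt (l k)) (pt (v k)) p" using a xs links_C_Suc[OF k] unfolding above_def by auto
    have "cr (pt (l k)) (pt (v k)) p = (1 - t) * cr (pt (l k)) (pt (v k)) (pt u)"
      unfolding pe cr_def by (simp add: algebra_simps)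
    also have "\<dots> = - ((1 - t) * of_int (orient (v k) (l k) u))"
      unfolding cr_pt using orient_flip[of "l k" "v k" u] orient_cyclic[of "l k" u "v k"] by simp
    finally show False using pos t ol by (simp add: mult_less_0_iff)
  next
    case False
    then have pos: "0 < cr (pt (v k)) (pt (r k)) p" using a xs links_C_Suc[OF k] unfolding above_def by auto
    have "cr (pt (v k)) (pt (r k)) p = (1 - t) * cr (pt (v k)) (pt (r k)) (pt u)"
      unfolding pe cr_def by (simp add: algebra_simps)
    also have "\<dots> = - ((1 - t) * of_int (orient (v k) u (r k)))"
      unfolding cr_pt using orient_flip[of "v k" "r k" u] by simp
    finally show False using pos t or by (simp add: mult_less_0_iff)
  qed
qed

lemma edge_above':
  assumes k: "k < n" and u: "u \<in> set (base k)" and p: "p \<in> closed_segment (pt u) (pt (v k))" "p \<noteq> pt u"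
  shows "above (C k) p"
proof -
  obtain t where t: "0 \<le> t" "t \<le> 1" "p = (1 - t) *\<^sub>R pt u + t *\<^sub>R pt (v k)"
    using p unfolding in_segment by blast
  have pe: "p = pt u + of_real t * (pt (v k) - pt u)"
    unfolding t(3) by (simp add: scaleR_conv_of_real algebra_simps)
  then have "t \<noteq> 0" using p(2) by auto
  then show ?thesis using edge_above[OF k u pe] t by simp
qed

lemma edges_at_top:
  assumes k: "k < n" and u: "u \<in> set (base k)" "u' \<in> set (base k)" "u \<noteq> u'"
    and p: "p \<in> closed_segment (pt u) (pt (v k))" "p \<in> closed_segment (pt u') (pt (v k))"
  shows "p = pt (v k)"
proof -
  obtain t where t: "0 \<le> t" "t \<le> 1" "p = (1 - t) *\<^sub>R pt u + t *\<^sub>R pt (v k)"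
    using p unfolding in_segment by blast
  obtain t' where t': "0 \<le> t'" "t' \<le> 1" "p = (1 - t') *\<^sub>R pt u' + t' *\<^sub>R pt (v k)"
    using p unfolding in_segment by blast
  have "cr (pt (v k)) (pt u) p = 0" unfolding t(3) cr_def by (simp add: algebra_simps)
  moreover have "cr (pt (v k)) (pt u) p = (1 - t') * cr (pt (v k)) (pt u) (pt u')"
    unfolding t'(3) cr_def by (simp add: algebra_simps)
  moreover have "orient (v k) u u' \<noteq> 0"
  proof -
    obtain i j where ij: "i < length (base k)" "u = base k ! i" "j < length (base k)" "u' = base k ! j"
      using u by (metis in_set_conv_nth)
    then have "i \<noteq> j" using u(3) by auto
    then consider "i < j" | "j < i" by linarith
    then show ?thesis
    proof cases
      case 1 then show ?thesis using angular_nth[OF k 1 ij(3)] ij by simp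
    next
      case 2 then show ?thesis using angular_nth[OF k 2 ij(1)] ij orient_flip[of "v k" u u'] by simp
    qed
  qed
  ultimately have "t' = 1" by (simp add: cr_pt)
  then show ?thesis using t'(3) by simp
qed

end

subsection \<open>The drawing of the graph\<close>

lemma links_tl: "(a, b) \<in> links xs \<Longrightarrow> b \<in> set (tl xs)"
  by (induction xs rule: induct_list012) auto

lemma links_butlast: "(a, b) \<in> links (xs @ [z]) \<Longrightarrow> a \<in> set xs"
  by (induction xs rule: induct_list012) auto

text \<open>In an open upper or lower half-plane \<open>Arg\<close> has no jump and two arguments
  differ by less than \<pi>, so the cross product decides their order.\<close>

lemma Arg_less:
  assumes "0 < Im d \<and> 0 < Im e \<or> Im d < 0 \<and> Im e < 0" and cross: "0 < Re e * Im d - Im e * Re d"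
  shows "Arg e < Arg d"
proof (rule ccontr)
  assume n: "\<not> Arg e < Arg d"
  have nz: "d \<noteq> 0" "e \<noteq> 0" using assms(1) by auto
  have r: "0 < Arg d \<and> Arg d < pi \<and> 0 < Arg e \<and> Arg e < pi \<or> - pi < Arg d \<and> Arg d < 0 \<and> - pi < Arg e \<and> Arg e < 0"
    using assms(1) Arg_lt_pi[of d] Arg_lt_pi[of e] mpi_less_Arg[of d] mpi_less_Arg[of e] Arg_neg_iff[of d] Arg_neg_iff[of e]
    by auto
  have d: "Re d = cmod d * cos (Arg d)" "Im d = cmod d * sin (Arg d)"
    and e: "Re e = cmod e * cos (Arg e)" "Im e = cmod e * sin (Arg e)"
    using cos_Arg[OF nz(1)] sin_Arg[OF nz(1)] cos_Arg[OF nz(2)] sin_Arg[OF nz(2)] nz by auto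
  have "Re e * Im d - Im e * Re d = cmod e * cmod d * sin (Arg d - Arg e)"
    unfolding d e sin_diff by (simp add: algebra_simps)
  moreover have "sin (Arg d - Arg e) \<le> 0"
  proof -
    have "0 \<le> Arg e - Arg d" "Arg e - Arg d \<le> pi" using n r by auto
    then have "0 \<le> sin (Arg e - Arg d)" by (intro sin_ge_zero)
    then show ?thesis by (metis minus_diff_eq neg_le_0_iff_le sin_minus)
  qed
  ultimately have "Re e * Im d - Im e * Re d \<le> 0"
    by (simp add: mult_nonneg_nonpos)
  then show False using cross by simp
qed

lemma is_Arg_shift: "is_Arg z \<theta> \<Longrightarrow> is_Arg z (\<theta> + 2 * pi)"
  unfolding is_Arg_def by (metis cis_conv_exp cis_2pi cis_mult mult_1_right)

abbreviation cw_before :: "complex \<Rightarrow> complex \<Rightarrow> bool" where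
  "cw_before d e \<equiv> 0 < Re e * Im d - Im e * Re d"

text \<open>Outgoing edges point up and have arguments between 0 and \<pi>, incoming ones point down
  and have negative arguments. The incoming edges X at the front of the list are raised by a full
  turn. As X follows Y in the cyclic order, the angles still span less than a full turn.\<close>

lemma clockwise_angles:
  assumes up: "\<forall>d\<in>set O'. 0 < Im d" and down: "\<forall>d\<in>set (Y @ X). Im d < 0"
    and sO: "sorted_wrt cw_before O'" and sYX: "sorted_wrt cw_before (Y @ X)"
  defines "ts \<equiv> map (\<lambda>d. Arg d + 2 * pi) X @ map Arg O' @ map Arg Y"
  shows "\<forall>i < length (X @ O' @ Y). (X @ O' @ Y) ! i \<noteq> 0 \<and> is_Arg ((X @ O' @ Y) ! i) (ts ! i)"
    "\<forall>j < length (X @ O' @ Y). \<forall>i < j. ts ! j < ts ! i"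
    "\<forall>i < length (X @ O' @ Y). ts ! 0 - ts ! i < 2 * pi"
proof -
  have len: "length (X @ O' @ Y) = length ts" by (simp add: ts_def)
  have aO: "0 < Arg d" "Arg d < pi" if "d \<in> set O'" for d
    using up that Arg_lt_pi[of d] by auto
  have aYX: "- pi < Arg d" "Arg d < 0" if "d \<in> set X \<union> set Y" for d
    using down that mpi_less_Arg[of d] Arg_neg_iff[of d] by auto
  have sO': "sorted_wrt (\<lambda>d e. Arg e < Arg d) O'"
    by (rule sorted_wrt_mono_rel[OF _ sO]) (use up in \<open>auto intro!: Arg_less\<close>)
  have sYX': "sorted_wrt (\<lambda>d e. Arg e < Arg d) (Y @ X)"
    by (rule sorted_wrt_mono_rel[OF _ sYX]) (use down in \<open>auto intro!: Arg_less\<close>)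
  then have sX: "sorted_wrt (\<lambda>d e. Arg e < Arg d) X" and sY: "sorted_wrt (\<lambda>d e. Arg e < Arg d) Y"
    and YX: "\<And>a b. a \<in> set Y \<Longrightarrow> b \<in> set X \<Longrightarrow> Arg b < Arg a" by (auto simp: sorted_wrt_append)
  have pi: "0 < pi" by simp
  let ?R = "\<lambda>a b::real. b < a \<and> a - b < 2 * pi"
  have "sorted_wrt ?R (map (\<lambda>d. Arg d + 2 * pi) X)"
    unfolding sorted_wrt_map
  proof (rule sorted_wrt_mono_rel[OF _ sX])
    fix a b assume "a \<in> set X" "b \<in> set X" "Arg b < Arg a"
    then show "Arg b + 2 * pi < Arg a + 2 * pi \<and> Arg a + 2 * pi - (Arg b + 2 * pi) < 2 * pi"
      using aYX[of a] aYX[of b] by auto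
  qed
  moreover have "sorted_wrt ?R (map Arg O')"
    unfolding sorted_wrt_map
  proof (rule sorted_wrt_mono_rel[OF _ sO'])
    fix a b assume "a \<in> set O'" "b \<in> set O'" "Arg b < Arg a"
    then show "Arg b < Arg a \<and> Arg a - Arg b < 2 * pi" using aO[of a] aO[of b] pi by linarith
  qed
  moreover have "sorted_wrt ?R (map Arg Y)"
    unfolding sorted_wrt_map
  proof (rule sorted_wrt_mono_rel[OF _ sY])
    fix a b assume "a \<in> set Y" "b \<in> set Y" "Arg b < Arg a"
    then show "Arg b < Arg a \<and> Arg a - Arg b < 2 * pi" using aYX[of a] aYX[of b] pi by auto
  qed
  moreover have "?R (Arg a + 2 * pi) (Arg b)" if "a \<in> set X" "b \<in> set O'" for a b
    using aYX[of a] aO[of b] that pi by auto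
  moreover have "?R (Arg a + 2 * pi) (Arg b)" if "a \<in> set X" "b \<in> set Y" for a b
    using aYX[of a] aYX[of b] YX[OF that(2,1)] that pi by auto
  moreover have "?R (Arg a) (Arg b)" if "a \<in> set O'" "b \<in> set Y" for a b
    using aO[OF that(1)] aYX[of b] that pi by auto
  ultimately have s: "sorted_wrt ?R ts" unfolding ts_def by (auto simp: sorted_wrt_append)
  show "\<forall>j < length (X @ O' @ Y). \<forall>i < j. ts ! j < ts ! i"
    unfolding len using sorted_wrt_nth_less[OF s] by blast
  show "\<forall>i < length (X @ O' @ Y). ts ! 0 - ts ! i < 2 * pi"
    unfolding len
  proof (intro allI impI)
    fix i assume i: "i < length ts"
    show "ts ! 0 - ts ! i < 2 * pi"
      using sorted_wrt_nth_less[OF s, of 0 i] i by (cases "i = 0") auto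
  qed
  have nz: "d \<noteq> 0" if "d \<in> set (X @ O' @ Y)" for d
  proof -
    have "0 < Im d \<or> Im d < 0"
    proof (cases "d \<in> set O'")
      case True then show ?thesis using up by blast
    next
      case False
      then have "d \<in> set (Y @ X)" using that by auto
      then show ?thesis using down by blast
    qed
    then have "Im d \<noteq> 0" by linarith
    then show ?thesis by auto
  qed
  show "\<forall>i < length (X @ O' @ Y). (X @ O' @ Y) ! i \<noteq> 0 \<and> is_Arg ((X @ O' @ Y) ! i) (ts ! i)"
    unfolding len
  proof (intro allI impI)
    fix i assume i: "i < length ts"
    then have mem: "(X @ O' @ Y) ! i \<in> set (X @ O' @ Y)" by (intro nth_mem) (simp add: ts_def)
    have "ts ! i = Arg ((X @ O' @ Y) ! i) + (if i < length X then 2 * pi else 0)"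
      using i by (auto simp: ts_def nth_append)
    then show "(X @ O' @ Y) ! i \<noteq> 0 \<and> is_Arg ((X @ O' @ Y) ! i) (ts ! i)"
      using nz[OF mem] is_Arg_Arg[OF nz[OF mem]] is_Arg_shift by auto
  qed
qed

lemma convex_unbounded_outside:
  assumes "convex H" "\<not> bounded H" "H \<inter> K = {}"
  shows "H \<subseteq> outside (K :: complex set)"
proof
  fix z assume z: "z \<in> H"
  have "H \<subseteq> connected_component_set (- K) z"
    using assms z by (intro connected_component_maximal) (auto intro: convex_connected)
  then have "\<not> bounded (connected_component_set (- K) z)" using assms(2) bounded_subset by blast
  then show "z \<in> outside K" using z assms(3) unfolding outside_def by auto
qed

lemma halfplanes:
  "convex {z. Im z < c}" "\<not> bounded {z. Im z < c}" "convex {z. c < Im z}" "\<not> bounded {z. c < Im z}"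
proof -
  show "convex {z. Im z < c}" "convex {z. c < Im z}"
    by (simp_all add: convex_halfspace_Im_lt convex_halfspace_Im_gt)
  show "\<not> bounded {z. Im z < c}"
  proof
    assume "bounded {z. Im z < c}"
    then obtain B where B: "\<And>z. Im z < c \<Longrightarrow> cmod z \<le> B" unfolding bounded_iff by auto
    have "cmod (Complex 0 (- \<bar>c\<bar> - \<bar>B\<bar> - 1)) \<le> B" by (intro B) auto
    then show False by (simp add: cmod_def)
  qed
  show "\<not> bounded {z. c < Im z}"
  proof
    assume "bounded {z. c < Im z}"
    then obtain B where B: "\<And>z. c < Im z \<Longrightarrow> cmod z \<le> B" unfolding bounded_iff by auto
    have "cmod (Complex 0 (\<bar>c\<bar> + \<bar>B\<bar> + 1)) \<le> B" by (intro B) auto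
    then show False by (simp add: cmod_def)
  qed
qed

section \<open>Planarity of the new drawing\<close>

locale contour_graph = ordered_st +
  fixes C P M S :: "nat \<Rightarrow> nat list" and l r :: "nat \<Rightarrow> nat" and x y :: "nat \<Rightarrow> int"
  assumes cd: "contour_drawing (nv G) (\<lambda>k. vtx G \<pi> (Suc k)) (nv G) (Suc (nv G)) C P M S l r x y"
    and ok: "k < nv G \<Longrightarrow> attach_ok G \<pi> k (C k) (l k) (M k) (r k)"
    and inv: "k \<le> nv G \<Longrightarrow> contour_inv G \<pi> k (C k)"

sublocale contour_graph \<subseteq> contour_drawing "nv G" "\<lambda>k. vtx G \<pi> (Suc k)" "nv G" "Suc (nv G)" C P M S l r x y
  by (rule cd)

context contour_graph
begin

abbreviation D where "D \<equiv> straight_line_drawing x y"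

lemma pos_D [simp]: "pos D w = pt w"
  by (simp add: straight_line_drawing_def pt_def)

lemma pos_D': "pos D = pt"
  by (rule ext) simp

lemma edge_points_D: "edge_points D e = [pt (fst e), pt (snd e)]"
  unfolding edge_points_def pos_D by (simp add: straight_line_drawing_def)

lemma img_D: "path_image (edge_curve D e) = closed_segment (pt (fst e)) (pt (snd e))"
  by (simp add: edge_curve_def edge_points_D)

lemma step_of: "w \<in> verts G \<Longrightarrow> \<exists>k. k < nv G \<and> vtx G \<pi> (Suc k) = w \<and> \<pi> w = Suc k"
  using pi_range[of w] vtx_unique[of w "\<pi> w - 1"] by (intro exI[of _ "\<pi> w - 1"]) auto

lemma pred_base: "k < nv G \<Longrightarrow> (a, vtx G \<pi> (Suc k)) \<in> arcs G \<Longrightarrow> a \<in> set (base k)"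
  using ok unfolding attach_ok_def Let_def by blast

lemma base_C: "k < nv G \<Longrightarrow> a \<in> set (base k) \<Longrightarrow> a \<in> set (C k)"
  using C_split by auto

lemma arc_edge_not_above:
  assumes "(a, b) \<in> arcs G" "\<pi> b \<le> m" "m \<le> nv G" "p \<in> closed_segment (pt a) (pt b)"
  shows "\<not> above (C m) p"
proof
  assume "above (C m) p"
  obtain k where k: "k < nv G" "vtx G \<pi> (Suc k) = b" "\<pi> b = Suc k"
    using step_of arcs_verts assms(1) by blast
  then have "above (C (Suc k)) p" using above_mono[of "Suc k" m p] assms \<open>above (C m) p\<close> by simp
  then show False using edge_not_above[OF k(1) pred_base[OF k(1)], of a p] assms k by simp
qed

lemma vertex_not_above:
  assumes "w \<in> verts G" "\<pi> w \<le> m" "m \<le> nv G"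
  shows "\<not> above (C m) (pt w)"
proof
  assume "above (C m) (pt w)"
  obtain k where k: "k < nv G" "vtx G \<pi> (Suc k) = w" "\<pi> w = Suc k" using step_of assms(1) by blast
  then have "above (C (Suc k)) (pt w)" using above_mono[of "Suc k" m] assms \<open>above (C m) (pt w)\<close> by simp
  then show False using edge_not_above[OF k(1), of "l k" "pt w"] k by simp
qed

lemma vertex_above:
  assumes "k < nv G"
  shows "above (C k) (pt (vtx G \<pi> (Suc k)))"
  using edge_above[OF assms, of "l k" _ 1] by simp

text \<open>A vertex is above the contour just before it is placed and not above any later
  contour.\<close>

lemma pt_inj:
  assumes "w \<in> verts G" "w' \<in> verts G" "pt w = pt w'"
  shows "w = w'"
proof -
  have less: False if w: "w \<in> verts G" "w' \<in> verts G" "pt w = pt w'" "\<pi> w < \<pi> w'" for w w'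
  proof -
    obtain k where k: "k < nv G" "vtx G \<pi> (Suc k) = w'" "\<pi> w' = Suc k" using step_of w(2) by blast
    then show False using vertex_above[OF k(1)] vertex_not_above[OF w(1), of k] w(3,4) by simp
  qed
  show ?thesis using less[of w w'] less[of w' w] assms pi_inj by (metis linorder_neqE_nat)
qed

lemma edge_off_old:
  assumes k: "k < nv G" and a: "(a, vtx G \<pi> (Suc k)) \<in> arcs G"
    and p: "p \<in> closed_segment (pt a) (pt (vtx G \<pi> (Suc k)))" "\<not> above (C k) p"
  shows "p = pt a"
  using edge_above'[OF k pred_base[OF k a] p(1)] p(2) by blast

lemma vertex_on_edge:
  assumes e: "(a, b) \<in> arcs G" and w: "w \<in> verts G" "pt w \<in> closed_segment (pt a) (pt b)"
  shows "w = a \<or> w = b"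
proof -
  obtain k where k: "k < nv G" "vtx G \<pi> (Suc k) = b" "\<pi> b = Suc k"
    using step_of arcs_verts e by blast
  consider "\<pi> w \<le> k" | "\<pi> w = \<pi> b" | "\<pi> b < \<pi> w" using k(3) by linarith
  then show ?thesis
  proof cases
    case 1
    then have "pt w = pt a" using edge_off_old[OF k(1), of a "pt w"] k(2) e w vertex_not_above[OF w(1), of k] k(1) by simp
    then show ?thesis using pt_inj[OF w(1)] arcs_verts e by blast
  next
    case 2
    then show ?thesis using pi_inj w(1) arcs_verts e by blast
  next
    case 3
    obtain m where m: "m < nv G" "vtx G \<pi> (Suc m) = w" "\<pi> w = Suc m" using step_of w(1) by blast
    then show ?thesis using vertex_above[OF m(1)] arc_edge_not_above[OF e, of m "pt w"] 3 w by simp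
  qed
qed

text \<open>When the later head is placed, the earlier edge is not above the contour, whereas the
  later edge is, except for its tail.\<close>

lemma edges_meet_less:
  assumes e: "(a, b) \<in> arcs G" "(a', b') \<in> arcs G" "\<pi> b < \<pi> b'"
    and p: "p \<in> closed_segment (pt a) (pt b)" "p \<in> closed_segment (pt a') (pt b')"
  shows "p = pt a' \<and> a' \<in> {a, b}"
proof -
  obtain k where k: "k < nv G" "vtx G \<pi> (Suc k) = b'" "\<pi> b' = Suc k"
    using step_of arcs_verts e(2) by blast
  have "\<not> above (C k) p" using arc_edge_not_above[OF e(1) _ _ p(1)] e(3) k by simp
  then have "p = pt a'" using edge_off_old[OF k(1), of a' p] e(2) p(2) k(2) by simp
  then show ?thesis using vertex_on_edge[OF e(1), of a'] arcs_verts[OF e(2)] p(1) by auto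
qed

lemma edges_meet_ends:
  assumes e: "(a, b) \<in> arcs G" "(a', b') \<in> arcs G" "(a, b) \<noteq> (a', b')"
    and p: "p \<in> closed_segment (pt a) (pt b)" "p \<in> closed_segment (pt a') (pt b')"
  shows "p \<in> pt ` ({a, b} \<inter> {a', b'})"
proof -
  consider "\<pi> b < \<pi> b'" | "\<pi> b' < \<pi> b" | "\<pi> b = \<pi> b'" by linarith
  then show ?thesis
  proof cases
    case 1 then show ?thesis using edges_meet_less[OF e(1,2) 1 p] by auto
  next
    case 2 then show ?thesis using edges_meet_less[OF e(2,1) 2 p(2,1)] by auto
  next
    case 3
    then have [simp]: "b' = b" using pi_inj arcs_verts e(1,2) by blast
    obtain k where k: "k < nv G" "vtx G \<pi> (Suc k) = b" using step_of arcs_verts e(1) by blast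
    have "p = pt b" using edges_at_top[OF k(1), of a a' p] pred_base[OF k(1)] e p k by auto
    then show ?thesis by simp
  qed
qed

lemma y_arc: "(a, b) \<in> arcs G \<Longrightarrow> y a < y b"
proof -
  assume e: "(a, b) \<in> arcs G"
  obtain k where k: "k < nv G" "vtx G \<pi> (Suc k) = b" using step_of arcs_verts e by blast
  then show ?thesis using y_above[OF k(1) pred_base[OF k(1)]] e by simp
qed

lemma planar: "planar_drawing G D"
  unfolding planar_drawing_def img_D pos_D'
proof (intro conjI ballI impI)
  show "inj_on pt (verts G)" using pt_inj by (auto simp: inj_on_def)
  show "arc (edge_curve D e)" if "e \<in> arcs G" for e
  proof -
    have "pt (fst e) \<noteq> pt (snd e)" using y_arc[of "fst e" "snd e"] that by (auto simp: pt_def)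
    then show ?thesis by (simp add: edge_curve_def edge_points_D)
  qed
  show "w \<in> {fst e, snd e}" if "e \<in> arcs G" "w \<in> verts G" "pt w \<in> closed_segment (pt (fst e)) (pt (snd e))" for e w
    using vertex_on_edge[of "fst e" "snd e" w] that by simp
  show "closed_segment (pt (fst e)) (pt (snd e)) \<inter> closed_segment (pt (fst e')) (pt (snd e'))
          \<subseteq> pt ` ({fst e, snd e} \<inter> {fst e', snd e'})" if "e \<in> arcs G" "e' \<in> arcs G" "e \<noteq> e'" for e e'
    using edges_meet_ends[of "fst e" "snd e" "fst e'" "snd e'"] that by (auto simp: prod_eq_iff)
qed

lemma grid: "has_grid_size G x y (2 * int (card (verts G)) - 2) (int (card (verts G)) - 1)"
  unfolding has_grid_size_def card_verts
proof
  fix w assume "w \<in> verts G"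
  then obtain k where "k < nv G" "vtx G \<pi> (Suc k) = w" using step_of by blast
  then show "x w \<in> {0..2 * int (nv G) - 2} \<and> y w \<in> {0..int (nv G) - 1}" using bounds[of k] by simp
qed

lemma upward: "upward_planar_grid_drawing G x y"
  unfolding upward_planar_grid_drawing_def using planar y_arc by auto

lemma real_not_ends: "w \<in> verts G \<Longrightarrow> w \<noteq> nv G \<and> w \<noteq> Suc (nv G)"
  by (auto simp: verts_def)

text \<open>As long as u has a pending edge, earlier edges to the left of it stay on or below the
  contour edge that enters u from the left. When z is placed, it is itself the left neighbour of u;
  later left neighbours are placed above the previous contour edge.\<close>

lemma order_left:
  assumes "k \<le> nv G" "(u, z) \<in> arcs G" "(u, z') \<in> arcs G" "\<pi> z \<le> k" "k < \<pi> z'"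
    "before (succ_list G u) z z'" "(a, u) \<in> links (C k)"
  shows "x z < x u \<and> 0 \<le> orient u a z"
  using assms
proof (induction k arbitrary: a)
  case 0
  then show ?case using pi_range[of z] arcs_verts by force
next
  case (Suc k)
  then have k: "k < nv G" by simp
  let ?v = "vtx G \<pi> (Suc k)"
  note v = vtx[OF k]
  have dC: "distinct (C (Suc k))" using C_distinct Suc.prems(1) by blast
  have uv: "u \<noteq> ?v" using pi_mono[OF Suc.prems(2)] Suc.prems(4) v by auto
  consider "(a, u) \<in> links (P k @ [l k])" | "(a, u) = (?v, r k)" | "(a, u) \<in> links (r k # S k)"
    using Suc.prems(7) links_C_Suc[OF k] uv by blast
  note cs = this
  show ?case
  proof (cases "\<pi> z = Suc k")
    case True
    then have [simp]: "z = ?v" using v pi_inj arcs_verts[OF Suc.prems(2)] by auto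
    have ur: "u = r k" using ok[OF k] Suc.prems(2,5,6) unfolding attach_ok_def Let_def by auto
    from cs have "a = ?v"
    proof cases
      case 1
      then have "r k \<in> set (P k @ [l k])" using links_mem[OF 1] ur by simp
      then show ?thesis using dC C_Suc[OF k] by auto
    next
      case 3
      then have "r k \<in> set (S k)" using links_tl[OF 3] ur by simp
      then show ?thesis using dC C_Suc[OF k] by auto
    qed simp
    then show ?thesis using x_v[OF k] ur by (simp add: orient_def)
  next
    case False
    then have zk: "\<pi> z \<le> k" "k < \<pi> z'" using Suc.prems by auto
    note IH = Suc.IH[OF less_imp_le[OF k] Suc.prems(2,3) zk Suc.prems(6)]
    from cs show ?thesis
    proof cases
      case 1 then show ?thesis using IH links_C[OF k] by blast
    next
      case 3 then show ?thesis using IH links_C[OF k] by blast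
    next
      case 2
      then have e: "a = ?v" "u = r k" by auto
      have "r k \<noteq> hd (base k)" using C_distinct[of k] C_split[OF k] k by auto
      then obtain a0 where a0: "(a0, r k) \<in> links (base k)" using links_left[of "r k" "base k"] by auto
      then have a0C: "(a0, u) \<in> links (C k)" using links_C[OF k] e by blast
      have IH0: "x z < x u" "0 \<le> orient u a0 z" using IH[OF a0C] by auto
      have o: "0 < orient u ?v a0" using orient_base[OF k a0] orient_cyclic[of a0 "r k" ?v] orient_cyclic[of ?v a0 "r k"] e by simp
      have xs: "x a0 < x u" "x ?v < x u" using x_less[OF _ a0C] k x_v[OF k] e by auto
      \<comment> \<open>The three-term relation at u for the new neighbour v, the old neighbour a0
        and z; all three are to the left of u.\<close>
      have "orient u ?v z * (x u - x a0) = orient u ?v a0 * (x u - x z) + orient u a0 z * (x u - x ?v)"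
        unfolding orient_def by algebra
      also have "\<dots> > 0" using o IH0 xs by (intro add_pos_nonneg mult_pos_pos mult_nonneg_nonneg) auto
      finally show ?thesis using IH0 xs e by (simp add: zero_less_mult_iff)
    qed
  qed
qed

lemma order_right:
  assumes "k \<le> nv G" "(u, z) \<in> arcs G" "(u, z') \<in> arcs G" "\<pi> z \<le> k" "k < \<pi> z'"
    "before (succ_list G u) z' z" "(u, b) \<in> links (C k)"
  shows "x u < x z \<and> 0 \<le> orient u z b"
  using assms
proof (induction k arbitrary: b)
  case 0
  then show ?case using pi_range[of z] arcs_verts by force
next
  case (Suc k)
  then have k: "k < nv G" by simp
  let ?v = "vtx G \<pi> (Suc k)"
  note v = vtx[OF k]
  have dC: "distinct (C (Suc k))" using C_distinct Suc.prems(1) by blast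
  have uv: "u \<noteq> ?v" using pi_mono[OF Suc.prems(2)] Suc.prems(4) v by auto
  consider "(u, b) \<in> links (P k @ [l k])" | "(u, b) = (l k, ?v)" | "(u, b) \<in> links (r k # S k)"
    using Suc.prems(7) links_C_Suc[OF k] uv by blast
  note cs = this
  show ?case
  proof (cases "\<pi> z = Suc k")
    case True
    then have [simp]: "z = ?v" using v pi_inj arcs_verts[OF Suc.prems(2)] by auto
    have ul: "u = l k" using ok[OF k] Suc.prems(2,5,6) unfolding attach_ok_def Let_def by auto
    from cs have "b = ?v"
    proof cases
      case 1
      then have "l k \<in> set (P k)" using links_butlast[OF 1] ul by simp
      then show ?thesis using dC C_Suc[OF k] by auto
    next
      case 3
      then have "l k \<in> set (r k # S k)" using links_mem[OF 3] ul by simp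
      then show ?thesis using dC C_Suc[OF k] by auto
    qed simp
    then show ?thesis using x_v[OF k] ul by (simp add: orient_def)
  next
    case False
    then have zk: "\<pi> z \<le> k" "k < \<pi> z'" using Suc.prems by auto
    note IH = Suc.IH[OF less_imp_le[OF k] Suc.prems(2,3) zk Suc.prems(6)]
    from cs show ?thesis
    proof cases
      case 1 then show ?thesis using IH links_C[OF k] by blast
    next
      case 3 then show ?thesis using IH links_C[OF k] by blast
    next
      case 2
      then have e: "b = ?v" "u = l k" by auto
      have "l k \<noteq> last (base k)" using C_distinct[of k] C_split[OF k] k by auto
      then obtain b0 where b0: "(l k, b0) \<in> links (base k)" using links_right[of "l k" "base k"] by auto
      then have b0C: "(u, b0) \<in> links (C k)" using links_C[OF k] e by blast
      have IH0: "x u < x z" "0 \<le> orient u z b0" using IH[OF b0C] by auto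
      have o: "0 < orient u b0 ?v" using orient_base[OF k b0] e by simp
      have xs: "x u < x b0" "x u < x ?v" using x_less[OF _ b0C] k x_v[OF k] e by auto
      have "orient u z ?v * (x b0 - x u) = orient u z b0 * (x ?v - x u) + orient u b0 ?v * (x z - x u)"
        unfolding orient_def by algebra
      also have "\<dots> > 0" using o IH0 xs by (intro add_nonneg_pos mult_pos_pos mult_nonneg_nonneg) auto
      finally show ?thesis using IH0 xs e by (simp add: zero_less_mult_iff)
    qed
  qed
qed

lemma orient_opposite: "x b \<le> x u \<Longrightarrow> x u < x a \<Longrightarrow> y u < y a \<Longrightarrow> y u < y b \<Longrightarrow> 0 < orient u a b"
  and orient_opposite': "x b < x u \<Longrightarrow> x u \<le> x a \<Longrightarrow> y u < y a \<Longrightarrow> y u < y b \<Longrightarrow> 0 < orient u a b"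
proof -
  show "0 < orient u a b" if "x b \<le> x u" "x u < x a" "y u < y a" "y u < y b"
  proof -
    have "0 < (x a - x u) * (y b - y u)" using that by simp
    moreover have "(y a - y u) * (x b - x u) \<le> 0" using that by (simp add: mult_le_0_iff)
    ultimately show ?thesis unfolding orient_def by linarith
  qed
  show "0 < orient u a b" if "x b < x u" "x u \<le> x a" "y u < y a" "y u < y b"
  proof -
    have "0 \<le> (x a - x u) * (y b - y u)" using that by simp
    moreover have "(y a - y u) * (x b - x u) < 0" using that by (simp add: mult_less_0_iff)
    ultimately show ?thesis unfolding orient_def by linarith
  qed
qed

text \<open>Consider the moment when the later of z and z' is placed. By \<open>order_left\<close>
  or \<open>order_right\<close> the other one is on or below the contour edge at u, while the new
  edge leaves above it. If u is the end of the base on that side, the two edges lie on different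
  sides of the vertical through u.\<close>

lemma succ_order:
  assumes e: "(u, z) \<in> arcs G" "(u, z') \<in> arcs G" and b: "before (succ_list G u) z z'"
  shows "0 < orient u z' z"
proof -
  have ys: "y u < y z" "y u < y z'" using y_arc e by auto
  have V: "z \<in> verts G" "z' \<in> verts G" "u \<in> verts G" using arcs_verts e by auto
  have "z \<noteq> z'" using b distinct_succ[of u] unfolding before_def by auto
  then have "\<pi> z \<noteq> \<pi> z'" using pi_inj V by blast
  then consider "\<pi> z < \<pi> z'" | "\<pi> z' < \<pi> z" by linarith
  then show ?thesis
  proof cases
    case 1
    obtain k where k: "k < nv G" "vtx G \<pi> (Suc k) = z'" "\<pi> z' = Suc k" using step_of V(2) by blast
    have ub: "u \<in> set (base k)" using pred_base[OF k(1)] k(2) e(2) by simp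
    have left: "x z < x u \<and> 0 \<le> orient u a z" if "(a, u) \<in> links (C k)" for a
      using order_left[OF _ e _ _ b that] k 1 by simp
    show ?thesis
    proof (cases "u = l k")
      case True
      have "u \<in> set (C k)" "u \<noteq> hd (C k)" using base_C[OF k(1) ub] C_ends[of k] k(1) real_not_ends[OF V(3)] by auto
      then obtain a where "(a, u) \<in> links (C k)" using links_left by metis
      then have "x z < x u" using left by blast
      moreover have "x u < x z'" using x_v[OF k(1)] True k(2) by simp
      ultimately show ?thesis using ys by (intro orient_opposite) auto
    next
      case False
      then obtain a where a: "(a, u) \<in> links (base k)" using links_left[of u "base k"] ub by auto
      then have aC: "(a, u) \<in> links (C k)" using links_C[OF k(1)] by blast
      have L: "x z < x u" "0 \<le> orient u a z" using left[OF aC] by auto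
      have o: "0 < orient u z' a" using orient_base[OF k(1) a] orient_cyclic[of a u z'] orient_cyclic[of z' a u] k(2) by simp
      have xa: "x a < x u" using x_less[OF _ aC] k(1) by simp
      show ?thesis
      proof (cases "x z' < x u")
        case True
        have "orient u z' z * (x u - x a) = orient u z' a * (x u - x z) + orient u a z * (x u - x z')"
          unfolding orient_def by algebra
        also have "\<dots> > 0" using o L True xa by (intro add_pos_nonneg mult_pos_pos mult_nonneg_nonneg) auto
        finally show ?thesis using xa by (simp add: zero_less_mult_iff)
      next
        case False
        then show ?thesis using L ys by (intro orient_opposite') auto
      qed
    qed
  next
    case 2
    obtain k where k: "k < nv G" "vtx G \<pi> (Suc k) = z" "\<pi> z = Suc k" using step_of V(1) by blast
    have ub: "u \<in> set (base k)" using pred_base[OF k(1)] k(2) e(1) by simp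
    have right: "x u < x z' \<and> 0 \<le> orient u z' c" if "(u, c) \<in> links (C k)" for c
      using order_right[OF _ e(2,1) _ _ b that] k 2 by simp
    show ?thesis
    proof (cases "u = r k")
      case True
      have "u \<in> set (C k)" "u \<noteq> last (C k)" using base_C[OF k(1) ub] C_ends[of k] k(1) real_not_ends[OF V(3)] by auto
      then obtain c where "(u, c) \<in> links (C k)" using links_right by metis
      then have "x u < x z'" using right by blast
      moreover have "x z < x u" using x_v[OF k(1)] True k(2) by simp
      ultimately show ?thesis using ys by (intro orient_opposite) auto
    next
      case False
      then obtain c where c: "(u, c) \<in> links (base k)" using links_right[of u "base k"] ub by auto
      then have cC: "(u, c) \<in> links (C k)" using links_C[OF k(1)] by blast
      have Rt: "x u < x z'" "0 \<le> orient u z' c" using right[OF cC] by auto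
      have o: "0 < orient u c z" using orient_base[OF k(1) c] k(2) by simp
      have xc: "x u < x c" using x_less[OF _ cC] k(1) by simp
      show ?thesis
      proof (cases "x u < x z")
        case True
        have "orient u z' z * (x c - x u) = orient u z' c * (x z - x u) + orient u c z * (x z' - x u)"
          unfolding orient_def by algebra
        also have "\<dots> > 0" using o Rt True xc by (intro add_nonneg_pos mult_pos_pos mult_nonneg_nonneg) auto
        finally show ?thesis using xc by (simp add: zero_less_mult_iff)
      next
        case False
        then show ?thesis using Rt ys by (intro orient_opposite) auto
      qed
    qed
  qed
qed

lemma before_nth: "i < j \<Longrightarrow> j < length xs \<Longrightarrow> before xs (xs ! i) (xs ! j)"
proof -
  assume ij: "i < j" "j < length xs"
  have "xs = take j xs @ xs ! j # drop (Suc j) xs" using ij by (simp add: id_take_nth_drop)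
  moreover have "take j xs = take i xs @ xs ! i # drop (Suc i) (take j xs)"
    using ij id_take_nth_drop[of i "take j xs"] by (simp add: min_def)
  ultimately have "xs = take i xs @ xs ! i # drop (Suc i) (take j xs) @ xs ! j # drop (Suc j) xs"
    by (metis append.assoc append_Cons)
  then show ?thesis unfolding before_def by blast
qed

abbreviation vec where "vec u w \<equiv> pt w - pt u"

lemma cw_before_vec: "cw_before (vec u a) (vec u b) \<longleftrightarrow> 0 < orient u b a"
proof -
  have "Re (vec u b) * Im (vec u a) - Im (vec u b) * Re (vec u a) = of_int (orient u b a)"
    by (simp add: orient_def)
  then show ?thesis by simp
qed

lemma succ_sorted: "sorted_wrt cw_before (map (vec u) (succ_list G u))"
  unfolding sorted_wrt_iff_nth_less
proof (intro allI impI)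
  fix i j assume ij: "i < j" "j < length (map (vec u) (succ_list G u))"
  let ?zs = "succ_list G u"
  have "0 < orient u (?zs ! j) (?zs ! i)"
    using ij before_nth[of i j ?zs] nth_mem[of i ?zs] nth_mem[of j ?zs]
    by (intro succ_order) (auto simp: in_succ_list)
  then show "cw_before (map (vec u) ?zs ! i) (map (vec u) ?zs ! j)"
    using ij unfolding cw_before_vec[symmetric] by simp
qed

lemma succ_up: "\<forall>d\<in>set (map (vec u) (succ_list G u)). 0 < Im d"
  using y_arc by (auto simp: in_succ_list)

lemma rot_structure:
  assumes u: "u \<in> verts G"
  obtains X Y where "rot G u = X @ succ_list G u @ Y"
    "\<forall>d\<in>set (map (vec u) Y @ map (vec u) X). Im d < 0"
    "sorted_wrt cw_before (map (vec u) Y @ map (vec u) X)"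
    "\<And>w. w \<in> set (Y @ X) \<Longrightarrow> (w, u) \<in> arcs G"
proof -
  obtain k where k: "k < nv G" "vtx G \<pi> (Suc k) = u" using step_of u by blast
  obtain X Y where XY: "rot G u = X @ succ_list G u @ Y" "Y @ X = rev (filter (\<lambda>w. (w, u) \<in> arcs G) (C k))"
    using ok[OF k(1)] k(2) unfolding attach_ok_def Let_def by blast
  let ?I = "filter (\<lambda>w. (w, u) \<in> arcs G) (C k)"
  have dC: "distinct (C k)" using C_distinct[of k] k(1) by simp
  have "filter (\<lambda>w. (w, u) \<in> arcs G) (P k) = []" "filter (\<lambda>w. (w, u) \<in> arcs G) (S k) = []"
    using dC pred_base[OF k(1)] k(2) unfolding C_split[OF k(1)] by (auto simp: filter_empty_conv)
  then have I: "?I = filter (\<lambda>w. (w, u) \<in> arcs G) (base k)" unfolding C_split[OF k(1)] by simp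
  have "sorted_wrt (\<lambda>a b. 0 < orient u a b) ?I"
    unfolding I using angular[OF k(1)] unfolding k(2) by (rule sorted_wrt_filter)
  then have "sorted_wrt (\<lambda>a b. 0 < orient u b a) (Y @ X)" unfolding XY(2) sorted_wrt_rev by simp
  then have s: "sorted_wrt cw_before (map (vec u) (Y @ X))" unfolding sorted_wrt_map cw_before_vec .
  have mem: "(w, u) \<in> arcs G" if "w \<in> set (Y @ X)" for w using that unfolding XY(2) by simp
  show thesis
    by (rule that[OF XY(1)]) (use s mem y_arc in auto)
qed

lemma direction_D:
  assumes "(u, w) \<in> arcs G \<or> (w, u) \<in> arcs G"
  shows "direction G D u w = vec u w"
  using assms arcs_antisym unfolding direction_def edge_points_D by auto

lemma map_direction: "u \<in> verts G \<Longrightarrow> map (direction G D u) (rot G u) = map (vec u) (rot G u)"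
  by (rule map_cong) (auto simp: rot_set direction_D)

lemma rot_clockwise_D:
  assumes u: "u \<in> verts G"
  shows "clockwise (map (direction G D u) (rot G u))"
proof -
  obtain X Y where XY: "rot G u = X @ succ_list G u @ Y"
    "\<forall>d\<in>set (map (vec u) Y @ map (vec u) X). Im d < 0"
    "sorted_wrt cw_before (map (vec u) Y @ map (vec u) X)" by (rule rot_structure[OF u])
  note ca = clockwise_angles[OF succ_up XY(2) succ_sorted XY(3)]
  have "clockwise (map (vec u) X @ map (vec u) (succ_list G u) @ map (vec u) Y)"
    unfolding clockwise_def by (rule exI, rule conjI[OF ca(1) conjI[OF ca(2,3)]])
  moreover have "map (vec u) (rot G u) = map (vec u) X @ map (vec u) (succ_list G u) @ map (vec u) Y"
    unfolding XY(1) by simp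
  ultimately show ?thesis by (simp only: map_direction[OF u])
qed

lemma y_ends_of_graph:
  assumes w: "w \<in> verts G"
  shows "y (src G) \<le> y w" "y w \<le> y (snk G)"
proof -
  obtain k where k: "k < nv G" "vtx G \<pi> (Suc k) = w" using step_of w by blast
  have n0: "0 < nv G" using k by simp
  have "vtx G \<pi> (Suc 0) = src G" using vtx_unique[OF src_verts, of 0] pi_src n0 by simp
  moreover have "y (vtx G \<pi> (Suc 0)) = 0"
  proof -
    have "tv (map y (base 0)) = 0 \<and> y (l 0) = -1 \<and> y (r 0) = -1"
    proof -
      have "P 0 @ base 0 @ S 0 = [nv G, Suc (nv G)]" using C_split[OF n0] C0 by simp
      then have "P 0 = []" "S 0 = []" "M 0 = []" "l 0 = nv G" "r 0 = Suc (nv G)"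
        by (auto simp: append_eq_Cons_conv)
      then show ?thesis using y_ends by simp
    qed
    then show ?thesis using y_step[OF n0] by linarith
  qed
  ultimately show "y (src G) \<le> y w" using bounds(3)[OF k(1)] k(2) by simp
  have "vtx G \<pi> (Suc (nv G - 1)) = snk G" using vtx_unique[OF snk_verts, of "nv G - 1"] pi_snk n0 by simp
  then show "y w \<le> y (snk G)" using bounds(4)[OF k(1)] k(2) y_last by simp
qed

end

section \<open>The outer face of the new drawing\<close>

sublocale contour_graph \<subseteq> drawn: planar_st G "straight_line_drawing x y"
  by unfold_locales (rule planar)

context contour_graph
begin

lemma K_heights:
  assumes "p \<in> drawn.K"
  shows "of_int (y (src G)) \<le> Im p" "Im p \<le> of_int (y (snk G))"
proof -
  have seg: "of_int (y (src G)) \<le> Im q \<and> Im q \<le> of_int (y (snk G))"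
    if w: "a \<in> verts G" "b \<in> verts G" "q \<in> closed_segment (pt a) (pt b)" for a b q
  proof -
    obtain t where t: "0 \<le> t" "t \<le> 1" "q = (1 - t) *\<^sub>R pt a + t *\<^sub>R pt b"
      using w(3) unfolding in_segment by blast
    have Im: "Im q = (1 - t) * of_int (y a) + t * of_int (y b)" unfolding t(3) by simp
    have ya: "real_of_int (y (src G)) \<le> of_int (y a)" "real_of_int (y (src G)) \<le> of_int (y b)"
        "real_of_int (y a) \<le> of_int (y (snk G))" "real_of_int (y b) \<le> of_int (y (snk G))"
      using y_ends_of_graph w by auto
    have "(1 - t) * of_int (y (src G)) + t * of_int (y (src G)) \<le> Im q"
      "Im q \<le> (1 - t) * of_int (y (snk G)) + t * of_int (y (snk G))"
      unfolding Im using ya t by (auto intro!: add_mono mult_left_mono)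
    then show ?thesis by (simp add: algebra_simps)
  qed
  have "of_int (y (src G)) \<le> Im p \<and> Im p \<le> of_int (y (snk G))"
  proof -
    consider w where "w \<in> verts G" "p = pt w" | a b where "(a, b) \<in> arcs G" "p \<in> closed_segment (pt a) (pt b)"
      using assms unfolding drawn.K_def img_D pos_D' by auto
    then show ?thesis
    proof cases
      case 1 then show ?thesis using seg[of w w p] by simp
    next
      case 2 then show ?thesis using seg[of a b p] arcs_verts by blast
    qed
  qed
  then show "of_int (y (src G)) \<le> Im p" "Im p \<le> of_int (y (snk G))" by auto
qed

text \<open>The source is a lowest and the sink a highest vertex, so the half-planes below and above
  miss the drawing. They give access to the outer face at both.\<close>

lemma halfplanes_outer:
  "{z. Im z < of_int (y (src G))} \<subseteq> outer_face G D" "{z. of_int (y (snk G)) < Im z} \<subseteq> outer_face G D"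
proof -
  have "{z. Im z < of_int (y (src G))} \<inter> drawn.K = {}" "{z. of_int (y (snk G)) < Im z} \<inter> drawn.K = {}"
    using K_heights by force+
  then show "{z. Im z < of_int (y (src G))} \<subseteq> outer_face G D" "{z. of_int (y (snk G)) < Im z} \<subseteq> outer_face G D"
    unfolding drawn.outer_face_K
    using convex_unbounded_outside[OF halfplanes(1,2)] convex_unbounded_outside[OF halfplanes(3,4)] by blast+
qed

lemma frontier_outer:
  assumes w: "w \<in> verts G" and near: "\<And>e. 0 < e \<Longrightarrow> \<exists>q\<in>outer_face G D. dist q (pt w) < e"
  shows "pt w \<in> frontier (outer_face G D)"
proof -
  have "pt w \<in> closure (outer_face G D)" unfolding closure_approachable using near by blast
  moreover have "pt w \<in> drawn.K" using w unfolding drawn.K_def pos_D' by blast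
  then have "pt w \<notin> outer_face G D" unfolding drawn.outer_face_K outside_def by simp
  ultimately show ?thesis unfolding frontier_def using interior_subset by blast
qed

lemma src_frontier: "pt (src G) \<in> frontier (outer_face G D)"
proof (rule frontier_outer[OF src_verts])
  fix e :: real assume e: "0 < e"
  have "pt (src G) - \<i> * of_real (e / 2) \<in> outer_face G D"
    using e by (intro halfplanes_outer(1)[THEN subsetD]) simp
  moreover have "dist (pt (src G) - \<i> * of_real (e / 2)) (pt (src G)) < e"
    using e by (simp add: dist_norm norm_mult)
  ultimately show "\<exists>q\<in>outer_face G D. dist q (pt (src G)) < e" by blast
qed

lemma snk_frontier: "pt (snk G) \<in> frontier (outer_face G D)"
proof (rule frontier_outer[OF snk_verts])
  fix e :: real assume e: "0 < e"
  have "pt (snk G) + \<i> * of_real (e / 2) \<in> outer_face G D"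
    using e by (intro halfplanes_outer(2)[THEN subsetD]) simp
  moreover have "dist (pt (snk G) + \<i> * of_real (e / 2)) (pt (snk G)) < e"
    using e by (simp add: dist_norm norm_mult)
  ultimately show "\<exists>q\<in>outer_face G D. dist q (pt (snk G)) < e" by blast
qed

text \<open>All edges at the source go up, so the free sector from the last to the first one
  contains the direction straight down, which leads into the lower half-plane.\<close>

lemma src_angle:
  assumes ne: "rot G (src G) \<noteq> []"
  shows "angle_in_face G D (src G) (last (rot G (src G))) (hd (rot G (src G))) (outer_face G D)"
proof -
  let ?s = "src G" and ?rs = "rot G (src G)"
  let ?ds = "map (direction G D ?s) ?rs"
  let ?n = "length ?rs"
  have ds: "?ds = map (vec ?s) (succ_list G ?s)" using map_direction[OF src_verts] rot_src by simp
  have up: "\<forall>d\<in>set ?ds. 0 < Im d" unfolding ds by (rule succ_up)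
  have so: "sorted_wrt cw_before ?ds" unfolding ds by (rule succ_sorted)
  define \<theta> where "\<theta> i = map Arg ?ds ! i" for i
  have \<theta>: "\<forall>i<length ?ds. ?ds ! i \<noteq> 0 \<and> is_Arg (?ds ! i) (\<theta> i)"
    "\<forall>j<length ?ds. \<forall>i<j. \<theta> j < \<theta> i" "\<forall>i<length ?ds. \<theta> 0 - \<theta> i < 2 * pi"
    using clockwise_angles[of ?ds "[]" "[]"] up so unfolding \<theta>_def by auto
  define i where "i = length ?ds - 1"
  have i: "i < length ?ds" "\<not> Suc i < length ?ds" "Suc i = length ?ds" using ne by (auto simp: i_def)
  define \<beta> where "\<beta> = \<theta> 0 - 2 * pi"
  obtain \<rho> where \<rho>: "0 < \<rho>" "\<beta> < \<theta> i" "is_Arg (?ds ! (Suc i mod length ?ds)) \<beta>"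
    "\<And>\<theta>' q. \<beta> < \<theta>' \<Longrightarrow> \<theta>' < \<theta> i \<Longrightarrow> 0 < q \<Longrightarrow> q < \<rho> \<Longrightarrow> pos D ?s + of_real q * cis \<theta>' \<notin> drawn.K"
    using star_sector_free[OF \<theta> drawn.vertex_star[OF src_verts] i(1), of \<beta>] i(2) unfolding \<beta>_def by auto
  obtain F where F: "F \<in> components (- drawn.K)"
    "\<And>\<theta>' q. \<beta> < \<theta>' \<Longrightarrow> \<theta>' < \<theta> i \<Longrightarrow> 0 < q \<Longrightarrow> q < \<rho> \<Longrightarrow> pos D ?s + of_real q * cis \<theta>' \<in> F"
    using sector_component[OF \<rho>(1,2), of "pos D ?s" drawn.K] \<rho>(4) by blast
  have Arg_up: "0 < \<theta> j \<and> \<theta> j < pi" if "j < length ?ds" for j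
  proof -
    have "0 < Im (?ds ! j)" using up nth_mem[OF that] by blast
    then show ?thesis using Arg_lt_pi[of "?ds ! j"] that unfolding \<theta>_def by simp
  qed
  have l0: "0 < length ?ds" using ne by simp
  have down: "\<beta> < - pi / 2" "- pi / 2 < \<theta> i" using Arg_up[OF l0] Arg_up[OF i(1)] unfolding \<beta>_def by auto
  let ?q = "pos D ?s + of_real (\<rho> / 2) * cis (- pi / 2)"
  have qF: "?q \<in> F" using down \<rho>(1) by (intro F(2)) auto
  have "Im ?q < of_int (y ?s)" using \<rho>(1) by (simp add: cis.ctr)
  then have "?q \<in> outer_face G D" using halfplanes_outer(1) by blast
  then have qo: "?q \<in> outside drawn.K" unfolding drawn.outer_face_K .
  have Fo: "F \<subseteq> outer_face G D"
  proof
    fix w assume w: "w \<in> F"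
    have "connected_component (- drawn.K) ?q w"
      using in_components_connected[OF F(1)] in_components_subset[OF F(1)] w qF
      unfolding connected_component_def by blast
    then show "w \<in> outer_face G D" unfolding drawn.outer_face_K using outside_same_component qo by blast
  qed
  have lasti: "direction G D ?s (last ?rs) = ?ds ! i" using ne unfolding i_def by (simp add: last_conv_nth)
  have hd0: "direction G D ?s (hd ?rs) = ?ds ! 0" using ne by (simp add: hd_conv_nth)
  have "\<theta> i \<le> \<theta> 0"
  proof (cases "i = 0")
    case False
    then show ?thesis using \<theta>(2) i(1) by (simp add: less_imp_le)
  qed simp
  then have "\<theta> i \<le> \<beta> + 2 * pi" by (simp add: \<beta>_def)
  moreover have "is_Arg (direction G D ?s (hd ?rs)) \<beta>" using \<rho>(3) i(3) hd0 by simp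
  moreover have "is_Arg (direction G D ?s (last ?rs)) (\<theta> i)" using \<theta>(1) i(1) lasti by simp
  moreover have "\<forall>\<theta>'\<in>{\<beta><..<\<theta> i}. \<forall>q\<in>{0<..<\<rho>}. pos D ?s + of_real q * cis \<theta>' \<in> outer_face G D"
    using F(2) Fo by auto
  ultimately show ?thesis unfolding angle_in_face_def using \<rho>(1,2) by blast
qed

lemma respects: "respects_embedding G D"
  unfolding respects_embedding_def
  using rot_clockwise_D src_frontier snk_frontier src_angle by simp

end

subsection \<open>The program\<close>

text \<open>Total correctness, with the running time as an argument of the postcondition.\<close>

definition tc :: "com \<Rightarrow> state \<Rightarrow> (nat \<Rightarrow> state \<Rightarrow> bool) \<Rightarrow> bool" where
  "tc p \<sigma> Q \<longleftrightarrow> (\<exists>k \<tau>. exec p \<sigma> k \<tau> \<and> Q k \<tau>)"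

lemma tc_conseq: "tc p \<sigma> Q \<Longrightarrow> (\<And>k \<tau>. Q k \<tau> \<Longrightarrow> Q' k \<tau>) \<Longrightarrow> tc p \<sigma> Q'"
  unfolding tc_def by blast

lemma tc_Skip: "Q 0 \<sigma> \<Longrightarrow> tc Skip \<sigma> Q"
  unfolding tc_def using exec.Skip by blast

lemma tc_Assign: "Q 1 (\<sigma>\<lparr>regs := (regs \<sigma>)(r := aval e \<sigma>)\<rparr>) \<Longrightarrow> tc (Assign r e) \<sigma> Q"
  unfolding tc_def using exec.Assign by blast

lemma tc_Put: "Q 1 (\<sigma>\<lparr>arrs := (arrs \<sigma>)(A := (arrs \<sigma> A)(aval i \<sigma> := aval e \<sigma>))\<rparr>) \<Longrightarrow> tc (Put A i e) \<sigma> Q"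
  unfolding tc_def using exec.Put by blast

lemma tc_Seq: "tc p \<sigma> (\<lambda>k \<tau>. tc q \<tau> (\<lambda>l. Q (k + l))) \<Longrightarrow> tc (Seq p q) \<sigma> Q"
  unfolding tc_def using exec.Seq by blast

lemma tc_Cond:
  "(bval b \<sigma> \<Longrightarrow> tc p \<sigma> (\<lambda>k. Q (Suc k))) \<Longrightarrow> (\<not> bval b \<sigma> \<Longrightarrow> tc q \<sigma> (\<lambda>k. Q (Suc k))) \<Longrightarrow> tc (Cond b p q) \<sigma> Q"
  unfolding tc_def using exec.CondTrue exec.CondFalse by metis

text \<open>For loops whose number N of iterations is known beforehand. The invariant carries the
  time spent so far; each iteration pays one unit for its test, and the failing test at the end
  costs one more.\<close>

lemma tc_While:
  assumes init: "Inv 0 0 \<sigma>"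
    and step: "\<And>i t \<tau>. i < N \<Longrightarrow> Inv i t \<tau> \<Longrightarrow> bval b \<tau> \<and> tc c \<tau> (\<lambda>t' \<tau>'. Inv (Suc i) (Suc (t + t')) \<tau>')"
    and fin: "\<And>t \<tau>. Inv N t \<tau> \<Longrightarrow> \<not> bval b \<tau> \<and> Q (Suc t) \<tau>"
  shows "tc (While b c) \<sigma> Q"
proof -
  have "\<exists>k \<tau>'. exec (While b c) \<tau> k \<tau>' \<and> Q (t + k) \<tau>'" if "i \<le> N" "Inv i t \<tau>" for i t \<tau>
    using that
  proof (induction i arbitrary: t \<tau> rule: inc_induct)
    case base
    then have "\<not> bval b \<tau>" "Q (Suc t) \<tau>" using fin by auto
    then show ?case using exec.WhileFalse[of b \<tau> c] by (intro exI[of _ 1] exI[of _ \<tau>]) simp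
  next
    case (step i)
    then have b: "bval b \<tau>" and "tc c \<tau> (\<lambda>t' \<tau>'. Inv (Suc i) (Suc (t + t')) \<tau>')"
      using assms(2) by auto
    then obtain t' \<tau>' where c: "exec c \<tau> t' \<tau>'" "Inv (Suc i) (Suc (t + t')) \<tau>'" unfolding tc_def by blast
    obtain k \<tau>'' where "exec (While b c) \<tau>' k \<tau>''" "Q (Suc (t + t') + k) \<tau>''"
      using step.IH[OF c(2)] by blast
    then show ?case using exec.WhileTrue[OF b c(1)] by (intro exI[of _ "Suc (t' + k)"] exI[of _ \<tau>'']) (simp add: add.assoc)
  qed
  then show ?thesis using init unfolding tc_def by force
qed

definition AbsDiff :: "nat \<Rightarrow> aexp \<Rightarrow> aexp \<Rightarrow> com" where
  "AbsDiff r e f = Cond (Less e f) (Assign r (Add (Reg r) (Sub f e))) (Assign r (Add (Reg r) (Sub e f)))"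

lemma tc_AbsDiff:
  "Q 2 (\<sigma>\<lparr>regs := (regs \<sigma>)(r := regs \<sigma> r + \<bar>aval f \<sigma> - aval e \<sigma>\<bar>)\<rparr>) \<Longrightarrow> tc (AbsDiff r e f) \<sigma> Q"
  unfolding AbsDiff_def
proof (rule tc_Cond; rule tc_Assign)
  assume Q: "Q 2 (\<sigma>\<lparr>regs := (regs \<sigma>)(r := regs \<sigma> r + \<bar>aval f \<sigma> - aval e \<sigma>\<bar>)\<rparr>)"
  show "Q (Suc 1) (\<sigma>\<lparr>regs := (regs \<sigma>)(r := aval (Add (Reg r) (Sub f e)) \<sigma>)\<rparr>)" if "bval (Less e f) \<sigma>"
  proof -
    have "\<bar>aval f \<sigma> - aval e \<sigma>\<bar> = aval f \<sigma> - aval e \<sigma>" using that by simp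
    then show ?thesis using Q by (simp add: numeral_2_eq_2)
  qed
  show "Q (Suc 1) (\<sigma>\<lparr>regs := (regs \<sigma>)(r := aval (Add (Reg r) (Sub e f)) \<sigma>)\<rparr>)" if "\<not> bval (Less e f) \<sigma>"
  proof -
    have "\<bar>aval f \<sigma> - aval e \<sigma>\<bar> = aval e \<sigma> - aval f \<sigma>" using that by simp
    then show ?thesis using Q by (simp add: numeral_2_eq_2)
  qed
qed

text \<open>Registers: 0 number of vertices, 1 current vertex, 2 position in the rotation lists, 3 end of a
  rotation list, 4 step, 5 and 6 the contour vertices that receive the new one, 7 and 8 current and
  previous vertex of the walk between them, 9 length of the walk. Arrays: 3 inverse of the ordering,
  4 and 5 next and previous contour vertex, 6 flags, 7 covering vertex, 8 height above the left end.\<close>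

definition Pi :: "aexp \<Rightarrow> aexp" where "Pi e = Get 0 (Add (Num 1) e)"
definition Off :: "aexp \<Rightarrow> aexp" where "Off e = Get 0 (Add (Add (Num 1) (Reg 0)) e)"
definition Rot :: "aexp \<Rightarrow> aexp" where "Rot e = Get 0 (Add (Add (Num 2) (Add (Reg 0) (Reg 0))) e)"

text \<open>Comparing neighbouring entries of every rotation list computes
  \<open>left_higher\<close> for all vertices in one pass.\<close>

definition flag_loop :: com where
  "flag_loop = While (Less (Reg 2) (Reg 3))
     (Seq (Cond (Conj (Less (Pi (Reg 1)) (Pi (Rot (Reg 2)))) (Less (Pi (Rot (Reg 2))) (Pi (Rot (Sub (Reg 2) (Num 1))))))
        (Put 6 (Rot (Reg 2)) (Num 1)) Skip)
      (Assign 2 (Add (Reg 2) (Num 1))))"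

definition prepare_loop :: com where
  "prepare_loop = While (Less (Reg 1) (Reg 0))
     (Seq (Put 3 (Pi (Reg 1)) (Reg 1))
     (Seq (Assign 2 (Add (Off (Reg 1)) (Num 1)))
     (Seq (Assign 3 (Off (Add (Reg 1) (Num 1))))
     (Seq flag_loop
      (Assign 1 (Add (Reg 1) (Num 1)))))))"

definition skip_in :: com where
  "skip_in = While (Less (Pi (Rot (Reg 2))) (Reg 4)) (Assign 2 (Add (Reg 2) (Num 1)))"

definition skip_out :: com where
  "skip_out = While (Less (Reg 4) (Pi (Rot (Reg 2)))) (Assign 2 (Add (Reg 2) (Num 1)))"

text \<open>Register 5 receives the entry cyclically before the first outgoing edge, the leftmost
  predecessor; register 6 the entry after the last outgoing edge, the rightmost one. Both kinds of
  edges exist, as source and sink are handled separately. If the two coincide, the flag tells on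
  which side the neighbour is taken.\<close>

definition find_ends :: com where
  "find_ends =
     Seq (Assign 2 (Off (Reg 1)))
     (Seq (Assign 3 (Off (Add (Reg 1) (Num 1))))
     (Seq skip_in
     (Seq (Cond (Less (Off (Reg 1)) (Reg 2)) (Assign 5 (Rot (Sub (Reg 2) (Num 1)))) (Assign 5 (Rot (Sub (Reg 3) (Num 1)))))
     (Seq skip_out
     (Seq (Assign 6 (Rot (Reg 2)))
      (Cond (Equal (Reg 5) (Reg 6))
        (Cond (Equal (Get 6 (Reg 1)) (Num 1)) (Assign 6 (Get 4 (Reg 5))) (Assign 5 (Get 5 (Reg 6))))
        Skip))))))"

text \<open>Register 9 accumulates the variation of the heights from l on. A covered vertex stores
  this value plus the shift of 1 as its provisional abscissa.\<close>

definition walk :: com where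
  "walk = While (Neg (Equal (Reg 7) (Reg 6)))
     (Seq (AbsDiff 9 (Get 2 (Reg 8)) (Get 2 (Reg 7)))
     (Seq (Put 1 (Reg 7) (Add (Reg 9) (Num 1)))
     (Seq (Put 7 (Reg 7) (Reg 1))
     (Seq (Assign 8 (Reg 7))
      (Assign 7 (Get 4 (Reg 7)))))))"

text \<open>The first command adds the last piece up to r and so completes the variation of the
  base.\<close>

definition place :: com where
  "place =
     Seq (AbsDiff 9 (Get 2 (Reg 8)) (Get 2 (Reg 6)))
     (Seq (Put 2 (Reg 1) (Half (Add (Add (Get 2 (Reg 5)) (Get 2 (Reg 6))) (Add (Reg 9) (Num 2)))))
     (Seq (Put 8 (Reg 1) (Sub (Get 2 (Reg 1)) (Get 2 (Reg 5))))
     (Seq (Put 4 (Reg 5) (Reg 1))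
     (Seq (Put 5 (Reg 1) (Reg 5))
     (Seq (Put 4 (Reg 1) (Reg 6))
     (Seq (Put 5 (Reg 6) (Reg 1))
      (Assign 4 (Add (Reg 4) (Num 1)))))))))"

text \<open>The first and the last vertex keep the artificial ends set before the
  conditional.\<close>

definition main_loop :: com where
  "main_loop = While (Less (Reg 4) (Add (Reg 0) (Num 1)))
     (Seq (Assign 1 (Get 3 (Reg 4)))
     (Seq (Assign 5 (Reg 0))
     (Seq (Assign 6 (Add (Reg 0) (Num 1)))
     (Seq (Cond (Conj (Less (Num 1) (Reg 4)) (Less (Reg 4) (Reg 0))) find_ends Skip)
     (Seq (Assign 8 (Reg 5))
     (Seq (Assign 7 (Get 4 (Reg 5)))
     (Seq (Assign 9 (Num 0))
     (Seq walk place))))))))"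

text \<open>Runs through the ordering backwards: a covering vertex is later than what it covers, so
  its abscissa is final when it is read.\<close>

definition x_loop :: com where
  "x_loop = While (Less (Num 0) (Reg 4))
     (Seq (Assign 1 (Get 3 (Reg 4)))
     (Seq (Put 1 (Reg 1) (Add (Sub (Get 1 (Get 7 (Reg 1))) (Get 8 (Get 7 (Reg 1)))) (Get 1 (Reg 1))))
      (Assign 4 (Sub (Reg 4) (Num 1)))))"

text \<open>The last two commands give the artificial ends the abscissas that
  \<open>contour_drawing\<close> prescribes.\<close>

definition draw :: com where
  "draw =
     Seq (Assign 0 (Get 0 (Num 0)))
     (Seq prepare_loop
     (Seq (Put 4 (Reg 0) (Add (Reg 0) (Num 1)))
     (Seq (Put 5 (Add (Reg 0) (Num 1)) (Reg 0))
     (Seq (Put 2 (Reg 0) (Num (-1)))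
     (Seq (Put 2 (Add (Reg 0) (Num 1)) (Num (-1)))
     (Seq (Assign 4 (Num 1))
     (Seq main_loop
     (Seq (Put 1 (Get 3 (Reg 0)) (Sub (Reg 0) (Num 1)))
     (Seq (Assign 4 (Sub (Reg 0) (Num 1)))
     (Seq x_loop
     (Seq (Put 1 (Reg 0) (Num (-1)))
      (Put 1 (Add (Reg 0) (Num 1)) (Sub (Add (Reg 0) (Reg 0)) (Num 1))))))))))))))"

lemma nth_concat_offset:
  "u < length xss \<Longrightarrow> j < length (xss ! u) \<Longrightarrow>
    concat xss ! ((\<Sum>w<u. length (xss ! w)) + j) = xss ! u ! j \<and>
    (\<Sum>w<u. length (xss ! w)) + j < length (concat xss)"
proof (induction xss arbitrary: u)
  case (Cons xs xss)
  show ?case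
  proof (cases u)
    case 0 then show ?thesis using Cons.prems by (simp add: nth_append)
  next
    case (Suc u')
    have "(\<Sum>w<Suc u'. length ((xs # xss) ! w)) = length xs + (\<Sum>w<u'. length (xss ! w))"
      by (subst sum.lessThan_Suc_shift) simp
    then show ?thesis using Cons.IH[of u'] Cons.prems Suc by (simp add: nth_append add.assoc)
  qed
qed simp

section \<open>Access to the input and the preparation pass\<close>

context ordered_st
begin

definition off :: "nat \<Rightarrow> nat" where "off u = (\<Sum>w<u. length (rot G w))"

definition inp :: "int \<Rightarrow> int" where "inp = arrs (initial_state (encode G \<pi>)) 0"

lemma off_Suc: "off (Suc u) = off u + length (rot G u)" by (simp add: off_def)

lemma inp_nat: "i < length (encode G \<pi>) \<Longrightarrow> inp (int i) = encode G \<pi> ! i"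
  by (simp add: inp_def initial_state_def)

lemma encode_eq: "encode G \<pi> = [int (nv G)] @ map (\<lambda>u. int (\<pi> u)) [0..<nv G] @ map (\<lambda>u. int (off u)) [0..<Suc (nv G)] @
    map int (concat (map (rot G) [0..<nv G]))"
  by (simp add: encode_def off_def o_def del: upt_Suc)

lemma inp_n: "inp 0 = int (nv G)"
  using inp_nat[of 0] by (simp add: encode_eq del: upt_Suc)

lemma inp_pi: "u < nv G \<Longrightarrow> inp (1 + int u) = int (\<pi> u)"
  using inp_nat[of "Suc u"] by (simp add: encode_eq nth_append del: upt_Suc)

lemma inp_off: "u \<le> nv G \<Longrightarrow> inp (1 + int (nv G) + int u) = int (off u)"
  using inp_nat[of "Suc (nv G + u)"] by (simp add: encode_eq nth_append add.assoc del: upt_Suc)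

lemma inp_rot: "u < nv G \<Longrightarrow> j < length (rot G u) \<Longrightarrow>
    inp (2 + (int (nv G) + int (nv G)) + int (off u + j)) = int (rot G u ! j)"
proof -
  assume u: "u < nv G" and j: "j < length (rot G u)"
  let ?cc = "concat (map (rot G) [0..<nv G])" and ?i = "Suc (Suc (nv G + nv G + (off u + j)))"
  have o: "(\<Sum>w<u. length (map (rot G) [0..<nv G] ! w)) = off u"
    unfolding off_def using u by (intro sum.cong) auto
  have c: "?cc ! (off u + j) = rot G u ! j" "off u + j < length ?cc"
    using nth_concat_offset[of u "map (rot G) [0..<nv G]" j] u j o by auto
  have "encode G \<pi> ! ?i = int (?cc ! (off u + j))"
    using c(2) by (simp add: encode_eq nth_append nth_Cons' del: upt_Suc map_concat)
  moreover have "?i < length (encode G \<pi>)" using c(2) by (simp add: encode_eq del: upt_Suc)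
  ultimately have "inp (int ?i) = int (rot G u ! j)" using inp_nat[of ?i] c(1) by simp
  then show ?thesis by (simp add: algebra_simps)
qed

definition pif :: "int \<Rightarrow> int" where "pif i = inp (1 + i)"
definition offf :: "int \<Rightarrow> int" where "offf i = inp (1 + int (nv G) + i)"
definition rotf :: "int \<Rightarrow> int" where "rotf i = inp (2 + (int (nv G) + int (nv G)) + i)"

lemma aval_Pi [simp]: "arrs \<sigma> 0 = inp \<Longrightarrow> aval (Pi e) \<sigma> = pif (aval e \<sigma>)"
  by (simp add: Pi_def pif_def)
lemma aval_Off [simp]: "arrs \<sigma> 0 = inp \<Longrightarrow> regs \<sigma> 0 = int (nv G) \<Longrightarrow> aval (Off e) \<sigma> = offf (aval e \<sigma>)"
  by (simp add: Off_def offf_def)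
lemma aval_Rot [simp]: "arrs \<sigma> 0 = inp \<Longrightarrow> regs \<sigma> 0 = int (nv G) \<Longrightarrow> aval (Rot e) \<sigma> = rotf (aval e \<sigma>)"
  by (simp add: Rot_def rotf_def)

lemma pif: "u < nv G \<Longrightarrow> pif (int u) = int (\<pi> u)" by (simp add: pif_def inp_pi)
lemma offf: "u \<le> nv G \<Longrightarrow> offf (int u) = int (off u)" by (simp add: offf_def inp_off)
lemma rotf: "u < nv G \<Longrightarrow> j < length (rot G u) \<Longrightarrow> i = int (off u + j) \<Longrightarrow> rotf i = int (rot G u ! j)"
  using inp_rot[of u j] by (simp add: rotf_def)

lemma rot_less: "u < nv G \<Longrightarrow> j < length (rot G u) \<Longrightarrow> rot G u ! j < nv G"
  using rot_set[of u] arcs_verts nth_mem[of j "rot G u"] unfolding verts_def by auto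

definition marks :: "nat \<Rightarrow> nat \<Rightarrow> nat \<Rightarrow> bool" where
  "marks u m w \<longleftrightarrow> (\<exists>j<m. Suc j < length (rot G u) \<and> rot G u ! Suc j = w \<and> \<pi> u < \<pi> w \<and> \<pi> w < \<pi> (rot G u ! j))"

definition flags :: "nat \<Rightarrow> nat \<Rightarrow> (int \<Rightarrow> int) \<Rightarrow> bool" where
  "flags u m f \<longleftrightarrow> (\<forall>w. f (int w) = (if (\<exists>u'<u. marks u' (length (rot G u')) w) \<or> marks u m w then 1 else 0))"

lemma tc_flag_loop:
  assumes u: "u < nv G" and \<sigma>: "arrs \<sigma> 0 = inp" "regs \<sigma> 0 = int (nv G)" "regs \<sigma> 1 = int u"
    "regs \<sigma> 2 = int (off u) + 1" "regs \<sigma> 3 = int (off u + length (rot G u))" "flags u 0 (arrs \<sigma> 6)"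
  shows "tc flag_loop \<sigma> (\<lambda>t \<tau>. t \<le> 4 * length (rot G u) + 1 \<and> regs \<tau> 0 = int (nv G) \<and> regs \<tau> 1 = int u \<and>
     (\<forall>A. A \<noteq> 6 \<longrightarrow> arrs \<tau> A = arrs \<sigma> A) \<and> flags u (length (rot G u)) (arrs \<tau> 6))"
proof -
  let ?len = "length (rot G u)"
  define Inv where "Inv i t \<tau> \<longleftrightarrow> t \<le> 4 * i \<and> regs \<tau> 0 = int (nv G) \<and> regs \<tau> 1 = int u \<and>
     regs \<tau> 2 = int (off u) + 1 + int i \<and> regs \<tau> 3 = int (off u + ?len) \<and>
     (\<forall>A. A \<noteq> 6 \<longrightarrow> arrs \<tau> A = arrs \<sigma> A) \<and> flags u i (arrs \<tau> 6)" for i t and \<tau> :: state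
  show ?thesis unfolding flag_loop_def
  \<comment> \<open>The loop starts at the second entry. For an empty list the truncated difference
    is 0, and the test indeed fails at once.\<close>
  proof (rule tc_While[where Inv = Inv and N = "?len - 1"])
    show "Inv 0 0 \<sigma>" using \<sigma> by (simp add: Inv_def)
    fix i t \<tau> assume i: "i < ?len - 1" and I: "Inv i t \<tau>"
    have a0: "arrs \<tau> 0 = inp" using I \<sigma>(1) unfolding Inv_def by simp
    have r2: "rotf (regs \<tau> 2) = int (rot G u ! Suc i)" "rotf (regs \<tau> 2 - 1) = int (rot G u ! i)"
      using i I unfolding Inv_def by (auto intro!: rotf[OF u])
    have p: "pif (int (rot G u ! Suc i)) = int (\<pi> (rot G u ! Suc i))" "pif (int (rot G u ! i)) = int (\<pi> (rot G u ! i))"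
      using rot_less[OF u] i by (auto intro!: pif)
    have marks_Suc: "marks u (Suc i) w \<longleftrightarrow> marks u i w \<or>
        (rot G u ! Suc i = w \<and> \<pi> u < \<pi> w \<and> \<pi> w < \<pi> (rot G u ! i))" for w
      unfolding marks_def using i by (auto simp: less_Suc_eq)
    have regs: "regs \<tau> 0 = int (nv G)" "regs \<tau> 1 = int u" using I unfolding Inv_def by auto
    have b: "bval (Less (Reg 2) (Reg 3)) \<tau>" using I i unfolding Inv_def by simp
    have "tc (Seq (Cond (Conj (Less (Pi (Reg 1)) (Pi (Rot (Reg 2)))) (Less (Pi (Rot (Reg 2))) (Pi (Rot (Sub (Reg 2) (Num 1))))))
        (Put 6 (Rot (Reg 2)) (Num 1)) Skip)
      (Assign 2 (Add (Reg 2) (Num 1)))) \<tau> (\<lambda>t' \<tau>'. Inv (Suc i) (Suc (t + t')) \<tau>')"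
    proof (rule tc_Seq, rule tc_Cond)
      assume "bval (Conj (Less (Pi (Reg 1)) (Pi (Rot (Reg 2)))) (Less (Pi (Rot (Reg 2))) (Pi (Rot (Sub (Reg 2) (Num 1)))))) \<tau>"
      then have c: "\<pi> u < \<pi> (rot G u ! Suc i)" "\<pi> (rot G u ! Suc i) < \<pi> (rot G u ! i)"
        using a0 regs r2 p pif[OF u] by simp_all
      have fl: "flags u (Suc i) ((arrs \<tau> 6)(int (rot G u ! Suc i) := 1))"
        using I c unfolding Inv_def flags_def marks_Suc by auto
      show "tc (Put 6 (Rot (Reg 2)) (Num 1)) \<tau> (\<lambda>k \<tau>. tc (Assign 2 (Add (Reg 2) (Num 1))) \<tau>
          (\<lambda>l \<tau>'. Inv (Suc i) (Suc (t + (Suc k + l))) \<tau>'))"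
        by (rule tc_Put, rule tc_Assign) (use I fl a0 regs r2 in \<open>simp add: Inv_def\<close>)
    next
      assume "\<not> bval (Conj (Less (Pi (Reg 1)) (Pi (Rot (Reg 2)))) (Less (Pi (Rot (Reg 2))) (Pi (Rot (Sub (Reg 2) (Num 1)))))) \<tau>"
      then have c: "\<not> (\<pi> u < \<pi> (rot G u ! Suc i) \<and> \<pi> (rot G u ! Suc i) < \<pi> (rot G u ! i))"
        using a0 regs r2 p pif[OF u] by simp
      have fl: "flags u (Suc i) (arrs \<tau> 6)"
        using I c unfolding Inv_def flags_def marks_Suc by auto
      show "tc Skip \<tau> (\<lambda>k \<tau>. tc (Assign 2 (Add (Reg 2) (Num 1))) \<tau>
          (\<lambda>l \<tau>'. Inv (Suc i) (Suc (t + (Suc k + l))) \<tau>'))"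
        by (rule tc_Skip, rule tc_Assign) (use I fl in \<open>simp add: Inv_def\<close>)
    qed
    then show "bval (Less (Reg 2) (Reg 3)) \<tau> \<and> tc (Seq (Cond (Conj (Less (Pi (Reg 1)) (Pi (Rot (Reg 2)))) (Less (Pi (Rot (Reg 2))) (Pi (Rot (Sub (Reg 2) (Num 1))))))
        (Put 6 (Rot (Reg 2)) (Num 1)) Skip)
      (Assign 2 (Add (Reg 2) (Num 1)))) \<tau> (\<lambda>t' \<tau>'. Inv (Suc i) (Suc (t + t')) \<tau>')" using b by blast
  next
    fix t \<tau> assume I: "Inv (?len - 1) t \<tau>"
    have "marks u (?len - 1) w \<longleftrightarrow> marks u ?len w" for w
    proof -
      have "j < ?len - 1 \<and> Suc j < ?len \<longleftrightarrow> j < ?len \<and> Suc j < ?len" for j by auto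
      then show ?thesis unfolding marks_def by blast
    qed
    then have "flags u ?len (arrs \<tau> 6)" using I unfolding Inv_def flags_def by simp
    then show "\<not> bval (Less (Reg 2) (Reg 3)) \<tau> \<and> Suc t \<le> 4 * ?len + 1 \<and> regs \<tau> 0 = int (nv G) \<and> regs \<tau> 1 = int u \<and>
     (\<forall>A. A \<noteq> 6 \<longrightarrow> arrs \<tau> A = arrs \<sigma> A) \<and> flags u ?len (arrs \<tau> 6)"
      using I unfolding Inv_def by auto
  qed
qed

lemma flags_next: "flags u (length (rot G u)) f \<Longrightarrow> flags (Suc u) 0 f"
  unfolding flags_def by (auto simp: less_Suc_eq marks_def)

lemma flags_all: "flags (nv G) 0 f \<Longrightarrow> f (int w) = (if left_higher G \<pi> w then 1 else 0)"
proof -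
  assume "flags (nv G) 0 f"
  moreover have "(\<exists>u'<nv G. marks u' (length (rot G u')) w) \<longleftrightarrow> left_higher G \<pi> w"
    unfolding marks_def left_higher_def using Suc_lessD by blast
  ultimately show ?thesis unfolding flags_def marks_def by simp
qed

lemma tc_prepare_loop:
  assumes \<sigma>: "arrs \<sigma> 0 = inp" "regs \<sigma> 0 = int (nv G)" "regs \<sigma> 1 = 0" "arrs \<sigma> 6 = (\<lambda>_. 0)"
  shows "tc prepare_loop \<sigma> (\<lambda>t \<tau>. t \<le> 10 * nv G + 4 * off (nv G) + 1 \<and> regs \<tau> 0 = int (nv G) \<and>
     (\<forall>A. A \<noteq> 3 \<and> A \<noteq> 6 \<longrightarrow> arrs \<tau> A = arrs \<sigma> A) \<and>
     (\<forall>k<nv G. arrs \<tau> 3 (int (Suc k)) = int (vtx G \<pi> (Suc k))) \<and>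
     (\<forall>w. arrs \<tau> 6 (int w) = (if left_higher G \<pi> w then 1 else 0)))"
proof -
  define Inv where "Inv i t \<tau> \<longleftrightarrow> t \<le> 10 * i + 4 * off i \<and> regs \<tau> 0 = int (nv G) \<and> regs \<tau> 1 = int i \<and>
     (\<forall>A. A \<noteq> 3 \<and> A \<noteq> 6 \<longrightarrow> arrs \<tau> A = arrs \<sigma> A) \<and>
     (\<forall>u<i. arrs \<tau> 3 (int (\<pi> u)) = int u) \<and> flags i 0 (arrs \<tau> 6)" for i t and \<tau> :: state
  show ?thesis unfolding prepare_loop_def
  proof (rule tc_While[where Inv = Inv and N = "nv G"], goal_cases)
    case 1
    show ?case using \<sigma> by (simp add: Inv_def off_def flags_def marks_def)
  next
    case (2 i t \<tau>)
    then have I: "Inv i t \<tau>" and i: "i < nv G" by auto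
    have a0: "arrs \<tau> 0 = inp" using I \<sigma>(1) unfolding Inv_def by simp
    have regs: "regs \<tau> 0 = int (nv G)" "regs \<tau> 1 = int i" using I unfolding Inv_def by auto
    define \<tau>1 where "\<tau>1 = \<tau>\<lparr>arrs := (arrs \<tau>)(3 := (arrs \<tau> 3)(int (\<pi> i) := int i)),
        regs := (regs \<tau>)(2 := int (off i) + 1, 3 := int (off (Suc i)))\<rparr>"
    have p3: "arrs \<tau>1 3 (int (\<pi> u)) = int u" if "u < Suc i" for u
    proof -
      have "\<pi> u = \<pi> i \<Longrightarrow> u = i" using pi_inj[of u i] that i by (simp add: verts_def)
      then show ?thesis using I that unfolding Inv_def \<tau>1_def by (auto simp: less_Suc_eq)
    qed
    have fl: "tc flag_loop \<tau>1 (\<lambda>t \<tau>. t \<le> 4 * length (rot G i) + 1 \<and> regs \<tau> 0 = int (nv G) \<and> regs \<tau> 1 = int i \<and>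
     (\<forall>A. A \<noteq> 6 \<longrightarrow> arrs \<tau> A = arrs \<tau>1 A) \<and> flags i (length (rot G i)) (arrs \<tau> 6))"
      by (rule tc_flag_loop[OF i]) (use I a0 regs in \<open>auto simp: \<tau>1_def Inv_def off_Suc\<close>)
    have offs: "offf (int i) = int (off i)" "offf (int i + 1) = int (off (Suc i))"
      using offf[of i] offf[of "Suc i"] i by (auto simp: add.commute)
    have "tc (Seq flag_loop (Assign 1 (Add (Reg 1) (Num 1)))) \<tau>1 (\<lambda>t' \<tau>'. Inv (Suc i) (Suc (t + (1 + (1 + (1 + t'))))) \<tau>')"
    proof (rule tc_Seq, rule tc_conseq[OF fl], rule tc_Assign, goal_cases)
      case (1 k \<tau>2)
      have frame: "arrs \<tau>2 A = arrs \<sigma> A" if "A \<noteq> 3" "A \<noteq> 6" for A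
        using 1 that I unfolding Inv_def \<tau>1_def by simp
      have "arrs \<tau>2 3 = arrs \<tau>1 3" using 1 by simp
      then show ?case using 1 I flags_next[of i "arrs \<tau>2 6"] p3 frame
        unfolding Inv_def by (simp add: off_Suc)
    qed
    then have "tc (Seq (Put 3 (Pi (Reg 1)) (Reg 1)) (Seq (Assign 2 (Add (Off (Reg 1)) (Num 1)))
         (Seq (Assign 3 (Off (Add (Reg 1) (Num 1)))) (Seq flag_loop (Assign 1 (Add (Reg 1) (Num 1)))))))
       \<tau> (\<lambda>t' \<tau>'. Inv (Suc i) (Suc (t + t')) \<tau>')"
      using a0 regs offs pif[OF i] unfolding \<tau>1_def
      by - (rule tc_Seq, rule tc_Put, rule tc_Seq, rule tc_Assign, rule tc_Seq, rule tc_Assign, simp add: fun_upd_def)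
    then show ?case using regs i by simp
  next
    case (3 t \<tau>)
    then have I: "Inv (nv G) t \<tau>" .
    have "arrs \<tau> 3 (int (Suc k)) = int (vtx G \<pi> (Suc k))" if "k < nv G" for k
      using I vtx[OF that] unfolding Inv_def verts_def by (metis lessThan_iff)
    moreover have "arrs \<tau> 6 (int w) = (if left_higher G \<pi> w then 1 else 0)" for w
      using I flags_all[of "arrs \<tau> 6" w] unfolding Inv_def by blast
    ultimately show ?case using I unfolding Inv_def by simp
  qed
qed

end

subsection \<open>Correctness and running time\<close>

lemma tc_Seq_bound:
  assumes "tc p \<sigma> (\<lambda>k \<tau>. k \<le> a \<and> R \<tau>)" "\<And>\<tau>. R \<tau> \<Longrightarrow> tc q \<tau> (\<lambda>k \<tau>'. k \<le> b \<and> R' \<tau>')"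
  shows "tc (Seq p q) \<sigma> (\<lambda>k \<tau>'. k \<le> a + b \<and> R' \<tau>')"
proof (rule tc_Seq, rule tc_conseq[OF assms(1)])
  fix k \<tau> assume "k \<le> a \<and> R \<tau>"
  then show "tc q \<tau> (\<lambda>l \<tau>'. k + l \<le> a + b \<and> R' \<tau>')"
    using tc_conseq[OF assms(2)[of \<tau>]] by fastforce
qed

text \<open>The distance of two integers has the parity of their sum, and the inner terms occur
  twice. Thus the halving in \<open>place\<close> is exact.\<close>

lemma tv_parity: "xs \<noteq> [] \<Longrightarrow> even (tv xs + hd xs + last xs)"
  by (induction xs rule: tv.induct) (auto simp: abs_if)

lemma tv_take:
  assumes "i < length M"
  shows "tv (map Y (l # take (Suc i) M)) = tv (map Y (l # take i M)) + \<bar>Y (M ! i) - Y ((l # M) ! i)\<bar>"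
proof -
  have 1: "l # take i M = take i (l # M) @ [(l # M) ! i]"
    using assms take_Suc_conv_app_nth[of i "l # M"] by simp
  have "l # take (Suc i) M = (l # take i M) @ [M ! i]" using assms by (simp add: take_Suc_conv_app_nth)
  also have "\<dots> = take i (l # M) @ (l # M) ! i # [M ! i]" unfolding 1 by simp
  finally have "tv (map Y (l # take (Suc i) M)) = tv (map Y (take i (l # M)) @ Y ((l # M) ! i) # [Y (M ! i)])"
    by simp
  also have "\<dots> = tv (map Y (take i (l # M)) @ [Y ((l # M) ! i)]) + tv (Y ((l # M) ! i) # [Y (M ! i)])"
    by (rule tv_append)
  also have "map Y (take i (l # M)) @ [Y ((l # M) ! i)] = map Y (l # take i M)" unfolding 1 by simp
  finally show ?thesis by simp
qed

context ordered_st
begin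

lemma tc_skip_in:
  assumes v: "v < nv G" and rot: "rot G v = A @ z # B" and A: "\<forall>x\<in>set A. \<pi> x < k" and z: "\<not> \<pi> z < k"
    and \<sigma>: "arrs \<sigma> 0 = inp" "regs \<sigma> 0 = int (nv G)" "regs \<sigma> 4 = int k" "regs \<sigma> 2 = int (off v)"
  shows "tc skip_in \<sigma> (\<lambda>t \<tau>. t \<le> 2 * length A + 1 \<and> \<tau> = \<sigma>\<lparr>regs := (regs \<sigma>)(2 := int (off v + length A))\<rparr>)"
proof -
  define Inv where "Inv i t \<tau> \<longleftrightarrow> t \<le> 2 * i \<and> \<tau> = \<sigma>\<lparr>regs := (regs \<sigma>)(2 := int (off v + i))\<rparr>" for i t and \<tau> :: state
  have val: "pif (rotf (int (off v + i))) = int (\<pi> (rot G v ! i))" if "i < length (rot G v)" for i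
    using rotf[OF v that refl] rot_less[OF v that] by (simp add: pif)
  show ?thesis unfolding skip_in_def
  proof (rule tc_While[where Inv = Inv and N = "length A"], goal_cases)
    case 1
    have "\<sigma> = \<sigma>\<lparr>regs := (regs \<sigma>)(2 := int (off v))\<rparr>" using \<sigma>(4) by (metis fun_upd_triv state.surjective state.update_convs(1))
    then show ?case by (simp add: Inv_def)
  next
    case (2 i t \<tau>)
    then have b: "bval (Less (Pi (Rot (Reg 2))) (Reg 4)) \<tau>"
      using \<sigma> val[of i] A rot by (auto simp: Inv_def nth_append simp del: of_nat_add)
    show ?case using b 2 by (auto intro!: tc_Assign simp: Inv_def add_ac)
  next
    case (3 t \<tau>)
    then show ?case using \<sigma> val[of "length A"] z rot by (auto simp: Inv_def nth_append simp del: of_nat_add)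
  qed
qed

lemma tc_skip_out:
  assumes v: "v < nv G" and rot: "rot G v = X @ A @ z # B" and A: "\<forall>x\<in>set A. k < \<pi> x" and z: "\<not> k < \<pi> z"
    and \<sigma>: "arrs \<sigma> 0 = inp" "regs \<sigma> 0 = int (nv G)" "regs \<sigma> 4 = int k" "regs \<sigma> 2 = int (off v + length X)"
  shows "tc skip_out \<sigma> (\<lambda>t \<tau>. t \<le> 2 * length A + 1 \<and> \<tau> = \<sigma>\<lparr>regs := (regs \<sigma>)(2 := int (off v + (length X + length A)))\<rparr>)"
proof -
  define Inv where "Inv i t \<tau> \<longleftrightarrow> t \<le> 2 * i \<and> \<tau> = \<sigma>\<lparr>regs := (regs \<sigma>)(2 := int (off v + (length X + i)))\<rparr>" for i t and \<tau> :: state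
  have val: "pif (rotf (int (off v + i))) = int (\<pi> (rot G v ! i))" if "i < length (rot G v)" for i
    using rotf[OF v that refl] rot_less[OF v that] by (simp add: pif)
  show ?thesis unfolding skip_out_def
  proof (rule tc_While[where Inv = Inv and N = "length A"], goal_cases)
    case 1
    have "\<sigma> = \<sigma>\<lparr>regs := (regs \<sigma>)(2 := int (off v + length X))\<rparr>" using \<sigma>(4) by (metis fun_upd_triv state.surjective state.update_convs(1))
    then show ?case by (simp add: Inv_def)
  next
    case (2 i t \<tau>)
    then have b: "bval (Less (Reg 4) (Pi (Rot (Reg 2)))) \<tau>"
      using \<sigma> val[of "length X + i"] A rot by (auto simp: Inv_def nth_append simp del: of_nat_add)
    show ?case using b 2 by (auto intro!: tc_Assign simp: Inv_def add_ac)
  next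
    case (3 t \<tau>)
    then show ?case using \<sigma> val[of "length X + length A"] z rot by (auto simp: Inv_def nth_append simp del: of_nat_add)
  qed
qed

end

section \<open>The program follows the contour\<close>

locale contour_sequence = ordered_st +
  fixes C P M S :: "nat \<Rightarrow> nat list" and l r :: "nat \<Rightarrow> nat"
  assumes C0: "C 0 = [nv G, Suc (nv G)]"
    and att: "k < nv G \<Longrightarrow> attach G \<pi> k (C k) (P k) (l k) (M k) (r k) (S k) (C (Suc k))"
    and inv: "k \<le> nv G \<Longrightarrow> contour_inv G \<pi> k (C k)"
begin

abbreviation "vk k \<equiv> vtx G \<pi> (Suc k)"

lemma C_split: "k < nv G \<Longrightarrow> C k = P k @ l k # M k @ r k # S k"
  and C_Suc: "k < nv G \<Longrightarrow> C (Suc k) = P k @ l k # vk k # r k # S k"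
  using att unfolding attach_def Let_def by blast+

lemma C_distinct: "k \<le> nv G \<Longrightarrow> distinct (C k)"
  and C_ends: "k \<le> nv G \<Longrightarrow> hd (C k) = nv G" "k \<le> nv G \<Longrightarrow> last (C k) = Suc (nv G)"
  and C_set: "k \<le> nv G \<Longrightarrow> set (C k) \<subseteq> insert (nv G) (insert (Suc (nv G)) {v \<in> verts G. \<pi> v \<le> k})"
  using inv unfolding contour_inv_def by blast+

lemma vk_less: "k < nv G \<Longrightarrow> vk k < nv G"
  using vtx(1)[of k] by (simp add: verts_def)

lemma vk_inj: "k < nv G \<Longrightarrow> k' < nv G \<Longrightarrow> vk k = vk k' \<longleftrightarrow> k = k'"
  using vtx(2) by (metis nat.inject)

lemma vk_notin_C: "k < nv G \<Longrightarrow> k' \<le> k \<Longrightarrow> vk k \<notin> set (C k')"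
  using C_set[of k'] vtx[of k] vk_less[of k] by fastforce

lemma M_verts: "k < nv G \<Longrightarrow> w \<in> set (M k) \<Longrightarrow> w \<in> verts G \<and> \<pi> w \<le> k"
proof -
  assume k: "k < nv G" and w: "w \<in> set (M k)"
  have "hd (C k) = hd (P k @ [l k])" "last (C k) = last (r k # S k)"
    unfolding C_split[OF k] by (simp_all add: hd_append)
  then have "nv G \<in> set (P k @ [l k])" "Suc (nv G) \<in> set (r k # S k)"
    using C_ends[of k] k by (metis hd_in_set less_imp_le snoc_eq_iff_butlast, metis last_in_set less_imp_le list.distinct(1))
  moreover have "set (M k) \<inter> set (P k @ [l k]) = {}" "set (M k) \<inter> set (r k # S k) = {}"
    using C_distinct[of k] k unfolding C_split[OF k] by auto
  ultimately have "w \<noteq> nv G" "w \<noteq> Suc (nv G)" using w by blast+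
  then show ?thesis using C_set[of k] k w unfolding C_split[OF k] by auto
qed

lemma M_notin_later: "Suc k \<le> m \<Longrightarrow> m \<le> nv G \<Longrightarrow> w \<in> set (M k) \<Longrightarrow> w \<notin> set (C m)"
proof (induction m rule: dec_induct)
  case base
  then have k: "k < nv G" by simp
  have "w \<noteq> vk k" using M_verts[OF k base(2)] vtx(2)[OF k] by auto
  then show ?case using C_distinct[of k] k base(2) unfolding C_Suc[OF k] C_split[OF k] by auto
next
  case (step m)
  then have m: "m < nv G" by simp
  have "w \<noteq> vk m" using M_verts[of k w] step vtx(2)[OF m] by auto
  then show ?case using step unfolding C_Suc[OF m] C_split[OF m] by auto
qed

lemma M_disjoint: "k < m \<Longrightarrow> m < nv G \<Longrightarrow> w \<in> set (M k) \<Longrightarrow> w \<notin> set (M m)"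
  using M_notin_later[of k m w] C_split[of m] by auto

definition linked :: "nat list \<Rightarrow> state \<Rightarrow> bool" where
  "linked ws \<sigma> \<longleftrightarrow> (\<forall>(a, b)\<in>links ws. arrs \<sigma> 4 (int a) = int b \<and> arrs \<sigma> 5 (int b) = int a)"

text \<open>In the rotation list of v the incoming edges have smaller and the outgoing ones larger
  order numbers than v, so two scans find the borders of the outgoing block in time linear in the
  degree.\<close>

lemma tc_find_ends:
  assumes k: "0 < k" "Suc k < nv G"
    and \<sigma>: "arrs \<sigma> 0 = inp" "regs \<sigma> 0 = int (nv G)" "regs \<sigma> 1 = int (vk k)" "regs \<sigma> 4 = int (Suc k)"
      "\<forall>w. arrs \<sigma> 6 (int w) = (if left_higher G \<pi> w then 1 else 0)" "linked (C k) \<sigma>"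
  shows "tc find_ends \<sigma> (\<lambda>t \<tau>. t \<le> 2 * length (rot G (vk k)) + 10 \<and> arrs \<tau> = arrs \<sigma> \<and>
     (\<forall>q\<in>{0, 1, 4}. regs \<tau> q = regs \<sigma> q) \<and> regs \<tau> 5 = int (l k) \<and> regs \<tau> 6 = int (r k))"
proof -
  let ?v = "vk k"
  have k': "k < nv G" using k by simp
  note v = vtx[OF k'] and vl = vk_less[OF k']
  obtain X Y where XY: "rot G ?v = X @ succ_list G ?v @ Y" "Y \<noteq> []"
    and lr: "if last (Y @ X) \<noteq> hd Y then l k = last (Y @ X) \<and> r k = hd Y
         else M k = [] \<and> (if left_higher G \<pi> ?v then l k = hd Y else r k = hd Y)"
    using att[OF k'] k unfolding attach_def Let_def by auto
  have d: "distinct (rot G ?v)" by (rule rot_distinct[OF v(1)])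
  have in_arc: "\<pi> w < Suc k" if "w \<in> set X \<union> set Y" for w
  proof -
    have "w \<notin> set (succ_list G ?v)" using d that unfolding XY(1) by auto
    then have "(w, ?v) \<in> arcs G" using rot_set[OF v(1)] that unfolding in_succ_list XY(1) by auto
    then show ?thesis using pi_mono v(2) by fastforce
  qed
  have out_arc: "Suc k < \<pi> w" if "w \<in> set (succ_list G ?v)" for w
    using that pi_mono[of ?v w] v(2) unfolding in_succ_list by simp
  have "?v \<noteq> snk G" using pi_snk v(2) k by auto
  then have "succ_list G ?v \<noteq> []" using ex_out_arc[OF v(1)] set_succ_list[OF v(1)] by auto
  then obtain o1 O' where O: "succ_list G ?v = o1 # O'" by (cases "succ_list G ?v") auto
  obtain y1 Y' where Y: "Y = y1 # Y'" using XY(2) by (cases Y) auto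
  let ?o = "off ?v" and ?lX = "length X" and ?lO = "length (succ_list G ?v)"
  have offs: "offf (int ?v) = int ?o" "offf (int ?v + 1) = int (off (Suc ?v))"
    using offf[of ?v] offf[of "Suc ?v"] vl by (auto simp: add.commute)
  define \<sigma>1 where "\<sigma>1 = \<sigma>\<lparr>regs := (regs \<sigma>)(2 := int ?o, 3 := int (off (Suc ?v)))\<rparr>"
  define \<sigma>2 where "\<sigma>2 = \<sigma>1\<lparr>regs := (regs \<sigma>1)(2 := int (?o + ?lX))\<rparr>"
  define \<sigma>3 where "\<sigma>3 = \<sigma>2\<lparr>regs := (regs \<sigma>2)(5 := int (last (Y @ X)))\<rparr>"
  define \<sigma>4 where "\<sigma>4 = \<sigma>3\<lparr>regs := (regs \<sigma>3)(2 := int (?o + (?lX + ?lO)))\<rparr>"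
  define \<sigma>5 where "\<sigma>5 = \<sigma>4\<lparr>regs := (regs \<sigma>4)(6 := int (hd Y))\<rparr>"
  have s1: "tc (Assign 2 (Off (Reg 1))) \<sigma> (\<lambda>t \<tau>. t \<le> 1 \<and> \<tau> = \<sigma>\<lparr>regs := (regs \<sigma>)(2 := int ?o)\<rparr>)"
    by (rule tc_Assign) (use \<sigma> offs in simp)
  have s2: "tc (Assign 3 (Off (Add (Reg 1) (Num 1)))) (\<sigma>\<lparr>regs := (regs \<sigma>)(2 := int ?o)\<rparr>) (\<lambda>t \<tau>. t \<le> 1 \<and> \<tau> = \<sigma>1)"
    by (rule tc_Assign) (use \<sigma> offs in \<open>simp add: \<sigma>1_def\<close>)
  have s3: "tc skip_in \<sigma>1 (\<lambda>t \<tau>. t \<le> 2 * ?lX + 1 \<and> \<tau> = \<sigma>2)"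
    unfolding \<sigma>2_def
    by (rule tc_skip_in[OF vl, of X o1 "O' @ Y" "Suc k"])
      (use XY O \<sigma> in_arc out_arc[of o1] in \<open>auto simp: \<sigma>1_def\<close>)
  have s4: "tc (Cond (Less (Off (Reg 1)) (Reg 2)) (Assign 5 (Rot (Sub (Reg 2) (Num 1)))) (Assign 5 (Rot (Sub (Reg 3) (Num 1)))))
      \<sigma>2 (\<lambda>t \<tau>. t \<le> 2 \<and> \<tau> = \<sigma>3)"
  proof (rule tc_Cond)
    assume "bval (Less (Off (Reg 1)) (Reg 2)) \<sigma>2"
    then have X: "X \<noteq> []" using \<sigma> offs by (auto simp: \<sigma>2_def \<sigma>1_def)
    have "rot G ?v ! (?lX - 1) = last X" using X unfolding XY(1) by (simp add: nth_append last_conv_nth)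
    then have "rotf (int (?o + ?lX) - 1) = int (last (Y @ X))"
      using rotf[OF vl, of "?lX - 1" "int (?o + ?lX) - 1"] X XY(1) by (cases X) auto
    then show "tc (Assign 5 (Rot (Sub (Reg 2) (Num 1)))) \<sigma>2 (\<lambda>k \<tau>. Suc k \<le> 2 \<and> \<tau> = \<sigma>3)"
      by (intro tc_Assign) (use \<sigma> in \<open>simp add: \<sigma>3_def \<sigma>2_def \<sigma>1_def\<close>)
  next
    assume "\<not> bval (Less (Off (Reg 1)) (Reg 2)) \<sigma>2"
    then have X: "X = []" using \<sigma> offs by (auto simp: \<sigma>2_def \<sigma>1_def)
    have ne: "rot G ?v \<noteq> []" using XY by auto
    then have lp: "0 < length (rot G ?v)" by simp
    have "rot G ?v ! (length (rot G ?v) - 1) = last (rot G ?v)" by (simp only: last_conv_nth[OF ne])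
    also have "\<dots> = last Y" using XY by simp
    finally have "rotf (int (off (Suc ?v)) - 1) = int (last (Y @ X))"
      using rotf[OF vl, of "length (rot G ?v) - 1" "int (off (Suc ?v)) - 1"] X lp by (auto simp: off_Suc)
    then show "tc (Assign 5 (Rot (Sub (Reg 3) (Num 1)))) \<sigma>2 (\<lambda>k \<tau>. Suc k \<le> 2 \<and> \<tau> = \<sigma>3)"
      by (intro tc_Assign) (use \<sigma> in \<open>simp add: \<sigma>3_def \<sigma>2_def \<sigma>1_def\<close>)
  qed
  have s5: "tc skip_out \<sigma>3 (\<lambda>t \<tau>. t \<le> 2 * ?lO + 1 \<and> \<tau> = \<sigma>4)"
    unfolding \<sigma>4_def
    by (rule tc_skip_out[OF vl, of X _ y1 Y' "Suc k"])
      (use XY Y \<sigma> in_arc[of y1] out_arc in \<open>auto simp: \<sigma>3_def \<sigma>2_def \<sigma>1_def\<close>)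
  have hdY: "rotf (int (?o + (?lX + ?lO))) = int (hd Y)"
  proof -
    have "rot G ?v ! (?lX + ?lO) = hd Y" "?lX + ?lO < length (rot G ?v)" unfolding XY(1) Y by (auto simp: nth_append)
    then show ?thesis using rotf[OF vl, of "?lX + ?lO"] by simp
  qed
  have s6: "tc (Assign 6 (Rot (Reg 2))) \<sigma>4 (\<lambda>t \<tau>. t \<le> 1 \<and> \<tau> = \<sigma>5)"
    by (rule tc_Assign) (use \<sigma> hdY in \<open>simp add: \<sigma>5_def \<sigma>4_def \<sigma>3_def \<sigma>2_def \<sigma>1_def\<close>)
  define R where "R \<tau> \<longleftrightarrow> arrs \<tau> = arrs \<sigma> \<and> (\<forall>q\<in>{0, 1, 4}. regs \<tau> q = regs \<sigma> q) \<and>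
      regs \<tau> 5 = int (l k) \<and> regs \<tau> 6 = int (r k)" for \<tau> :: state
  have R5: "arrs \<sigma>5 = arrs \<sigma>" "\<forall>q\<in>{0, 1, 4}. regs \<sigma>5 q = regs \<sigma> q"
     "regs \<sigma>5 5 = int (last (Y @ X))" "regs \<sigma>5 6 = int (hd Y)"
    by (auto simp: \<sigma>5_def \<sigma>4_def \<sigma>3_def \<sigma>2_def \<sigma>1_def)
  have adjacent: "arrs \<sigma> 4 (int (l k)) = int (r k)" "arrs \<sigma> 5 (int (r k)) = int (l k)" if "M k = []"
  proof -
    have "(l k, r k) \<in> links (C k)"
      using links_append[of "P k" "l k" "r k # S k"] that unfolding C_split[OF k'] by simp
    then show "arrs \<sigma> 4 (int (l k)) = int (r k)" "arrs \<sigma> 5 (int (r k)) = int (l k)"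
      using \<sigma>(6) unfolding linked_def by auto
  qed
  have s7: "tc (Cond (Equal (Reg 5) (Reg 6))
        (Cond (Equal (Get 6 (Reg 1)) (Num 1)) (Assign 6 (Get 4 (Reg 5))) (Assign 5 (Get 5 (Reg 6))))
        Skip) \<sigma>5 (\<lambda>t \<tau>. t \<le> 3 \<and> R \<tau>)"
  proof (rule tc_Cond)
    assume "bval (Equal (Reg 5) (Reg 6)) \<sigma>5"
    then have eq: "last (Y @ X) = hd Y" using R5 by simp
    show "tc (Cond (Equal (Get 6 (Reg 1)) (Num 1)) (Assign 6 (Get 4 (Reg 5))) (Assign 5 (Get 5 (Reg 6)))) \<sigma>5
        (\<lambda>k \<tau>. Suc k \<le> 3 \<and> R \<tau>)"
    proof (rule tc_Cond)
      assume "bval (Equal (Get 6 (Reg 1)) (Num 1)) \<sigma>5"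
      then have "left_higher G \<pi> ?v" using R5 \<sigma>(3,5) by (auto split: if_splits)
      then show "tc (Assign 6 (Get 4 (Reg 5))) \<sigma>5 (\<lambda>k \<tau>. Suc (Suc k) \<le> 3 \<and> R \<tau>)"
        by (intro tc_Assign) (use eq lr R5 adjacent in \<open>simp add: R_def\<close>)
    next
      assume "\<not> bval (Equal (Get 6 (Reg 1)) (Num 1)) \<sigma>5"
      then have "\<not> left_higher G \<pi> ?v" using R5 \<sigma>(3,5) by (auto split: if_splits)
      then show "tc (Assign 5 (Get 5 (Reg 6))) \<sigma>5 (\<lambda>k \<tau>. Suc (Suc k) \<le> 3 \<and> R \<tau>)"
        by (intro tc_Assign) (use eq lr R5 adjacent in \<open>simp add: R_def\<close>)
    qed
  next
    assume "\<not> bval (Equal (Reg 5) (Reg 6)) \<sigma>5"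
    then have "last (Y @ X) \<noteq> hd Y" using R5 by simp
    then show "tc Skip \<sigma>5 (\<lambda>k \<tau>. Suc k \<le> 3 \<and> R \<tau>)"
      by (intro tc_Skip) (use lr R5 in \<open>simp add: R_def\<close>)
  qed
  have "tc find_ends \<sigma> (\<lambda>t \<tau>. t \<le> 1 + (1 + ((2 * ?lX + 1) + (2 + ((2 * ?lO + 1) + (1 + 3))))) \<and> R \<tau>)"
    unfolding find_ends_def
    by (rule tc_Seq_bound[OF s1], simp only:, rule tc_Seq_bound[OF s2], simp only:, rule tc_Seq_bound[OF s3], simp only:,
        rule tc_Seq_bound[OF s4], simp only:, rule tc_Seq_bound[OF s5], simp only:, rule tc_Seq_bound[OF s6], simp only:, rule s7)
  moreover have "1 + (1 + ((2 * ?lX + 1) + (2 + ((2 * ?lO + 1) + (1 + 3))))) \<le> 2 * length (rot G ?v) + 10"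
    unfolding XY(1) by simp
  ultimately show ?thesis by (auto elim!: tc_conseq simp: R_def)
qed

text \<open>A covered vertex costs one test, 2 units for the absolute difference and 4 for the
  writes. The walk reads the links of the old contour, which \<open>place\<close> changes only
  afterwards.\<close>

lemma tc_walk:
  assumes k: "k < nv G"
    and \<sigma>: "regs \<sigma> 1 = int (vk k)" "regs \<sigma> 6 = int (r k)" "regs \<sigma> 8 = int (l k)"
      "regs \<sigma> 7 = arrs \<sigma> 4 (int (l k))" "regs \<sigma> 9 = 0" "linked (C k) \<sigma>"
  defines "Y \<equiv> \<lambda>w. arrs \<sigma> 2 (int w)"
  shows "tc walk \<sigma> (\<lambda>t \<tau>. t \<le> 7 * length (M k) + 1 \<and> ((\<forall>q\<in>{0, 1, 4, 5, 6}. regs \<tau> q = regs \<sigma> q) \<and>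
     regs \<tau> 8 = int (last (l k # M k)) \<and> regs \<tau> 9 = tv (map Y (l k # M k)) \<and>
     (\<forall>A. A \<noteq> 1 \<and> A \<noteq> 7 \<longrightarrow> arrs \<tau> A = arrs \<sigma> A) \<and>
     (\<forall>j<length (M k). arrs \<tau> 1 (int (M k ! j)) = 1 + tv (map Y (l k # take (Suc j) (M k))) \<and>
        arrs \<tau> 7 (int (M k ! j)) = int (vk k)) \<and>
     (\<forall>w. w \<notin> set (M k) \<longrightarrow> arrs \<tau> 1 (int w) = arrs \<sigma> 1 (int w) \<and> arrs \<tau> 7 (int w) = arrs \<sigma> 7 (int w))))"
proof -
  let ?M = "M k" and ?ws = "M k @ [r k]" and ?pre = "l k # M k"
  have dist: "distinct (l k # M k @ [r k])" using C_distinct[of k] k unfolding C_split[OF k] by auto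
  have lk: "arrs \<sigma> 4 (int (?pre ! i)) = int (?ws ! i)" if "i < Suc (length ?M)" for i
  proof -
    have "(?pre ! i, ?ws ! i) \<in> links (l k # M k @ [r k])"
      unfolding links_nth using that by (intro exI[of _ i]) (auto simp: nth_append nth_Cons' split: if_splits)
    then have "(?pre ! i, ?ws ! i) \<in> links (C k)"
      using links_append[of "P k" "l k" "M k @ r k # S k"] links_append[of "l k # M k" "r k" "S k"]
      unfolding C_split[OF k] by auto
    then show ?thesis using \<sigma>(6) unfolding linked_def by auto
  qed
  define Inv where "Inv i t \<tau> \<longleftrightarrow> t \<le> 7 * i \<and> (\<forall>q\<in>{0, 1, 4, 5, 6}. regs \<tau> q = regs \<sigma> q) \<and>
     regs \<tau> 8 = int (?pre ! i) \<and> regs \<tau> 7 = int (?ws ! i) \<and> regs \<tau> 9 = tv (map Y (l k # take i ?M)) \<and>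
     (\<forall>A. A \<noteq> 1 \<and> A \<noteq> 7 \<longrightarrow> arrs \<tau> A = arrs \<sigma> A) \<and>
     (\<forall>j<i. arrs \<tau> 1 (int (?M ! j)) = 1 + tv (map Y (l k # take (Suc j) ?M)) \<and> arrs \<tau> 7 (int (?M ! j)) = int (vk k)) \<and>
     (\<forall>w. w \<notin> set (M k) \<longrightarrow> arrs \<tau> 1 (int w) = arrs \<sigma> 1 (int w) \<and> arrs \<tau> 7 (int w) = arrs \<sigma> 7 (int w))"
    for i t and \<tau> :: state
  show ?thesis unfolding walk_def
  proof (rule tc_While[where Inv = Inv and N = "length ?M"], goal_cases)
    case 1
    have "regs \<sigma> 7 = int (?ws ! 0)" using \<sigma>(4) lk[of 0] by simp
    then show ?case using \<sigma> by (simp add: Inv_def)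
  next
    case (2 i t \<tau>)
    then have i: "i < length ?M" and I: "Inv i t \<tau>" by auto
    have wsi: "?ws ! i = ?M ! i" "?pre ! Suc i = ?M ! i" using i by (auto simp: nth_append)
    have regs: "regs \<tau> 1 = int (vk k)" "regs \<tau> 6 = int (r k)" "regs \<tau> 8 = int (?pre ! i)" "regs \<tau> 7 = int (?M ! i)"
      using I \<sigma> wsi unfolding Inv_def by auto
    have "?M ! i \<noteq> r k"
    proof
      assume "?M ! i = r k"
      then have "r k \<in> set ?M" using i nth_mem by metis
      then show False using dist by simp
    qed
    then have b: "bval (Neg (Equal (Reg 7) (Reg 6))) \<tau>" using regs by simp
    have arr: "arrs \<tau> 2 = arrs \<sigma> 2" "arrs \<tau> 4 = arrs \<sigma> 4" using I unfolding Inv_def by auto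
    have D: "regs \<tau> 9 + \<bar>Y (?M ! i) - Y (?pre ! i)\<bar> = tv (map Y (l k # take (Suc i) ?M))"
      using tv_take[OF i, of Y "l k"] I unfolding Inv_def by simp
    have ne: "?M ! j \<noteq> ?M ! i" if "j < i" for j
      using dist that i nth_eq_iff_index_eq[of ?M j i] by auto
    have nxt: "arrs \<sigma> 4 (int (?M ! i)) = int (?ws ! Suc i)" using lk[of "Suc i"] i wsi by simp
    have "tc (Seq (AbsDiff 9 (Get 2 (Reg 8)) (Get 2 (Reg 7)))
     (Seq (Put 1 (Reg 7) (Add (Reg 9) (Num 1)))
     (Seq (Put 7 (Reg 7) (Reg 1))
     (Seq (Assign 8 (Reg 7))
      (Assign 7 (Get 4 (Reg 7))))))) \<tau> (\<lambda>t' \<tau>'. Inv (Suc i) (Suc (t + t')) \<tau>')"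
    proof (rule tc_Seq, rule tc_AbsDiff, rule tc_Seq, rule tc_Put, rule tc_Seq, rule tc_Put, rule tc_Seq,
        rule tc_Assign, rule tc_Assign, goal_cases)
      case 1
      have D': "regs \<tau> 9 + \<bar>arrs \<sigma> 2 (int (?M ! i)) - arrs \<sigma> 2 (int (?pre ! i))\<bar> = tv (map Y (l k # take (Suc i) ?M))"
        using D unfolding Y_def .
      have old: "arrs \<tau> 1 (int (?M ! j)) = 1 + tv (map Y (l k # take (Suc j) ?M)) \<and> arrs \<tau> 7 (int (?M ! j)) = int (vk k)"
        if "j < i" for j using I that unfolding Inv_def by blast
      have mem: "?M ! i \<in> set ?M" using i by simp
      have frame: "arrs \<tau> 1 (int w) = arrs \<sigma> 1 (int w) \<and> arrs \<tau> 7 (int w) = arrs \<sigma> 7 (int w)" if "w \<notin> set ?M" for w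
        using I that unfolding Inv_def by blast
      have other: "arrs \<tau> A = arrs \<sigma> A" if "A \<noteq> 1" "A \<noteq> 7" for A using I that unfolding Inv_def by blast
      have rq: "\<forall>q\<in>{0, 1, 4, 5, 6}. regs \<tau> q = regs \<sigma> q" "t \<le> 7 * i" using I unfolding Inv_def by auto
      show ?case
        unfolding Inv_def
      proof (intro conjI allI impI, goal_cases)
        case 1 then show ?case using rq by simp
      next
        case 2 then show ?case using rq by simp
      next
        case 3 then show ?case using regs by simp
      next
        case 4 then show ?case using regs arr nxt by simp
      next
        case 5 then show ?case using regs arr D' by simp
      next
        case (6 A) then show ?case using other by auto
      next
        case (7 j) then show ?case using regs arr D' old[of j] ne[of j] by (cases "j = i") auto
      next
        case (8 j) then show ?case using regs arr D' old[of j] ne[of j] by (cases "j = i") auto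
      next
        case (9 w) then show ?case using regs frame[of w] mem by auto
      next
        case (10 w) then show ?case using regs frame[of w] mem by auto
      qed
    qed
    then show ?case using b by blast
  next
    case (3 t \<tau>)
    then have I: "Inv (length ?M) t \<tau>" .
    have "?pre ! length ?M = last ?pre" by (simp add: last_conv_nth nth_Cons')
    then show ?case using I \<sigma>(2) unfolding Inv_def by simp
  qed
qed

text \<open>Heights are final here, while array 1 still holds the abscissa relative to the position
  of l at the time of covering. Array 8 is the distance from that position to v, because the left
  side of v has slope 1.\<close>

definition placed :: "nat \<Rightarrow> state \<Rightarrow> bool" where
  "placed k \<sigma> \<longleftrightarrow> (let Y = (\<lambda>w. arrs \<sigma> 2 (int w)) in
     2 * Y (vk k) = Y (l k) + Y (r k) + tv (map Y (l k # M k @ [r k])) + 2 \<and>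
     arrs \<sigma> 8 (int (vk k)) = Y (vk k) - Y (l k) \<and>
     (\<forall>j<length (M k). arrs \<sigma> 1 (int (M k ! j)) = 1 + tv (map Y (l k # take (Suc j) (M k))) \<and>
        arrs \<sigma> 7 (int (M k ! j)) = int (vk k)))"

text \<open>What an earlier step recorded survives, since a step writes heights only at its new
  vertex and provisional abscissas only at vertices that no earlier step has covered.\<close>

lemma placed_cong:
  assumes k: "k < nv G" and p: "placed k \<sigma>"
    and Y: "\<And>w. w \<in> set (C k) \<Longrightarrow> arrs \<tau> 2 (int w) = arrs \<sigma> 2 (int w)"
      "arrs \<tau> 2 (int (vk k)) = arrs \<sigma> 2 (int (vk k))" "arrs \<tau> 8 (int (vk k)) = arrs \<sigma> 8 (int (vk k))"
    and M: "\<And>w. w \<in> set (M k) \<Longrightarrow> arrs \<tau> 1 (int w) = arrs \<sigma> 1 (int w) \<and> arrs \<tau> 7 (int w) = arrs \<sigma> 7 (int w)"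
  shows "placed k \<tau>"
proof -
  have C: "l k \<in> set (C k)" "r k \<in> set (C k)" "set (M k) \<subseteq> set (C k)" unfolding C_split[OF k] by auto
  have m1: "map (\<lambda>w. arrs \<tau> 2 (int w)) (l k # M k @ [r k]) = map (\<lambda>w. arrs \<sigma> 2 (int w)) (l k # M k @ [r k])"
    using Y(1) C by (intro map_cong) auto
  have m2: "map (\<lambda>w. arrs \<tau> 2 (int w)) (l k # take j (M k)) = map (\<lambda>w. arrs \<sigma> 2 (int w)) (l k # take j (M k))" for j
    using Y(1) C set_take_subset[of j "M k"] by (intro map_cong) auto
  show ?thesis
    unfolding placed_def Let_def m1 m2 Y(2,3) Y(1)[OF C(1)] Y(1)[OF C(2)]
    using p M unfolding placed_def Let_def by simp
qed

text \<open>The time is bounded by a sum over the steps, since neither degrees nor covered parts are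
  bounded singly. Besides these two, an iteration costs at most 28 units; 40 is a generous round
  bound.\<close>

definition main_inv :: "nat \<Rightarrow> nat \<Rightarrow> state \<Rightarrow> bool" where
  "main_inv k t \<sigma> \<longleftrightarrow> t \<le> (\<Sum>i<k. 40 + 2 * length (rot G (vk i)) + 7 * length (M i)) \<and>
     regs \<sigma> 0 = int (nv G) \<and> regs \<sigma> 4 = int (Suc k) \<and> arrs \<sigma> 0 = inp \<and>
     (\<forall>i<nv G. arrs \<sigma> 3 (int (Suc i)) = int (vk i)) \<and>
     (\<forall>w. arrs \<sigma> 6 (int w) = (if left_higher G \<pi> w then 1 else 0)) \<and>
     linked (C k) \<sigma> \<and> arrs \<sigma> 2 (int (nv G)) = -1 \<and> arrs \<sigma> 2 (int (Suc (nv G))) = -1 \<and>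
     (\<forall>i<k. placed i \<sigma>)"

lemma tc_place:
  assumes k: "k < nv G"
    and \<sigma>: "regs \<sigma> 1 = int (vk k)" "regs \<sigma> 5 = int (l k)" "regs \<sigma> 6 = int (r k)" "regs \<sigma> 8 = int (last (l k # M k))"
      "regs \<sigma> 9 = tv (map (\<lambda>w. arrs \<sigma> 2 (int w)) (l k # M k))"
      "\<forall>j<length (M k). arrs \<sigma> 1 (int (M k ! j)) = 1 + tv (map (\<lambda>w. arrs \<sigma> 2 (int w)) (l k # take (Suc j) (M k))) \<and>
        arrs \<sigma> 7 (int (M k ! j)) = int (vk k)"
      "linked (C k) \<sigma>"
  shows "tc place \<sigma> (\<lambda>t \<tau>. t \<le> 9 \<and> (regs \<tau> 0 = regs \<sigma> 0 \<and> regs \<tau> 4 = regs \<sigma> 4 + 1 \<and>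
     (\<forall>A. A \<notin> {2, 4, 5, 8} \<longrightarrow> arrs \<tau> A = arrs \<sigma> A) \<and>
     (\<forall>w. w \<noteq> vk k \<longrightarrow> arrs \<tau> 2 (int w) = arrs \<sigma> 2 (int w) \<and> arrs \<tau> 8 (int w) = arrs \<sigma> 8 (int w)) \<and>
     linked (C (Suc k)) \<tau> \<and> placed k \<tau>))"
proof -
  let ?v = "vk k"
  define Y where "Y w = arrs \<sigma> 2 (int w)" for w
  have dist: "distinct (P k @ l k # ?v # M k @ r k # S k)"
    using C_distinct[of k] vk_notin_C[of k k] k unfolding C_split[OF k] by auto
  then have ne: "?v \<noteq> l k" "?v \<noteq> r k" "l k \<noteq> r k" by auto
  let ?ys = "map Y (l k # M k @ [r k])"
  have T: "tv (map Y (l k # M k)) + \<bar>Y (r k) - Y (last (l k # M k))\<bar> = tv ?ys"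
  proof -
    obtain N z where N: "l k # M k = N @ [z]" by (metis list.distinct(1) rev_exhaust)
    have "?ys = map Y ((l k # M k) @ [r k])" by simp
    also have "\<dots> = map Y N @ Y z # [Y (r k)]" unfolding N by simp
    finally have ysN: "?ys = map Y N @ Y z # [Y (r k)]" .
    have "tv ?ys = tv (map Y N @ [Y z]) + tv [Y z, Y (r k)]" unfolding ysN by (rule tv_append)
    then show ?thesis unfolding N by simp
  qed
  define W where "W = tv ?ys"
  define y where "y = (Y (l k) + Y (r k) + (W + 2)) div 2"
  \<comment> \<open>Makes the integer division in \<open>y\<close> exact.\<close>
  have "even (tv ?ys + hd ?ys + last ?ys)" by (rule tv_parity) simp
  then have "even (Y (l k) + Y (r k) + (W + 2))" unfolding W_def by auto
  then have y2: "2 * y = Y (l k) + Y (r k) + tv ?ys + 2" unfolding y_def W_def[symmetric] by simp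
  define Rel where "Rel \<tau> \<longleftrightarrow> regs \<tau> 0 = regs \<sigma> 0 \<and> regs \<tau> 4 = regs \<sigma> 4 + 1 \<and>
      (\<forall>A. A \<notin> {2, 4, 5, 8} \<longrightarrow> arrs \<tau> A = arrs \<sigma> A) \<and>
      arrs \<tau> 2 = (arrs \<sigma> 2)(int ?v := y) \<and> arrs \<tau> 8 = (arrs \<sigma> 8)(int ?v := y - Y (l k)) \<and>
      arrs \<tau> 4 = (arrs \<sigma> 4)(int (l k) := int ?v, int ?v := int (r k)) \<and>
      arrs \<tau> 5 = (arrs \<sigma> 5)(int ?v := int (l k), int (r k) := int ?v)" for \<tau> :: state
  have run: "tc place \<sigma> (\<lambda>t \<tau>. t \<le> 9 \<and> Rel \<tau>)"
  proof -
    have D: "regs \<sigma> 9 + \<bar>aval (Get 2 (Reg 6)) \<sigma> - aval (Get 2 (Reg 8)) \<sigma>\<bar> = W"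
      using T \<sigma>(5) unfolding Y_def W_def by (simp add: \<sigma>(3,4))
    have Y1: "arrs \<sigma> 2 (int (l k)) = Y (l k)" "arrs \<sigma> 2 (int (r k)) = Y (r k)" by (auto simp: Y_def)
    define St where "St A = \<sigma>\<lparr>regs := (regs \<sigma>)(9 := W), arrs := A\<rparr>" for A
    have St: "regs (St A) 1 = int ?v" "regs (St A) (Suc 0) = int ?v" "regs (St A) 5 = int (l k)" "regs (St A) 6 = int (r k)" "regs (St A) 9 = W"
        "arrs (St A) = A" "regs (St A) 4 = regs \<sigma> 4" "regs (St A) 0 = regs \<sigma> 0"
        "(St A)\<lparr>arrs := A'\<rparr> = St A'" for A A'
      using \<sigma>(1-3) by (simp_all add: St_def)
    let ?A1 = "arrs \<sigma>" and ?a2 = "(arrs \<sigma> 2)(int ?v := y)" and ?a8 = "(arrs \<sigma> 8)(int ?v := y - Y (l k))"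
      and ?a4 = "(arrs \<sigma> 4)(int (l k) := int ?v)" and ?a5 = "(arrs \<sigma> 5)(int ?v := int (l k))"
    let ?A2 = "?A1(2 := ?a2)"
    let ?A3 = "?A2(8 := ?a8)"
    let ?A4 = "?A3(4 := ?a4)"
    let ?A5 = "?A4(5 := ?a5)"
    let ?A6 = "?A5(4 := ?a4(int ?v := int (r k)))"
    let ?A7 = "?A6(5 := ?a5(int (r k) := int ?v))"
    have p1: "tc (AbsDiff 9 (Get 2 (Reg 8)) (Get 2 (Reg 6))) \<sigma> (\<lambda>t \<tau>. t \<le> 2 \<and> \<tau> = St ?A1)"
      by (rule tc_AbsDiff, unfold D) (simp add: St_def)
    have p2: "tc (Put 2 (Reg 1) (Half (Add (Add (Get 2 (Reg 5)) (Get 2 (Reg 6))) (Add (Reg 9) (Num 2))))) (St ?A1)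
        (\<lambda>t \<tau>. t \<le> 1 \<and> \<tau> = St ?A2)"
      by (rule tc_Put) (simp add: St Y1 y_def)
    have p3: "tc (Put 8 (Reg 1) (Sub (Get 2 (Reg 1)) (Get 2 (Reg 5)))) (St ?A2) (\<lambda>t \<tau>. t \<le> 1 \<and> \<tau> = St ?A3)"
      by (rule tc_Put) (use ne in \<open>simp add: St Y1\<close>)
    have p4: "tc (Put 4 (Reg 5) (Reg 1)) (St ?A3) (\<lambda>t \<tau>. t \<le> 1 \<and> \<tau> = St ?A4)" by (rule tc_Put) (simp add: St)
    have p5: "tc (Put 5 (Reg 1) (Reg 5)) (St ?A4) (\<lambda>t \<tau>. t \<le> 1 \<and> \<tau> = St ?A5)" by (rule tc_Put) (simp add: St)
    have p6: "tc (Put 4 (Reg 1) (Reg 6)) (St ?A5) (\<lambda>t \<tau>. t \<le> 1 \<and> \<tau> = St ?A6)" by (rule tc_Put) (simp add: St)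
    have p7: "tc (Put 5 (Reg 6) (Reg 1)) (St ?A6) (\<lambda>t \<tau>. t \<le> 1 \<and> \<tau> = St ?A7)" by (rule tc_Put) (simp add: St)
    have p8: "tc (Assign 4 (Add (Reg 4) (Num 1))) (St ?A7) (\<lambda>t \<tau>. t \<le> 1 \<and> Rel \<tau>)"
      by (rule tc_Assign) (simp add: St Rel_def)
    have "tc place \<sigma> (\<lambda>t \<tau>. t \<le> 2 + (1 + (1 + (1 + (1 + (1 + (1 + 1)))))) \<and> Rel \<tau>)"
      unfolding place_def
      by (rule tc_Seq_bound[OF p1], simp only:, rule tc_Seq_bound[OF p2], simp only:, rule tc_Seq_bound[OF p3], simp only:,
        rule tc_Seq_bound[OF p4], simp only:, rule tc_Seq_bound[OF p5], simp only:, rule tc_Seq_bound[OF p6], simp only:,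
        rule tc_Seq_bound[OF p7], simp only:, rule p8)
    then show ?thesis by (rule tc_conseq) simp
  qed
  show ?thesis
  proof (rule tc_conseq[OF run])
    fix t and \<tau> :: state assume "t \<le> 9 \<and> Rel \<tau>"
    then have t: "t \<le> 9" and R: "Rel \<tau>" by auto
    have \<tau>_def: "arrs \<tau> 2 = (arrs \<sigma> 2)(int ?v := y)" "arrs \<tau> 8 = (arrs \<sigma> 8)(int ?v := y - Y (l k))"
        "arrs \<tau> 4 = (arrs \<sigma> 4)(int (l k) := int ?v, int ?v := int (r k))"
        "arrs \<tau> 5 = (arrs \<sigma> 5)(int ?v := int (l k), int (r k) := int ?v)" "arrs \<tau> 1 = arrs \<sigma> 1" "arrs \<tau> 7 = arrs \<sigma> 7"
      using R unfolding Rel_def by auto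
    have arr2: "arrs \<tau> 2 (int w) = (if w = ?v then y else Y w)" for w by (simp add: \<tau>_def Y_def)
    have mapY: "map (\<lambda>w. arrs \<tau> 2 (int w)) ws = map Y ws" if "?v \<notin> set ws" for ws
      using that by (intro map_cong) (auto simp: arr2)
    have links': "linked (C (Suc k)) \<tau>"
      unfolding linked_def
    proof (intro ballI, clarify)
      fix a b assume "(a, b) \<in> links (C (Suc k))"
      then consider "(a, b) \<in> links (P k @ [l k])" | "(a, b) = (l k, ?v)" | "(a, b) = (?v, r k)" | "(a, b) \<in> links (r k # S k)"
        using links_append[of "P k" "l k" "?v # r k # S k"] unfolding C_Suc[OF k] by auto
      then show "arrs \<tau> 4 (int a) = int b \<and> arrs \<tau> 5 (int b) = int a"
      proof cases
        case 1
        then have "(a, b) \<in> links (C k)"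
          using links_append[of "P k" "l k" "M k @ r k # S k"] unfolding C_split[OF k] by simp
        moreover have "a \<in> set (P k)" "b \<in> set (P k @ [l k])" using links_butlast[OF 1] links_mem[OF 1] by auto
        then have "a \<noteq> l k" "a \<noteq> ?v" "b \<noteq> r k" "b \<noteq> ?v" using dist by auto
        ultimately show ?thesis using \<sigma>(7) unfolding linked_def by (auto simp: \<tau>_def)
      next
        case 4
        then have "(a, b) \<in> links (C k)"
          using links_append[of "P k @ l k # M k" "r k" "S k"] unfolding C_split[OF k] by simp
        moreover have "a \<in> set (r k # S k)" "b \<in> set (S k)" using links_tl[OF 4] links_mem[OF 4] by auto
        then have "a \<noteq> l k" "a \<noteq> ?v" "b \<noteq> r k" "b \<noteq> ?v" using dist by auto
        ultimately show ?thesis using \<sigma>(7) unfolding linked_def by (auto simp: \<tau>_def)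
      qed (use ne in \<open>auto simp: \<tau>_def\<close>)
    qed
    have "placed k \<tau>"
    proof -
      have vM: "?v \<notin> set (l k # M k @ [r k])" using dist by auto
      have take: "?v \<notin> set (l k # take (Suc j) (M k))" for j
        using vM set_take_subset[of "Suc j" "M k"] by auto
      have "arrs \<tau> 1 = arrs \<sigma> 1" "arrs \<tau> 7 = arrs \<sigma> 7" "arrs \<tau> 8 (int ?v) = y - Y (l k)" using \<tau>_def by auto
      then show ?thesis
        unfolding placed_def Let_def mapY[OF vM] mapY[OF take]
        using \<sigma>(6) y2 ne by (simp add: arr2 Y_def[symmetric])
    qed
    then show "t \<le> 9 \<and> (regs \<tau> 0 = regs \<sigma> 0 \<and> regs \<tau> 4 = regs \<sigma> 4 + 1 \<and>
       (\<forall>A. A \<notin> {2, 4, 5, 8} \<longrightarrow> arrs \<tau> A = arrs \<sigma> A) \<and>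
       (\<forall>w. w \<noteq> vk k \<longrightarrow> arrs \<tau> 2 (int w) = arrs \<sigma> 2 (int w) \<and> arrs \<tau> 8 (int w) = arrs \<sigma> 8 (int w)) \<and>
       linked (C (Suc k)) \<tau> \<and> placed k \<tau>)"
      using links' t R unfolding Rel_def by simp
  qed
qed

lemma main_step:
  assumes k: "k < nv G" and I: "main_inv k t \<sigma>"
  shows "tc (Seq (Assign 1 (Get 3 (Reg 4)))
     (Seq (Assign 5 (Reg 0))
     (Seq (Assign 6 (Add (Reg 0) (Num 1)))
     (Seq (Cond (Conj (Less (Num 1) (Reg 4)) (Less (Reg 4) (Reg 0))) find_ends Skip)
     (Seq (Assign 8 (Reg 5))
     (Seq (Assign 7 (Get 4 (Reg 5)))
     (Seq (Assign 9 (Num 0))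
     (Seq walk place)))))))) \<sigma> (\<lambda>t' \<tau>. main_inv (Suc k) (Suc (t + t')) \<tau>)"
proof -
  let ?v = "vk k" and ?L = "nv G" and ?R = "Suc (nv G)"
  have r0: "regs \<sigma> 0 = int (nv G)" "regs \<sigma> 4 = int (Suc k)" and a0: "arrs \<sigma> 0 = inp"
    and a3: "\<forall>i<nv G. arrs \<sigma> 3 (int (Suc i)) = int (vk i)"
    and a6: "\<forall>w. arrs \<sigma> 6 (int w) = (if left_higher G \<pi> w then 1 else 0)"
    and lk: "linked (C k) \<sigma>" and pl: "\<forall>i<k. placed i \<sigma>"
    and yLR: "arrs \<sigma> 2 (int (nv G)) = -1" "arrs \<sigma> 2 (int (Suc (nv G))) = -1"
    using I unfolding main_inv_def by auto
  define \<sigma>1 where "\<sigma>1 = \<sigma>\<lparr>regs := (regs \<sigma>)(1 := int ?v, 5 := int ?L, 6 := int ?R)\<rparr>"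
  define A1 where "A1 \<tau> \<longleftrightarrow> arrs \<tau> = arrs \<sigma> \<and> regs \<tau> 0 = int (nv G) \<and> regs \<tau> 1 = int ?v \<and> regs \<tau> 4 = int (Suc k) \<and>
      regs \<tau> 5 = int (l k) \<and> regs \<tau> 6 = int (r k)" for \<tau> :: state
  define A2 where "A2 \<tau> \<longleftrightarrow> A1 \<tau> \<and> regs \<tau> 8 = int (l k) \<and> regs \<tau> 7 = arrs \<tau> 4 (int (l k)) \<and> regs \<tau> 9 = 0" for \<tau> :: state
  have s1: "tc (Assign 1 (Get 3 (Reg 4))) \<sigma> (\<lambda>t \<tau>. t \<le> 1 \<and> \<tau> = \<sigma>\<lparr>regs := (regs \<sigma>)(1 := int ?v)\<rparr>)"
    by (rule tc_Assign) (use r0 a3 k in \<open>simp del: of_nat_Suc\<close>)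
  have s2: "tc (Assign 5 (Reg 0)) (\<sigma>\<lparr>regs := (regs \<sigma>)(1 := int ?v)\<rparr>)
      (\<lambda>t \<tau>. t \<le> 1 \<and> \<tau> = \<sigma>\<lparr>regs := (regs \<sigma>)(1 := int ?v, 5 := int ?L)\<rparr>)"
    by (rule tc_Assign) (use r0 in simp)
  have s3: "tc (Assign 6 (Add (Reg 0) (Num 1))) (\<sigma>\<lparr>regs := (regs \<sigma>)(1 := int ?v, 5 := int ?L)\<rparr>) (\<lambda>t \<tau>. t \<le> 1 \<and> \<tau> = \<sigma>1)"
    by (rule tc_Assign) (use r0 in \<open>simp add: \<sigma>1_def add.commute\<close>)
  have s4: "tc (Cond (Conj (Less (Num 1) (Reg 4)) (Less (Reg 4) (Reg 0))) find_ends Skip) \<sigma>1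
      (\<lambda>t \<tau>. t \<le> 2 * length (rot G ?v) + 11 \<and> A1 \<tau>)"
  proof (rule tc_Cond)
    assume "bval (Conj (Less (Num 1) (Reg 4)) (Less (Reg 4) (Reg 0))) \<sigma>1"
    then have k': "0 < k" "Suc k < nv G" using r0 by (auto simp: \<sigma>1_def)
    have "linked (C k) \<sigma>1" using lk unfolding linked_def \<sigma>1_def by simp
    then have "tc find_ends \<sigma>1 (\<lambda>t \<tau>. t \<le> 2 * length (rot G ?v) + 10 \<and> arrs \<tau> = arrs \<sigma>1 \<and>
     (\<forall>q\<in>{0, 1, 4}. regs \<tau> q = regs \<sigma>1 q) \<and> regs \<tau> 5 = int (l k) \<and> regs \<tau> 6 = int (r k))"
      by (intro tc_find_ends[OF k']) (use r0 a0 a6 in \<open>auto simp: \<sigma>1_def\<close>)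
    then show "tc find_ends \<sigma>1 (\<lambda>t \<tau>. Suc t \<le> 2 * length (rot G ?v) + 11 \<and> A1 \<tau>)"
      by (rule tc_conseq) (use r0 in \<open>auto simp: A1_def \<sigma>1_def\<close>)
  next
    assume "\<not> bval (Conj (Less (Num 1) (Reg 4)) (Less (Reg 4) (Reg 0))) \<sigma>1"
    then have "k = 0 \<or> Suc k = nv G" using r0 k by (auto simp: \<sigma>1_def)
    then have "l k = ?L" "r k = ?R" using att[OF k] unfolding attach_def Let_def by auto
    then show "tc Skip \<sigma>1 (\<lambda>t \<tau>. Suc t \<le> 2 * length (rot G ?v) + 11 \<and> A1 \<tau>)"
      by (intro tc_Skip) (use r0 in \<open>simp add: A1_def \<sigma>1_def\<close>)
  qed
  define A8 where "A8 \<tau> \<longleftrightarrow> A1 \<tau> \<and> regs \<tau> 8 = int (l k)" for \<tau> :: state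
  define A7 where "A7 \<tau> \<longleftrightarrow> A8 \<tau> \<and> regs \<tau> 7 = arrs \<tau> 4 (int (l k))" for \<tau> :: state
  have s5: "tc (Assign 8 (Reg 5)) \<tau> (\<lambda>t \<tau>'. t \<le> 1 \<and> A8 \<tau>')" if "A1 \<tau>" for \<tau>
    by (rule tc_Assign) (use that in \<open>simp add: A8_def A1_def\<close>)
  have s6: "tc (Assign 7 (Get 4 (Reg 5))) \<tau> (\<lambda>t \<tau>'. t \<le> 1 \<and> A7 \<tau>')" if "A8 \<tau>" for \<tau>
    by (rule tc_Assign) (use that in \<open>simp add: A7_def A8_def A1_def\<close>)
  have s7: "tc (Assign 9 (Num 0)) \<tau> (\<lambda>t \<tau>'. t \<le> 1 \<and> A2 \<tau>')" if "A7 \<tau>" for \<tau>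
    by (rule tc_Assign) (use that in \<open>simp add: A2_def A7_def A8_def A1_def\<close>)
  define B where "B \<tau> \<longleftrightarrow> regs \<tau> 0 = int (nv G) \<and> regs \<tau> 1 = int ?v \<and> regs \<tau> 4 = int (Suc k) \<and>
      regs \<tau> 5 = int (l k) \<and> regs \<tau> 6 = int (r k) \<and>
     regs \<tau> 8 = int (last (l k # M k)) \<and> regs \<tau> 9 = tv (map (\<lambda>w. arrs \<sigma> 2 (int w)) (l k # M k)) \<and>
     (\<forall>A. A \<noteq> 1 \<and> A \<noteq> 7 \<longrightarrow> arrs \<tau> A = arrs \<sigma> A) \<and>
     (\<forall>j<length (M k). arrs \<tau> 1 (int (M k ! j)) = 1 + tv (map (\<lambda>w. arrs \<sigma> 2 (int w)) (l k # take (Suc j) (M k))) \<and>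
        arrs \<tau> 7 (int (M k ! j)) = int ?v) \<and>
     (\<forall>w. w \<notin> set (M k) \<longrightarrow> arrs \<tau> 1 (int w) = arrs \<sigma> 1 (int w) \<and> arrs \<tau> 7 (int w) = arrs \<sigma> 7 (int w))"
    for \<tau> :: state
  have s8: "tc walk \<tau> (\<lambda>t \<tau>'. t \<le> 7 * length (M k) + 1 \<and> B \<tau>')" if "A2 \<tau>" for \<tau>
  proof -
    have A: "A2 \<tau>" by (rule that)
    have "linked (C k) \<tau>" using lk A unfolding linked_def A2_def A1_def by simp
    then show ?thesis
      by (intro tc_conseq[OF tc_walk[OF k]]) (use A in \<open>auto simp: A2_def A1_def B_def\<close>)
  qed
  \<comment> \<open>\<open>main_inv\<close> only bounds its time argument from above. It can
    therefore be established with the worst case of the whole iteration, here t0, so that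
    \<open>tc_Seq_bound\<close> applies although its intermediate conditions do not mention
    time.\<close>
  have s9: "tc place \<tau> (\<lambda>t \<tau>'. t \<le> 9 \<and> main_inv (Suc k) (t0 + (\<Sum>i<k. 40 + 2 * length (rot G (vk i)) + 7 * length (M i))) \<tau>')"
    if t0: "t0 \<le> 40 + 2 * length (rot G ?v) + 7 * length (M k)" and B: "B \<tau>" for \<tau> t0
  proof -
    have arr: "arrs \<tau> 2 = arrs \<sigma> 2" "arrs \<tau> 4 = arrs \<sigma> 4" "arrs \<tau> 5 = arrs \<sigma> 5" "arrs \<tau> 8 = arrs \<sigma> 8"
       "arrs \<tau> 0 = arrs \<sigma> 0" "arrs \<tau> 3 = arrs \<sigma> 3" "arrs \<tau> 6 = arrs \<sigma> 6"
      using B unfolding B_def by auto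
    have "tc place \<tau> (\<lambda>t \<tau>'. t \<le> 9 \<and> (regs \<tau>' 0 = regs \<tau> 0 \<and> regs \<tau>' 4 = regs \<tau> 4 + 1 \<and>
     (\<forall>A. A \<notin> {2, 4, 5, 8} \<longrightarrow> arrs \<tau>' A = arrs \<tau> A) \<and>
     (\<forall>w. w \<noteq> vk k \<longrightarrow> arrs \<tau>' 2 (int w) = arrs \<tau> 2 (int w) \<and> arrs \<tau>' 8 (int w) = arrs \<tau> 8 (int w)) \<and>
     linked (C (Suc k)) \<tau>' \<and> placed k \<tau>'))"
    proof (rule tc_place[OF k])
      show "linked (C k) \<tau>" using lk unfolding linked_def arr .
    qed (use B in \<open>auto simp: B_def arr\<close>)
    then show ?thesis
    proof (rule tc_conseq, goal_cases)
      case (1 t' \<tau>')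
      have vLR: "vk k \<noteq> nv G" "vk k \<noteq> Suc (nv G)" using vk_less[OF k] by auto
      have pl': "placed i \<tau>'" if i: "i < k" for i
      proof (rule placed_cong)
        show "i < nv G" using i k by simp
        show "placed i \<sigma>" using pl i by simp
        have n: "vk k \<notin> set (C i)" using vk_notin_C[OF k] i by simp
        show "arrs \<tau>' 2 (int w) = arrs \<sigma> 2 (int w)" if "w \<in> set (C i)" for w
        proof -
          have "w \<noteq> vk k" using n that by blast
          then show ?thesis using 1 arr by simp
        qed
        have "vk i \<noteq> vk k" using vk_inj[of i k] i k by simp
        then show "arrs \<tau>' 2 (int (vk i)) = arrs \<sigma> 2 (int (vk i))" "arrs \<tau>' 8 (int (vk i)) = arrs \<sigma> 8 (int (vk i))"
          using 1 arr by simp_all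
        show "arrs \<tau>' 1 (int w) = arrs \<sigma> 1 (int w) \<and> arrs \<tau>' 7 (int w) = arrs \<sigma> 7 (int w)" if "w \<in> set (M i)" for w
          using M_disjoint[OF i k that] 1 B unfolding B_def by simp
      qed
      have "placed i \<tau>'" if "i < Suc k" for i using pl'[of i] 1 that by (cases "i = k") auto
      moreover have "t0 + (\<Sum>i<k. 40 + 2 * length (rot G (vk i)) + 7 * length (M i)) \<le>
          (\<Sum>i<Suc k. 40 + 2 * length (rot G (vk i)) + 7 * length (M i))" using t0 by simp
      moreover have "arrs \<tau>' 2 (int (nv G)) = -1" "arrs \<tau>' 2 (int (Suc (nv G))) = -1"
        using 1 vLR yLR arr by metis+
      ultimately show ?case using 1 B a0 a3 a6 arr unfolding main_inv_def by (simp add: B_def)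
    qed
  qed
  let ?K = "1 + (1 + (1 + ((2 * length (rot G ?v) + 11) + (1 + (1 + (1 + ((7 * length (M k) + 1) + 9)))))))"
  have t: "t \<le> (\<Sum>i<k. 40 + 2 * length (rot G (vk i)) + 7 * length (M i))" using I unfolding main_inv_def by simp
  have K: "Suc ?K \<le> 40 + 2 * length (rot G ?v) + 7 * length (M k)" by simp
  let ?E = "\<lambda>\<tau>'. main_inv (Suc k) (Suc ?K + (\<Sum>i<k. 40 + 2 * length (rot G (vk i)) + 7 * length (M i))) \<tau>'"
  have s9': "tc place \<tau> (\<lambda>t \<tau>'. t \<le> 9 \<and> ?E \<tau>')" if "B \<tau>" for \<tau> by (rule s9[OF K that])
  have c8: "tc (Seq walk place) \<tau> (\<lambda>t \<tau>'. t \<le> (7 * length (M k) + 1) + 9 \<and> ?E \<tau>')" if "A2 \<tau>" for \<tau>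
    by (rule tc_Seq_bound[OF s8[OF that] s9'])
  note c7 = tc_Seq_bound[OF s7 c8]
  note c6 = tc_Seq_bound[OF s6 c7]
  note c5 = tc_Seq_bound[OF s5 c6]
  note c4 = tc_Seq_bound[OF s4 c5]
  have c3: "tc (Seq (Assign 6 (Add (Reg 0) (Num 1))) (Seq (Cond (Conj (Less (Num 1) (Reg 4)) (Less (Reg 4) (Reg 0))) find_ends Skip)
     (Seq (Assign 8 (Reg 5)) (Seq (Assign 7 (Get 4 (Reg 5))) (Seq (Assign 9 (Num 0)) (Seq walk place))))))
     (\<sigma>\<lparr>regs := (regs \<sigma>)(1 := int ?v, 5 := int ?L)\<rparr>)
     (\<lambda>t \<tau>'. t \<le> 1 + ((2 * length (rot G ?v) + 11) + (1 + (1 + (1 + ((7 * length (M k) + 1) + 9))))) \<and> ?E \<tau>')"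
    by (rule tc_Seq_bound[OF s3]) (simp only:, rule c4)
  have c2: "tc (Seq (Assign 5 (Reg 0)) (Seq (Assign 6 (Add (Reg 0) (Num 1))) (Seq (Cond (Conj (Less (Num 1) (Reg 4)) (Less (Reg 4) (Reg 0))) find_ends Skip)
     (Seq (Assign 8 (Reg 5)) (Seq (Assign 7 (Get 4 (Reg 5))) (Seq (Assign 9 (Num 0)) (Seq walk place)))))))
     (\<sigma>\<lparr>regs := (regs \<sigma>)(1 := int ?v)\<rparr>)
     (\<lambda>t \<tau>'. t \<le> 1 + (1 + ((2 * length (rot G ?v) + 11) + (1 + (1 + (1 + ((7 * length (M k) + 1) + 9)))))) \<and> ?E \<tau>')"
    by (rule tc_Seq_bound[OF s2]) (simp only:, rule c3)
  have "tc (Seq (Assign 1 (Get 3 (Reg 4))) (Seq (Assign 5 (Reg 0)) (Seq (Assign 6 (Add (Reg 0) (Num 1))) (Seq (Cond (Conj (Less (Num 1) (Reg 4)) (Less (Reg 4) (Reg 0))) find_ends Skip)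
     (Seq (Assign 8 (Reg 5)) (Seq (Assign 7 (Get 4 (Reg 5))) (Seq (Assign 9 (Num 0)) (Seq walk place)))))))) \<sigma> (\<lambda>t \<tau>'. t \<le> ?K \<and> ?E \<tau>')"
    by (rule tc_Seq_bound[OF s1]) (simp only:, rule c2)
  then show ?thesis
  proof (rule tc_conseq)
    fix t' \<tau> assume a: "t' \<le> ?K \<and> ?E \<tau>"
    then show "main_inv (Suc k) (Suc (t + t')) \<tau>" using t unfolding main_inv_def by auto
  qed
qed

lemma tc_main_loop:
  assumes "main_inv 0 0 \<sigma>"
  shows "tc main_loop \<sigma> (\<lambda>t \<tau>. main_inv (nv G) (t - 1) \<tau>)"
  unfolding main_loop_def
proof (rule tc_While[where Inv = main_inv and N = "nv G"])
  fix i t and \<tau> :: state assume "i < nv G" "main_inv i t \<tau>"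
  moreover from this have "bval (Less (Reg 4) (Add (Reg 0) (Num 1))) \<tau>" unfolding main_inv_def by simp
  ultimately show "bval (Less (Reg 4) (Add (Reg 0) (Num 1))) \<tau> \<and> tc (Seq (Assign 1 (Get 3 (Reg 4)))
     (Seq (Assign 5 (Reg 0)) (Seq (Assign 6 (Add (Reg 0) (Num 1)))
     (Seq (Cond (Conj (Less (Num 1) (Reg 4)) (Less (Reg 4) (Reg 0))) find_ends Skip)
     (Seq (Assign 8 (Reg 5)) (Seq (Assign 7 (Get 4 (Reg 5))) (Seq (Assign 9 (Num 0))
     (Seq walk place)))))))) \<tau> (\<lambda>t' \<tau>'. main_inv (Suc i) (Suc (t + t')) \<tau>')"
    using main_step by blast
qed (use assms in \<open>auto simp: main_inv_def\<close>)

text \<open>After i iterations the vertices with order number at least \<open>nv G - i\<close> are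
  final and the earlier ones still relative. The last vertex has received its abscissa before the
  loop.\<close>

lemma tc_x_loop:
  assumes \<sigma>: "regs \<sigma> 4 = int (nv G - 1)" "\<forall>i<nv G. arrs \<sigma> 3 (int (Suc i)) = int (vk i)"
      "\<forall>k<nv G. \<forall>w\<in>set (M k). arrs \<sigma> 7 (int w) = int (vk k)"
  shows "tc x_loop \<sigma> (\<lambda>t \<tau>. t \<le> 4 * nv G + 1 \<and> (regs \<tau> 0 = regs \<sigma> 0 \<and> (\<forall>A. A \<noteq> 1 \<longrightarrow> arrs \<tau> A = arrs \<sigma> A) \<and>
     arrs \<tau> 1 (int (vk (nv G - 1))) = arrs \<sigma> 1 (int (vk (nv G - 1))) \<and>
     (\<forall>k<nv G. \<forall>w\<in>set (M k). arrs \<tau> 1 (int w) = arrs \<tau> 1 (int (vk k)) - arrs \<sigma> 8 (int (vk k)) + arrs \<sigma> 1 (int w))))"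
proof -
  let ?n = "nv G"
  define Inv where "Inv i t \<tau> \<longleftrightarrow> t \<le> 4 * i \<and> regs \<tau> 0 = regs \<sigma> 0 \<and> regs \<tau> 4 = int (?n - 1 - i) \<and>
     (\<forall>A. A \<noteq> 1 \<longrightarrow> arrs \<tau> A = arrs \<sigma> A) \<and>
     (\<forall>w\<in>verts G. \<pi> w + i < ?n \<longrightarrow> arrs \<tau> 1 (int w) = arrs \<sigma> 1 (int w)) \<and>
     arrs \<tau> 1 (int (vk (?n - 1))) = arrs \<sigma> 1 (int (vk (?n - 1))) \<and>
     (\<forall>k<?n. \<forall>w\<in>set (M k). ?n \<le> \<pi> w + i \<longrightarrow>
        arrs \<tau> 1 (int w) = arrs \<tau> 1 (int (vk k)) - arrs \<sigma> 8 (int (vk k)) + arrs \<sigma> 1 (int w))" for i t and \<tau> :: state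
  show ?thesis unfolding x_loop_def
  proof (rule tc_While[where Inv = Inv and N = "?n - 1"], goal_cases)
    case 1
    have "\<not> ?n \<le> \<pi> w + 0" if "k < ?n" "w \<in> set (M k)" for k w using M_verts[OF that] that by simp
    then show ?case using \<sigma>(1) unfolding Inv_def by simp
  next
    case (2 i t \<tau>)
    then have i: "i < ?n - 1" and I: "Inv i t \<tau>" by auto
    \<comment> \<open>Iteration i treats the vertex with order number \<open>nv G - 1 - i\<close>,
      which is \<open>vk m\<close> because \<open>vk\<close> counts from 0.\<close>
    define m where "m = ?n - 2 - i"
    have m: "m < ?n" "?n - 1 - i = Suc m" "?n - 1 - Suc i = m" "Suc m + i < ?n" using i by (auto simp: m_def)
    let ?w = "vk m"
    note wv = vtx[OF m(1)]
    have regs: "regs \<tau> 4 = int (Suc m)" using I m(2) unfolding Inv_def by simp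
    have arr: "arrs \<tau> A = arrs \<sigma> A" if "A \<noteq> 1" for A using I that unfolding Inv_def by blast
    have old: "arrs \<tau> 1 (int ?w) = arrs \<sigma> 1 (int ?w)" using I wv m unfolding Inv_def by simp
    have b: "bval (Less (Num 0) (Reg 4)) \<tau>" using regs by simp
    let ?x = "arrs \<tau> 1 (arrs \<sigma> 7 (int ?w)) - arrs \<sigma> 8 (arrs \<sigma> 7 (int ?w)) + arrs \<sigma> 1 (int ?w)"
    have "tc (Seq (Assign 1 (Get 3 (Reg 4)))
     (Seq (Put 1 (Reg 1) (Add (Sub (Get 1 (Get 7 (Reg 1))) (Get 8 (Get 7 (Reg 1)))) (Get 1 (Reg 1))))
      (Assign 4 (Sub (Reg 4) (Num 1))))) \<tau> (\<lambda>t' \<tau>'. Inv (Suc i) (Suc (t + t')) \<tau>')"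
    proof (rule tc_Seq, rule tc_Assign, rule tc_Seq, rule tc_Put, rule tc_Assign, goal_cases)
      case 1
      have a3: "arrs \<tau> 3 (regs \<tau> 4) = int ?w" using arr[of 3] \<sigma>(2) m(1) regs by simp
      define \<tau>' where "\<tau>' = \<tau>\<lparr>arrs := (arrs \<tau>)(1 := (arrs \<tau> 1)(int ?w := ?x)), regs := (regs \<tau>)(1 := int ?w, 4 := int m)\<rparr>"
      have other: "arrs \<tau>' 1 (int w) = arrs \<tau> 1 (int w)" if "w \<noteq> ?w" for w using that by (simp add: \<tau>'_def)
      have "Inv (Suc i) (Suc (t + (1 + (1 + 1)))) \<tau>'"
        unfolding Inv_def
      proof (intro conjI allI impI ballI, goal_cases)
        case 1 then show ?case using I unfolding Inv_def by simp
      next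
        case 2 then show ?case using I unfolding Inv_def by (simp add: \<tau>'_def)
      next
        case 3 then show ?case using m by (simp add: \<tau>'_def)
      next
        case (4 A) then show ?case using arr[of A] by (simp add: \<tau>'_def)
      next
        case (5 w)
        then have "w \<noteq> ?w" using wv m by auto
        then show ?case using other[of w] I 5 unfolding Inv_def by simp
      next
        case 6
        have "vk (?n - 1) \<noteq> ?w" using vk_inj[of "?n - 1" m] m i by auto
        then show ?case using other[of "vk (?n - 1)"] I unfolding Inv_def by simp
      next
        case (7 k w)
        then have k: "k < ?n" and w: "w \<in> set (M k)" by auto
        note mw = M_verts[OF k w]
        have vk: "vk k \<noteq> ?w"
        proof
          assume "vk k = ?w"
          then have "k = m" using vk_inj[OF k m(1)] by simp
          then show False using mw 7(3) m by simp
        qed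
        show ?case
        proof (cases "w = ?w")
          case True
          have "arrs \<sigma> 7 (int ?w) = int (vk k)" using \<sigma>(3) k w True by blast
          moreover have "arrs \<tau>' 1 (int ?w) = ?x" by (simp add: \<tau>'_def)
          ultimately show ?thesis using other[OF vk] True by simp
        next
          case False
          then have "\<pi> w \<noteq> Suc m" using vtx_unique[of w m] mw m(1) by blast
          then have "?n \<le> \<pi> w + i" using 7(3) m by simp
          then show ?thesis using other[OF vk] other[OF False] I k w unfolding Inv_def by simp
        qed
      qed
      then show ?case using a3 arr[of 7] arr[of 8] old regs by (simp add: \<tau>'_def)
    qed
    then show ?case using b by blast
  next
    case (3 t \<tau>)
    then have I: "Inv (?n - 1) t \<tau>" .
    have "?n \<le> \<pi> w + (?n - 1)" if "k < ?n" "w \<in> set (M k)" for k w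
      using M_verts[OF that] pi_range[of w] nv_pos by fastforce
    then show ?case using I unfolding Inv_def by auto
  qed
qed

text \<open>A step puts one vertex on the contour and removes the covered ones. So all walks
  together visit fewer than \<open>nv G\<close> covered vertices, which makes the main loop
  linear.\<close>

lemma sum_M: "k \<le> nv G \<Longrightarrow> (\<Sum>i<k. length (M i)) + length (C k) = k + 2"
proof (induction k)
  case (Suc k)
  then show ?case using C_Suc[of k] C_split[of k] by simp
qed (simp add: C0)

lemma sum_rot: "(\<Sum>k<nv G. length (rot G (vk k))) = off (nv G)"
proof -
  have "bij_betw vk {..<nv G} {..<nv G}"
  proof (rule bij_betw_byWitness[where f' = "\<lambda>v. \<pi> v - 1"])
    show "\<forall>a\<in>{..<nv G}. \<pi> (vk a) - 1 = a" using vtx by simp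
    show "\<forall>v\<in>{..<nv G}. vk (\<pi> v - 1) = v"
    proof
      fix v assume "v \<in> {..<nv G}"
      then have v: "v \<in> verts G" by (simp add: verts_def)
      then show "vk (\<pi> v - 1) = v" using pi_range[OF v] by (intro vtx_unique) auto
    qed
    show "vk ` {..<nv G} \<subseteq> {..<nv G}" using vk_less by auto
    show "(\<lambda>v. \<pi> v - 1) ` {..<nv G} \<subseteq> {..<nv G}"
    proof
      fix i assume "i \<in> (\<lambda>v. \<pi> v - 1) ` {..<nv G}"
      then obtain v where v: "v \<in> verts G" "i = \<pi> v - 1" by (auto simp: verts_def)
      then show "i \<in> {..<nv G}" using pi_range[OF v(1)] by auto
    qed
  qed
  then show ?thesis unfolding off_def by (rule sum.reindex_bij_betw)
qed

text \<open>Handshaking: every edge occurs in the rotation lists of both its ends.\<close>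

lemma off_arcs: "off (nv G) = 2 * card (arcs G)"
proof -
  have len: "length (rot G u) = card {v. (u, v) \<in> arcs G} + card {v. (v, u) \<in> arcs G}" if "u \<in> verts G" for u
  proof -
    have "length (rot G u) = card (set (rot G u))" using rot_distinct[OF that] by (simp add: distinct_card)
    also have "set (rot G u) = {v. (u, v) \<in> arcs G} \<union> {v. (v, u) \<in> arcs G}" using rot_set[OF that] by auto
    also have "card \<dots> = card {v. (u, v) \<in> arcs G} + card {v. (v, u) \<in> arcs G}"
    proof (rule card_Un_disjoint)
      show "finite {v. (u, v) \<in> arcs G}" "finite {v. (v, u) \<in> arcs G}"
        using arcs_verts by (auto intro!: finite_subset[OF _ finite_verts])
      show "{v. (u, v) \<in> arcs G} \<inter> {v. (v, u) \<in> arcs G} = {}" using arcs_antisym by auto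
    qed
    finally show ?thesis .
  qed
  have fin: "finite {v. (u, v) \<in> arcs G}" "finite {v. (v, u) \<in> arcs G}" for u
    using arcs_verts by (auto intro!: finite_subset[OF _ finite_verts])
  have "(\<Sum>u\<in>verts G. card {v. (u, v) \<in> arcs G}) = card (SIGMA u:verts G. {v. (u, v) \<in> arcs G})"
    using fin by simp
  also have "(SIGMA u:verts G. {v. (u, v) \<in> arcs G}) = arcs G" using arcs_verts by auto
  finally have 1: "(\<Sum>u\<in>verts G. card {v. (u, v) \<in> arcs G}) = card (arcs G)" .
  have "(\<Sum>u\<in>verts G. card {v. (v, u) \<in> arcs G}) = card (SIGMA u:verts G. {v. (v, u) \<in> arcs G})"
    using fin by simp
  also have "(SIGMA u:verts G. {v. (v, u) \<in> arcs G}) = (arcs G)\<inverse>" using arcs_verts by auto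
  finally have 2: "(\<Sum>u\<in>verts G. card {v. (v, u) \<in> arcs G}) = card (arcs G)" by simp
  have "off (nv G) = (\<Sum>u\<in>verts G. card {v. (u, v) \<in> arcs G} + card {v. (v, u) \<in> arcs G})"
    unfolding off_def using len by (auto simp: verts_def intro!: sum.cong)
  then show ?thesis unfolding sum.distrib 1 2 by simp
qed

lemma C_last: "C (nv G) = [nv G, vk (nv G - 1), Suc (nv G)]"
proof -
  define k where "k = nv G - 1"
  have k: "k < nv G" "Suc k = nv G" using nv_pos by (auto simp: k_def)
  have lr: "l k = nv G" "r k = Suc (nv G)" using att[OF k(1)] k(2) unfolding attach_def Let_def by auto
  have C: "C (nv G) = P k @ nv G # vk k # Suc (nv G) # S k" using C_Suc[OF k(1)] unfolding lr k(2) .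
  have d: "distinct (C (nv G))" using C_distinct by simp
  have "P k = []"
  proof (rule ccontr)
    assume "P k \<noteq> []"
    then have "nv G \<in> set (P k)" using C_ends(1)[of "nv G"] unfolding C by (metis hd_append2 hd_in_set order_refl)
    then show False using d unfolding C by auto
  qed
  moreover have "S k = []"
  proof (rule ccontr)
    assume "S k \<noteq> []"
    then have "Suc (nv G) \<in> set (S k)" using C_ends(2)[of "nv G"] last_in_set[of "S k"] unfolding C by simp
    then show False using d unfolding C by auto
  qed
  ultimately show ?thesis using C by (simp add: k_def)
qed

definition drawn_state :: "state \<Rightarrow> bool" where
  "drawn_state \<tau> \<longleftrightarrow> contour_drawing (nv G) vk (nv G) (Suc (nv G)) C P M S l r
     (\<lambda>w. arrs \<tau> 1 (int w)) (\<lambda>w. arrs \<tau> 2 (int w))"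

lemma drawn_stateI:
  assumes pl: "\<forall>k<nv G. placed k \<sigma>"
    and y: "arrs \<sigma> 2 (int (nv G)) = -1" "arrs \<sigma> 2 (int (Suc (nv G))) = -1"
    and \<tau>: "arrs \<tau> 2 = arrs \<sigma> 2" "arrs \<tau> 1 (int (nv G)) = -1" "arrs \<tau> 1 (int (Suc (nv G))) = 2 * int (nv G) - 1"
      "arrs \<tau> 1 (int (vk (nv G - 1))) = int (nv G) - 1"
      "\<And>k w. k < nv G \<Longrightarrow> w \<in> set (M k) \<Longrightarrow> arrs \<tau> 1 (int w) = arrs \<tau> 1 (int (vk k)) - arrs \<sigma> 8 (int (vk k)) + arrs \<sigma> 1 (int w)"
  shows "drawn_state \<tau>"
  unfolding drawn_state_def
proof
  show "1 \<le> nv G" by (rule nv_pos)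
  show "C 0 = [nv G, Suc (nv G)]" by (rule C0)
  show "C (nv G) = [nv G, vk (nv G - 1), Suc (nv G)]" by (rule C_last)
  fix k
  show "C k = P k @ l k # M k @ r k # S k" if "k < nv G" by (rule C_split[OF that])
  show "C (Suc k) = P k @ l k # vk k # r k # S k" if "k < nv G" by (rule C_Suc[OF that])
  show "distinct (C k)" "hd (C k) = nv G" "last (C k) = Suc (nv G)" if "k \<le> nv G"
    using C_distinct[OF that] C_ends[OF that] by auto
  show "2 * arrs \<tau> 2 (int (vk k)) = arrs \<tau> 2 (int (l k)) + arrs \<tau> 2 (int (r k)) +
      tv (map (\<lambda>w. arrs \<tau> 2 (int w)) (l k # M k @ [r k])) + 2" if "k < nv G"
    using pl that unfolding placed_def Let_def \<tau>(1) by blast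
  fix j
  show "arrs \<tau> 1 (int (M k ! j)) = arrs \<tau> 1 (int (vk k)) - (arrs \<tau> 2 (int (vk k)) - arrs \<tau> 2 (int (l k))) + 1 +
      tv (map (\<lambda>w. arrs \<tau> 2 (int w)) (l k # take (Suc j) (M k)))" if "k < nv G" "j < length (M k)"
    using \<tau>(5)[of k "M k ! j"] pl that unfolding placed_def Let_def \<tau>(1) by simp
qed (use y \<tau> in simp_all)

lemma tc_finish:
  assumes I: "main_inv (nv G) t0 \<sigma>"
  shows "tc (Seq (Put 1 (Get 3 (Reg 0)) (Sub (Reg 0) (Num 1)))
     (Seq (Assign 4 (Sub (Reg 0) (Num 1)))
     (Seq x_loop
     (Seq (Put 1 (Reg 0) (Num (-1)))
      (Put 1 (Add (Reg 0) (Num 1)) (Sub (Add (Reg 0) (Reg 0)) (Num 1))))))) \<sigma>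
    (\<lambda>t \<tau>. t \<le> 4 * nv G + 5 \<and> drawn_state \<tau>)"
proof -
  let ?n = "nv G" and ?t = "vk (nv G - 1)"
  have r0: "regs \<sigma> 0 = int ?n" and a3: "\<forall>i<?n. arrs \<sigma> 3 (int (Suc i)) = int (vk i)"
    and y: "arrs \<sigma> 2 (int ?n) = -1" "arrs \<sigma> 2 (int (Suc ?n)) = -1" and pl: "\<forall>k<?n. placed k \<sigma>"
    using I unfolding main_inv_def by auto
  have n1: "?n - 1 < ?n" "Suc (?n - 1) = ?n" using nv_pos by auto
  have t3: "arrs \<sigma> 3 (int ?n) = int ?t" using a3 n1 by metis
  define \<sigma>1 where "\<sigma>1 = \<sigma>\<lparr>arrs := (arrs \<sigma>)(1 := (arrs \<sigma> 1)(int ?t := int ?n - 1)), regs := (regs \<sigma>)(4 := int (?n - 1))\<rparr>"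
  have tM: "w \<noteq> ?t" if "k < ?n" "w \<in> set (M k)" for k w
    using M_verts[OF that] vtx(2)[OF n1(1)] that n1 by auto
  have xl: "tc x_loop \<sigma>1 (\<lambda>t \<tau>. t \<le> 4 * ?n + 1 \<and> (regs \<tau> 0 = regs \<sigma>1 0 \<and> (\<forall>A. A \<noteq> 1 \<longrightarrow> arrs \<tau> A = arrs \<sigma>1 A) \<and>
     arrs \<tau> 1 (int ?t) = arrs \<sigma>1 1 (int ?t) \<and>
     (\<forall>k<?n. \<forall>w\<in>set (M k). arrs \<tau> 1 (int w) = arrs \<tau> 1 (int (vk k)) - arrs \<sigma>1 8 (int (vk k)) + arrs \<sigma>1 1 (int w))))"
  proof (rule tc_x_loop)
    show "\<forall>k<?n. \<forall>w\<in>set (M k). arrs \<sigma>1 7 (int w) = int (vk k)"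
    proof (intro allI impI ballI)
      fix k w assume k: "k < ?n" and "w \<in> set (M k)"
      then obtain j where "j < length (M k)" "M k ! j = w" by (metis in_set_conv_nth)
      then show "arrs \<sigma>1 7 (int w) = int (vk k)" using pl k unfolding placed_def Let_def \<sigma>1_def by auto
    qed
  qed (use a3 in \<open>auto simp: \<sigma>1_def\<close>)
  have last: "tc (Seq (Put 1 (Reg 0) (Num (-1))) (Put 1 (Add (Reg 0) (Num 1)) (Sub (Add (Reg 0) (Reg 0)) (Num 1)))) \<tau>
      (\<lambda>t \<tau>'. t \<le> 2 \<and> drawn_state \<tau>')"
    if \<tau>: "regs \<tau> 0 = regs \<sigma>1 0 \<and> (\<forall>A. A \<noteq> 1 \<longrightarrow> arrs \<tau> A = arrs \<sigma>1 A) \<and>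
     arrs \<tau> 1 (int ?t) = arrs \<sigma>1 1 (int ?t) \<and>
     (\<forall>k<?n. \<forall>w\<in>set (M k). arrs \<tau> 1 (int w) = arrs \<tau> 1 (int (vk k)) - arrs \<sigma>1 8 (int (vk k)) + arrs \<sigma>1 1 (int w))" for \<tau>
  proof (rule tc_Seq, rule tc_Put, rule tc_Put, goal_cases)
    case 1
    have r: "regs \<tau> 0 = int ?n" using \<tau> r0 by (simp add: \<sigma>1_def)
    define \<tau>' where "\<tau>' = \<tau>\<lparr>arrs := (arrs \<tau>)(1 := (arrs \<tau> 1)(int ?n := -1, int ?n + 1 := int ?n + int ?n - 1))\<rparr>"
    have keep: "arrs \<tau>' 1 (int w) = arrs \<tau> 1 (int w)" if "w < ?n" for w using that by (simp add: \<tau>'_def)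
    have "drawn_state \<tau>'"
    proof (rule drawn_stateI[OF pl y])
      show "arrs \<tau>' 2 = arrs \<sigma> 2" using \<tau> by (simp add: \<tau>'_def \<sigma>1_def)
      show "arrs \<tau>' 1 (int ?n) = -1" "arrs \<tau>' 1 (int (Suc ?n)) = 2 * int ?n - 1" by (simp_all add: \<tau>'_def add.commute)
      show "arrs \<tau>' 1 (int ?t) = int ?n - 1" using keep[OF vk_less[OF n1(1)]] \<tau> by (simp add: \<sigma>1_def)
      fix k w assume k: "k < ?n" and w: "w \<in> set (M k)"
      have "w < ?n" using M_verts[OF k w] by (simp add: verts_def)
      moreover have "arrs \<sigma>1 8 = arrs \<sigma> 8" by (simp add: \<sigma>1_def)
      moreover have "arrs \<sigma>1 1 (int w) = arrs \<sigma> 1 (int w)" using tM[OF k w] by (simp add: \<sigma>1_def)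
      ultimately show "arrs \<tau>' 1 (int w) = arrs \<tau>' 1 (int (vk k)) - arrs \<sigma> 8 (int (vk k)) + arrs \<sigma> 1 (int w)"
        using keep[of w] keep[OF vk_less[OF k]] \<tau> k w by simp
    qed
    then show ?case using r by (simp add: \<tau>'_def)
  qed
  have "tc (Seq x_loop (Seq (Put 1 (Reg 0) (Num (-1))) (Put 1 (Add (Reg 0) (Num 1)) (Sub (Add (Reg 0) (Reg 0)) (Num 1))))) \<sigma>1
      (\<lambda>t \<tau>. t \<le> (4 * ?n + 1) + 2 \<and> drawn_state \<tau>)"
    by (rule tc_Seq_bound[OF xl last])
  note run = this
  show ?thesis
  proof (rule tc_Seq, rule tc_Put, rule tc_Seq, rule tc_Assign, goal_cases)
    case 1
    let ?A = "(arrs \<sigma>)(1 := (arrs \<sigma> 1)(int ?t := int ?n - 1))"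
    have "int (?n - 1) = int ?n - 1" using nv_pos by (simp add: of_nat_diff)
    then have \<sigma>1: "\<sigma>\<lparr>arrs := ?A, regs := (regs \<sigma>)(4 := int ?n - 1)\<rparr> = \<sigma>1" by (simp add: \<sigma>1_def)
    have "tc (Seq x_loop (Seq (Put 1 (Reg 0) (Num (-1))) (Put 1 (Add (Reg 0) (Num 1)) (Sub (Add (Reg 0) (Reg 0)) (Num 1))))) \<sigma>1 (\<lambda>l \<tau>. 1 + (1 + l) \<le> 4 * ?n + 5 \<and> drawn_state \<tau>)"
      by (rule tc_conseq[OF run]) simp
    then show ?case using r0 t3 \<sigma>1 by simp
  qed
qed

lemma tc_draw:
  "tc draw (initial_state (encode G \<pi>)) (\<lambda>t \<tau>. t \<le> 80 * (card (verts G) + card (arcs G)) \<and> drawn_state \<tau>)"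
proof -
  let ?n = "nv G" and ?i = "initial_state (encode G \<pi>)"
  define T where "T = (\<Sum>i<?n. 40 + 2 * length (rot G (vk i)) + 7 * length (M i))"
  have T: "T \<le> 47 * ?n + 2 * off ?n"
  proof -
    have "T = 40 * ?n + 2 * (\<Sum>i<?n. length (rot G (vk i))) + 7 * (\<Sum>i<?n. length (M i))"
      unfolding T_def by (simp add: sum.distrib sum_distrib_left)
    moreover have "(\<Sum>i<?n. length (M i)) \<le> ?n"
      using sum_M[of ?n] C_last by simp
    ultimately show ?thesis unfolding sum_rot by simp
  qed
  have i: "arrs ?i 0 = inp" "regs ?i = (\<lambda>_. 0)" "A \<noteq> 0 \<Longrightarrow> arrs ?i A = (\<lambda>_. 0)" for A
    by (auto simp: inp_def initial_state_def)
  define \<sigma>0 where "\<sigma>0 = ?i\<lparr>regs := (\<lambda>_. 0)(0 := int ?n)\<rparr>"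
  have s0: "tc (Assign 0 (Get 0 (Num 0))) ?i (\<lambda>t \<tau>. t \<le> 1 \<and> \<tau> = \<sigma>0)"
    by (rule tc_Assign) (simp add: \<sigma>0_def i inp_n)
  define R1 where "R1 \<tau> \<longleftrightarrow> regs \<tau> 0 = int ?n \<and> arrs \<tau> 0 = inp \<and>
     (\<forall>k<?n. arrs \<tau> 3 (int (Suc k)) = int (vk k)) \<and>
     (\<forall>w. arrs \<tau> 6 (int w) = (if left_higher G \<pi> w then 1 else 0))" for \<tau> :: state
  have s1: "tc prepare_loop \<sigma>0 (\<lambda>t \<tau>. t \<le> 10 * ?n + 4 * off ?n + 1 \<and> R1 \<tau>)"
    by (rule tc_conseq[OF tc_prepare_loop]) (auto simp: \<sigma>0_def i R1_def)
  define R2 where "R2 \<tau> \<longleftrightarrow> R1 \<tau> \<and> arrs \<tau> 4 (int ?n) = int (Suc ?n)" for \<tau>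
  define R3 where "R3 \<tau> \<longleftrightarrow> R2 \<tau> \<and> arrs \<tau> 5 (int (Suc ?n)) = int ?n" for \<tau>
  define R4 where "R4 \<tau> \<longleftrightarrow> R3 \<tau> \<and> arrs \<tau> 2 (int ?n) = -1" for \<tau>
  define R5 where "R5 \<tau> \<longleftrightarrow> R4 \<tau> \<and> arrs \<tau> 2 (int (Suc ?n)) = -1" for \<tau>
  have s2: "tc (Put 4 (Reg 0) (Add (Reg 0) (Num 1))) \<tau> (\<lambda>t \<tau>. t \<le> 1 \<and> R2 \<tau>)" if "R1 \<tau>" for \<tau>
    by (rule tc_Put) (use that in \<open>simp add: R1_def R2_def\<close>)
  have s3: "tc (Put 5 (Add (Reg 0) (Num 1)) (Reg 0)) \<tau> (\<lambda>t \<tau>. t \<le> 1 \<and> R3 \<tau>)" if "R2 \<tau>" for \<tau>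
    by (rule tc_Put) (use that in \<open>simp add: R1_def R2_def R3_def add.commute\<close>)
  have s4: "tc (Put 2 (Reg 0) (Num (-1))) \<tau> (\<lambda>t \<tau>. t \<le> 1 \<and> R4 \<tau>)" if "R3 \<tau>" for \<tau>
    by (rule tc_Put) (use that in \<open>simp add: R1_def R2_def R3_def R4_def\<close>)
  have s5: "tc (Put 2 (Add (Reg 0) (Num 1)) (Num (-1))) \<tau> (\<lambda>t \<tau>. t \<le> 1 \<and> R5 \<tau>)" if "R4 \<tau>" for \<tau>
    by (rule tc_Put) (use that in \<open>simp add: R1_def R2_def R3_def R4_def R5_def add.commute\<close>)
  have s6: "tc (Assign 4 (Num 1)) \<tau> (\<lambda>t \<tau>. t \<le> 1 \<and> main_inv 0 0 \<tau>)" if "R5 \<tau>" for \<tau>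
    by (rule tc_Assign) (use that in \<open>simp add: R1_def R2_def R3_def R4_def R5_def main_inv_def linked_def C0\<close>)
  define R7 where "R7 \<tau> \<longleftrightarrow> (\<exists>t. main_inv ?n t \<tau>)" for \<tau>
  have s7: "tc main_loop \<tau> (\<lambda>t \<tau>. t \<le> T + 1 \<and> R7 \<tau>)" if "main_inv 0 0 \<tau>" for \<tau>
  proof (rule tc_conseq[OF tc_main_loop[OF that]])
    fix t \<tau>' assume I: "main_inv ?n (t - 1) \<tau>'"
    then have "t - 1 \<le> T" unfolding main_inv_def T_def by simp
    then show "t \<le> T + 1 \<and> R7 \<tau>'" using I unfolding R7_def by auto
  qed
  have s8: "tc (Seq (Put 1 (Get 3 (Reg 0)) (Sub (Reg 0) (Num 1)))
     (Seq (Assign 4 (Sub (Reg 0) (Num 1)))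
     (Seq x_loop
     (Seq (Put 1 (Reg 0) (Num (-1)))
      (Put 1 (Add (Reg 0) (Num 1)) (Sub (Add (Reg 0) (Reg 0)) (Num 1))))))) \<tau>
    (\<lambda>t \<tau>. t \<le> 4 * ?n + 5 \<and> drawn_state \<tau>)" if "R7 \<tau>" for \<tau>
    using that tc_finish unfolding R7_def by blast
  note c7 = tc_Seq_bound[OF s7 s8]
  note c6 = tc_Seq_bound[OF s6 c7]
  note c5 = tc_Seq_bound[OF s5 c6]
  note c4 = tc_Seq_bound[OF s4 c5]
  note c3 = tc_Seq_bound[OF s3 c4]
  note c2 = tc_Seq_bound[OF s2 c3]
  note c1 = tc_Seq_bound[OF s1 c2]
  have "tc draw ?i (\<lambda>t \<tau>. t \<le> 1 + ((10 * ?n + 4 * off ?n + 1) + (1 + (1 + (1 + (1 + (1 + ((T + 1) + (4 * ?n + 5)))))))) \<and>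
      drawn_state \<tau>)"
    unfolding draw_def by (rule tc_Seq_bound[OF s0], simp only:, rule c1)
  \<comment> \<open>With n vertices and m edges the left side is at most 13 + 61 n + 12 m, and n is
    at least 1.\<close>
  moreover have "1 + ((10 * ?n + 4 * off ?n + 1) + (1 + (1 + (1 + (1 + (1 + ((T + 1) + (4 * ?n + 5)))))))) \<le>
      80 * (card (verts G) + card (arcs G))"
    using T nv_pos unfolding off_arcs card_verts by simp
  ultimately show ?thesis by (auto elim!: tc_conseq)
qed

end

theorem theorem1:
  shows "\<exists>(p :: com) (c :: nat). \<forall>(G :: emb_graph) (\<pi> :: nat \<Rightarrow> nat).
    embedded_planar_st_graph G \<and> bitonic_st_ordering G \<pi> \<longrightarrow>
    (\<exists>x y. computes_within p (encode G \<pi>) (c * (card (verts G) + card (arcs G))) x y \<and>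
       upward_planar_grid_drawing G x y \<and>
       respects_embedding G (straight_line_drawing x y) \<and>
       has_grid_size G x y (2 * int (card (verts G)) - 2) (int (card (verts G)) - 1))"
proof (rule exI[of _ draw], rule exI[of _ 80], intro allI impI, elim conjE)
  fix G :: emb_graph and \<pi> :: "nat \<Rightarrow> nat"
  assume G: "embedded_planar_st_graph G" and \<pi>: "bitonic_st_ordering G \<pi>"
  have so: "st_ordering G \<pi>" using \<pi> unfolding bitonic_st_ordering_def by blast
  obtain Q where Q: "sweep G \<pi> Q" using sweep_exists[OF G so] by blast
  interpret bitonic_sweep G \<pi> Q
    using G \<pi> so Q unfolding embedded_planar_st_graph_def bitonic_st_ordering_def by unfold_locales blast+
  obtain C P l M r S where C: "C 0 = [nv G, Suc (nv G)]"
      "\<And>k. k < nv G \<Longrightarrow> attach G \<pi> k (C k) (P k) (l k) (M k) (r k) (S k) (C (Suc k))"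
      "\<And>k. k < nv G \<Longrightarrow> attach_ok G \<pi> k (C k) (l k) (M k) (r k)"
      "\<And>k. k \<le> nv G \<Longrightarrow> contour_inv G \<pi> k (C k)"
    using contour_exists by metis
  \<comment> \<open>The contours are fixed before the run and depend on the given drawing through
    \<open>sweep\<close>. The program knows nothing of them; its run is shown to follow them, and
    the coordinates it leaves form a contour drawing.\<close>
  interpret cs: contour_sequence G \<pi> C P M S l r by unfold_locales (use C in auto)
  obtain t \<tau> where \<tau>: "exec draw (initial_state (encode G \<pi>)) t \<tau>" "t \<le> 80 * (card (verts G) + card (arcs G))"
      "cs.drawn_state \<tau>"
    using cs.tc_draw unfolding tc_def by blast
  define x where "x v = arrs \<tau> 1 (int v)" for v
  define y where "y v = arrs \<tau> 2 (int v)" for v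
  interpret cg: contour_graph G \<pi> C P M S l r x y
    by (rule contour_graph.intro[OF ordered_st_axioms], rule contour_graph_axioms.intro)
      (use C(3,4) \<tau>(3) in \<open>simp_all add: cs.drawn_state_def x_def[abs_def] y_def[abs_def]\<close>)
  have "computes_within draw (encode G \<pi>) (80 * (card (verts G) + card (arcs G))) x y"
    unfolding computes_within_def using \<tau>(1,2) x_def y_def by blast
  then show "\<exists>x y. computes_within draw (encode G \<pi>) (80 * (card (verts G) + card (arcs G))) x y \<and>
       upward_planar_grid_drawing G x y \<and>
       respects_embedding G (straight_line_drawing x y) \<and>
       has_grid_size G x y (2 * int (card (verts G)) - 2) (int (card (verts G)) - 1)"
    using cg.upward cg.respects cg.grid by blast
qed

end
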